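(* Let $T>0$, $x=\begin{pmatrix}u\\ z\end{pmatrix}\in\mathbb{R}\times\mathbb{C}$, $v\in\mathbb{R}\times\mathbb{C}$, and let $$h=h(x,v,T)=-a_T^{*}\left(a_Ta_T^{*}\right)^{-1}\begin{pmatrix}1&0\\0&R(-u)\end{pmatrix}v .$$ Then $h\in L^p(\Omega,H)$ for every $p\ge 1$ and $h$ is in the domain of $\delta$. Its Malliavin dual $\delta h=\delta h(x,v,T)$ is given by $$\begin{aligned}-\delta h&=\begin{pmatrix}B_T\\-i\int_0^Te^{iB_t}(B_T-B_t)\,dt\end{pmatrix}^{*}\mathcal{C}(T)^{-1}\begin{pmatrix}1&0\\0&R(-u)\end{pmatrix}v\\&\quad+\int_0^T\int_0^t\begin{pmatrix}s\\ i\int_0^se^{iB_\rho}(\rho-s)\,d\rho\end{pmatrix}^{*}\mathcal{C}(T)^{-1}\mathscr{K}(t,s)\,\mathcal{C}(T)^{-1}\begin{pmatrix}1&0\\0&R(-u)\end{pmatrix}v\,ds\,dt,\end{aligned}$$ where $$\mathscr{K}(t,s)=\begin{pmatrix}0&\left(e^{iB_s}\right)^{*}\\ e^{iB_s}&-e^{iB_s}\left(i\int_0^te^{iB_r}dr\right)^{*}-i\int_0^te^{iB_r}dr\left(e^{iB_s}\right)^{*}\end{pmatrix}.$$ The Malliavin dual $\delta h$ given by this formula is also in $L^p(\Omega,\mathbb{R})$ for every $p\ge1$. Moreover, for any bounded measurable function $f:\mathbb{R}\times\mathbb{C}\to\mathbb{R}$ and any $T>0$, $x\in\mathbb{R}\times\mathbb{C}$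 and $v\in\mathbb{R}\times\mathbb{C}$, $$(d_xP_Tf,v)=-\mathbb{E}\left[f(X_T^x)\,\delta h\right],$$ where $\delta h=\delta h(x,v,T)$ is given by the formula above.
   Context: Conventions: $\mathbb{C}$ is identified with $\mathbb{R}^2$, a complex number $w$ being the column vector $\binom{\mathrm{Re}\,w}{\mathrm{Im}\,w}$; elements of $\mathbb{R}\times\mathbb{C}$ are column vectors of $\mathbb{R}^3$; $*$ denotes (real) transposition of vectors and matrices (so $(e^{iB_s})^*$ is the row vector $(\cos B_s,\sin B_s)$), and products such as $w\,w'^{*}$ with $w,w'\in\mathbb{C}$ are real $2\times2$ matrices. $R(u)=\begin{pmatrix}\cos u&-\sin u\\ \sin u&\cos u\end{pmatrix}$. $(d_xg,v)$ is the differential of $g$ at $x$ in direction $v$. Let $(B_t)_{t\ge0}$ be a standard real Brownian motion started at $0$. The kinetic Brownian motion (lifted to $\mathbb{R}\times\mathbb{C}$) started at $x=\binom uz$ is $X_t^x=\binom{U_t}{Z_t}$ with $U_t=u+B_t$, $Z_t=z+e^{iu}\int_0^te^{iB_s}ds$. Its semigroup is $P_Tf(x)=\mathbb{E}[f(X_T^x)]$. Let $H=L^2([0,T],\mathbb{R})$. The Malliavin derivative of $X_T^x$ in the (possibly random) direction $h\in H$ is $\mathcal{D}X_T^x(h)=\begin{pmatrix}\int_0^Th(t)\,dt\\ ie^{iu}\int_0^Te^{iB_t}\int_0^th(s)\,ds\,dt\end{pmatrix}$. A random $h\in H$ is in the domain of $\delta$, with Malliavin dual $\delta h$ (an integrable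 real random variable), if $\mathbb{E}[(d_{X_T^x}f,\mathcal{D}X_T^x(h))]=\mathbb{E}[f(X_T^x)\,\delta h]$ for every bounded $\mathcal{C}^1$ function $f:\mathbb{R}\times\mathbb{C}\to\mathbb{R}$ with bounded derivative. Set, for $t\in[0,T]$, $h_0(t)=1$, $h_1(t)=\int_0^t\sin(B_s)\,ds$, $h_2(t)=-\int_0^t\cos(B_s)\,ds$. The random linear map $a_T:H\to\mathbb{R}\times\mathbb{C}\simeq\mathbb{R}^3$ is $a_T(h)=(\langle h_0,h\rangle,\langle h_1,h\rangle,\langle h_2,h\rangle)^*$, with adjoint $a_T^*(\lambda_0,\lambda_1,\lambda_2)=\lambda_0h_0+\lambda_1h_1+\lambda_2h_2$, and $\mathcal{C}(T)=a_Ta_T^*$ is the $3\times 3$ Gram matrix $(\langle h_i,h_j\rangle_H)_{0\le i,j\le2}$ (the reduced Malliavin matrix), which is almost surely invertible. *)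

theory Defs
  imports "HOL-Probability.Probability"
begin

locale brownian_motion = prob_space M
  for M :: "'w measure" and B :: "real \<Rightarrow> 'w \<Rightarrow> real" +
  assumes measurable: "\<And>t. 0 \<le> t \<Longrightarrow> B t \<in> borel_measurable M"
    and start: "AE \<omega> in M. B 0 \<omega> = 0"
    and continuous_paths: "\<And>\<omega>. \<omega> \<in> space M \<Longrightarrow> continuous_on {0..} (\<lambda>t. B t \<omega>)"
    and gaussian_increments: "\<And>s t. 0 \<le> s \<Longrightarrow> s < t \<Longrightarrow>
      distributed M lborel (\<lambda>\<omega>. B t \<omega> - B s \<omega>) (normal_density 0 (sqrt (t - s)))"
    and independent_increments: "\<And>n (\<tau> :: nat \<Rightarrow> real). 0 \<le> \<tau> 0 \<Longrightarrow> (\<And>i. i < n \<Longrightarrow> \<tau> i \<le> \<tau> (Suc i)) \<Longrightarrow>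
      indep_vars (\<lambda>_. borel) (\<lambda>i \<omega>. B (\<tau> (Suc i)) \<omega> - B (\<tau> i) \<omega>) {..<n}"

section \<open>Column vectors and matrices\<close>

definition col2 :: "complex \<Rightarrow> real^2" where
  "col2 w = vector [Re w, Im w]"

definition col3 :: "real \<times> complex \<Rightarrow> real^3" where
  "col3 x = vector [fst x, Re (snd x), Im (snd x)]"

text \<open>The product of the column vector of \<open>w\<close> with the transpose of that of \<open>w'\<close>.\<close>

definition outer :: "complex \<Rightarrow> complex \<Rightarrow> real^2^2" where
  "outer w w' = (columnvector (col2 w) :: real^1^2) ** rowvector (col2 w')"

text \<open>The block matrix with rows \<open>(a, r\<^sup>T)\<close> and \<open>(c, D)\<close>.\<close>

definition block :: "real \<Rightarrow> real^2 \<Rightarrow> real^2 \<Rightarrow> real^2^2 \<Rightarrow> real^3^3" where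
  "block a r c D = vector [
     vector [a,   r$1, r$2],
     vector [c$1, D$1$1, D$1$2],
     vector [c$2, D$2$1, D$2$2]]"

definition rot :: "real \<Rightarrow> real^2^2" where
  "rot u = vector [vector [cos u, - sin u], vector [sin u, cos u]]"

section \<open>Kinetic Brownian motion\<close>

text \<open>
  Random objects are written as functionals of a single path \<open>b\<close>, to be instantiated with
  \<open>\<lambda>s. B s \<omega>\<close>; only the values of \<open>b\<close> on \<open>[0,T]\<close> matter. The complex exponential
  of \<open>i \<theta>\<close> is \<open>cis \<theta>\<close>.
\<close>

definition kbm :: "real \<Rightarrow> real \<times> complex \<Rightarrow> (real \<Rightarrow> real) \<Rightarrow> real \<times> complex" where
  "kbm t x b = (fst x + b t, snd x + cis (fst x) * (LBINT s:{0..t}. cis (b s)))"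

definition kbm_semigroup ::
  "'w measure \<Rightarrow> (real \<Rightarrow> 'w \<Rightarrow> real) \<Rightarrow> real \<Rightarrow> (real \<times> complex \<Rightarrow> real) \<Rightarrow> real \<times> complex \<Rightarrow> real" where
  "kbm_semigroup M B t f x = (LINT \<omega>|M. f (kbm t x (\<lambda>s. B s \<omega>)))"

section \<open>Random elements of $L^2([0,T])$\<close>

definition L2_inner :: "real \<Rightarrow> (real \<Rightarrow> real) \<Rightarrow> (real \<Rightarrow> real) \<Rightarrow> real" where
  "L2_inner T g k = (LBINT t:{0..T}. g t * k t)"

definition L2_norm :: "real \<Rightarrow> (real \<Rightarrow> real) \<Rightarrow> real" where
  "L2_norm T g = sqrt (L2_inner T g g)"

text \<open>
  An $L^2([0,T])$-valued random variable, given by a jointly measurable representative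
  \<open>(\<omega>, t) \<mapsto> h \<omega> t\<close>. As $L^2([0,T])$ is separable, every random variable with values in it
  has such a representative. Values of \<open>h \<omega>\<close> outside \<open>[0,T]\<close> are irrelevant.
\<close>

definition random_L2 :: "'w measure \<Rightarrow> real \<Rightarrow> ('w \<Rightarrow> real \<Rightarrow> real) \<Rightarrow> bool" where
  "random_L2 M T h \<longleftrightarrow>
     (\<lambda>(\<omega>, t). h \<omega> t) \<in> borel_measurable (M \<Otimes>\<^sub>M restrict_space lborel {0..T}) \<and>
     (\<forall>\<omega>\<in>space M. set_integrable lborel {0..T} (\<lambda>t. (h \<omega> t)\<^sup>2))"

definition Lp_L2 :: "'w measure \<Rightarrow> real \<Rightarrow> real \<Rightarrow> ('w \<Rightarrow> real \<Rightarrow> real) \<Rightarrow> bool" where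
  "Lp_L2 M T p h \<longleftrightarrow> random_L2 M T h \<and> integrable M (\<lambda>\<omega>. L2_norm T (h \<omega>) powr p)"

definition Lp_real :: "'w measure \<Rightarrow> real \<Rightarrow> ('w \<Rightarrow> real) \<Rightarrow> bool" where
  "Lp_real M p Y \<longleftrightarrow> Y \<in> borel_measurable M \<and> integrable M (\<lambda>\<omega>. \<bar>Y \<omega>\<bar> powr p)"

section \<open>Malliavin derivative and Malliavin dual\<close>

definition malliavin_deriv ::
  "real \<Rightarrow> real \<times> complex \<Rightarrow> (real \<Rightarrow> real) \<Rightarrow> (real \<Rightarrow> real) \<Rightarrow> real \<times> complex" where
  "malliavin_deriv T x b h =
     (LBINT t:{0..T}. h t,
      \<i> * cis (fst x) * (LBINT t:{0..T}. cis (b t) * of_real (LBINT s:{0..t}. h s)))"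

definition bounded_C1 ::
  "(real \<times> complex \<Rightarrow> real) \<Rightarrow> (real \<times> complex \<Rightarrow> (real \<times> complex) \<Rightarrow>\<^sub>L real) \<Rightarrow> bool" where
  "bounded_C1 f f' \<longleftrightarrow>
     (\<forall>y. (f has_derivative blinfun_apply (f' y)) (at y)) \<and> continuous_on UNIV f' \<and>
     bounded (range f) \<and> bounded (range f')"

text \<open>
  \<open>h\<close> is in the domain of the divergence and \<open>D\<close> is a Malliavin dual of \<open>h\<close>. Integrability of the
  left-hand side is required because the Bochner integral is \<open>0\<close> for non-integrable functions;
  the right-hand side is integrable since \<open>D\<close> is and \<open>f\<close> is bounded.
\<close>

definition has_malliavin_dual ::
  "'w measure \<Rightarrow> (real \<Rightarrow> 'w \<Rightarrow> real) \<Rightarrow> real \<Rightarrow> real \<times> complex \<Rightarrow> ('w \<Rightarrow> real \<Rightarrow> real) \<Rightarrow> ('w \<Rightarrow> real) \<Rightarrow> bool" where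
  "has_malliavin_dual M B T x h D \<longleftrightarrow>
     random_L2 M T h \<and> integrable M D \<and>
     (\<forall>f f'. bounded_C1 f f' \<longrightarrow>
        integrable M (\<lambda>\<omega>. blinfun_apply (f' (kbm T x (\<lambda>s. B s \<omega>))) (malliavin_deriv T x (\<lambda>s. B s \<omega>) (h \<omega>))) \<and>
        (LINT \<omega>|M. blinfun_apply (f' (kbm T x (\<lambda>s. B s \<omega>))) (malliavin_deriv T x (\<lambda>s. B s \<omega>) (h \<omega>)))
          = (LINT \<omega>|M. f (kbm T x (\<lambda>s. B s \<omega>)) * D \<omega>))"

section \<open>The reduced Malliavin matrix\<close>

definition h_vec :: "(real \<Rightarrow> real) \<Rightarrow> real \<Rightarrow> real^3" where
  "h_vec b t = vector [1, LBINT s:{0..t}. sin (b s), - (LBINT s:{0..t}. cos (b s))]"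

definition a_map :: "real \<Rightarrow> (real \<Rightarrow> real) \<Rightarrow> (real \<Rightarrow> real) \<Rightarrow> real^3" where
  "a_map T b h = (\<chi> i. L2_inner T (\<lambda>t. h_vec b t $ i) h)"

definition a_adj :: "(real \<Rightarrow> real) \<Rightarrow> real^3 \<Rightarrow> real \<Rightarrow> real" where
  "a_adj b l t = (\<Sum>i\<in>UNIV. l $ i * h_vec b t $ i)"

definition red_malliavin :: "real \<Rightarrow> (real \<Rightarrow> real) \<Rightarrow> real^3^3" where
  "red_malliavin T b = matrix (\<lambda>l. a_map T b (a_adj b l))"

lemma red_malliavin_gram:
  "red_malliavin T b = (\<chi> i j. L2_inner T (\<lambda>t. h_vec b t $ i) (\<lambda>t. h_vec b t $ j))"
proof -
  have "a_adj b (axis j 1) = (\<lambda>t. h_vec b t $ j)" for j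
    by (rule ext) (simp add: a_adj_def axis_def if_distrib[where f = "\<lambda>x. x * _"] cong: if_cong)
  then show ?thesis
    by (simp add: red_malliavin_def matrix_def a_map_def)
qed

section \<open>The direction $h$ and its dual\<close>

text \<open>
  On the null event where the reduced Malliavin matrix is singular, \<open>matrix_inv\<close> is a fixed
  unspecified matrix; \<open>h_dir\<close> and \<open>delta_h\<close> are determined almost surely.
\<close>

definition weight_vec :: "real \<Rightarrow> real \<times> complex \<Rightarrow> real \<times> complex \<Rightarrow> (real \<Rightarrow> real) \<Rightarrow> real^3" where
  "weight_vec T x v b = matrix_inv (red_malliavin T b) *v (block 1 0 0 (rot (- fst x)) *v col3 v)"

definition h_dir :: "real \<Rightarrow> real \<times> complex \<Rightarrow> real \<times> complex \<Rightarrow> (real \<Rightarrow> real) \<Rightarrow> real \<Rightarrow> real" where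
  "h_dir T x v b t = - a_adj b (weight_vec T x v b) t"

definition K_mat :: "(real \<Rightarrow> real) \<Rightarrow> real \<Rightarrow> real \<Rightarrow> real^3^3" where
  "K_mat b t s =
     (let e = cis (b s); w = \<i> * (LBINT r:{0..t}. cis (b r))
      in block 0 (col2 e) (col2 e) (- outer e w - outer w e))"

definition delta_h :: "real \<Rightarrow> real \<times> complex \<Rightarrow> real \<times> complex \<Rightarrow> (real \<Rightarrow> real) \<Rightarrow> real" where
  "delta_h T x v b = - (
     col3 (b T, - \<i> * (LBINT t:{0..T}. cis (b t) * of_real (b T - b t))) \<bullet> weight_vec T x v b
     + (LBINT t:{0..T}. LBINT s:{0..t}.
          col3 (s, \<i> * (LBINT \<rho>:{0..s}. cis (b \<rho>) * of_real (\<rho> - s)))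
            \<bullet> (matrix_inv (red_malliavin T b) *v (K_mat b t s *v weight_vec T x v b))))"

end

theory Submission
  imports Defs
begin

text \<open>
  The Malliavin calculus needed here reduces to one-dimensional Gaussian integration by parts. On a
  grid, a functional of the step path is differentiated in a single Brownian increment, which is
  independent of the others; the functions \<open>h_vec b t $ i\<close> are adapted, so they do not see the
  increment after \<open>t\<close>. Summing over the grid and refining it gives integration by parts in the
  directions \<open>h_vec b\<close> $ \<open>i\<close>, with a pathwise expression for the stochastic integrals
  \<open>\<delta>(h_i)\<close>. The weight is first regularised to \<open>(C + \<epsilon>)\<^sup>-\<^sup>1 w\<close>, and
  \<open>\<epsilon> \<rightarrow> 0\<close> is justified by moments of the inverse Gram matrix.

  These moments come from a small ball estimate. Differences of \<open>v \<bullet> h_vec b\<close> over a very short time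
  after \<open>a\<close> and \<open>a'\<close> determine \<open>(v $ 2, v $ 3)\<close> through a linear system with determinant
  proportional to \<open>sin (b a' - b a)\<close>, and many independent increments are unlikely to all have a
  small sine.

  For \<open>C\<^sup>1\<close> functions the derivative formula integrates to
  \<open>P f (x + v) - P f x = - \<integral>\<^sub>0\<^sup>1 E [f (X (x + r v)) \<delta>h (x + r v, v, T)] dr\<close>, which extends to bounded Borel
  functions by a monotone class argument. It shows that the law of \<open>X x\<close> is Lipschitz in \<open>x\<close> for the
  total variation distance, whence the integrand is continuous and \<open>P f\<close> is differentiable.
\<close>

section \<open>Integrals and Gaussian integration by parts\<close>

text \<open>The inverse Gram matrix looks at the whole path and is not adapted, so it cannot sit
  inside a stochastic integral. It enters through the product rule \<delta>(\<lambda> h) = \<lambda>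
  \<delta>(h) - D_h \<lambda>: each coordinate of the weight is part of the functional that is
  differentiated, in the direction h_i with the same index, and its derivative becomes the double
  integral in \<open>delta_h\<close>. The direction is dictated by Fubini: for a given path, the
  Malliavin derivative of X along h depends on h only through a_T h, and it is minus the derivative
  of X in the starting point along v as soon as a_T h is minus the rotated v. Among such h the
  formula takes the one in the range of a_T^*. The minus sign in the semigroup formula has the same
  origin. In the small ball estimate base points lie \<theta> apart and the windows have length w =
  \<theta>^3. Over a window the path moves by about \<theta>^(3/2), which is negligible against the
  size \<theta> demanded of the sine, so the linear system can be computed with a frozen
  path.\<close>

lemma set_integrable_bounded:
  fixes f :: "real \<Rightarrow> 'a::{banach,second_countable_topology}"
  assumes [measurable]: "f \<in> borel_measurable borel" and b: "\<And>t. t \<in> {a..b} \<Longrightarrow> norm (f t) \<le> K"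
  shows "set_integrable lborel {a..b} f"
  unfolding set_integrable_def
  by (rule integrableI_bounded_set[of "{a..b}" _ _ K])
     (auto simp: b emeasure_lborel_Icc_eq indicator_def)

lemma set_integral_norm_le:
  fixes f :: "real \<Rightarrow> 'a::{banach,second_countable_topology}"
  assumes [measurable]: "f \<in> borel_measurable borel" and b: "\<And>t. t \<in> {a..b} \<Longrightarrow> norm (f t) \<le> K" and ab: "a \<le> b"
  shows "norm (LBINT t:{a..b}. f t) \<le> K * (b - a)"
proof -
  have "set_integrable lborel {a..b} f" using b by (intro set_integrable_bounded) auto
  then have "norm (LBINT t:{a..b}. f t) \<le> (LBINT t:{a..b}. norm (f t))"
    by (simp add: set_integral_norm_bound)
  also have "\<dots> \<le> (LBINT t:{a..b}. K)"
    by (intro set_integral_mono set_integrable_bounded[of _ _ _ K] b) (auto simp: b intro: order_trans[OF norm_ge_zero b])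
  also have "\<dots> = K * (b - a)" using ab by (simp add: set_integral_const)
  finally show ?thesis .
qed

lemma set_integral_tendsto:
  fixes f :: "nat \<Rightarrow> real \<Rightarrow> 'a::{banach,second_countable_topology}"
  assumes [measurable]: "\<And>n. f n \<in> borel_measurable borel" "g \<in> borel_measurable borel"
    and b: "\<And>n t. t \<in> {a..b} \<Longrightarrow> norm (f n t) \<le> K"
    and l: "AE t in lborel. t \<in> {a..b} \<longrightarrow> (\<lambda>n. f n t) \<longlonglongrightarrow> g t"
  shows "(\<lambda>n. LBINT t:{a..b}. f n t) \<longlonglongrightarrow> (LBINT t:{a..b}. g t)"
  unfolding set_lebesgue_integral_def
proof (rule integral_dominated_convergence[where w = "\<lambda>t. indicator {a..b} t * \<bar>K\<bar>"])
  show "integrable lborel (\<lambda>t. indicator {a..b} t * \<bar>K\<bar>)"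
    using set_integrable_bounded[of "\<lambda>_. \<bar>K\<bar>" a b "\<bar>K\<bar>"] by (simp add: set_integrable_def)
  show "AE x in lborel. (\<lambda>i. indicat_real {a..b} x *\<^sub>R f i x) \<longlonglongrightarrow> indicat_real {a..b} x *\<^sub>R g x"
    using l by eventually_elim (auto simp: indicator_def)
  show "AE x in lborel. norm (indicat_real {a..b} x *\<^sub>R f i x) \<le> indicat_real {a..b} x * \<bar>K\<bar>" for i
    using b[of _ i] by (intro AE_I2) (auto simp: indicator_def intro!: order_trans[OF b abs_ge_self])
qed auto

lemma DERIV_quot_bound:
  fixes f :: "real \<Rightarrow> real"
  assumes "\<And>x. (f has_real_derivative f' x) (at x)" "\<And>x. \<bar>f' x\<bar> \<le> K"
  shows "\<bar>f (c + h) - f c\<bar> \<le> K * \<bar>h\<bar>"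
  using field_differentiable_bound[of UNIV f f' K "c+h" c] assms by auto

text \<open>Differentiation under the integral sign. The mean value inequality bounds the difference
  quotients by \<open>K'\<close>, so dominated convergence applies along any sequence of
  increments.\<close>

lemma DERIV_set_integral:
  fixes f :: "real \<Rightarrow> real \<Rightarrow> real"
  assumes m[measurable]: "\<And>c. f c \<in> borel_measurable borel" "\<And>c. f' c \<in> borel_measurable borel"
    and d: "\<And>c t. t \<in> {a..b} \<Longrightarrow> ((\<lambda>c. f c t) has_real_derivative f' c t) (at c)"
    and bd: "\<And>c t. t \<in> {a..b} \<Longrightarrow> \<bar>f c t\<bar> \<le> K" and bd': "\<And>c t. t \<in> {a..b} \<Longrightarrow> \<bar>f' c t\<bar> \<le> K'"
  shows "((\<lambda>c. LBINT t:{a..b}. f c t) has_real_derivative (LBINT t:{a..b}. f' c t)) (at c)"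
  unfolding DERIV_def tendsto_at_iff_sequentially
proof (intro allI impI)
  fix X :: "nat \<Rightarrow> real" assume X: "\<forall>i. X i \<in> UNIV - {0}" "X \<longlonglongrightarrow> 0"
  have si: "set_integrable lborel {a..b} (f c)" for c using bd by (intro set_integrable_bounded[of _ _ _ K]) auto
  have "((\<lambda>h. ((LBINT t:{a..b}. f (c + h) t) - (LBINT t:{a..b}. f c t)) / h) \<circ> X)
      = (\<lambda>n. LBINT t:{a..b}. (f (c + X n) t - f c t) / X n)"
    by (simp add: o_def fun_eq_iff set_integral_diff si)
  also have "\<dots> \<longlonglongrightarrow> (LBINT t:{a..b}. f' c t)"
  proof (rule set_integral_tendsto[where K=K'])
    show "AE t in lborel. t \<in> {a..b} \<longrightarrow> (\<lambda>n. (f (c + X n) t - f c t) / X n) \<longlonglongrightarrow> f' c t"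
    proof (intro AE_I2 impI)
      fix t assume "t \<in> {a..b}"
      then have "((\<lambda>h. (f (c + h) t - f c t) / h) \<longlongrightarrow> f' c t) (at 0)" using d unfolding DERIV_def by auto
      then show "(\<lambda>n. (f (c + X n) t - f c t) / X n) \<longlonglongrightarrow> f' c t"
        unfolding tendsto_at_iff_sequentially using X by (force simp: o_def)
    qed
    fix n t assume t: "t \<in> {a..b}"
    have "\<bar>f (c + X n) t - f c t\<bar> \<le> K' * \<bar>X n\<bar>" by (rule DERIV_quot_bound[OF d[OF t] bd'[OF t]])
    then show "norm ((f (c + X n) t - f c t) / X n) \<le> K'"
      using X by (auto simp: field_simps)
  qed auto
  finally show "((\<lambda>h. ((LBINT t:{a..b}. f (c + h) t) - (LBINT t:{a..b}. f c t)) / h) \<circ> X) \<longlonglongrightarrow> (LBINT t:{a..b}. f' c t)" .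
qed

text \<open>Convexity of the power at \<open>y\<close>: Bernoulli's inequality for
  \<open>x / y\<close>, multiplied by \<open>y ^ n\<close>.\<close>

lemma power_tangent_le:
  fixes x y :: real assumes "0 \<le> x" "0 \<le> y"
  shows "y ^ n + real n * y ^ (n - 1) * (x - y) \<le> x ^ n"
proof (cases "n = 0 \<or> y = 0")
  case True
  then show ?thesis using assms by (cases "n = 1") (auto simp: power_0_left)
next
  case False
  then have y: "y > 0" and n: "n > 0" using assms by auto
  have "1 + real n * (x / y - 1) \<le> (1 + (x / y - 1)) ^ n"
    using y assms by (intro Bernoulli_inequality) auto
  then have "y ^ n * (1 + real n * (x / y - 1)) \<le> y ^ n * (x / y) ^ n"
    using y by (intro mult_left_mono) auto
  also have "y ^ n * (x / y) ^ n = x ^ n" using y by (simp flip: power_mult_distrib)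
  also have "y ^ n * (1 + real n * (x / y - 1)) = y ^ n + real n * y ^ (n - 1) * (x - y)"
    using y n by (cases n) (auto simp: field_simps)
  finally show ?thesis .
qed

text \<open>Jensen's inequality for powers. The tangent at the mean value \<open>y\<close> lies
  below the power, and its linear term integrates to zero.\<close>

lemma set_integral_power_le:
  fixes f :: "real \<Rightarrow> real"
  assumes f: "set_integrable lborel {a..b} f" and fn: "set_integrable lborel {a..b} (\<lambda>t. f t ^ Suc n)"
    and nn: "\<And>t. t \<in> {a..b} \<Longrightarrow> 0 \<le> f t" and ab: "a < b"
  shows "(LBINT t:{a..b}. f t) ^ Suc n \<le> (b - a) ^ n * (LBINT t:{a..b}. f t ^ Suc n)"
proof -
  define y where "y = (LBINT t:{a..b}. f t) / (b - a)"
  have y0: "0 \<le> y" unfolding y_def set_lebesgue_integral_def using nn ab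
    by (intro divide_nonneg_pos integral_nonneg_AE) (auto simp: indicator_def)
  have c: "set_integrable lborel {a..b} (\<lambda>t. c)" for c :: real by (rule set_integrable_bounded[of _ _ _ "\<bar>c\<bar>"]) auto
  have I: "(LBINT t:{a..b}. f t) = y * (b - a)" using ab by (simp add: y_def)
  have "(LBINT t:{a..b}. y ^ Suc n + (real (Suc n) * y ^ n) * (f t - y)) \<le> (LBINT t:{a..b}. f t ^ Suc n)"
  proof (rule set_integral_mono)
    show "set_integrable lborel {a..b} (\<lambda>t. y ^ Suc n + (real (Suc n) * y ^ n) * (f t - y))"
      by (intro set_integral_add(1) set_integrable_mult_right set_integral_diff(1) c f)
    show "y ^ Suc n + real (Suc n) * y ^ n * (f x - y) \<le> f x ^ Suc n" if "x \<in> {a..b}" for x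
      using power_tangent_le[of "f x" y "Suc n"] nn[OF that] y0 by simp
  qed (rule fn)
  also have "(LBINT t:{a..b}. y ^ Suc n + (real (Suc n) * y ^ n) * (f t - y))
      = y ^ Suc n * (b - a) + (real (Suc n) * y ^ n) * (y * (b - a) - y * (b - a))"
    using ab by (simp only: set_integral_add(2) set_integral_mult_right set_integral_diff(2) c f set_integrable_mult_right set_integral_diff(1) I)
      (simp add: set_integral_const)
  finally have "y ^ Suc n * (b - a) \<le> (LBINT t:{a..b}. f t ^ Suc n)" by simp
  then have "(b - a) ^ n * (y ^ Suc n * (b - a)) \<le> (b - a) ^ n * (LBINT t:{a..b}. f t ^ Suc n)"
    using ab by (intro mult_left_mono) auto
  then show ?thesis by (simp add: I power_mult_distrib mult_ac)
qed

text \<open>Vitali's theorem in the L2-bounded case, meant for the discrete stochastic integrals,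
  which converge almost surely but come with a second moment bound instead of a dominating function.
  Fatou's lemma carries the bound over to \<open>Z\<close>, and truncation at level \<open>R\<close>
  changes each expectation by at most \<open>K / R\<close>.\<close>

lemma (in prob_space) integral_tendsto_of_L2_bounded:
  fixes Y :: "nat \<Rightarrow> 'a \<Rightarrow> real"
  assumes [measurable]: "\<And>n. Y n \<in> borel_measurable M" "Z \<in> borel_measurable M"
    and lim: "AE \<omega> in M. (\<lambda>n. Y n \<omega>) \<longlonglongrightarrow> Z \<omega>"
    and i2: "\<And>n. integrable M (\<lambda>\<omega>. (Y n \<omega>)\<^sup>2)" and K: "\<And>n. (LINT \<omega>|M. (Y n \<omega>)\<^sup>2) \<le> K"
  shows "integrable M Z" "(\<lambda>n. LINT \<omega>|M. Y n \<omega>) \<longlonglongrightarrow> (LINT \<omega>|M. Z \<omega>)"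
proof -
  have sq: "\<bar>y\<bar> \<le> 1 + y\<^sup>2" for y :: real
    using sum_squares_bound[of "\<bar>y\<bar>" 1] by simp
  have K0: "0 \<le> K" by (rule order_trans[OF _ K[of 0]]) simp
  have iY: "integrable M (Y n)" for n
    by (rule Bochner_Integration.integrable_bound[of _ "\<lambda>\<omega>. 1 + (Y n \<omega>)\<^sup>2"]) (auto simp: i2 intro: order_trans[OF sq])
  have "(\<integral>\<^sup>+\<omega>. ennreal ((Z \<omega>)\<^sup>2) \<partial>M) \<le> (\<integral>\<^sup>+\<omega>. liminf (\<lambda>n. ennreal ((Y n \<omega>)\<^sup>2)) \<partial>M)"
  proof (rule nn_integral_mono_AE, use lim in eventually_elim)
    fix \<omega> assume "(\<lambda>n. Y n \<omega>) \<longlonglongrightarrow> Z \<omega>"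
    then have "(\<lambda>n. ennreal ((Y n \<omega>)\<^sup>2)) \<longlonglongrightarrow> ennreal ((Z \<omega>)\<^sup>2)" by (intro tendsto_intros)
    then show "ennreal ((Z \<omega>)\<^sup>2) \<le> liminf (\<lambda>n. ennreal ((Y n \<omega>)\<^sup>2))"
      using lim_imp_Liminf[of sequentially] trivial_limit_sequentially by (metis order_refl)
  qed
  also have "\<dots> \<le> liminf (\<lambda>n. \<integral>\<^sup>+\<omega>. ennreal ((Y n \<omega>)\<^sup>2) \<partial>M)" by (intro nn_integral_liminf) auto
  also have "\<dots> \<le> ennreal K"
  proof (rule Liminf_le[OF sequentially_bot])
    show "\<forall>\<^sub>F n in sequentially. (\<integral>\<^sup>+\<omega>. ennreal ((Y n \<omega>)\<^sup>2) \<partial>M) \<le> ennreal K"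
      by (simp add: nn_integral_eq_integral i2 K ennreal_leI)
  qed
  finally have Z2: "(\<integral>\<^sup>+\<omega>. ennreal ((Z \<omega>)\<^sup>2) \<partial>M) \<le> ennreal K" .
  then have iZ2: "integrable M (\<lambda>\<omega>. (Z \<omega>)\<^sup>2)"
    by (intro integrableI_bounded) (auto simp: top_unique intro: le_less_trans)
  have KZ: "(LINT \<omega>|M. (Z \<omega>)\<^sup>2) \<le> K"
    using Z2 K0 by (simp add: nn_integral_eq_integral iZ2)
  show iZ: "integrable M Z"
    by (rule Bochner_Integration.integrable_bound[of _ "\<lambda>\<omega>. 1 + (Z \<omega>)\<^sup>2"]) (auto simp: iZ2 intro: order_trans[OF sq])
  define \<tau> where "\<tau> R y = max (-R) (min R y)" for R y :: real
  have [measurable]: "\<tau> R \<in> borel_measurable borel" for R unfolding \<tau>_def by measurable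
  have \<tau>b: "\<bar>\<tau> R y\<bar> \<le> R" if "R > 0" for R y using that by (auto simp: \<tau>_def)
  have \<tau>e: "\<bar>y - \<tau> R y\<bar> \<le> y\<^sup>2 / R" if "R > 0" for R y
  proof (cases "\<bar>y\<bar> \<le> R")
    case True then show ?thesis using that by (auto simp: \<tau>_def)
  next
    case False
    have "\<bar>y - \<tau> R y\<bar> \<le> \<bar>y\<bar>" using that False by (auto simp: \<tau>_def)
    moreover have "R * \<bar>y\<bar> \<le> \<bar>y\<bar> * \<bar>y\<bar>" using False that by (intro mult_right_mono) auto
    ultimately show ?thesis using that by (simp add: field_simps power2_eq_square) (smt (verit) mult_left_mono)
  qed
  have i\<tau>: "integrable M (\<lambda>\<omega>. \<tau> R (X \<omega>))" if "R > 0" "X \<in> borel_measurable M" for R X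
    using that by (intro integrable_const_bound[of _ R]) (auto simp: \<tau>b)
  have err: "\<bar>(LINT \<omega>|M. X \<omega>) - (LINT \<omega>|M. \<tau> R (X \<omega>))\<bar> \<le> K / R"
    if R: "R > 0" and [measurable]: "X \<in> borel_measurable M" and X: "integrable M X" "integrable M (\<lambda>\<omega>. (X \<omega>)\<^sup>2)" "(LINT \<omega>|M. (X \<omega>)\<^sup>2) \<le> K" for R X
  proof -
    have "\<bar>(LINT \<omega>|M. X \<omega>) - (LINT \<omega>|M. \<tau> R (X \<omega>))\<bar> = \<bar>LINT \<omega>|M. X \<omega> - \<tau> R (X \<omega>)\<bar>"
      using R X i\<tau> by simp
    also have "\<dots> \<le> (LINT \<omega>|M. \<bar>X \<omega> - \<tau> R (X \<omega>)\<bar>)" by (rule integral_abs_bound)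
    also have "\<dots> \<le> (LINT \<omega>|M. (X \<omega>)\<^sup>2 / R)"
      using R X i\<tau> by (intro integral_mono) (auto simp: \<tau>e)
    also have "\<dots> \<le> K / R" using X R by (simp add: divide_right_mono)
    finally show ?thesis .
  qed
  show "(\<lambda>n. LINT \<omega>|M. Y n \<omega>) \<longlonglongrightarrow> (LINT \<omega>|M. Z \<omega>)"
  proof (rule LIMSEQ_I)
    fix e :: real assume e: "0 < e"
    \<comment> \<open>With this level truncation costs less than \<open>e / 3\<close> for each of
      \<open>Y n\<close> and \<open>Z\<close>; dominated convergence of the truncated variables
      supplies the last third.\<close>
    define R where "R = 3 * K / e + 1"
    have R: "R > 0" using K0 e by (auto simp: R_def intro: add_nonneg_pos)
    have KR: "K / R < e / 3" using R e K0 by (simp add: R_def field_simps)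
    have "(\<lambda>n. LINT \<omega>|M. \<tau> R (Y n \<omega>)) \<longlonglongrightarrow> (LINT \<omega>|M. \<tau> R (Z \<omega>))"
    proof (rule integral_dominated_convergence[where w = "\<lambda>_. R"])
      show "AE \<omega> in M. (\<lambda>n. \<tau> R (Y n \<omega>)) \<longlonglongrightarrow> \<tau> R (Z \<omega>)"
        using lim by eventually_elim (auto simp: \<tau>_def intro!: tendsto_intros)
    qed (use R \<tau>b in auto)
    then obtain N where N: "\<And>n. n \<ge> N \<Longrightarrow> \<bar>(LINT \<omega>|M. \<tau> R (Y n \<omega>)) - (LINT \<omega>|M. \<tau> R (Z \<omega>))\<bar> < e / 3"
      using e unfolding LIMSEQ_iff by (metis divide_pos_pos real_norm_def zero_less_numeral)
    show "\<exists>no. \<forall>n\<ge>no. norm ((LINT \<omega>|M. Y n \<omega>) - (LINT \<omega>|M. Z \<omega>)) < e"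
    proof (intro exI allI impI)
      fix n assume "n \<ge> N"
      note N[OF this]
      moreover have "\<bar>(LINT \<omega>|M. Y n \<omega>) - (LINT \<omega>|M. \<tau> R (Y n \<omega>))\<bar> \<le> K / R" by (rule err[OF R _ iY i2 K]) simp
      moreover have "\<bar>(LINT \<omega>|M. Z \<omega>) - (LINT \<omega>|M. \<tau> R (Z \<omega>))\<bar> \<le> K / R" by (rule err[OF R _ iZ iZ2 KZ]) simp
      ultimately show "norm ((LINT \<omega>|M. Y n \<omega>) - (LINT \<omega>|M. Z \<omega>)) < e"
        using KR unfolding real_norm_def by linarith
    qed
  qed
qed

text \<open>Stein's identity. The density has logarithmic derivative -y / \<sigma>^2, so the
  derivative of density times \<open>G\<close> contains both integrands. Its integral over the line
  vanishes because \<open>G\<close> is bounded and the density tends to 0 at both ends.\<close>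

lemma normal_density_ibp:
  fixes G :: "real \<Rightarrow> real"
  assumes s: "\<sigma> > 0" and G: "\<And>y. (G has_real_derivative G' y) (at y)" and c: "\<And>y. isCont G' y"
    and K: "\<And>y. \<bar>G y\<bar> \<le> K" and K': "\<And>y. \<bar>G' y\<bar> \<le> K'"
  shows "(LINT y|lborel. normal_density 0 \<sigma> y * (G y * y)) = \<sigma>\<^sup>2 * (LINT y|lborel. normal_density 0 \<sigma> y * G' y)"
proof -
  let ?n = "normal_density 0 \<sigma>"
  have [measurable]: "G' \<in> borel_measurable borel"
    using c by (auto intro!: borel_measurable_continuous_onI continuous_at_imp_continuous_on)
  have [measurable]: "G \<in> borel_measurable borel"
    using DERIV_isCont[OF G] by (auto intro!: borel_measurable_continuous_onI continuous_at_imp_continuous_on)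
  have nd: "(?n has_real_derivative (- y / \<sigma>\<^sup>2 * ?n y)) (at y)" for y
    unfolding normal_density_def using s
    by (auto intro!: derivative_eq_intros simp: field_simps power2_eq_square)
  have sq: "filterlim (\<lambda>y. y ^ 2 :: real) at_top at_top" "filterlim (\<lambda>y. y ^ 2 :: real) at_top at_bot"
    by (intro filterlim_pow_at_top filterlim_pow_at_bot_even filterlim_ident; simp)+
  have i1: "integrable lborel (\<lambda>y. ?n y * G' y)"
    by (rule Bochner_Integration.integrable_bound[of _ "\<lambda>y. ?n y * K'"])
       (auto simp: abs_mult s intro!: mult_left_mono order_trans[OF K'])
  have i2: "integrable lborel (\<lambda>y. ?n y * (G y * y))"
  proof (rule Bochner_Integration.integrable_bound)
    show "integrable lborel (\<lambda>y. K * (?n y * \<bar>y - 0\<bar> ^ 1))"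
      by (intro integrable_mult_right integrable_normal_moment_abs s)
    have "?n y * (\<bar>G y\<bar> * \<bar>y\<bar>) \<le> \<bar>K\<bar> * (?n y * \<bar>y\<bar>)" for y
      using mult_left_mono[OF mult_right_mono[OF order_trans[OF K abs_ge_self], of "\<bar>y\<bar>"], of "?n y"]
      by (simp add: mult_ac)
    then show "AE y in lborel. norm (?n y * (G y * y)) \<le> norm (K * (?n y * \<bar>y - 0\<bar> ^ 1))"
      by (simp add: abs_mult)
  qed simp
  have lim0: "(?n \<longlongrightarrow> 0) F" if F: "filterlim (\<lambda>y. y ^ 2 :: real) at_top F" for F
  proof -
    have "filterlim (\<lambda>y. - ((1 / (2 * \<sigma>\<^sup>2)) * y ^ 2)) at_bot F"
      using s by (intro filterlim_uminus_at_top[THEN iffD1] filterlim_tendsto_pos_mult_at_top[OF tendsto_const _ F]) auto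
    then have "((\<lambda>y. 1 / sqrt (2 * pi * \<sigma>\<^sup>2) * exp (- ((1 / (2 * \<sigma>\<^sup>2)) * y ^ 2))) \<longlongrightarrow> 0) F"
      by (intro tendsto_mult_right_zero filterlim_compose[OF exp_at_bot])
    then show ?thesis by (simp add: normal_density_def[abs_def])
  qed
  have lim: "((\<lambda>y. ?n y * G y) \<longlongrightarrow> 0) F" if "(?n \<longlongrightarrow> 0) F" for F
  proof (rule Lim_null_comparison)
    show "\<forall>\<^sub>F y in F. norm (?n y * G y) \<le> ?n y * K"
      by (auto simp: abs_mult K intro!: always_eventually mult_left_mono)
    show "((\<lambda>y. ?n y * K) \<longlongrightarrow> 0) F" using tendsto_mult_left_zero[OF that] .
  qed
  have "(LBINT y=-\<infinity>..\<infinity>. ?n y * G' y - (1 / \<sigma>\<^sup>2) * (?n y * (G y * y))) = 0 - 0"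
  proof (rule interval_integral_FTC_integrable[where F = "\<lambda>y. ?n y * G y"])
    show "((\<lambda>y. ?n y * G y) has_vector_derivative ?n x * G' x - 1 / \<sigma>\<^sup>2 * (?n x * (G x * x))) (at x)" for x
      unfolding has_real_derivative_iff_has_vector_derivative[symmetric]
      by (auto intro!: derivative_eq_intros nd G)
    show "isCont (\<lambda>y. ?n y * G' y - 1 / \<sigma>\<^sup>2 * (?n y * (G y * y))) x" for x
      by (intro continuous_intros c DERIV_isCont[OF G] DERIV_isCont[OF nd])
    show "set_integrable lborel (einterval (-\<infinity>) \<infinity>) (\<lambda>y. ?n y * G' y - 1 / \<sigma>\<^sup>2 * (?n y * (G y * y)))"
      using i1 i2 by (simp add: set_integrable_def)
  qed (auto simp: ereal_tendsto_simps1 intro!: lim lim0 sq)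
  then have "(LINT y|lborel. ?n y * G' y - (1 / \<sigma>\<^sup>2) * (?n y * (G y * y))) = 0"
    by (simp add: interval_lebesgue_integral_def set_lebesgue_integral_def)
  then have "(LINT y|lborel. ?n y * G' y) = (1 / \<sigma>\<^sup>2) * (LINT y|lborel. ?n y * (G y * y))"
    using i1 i2 by (simp only: Bochner_Integration.integral_diff integrable_mult_right integral_mult_right_zero)
  then show ?thesis using s by simp
qed

section \<open>Coercive matrices and bounded Borel functions\<close>

text \<open>Plays the part of a lower bound for the smallest eigenvalue. Stated through the
  quadratic form, it survives adding a nonnegative multiple of the identity and yields the norm
  bound 1 / \<kappa> for the inverse.\<close>

definition coercive :: "real \<Rightarrow> real^'n^'n \<Rightarrow> bool" where
  "coercive \<kappa> A \<longleftrightarrow> \<kappa> > 0 \<and> (\<forall>v. \<kappa> * (v \<bullet> v) \<le> v \<bullet> (A *v v))"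

lemma coercive_norm_le:
  assumes "coercive \<kappa> A" shows "\<kappa> * norm v \<le> norm (A *v v)"
proof (cases "v = 0")
  case False
  have "\<kappa> * norm v * norm v \<le> v \<bullet> (A *v v)" using assms by (simp add: coercive_def dot_square_norm power2_eq_square mult_ac)
  also have "\<dots> \<le> norm (A *v v) * norm v" using norm_cauchy_schwarz by (metis mult.commute)
  finally show ?thesis using False by simp
qed simp

lemma coercive_invertible:
  fixes A :: "real^'n^'n"
  assumes "coercive \<kappa> A" shows "invertible A"
proof -
  have "x = 0" if "A *v x = 0" for x
    using coercive_norm_le[OF assms, of x] that assms by (auto simp: coercive_def mult_le_0_iff)
  then show ?thesis by (simp add: invertible_left_inverse matrix_left_invertible_ker)
qed

lemma matrix_inv_mult:
  fixes A :: "real^'n^'n" assumes "invertible A"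
  shows "A ** matrix_inv A = mat 1" "matrix_inv A ** A = mat 1"
  using someI_ex[of "\<lambda>A'. A ** A' = mat 1 \<and> A' ** A = mat 1"] assms
  unfolding invertible_def matrix_inv_def by auto

lemma matrix_inv_vector:
  fixes A :: "real^'n^'n" assumes "invertible A"
  shows "A *v (matrix_inv A *v y) = y" "matrix_inv A *v (A *v y) = y"
  using matrix_inv_mult[OF assms] by (simp_all add: matrix_vector_mul_assoc)

lemma coercive_inv_norm_le:
  fixes A :: "real^'n^'n"
  assumes "coercive \<kappa> A" shows "norm (matrix_inv A *v y) \<le> norm y / \<kappa>"
  using coercive_norm_le[OF assms, of "matrix_inv A *v y"] assms
  by (simp add: matrix_inv_vector coercive_invertible[OF assms] coercive_def field_simps)

text \<open>The resolvent identity. Continuity and differentiability of the inverse are both read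
  off from it below.\<close>

lemma matrix_inv_resolvent:
  fixes A B :: "real^'n^'n" assumes "invertible A" "invertible B"
  shows "matrix_inv A *v y - matrix_inv B *v y = matrix_inv A *v ((B - A) *v (matrix_inv B *v y))"
  using assms by (simp add: matrix_vector_mult_diff_rdistrib matrix_vector_mult_diff_distrib matrix_inv_vector)

lemma tendsto_matrix_vector_mult:
  fixes A :: "'b \<Rightarrow> real^'n^'m"
  assumes "(A \<longlongrightarrow> A0) F" "(y \<longlongrightarrow> y0) F" shows "((\<lambda>c. A c *v y c) \<longlongrightarrow> A0 *v y0) F"
  unfolding matrix_vector_mult_def using assms by (intro tendsto_intros)

text \<open>The common constant \<open>\<kappa>\<close> bounds all inverses at once, so the
  difference of the solutions is at most the residual \<open>?r c\<close> of the limit solution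
  divided by \<open>\<kappa>\<close>.\<close>

lemma tendsto_matrix_inv_vector:
  fixes A :: "'b \<Rightarrow> real^'n^'n"
  assumes A: "(A \<longlongrightarrow> A0) F" and y: "(y \<longlongrightarrow> y0) F" and co: "\<And>c. coercive \<kappa> (A c)" "coercive \<kappa> A0"
  shows "((\<lambda>c. matrix_inv (A c) *v y c) \<longlongrightarrow> matrix_inv A0 *v y0) F"
proof -
  let ?r = "\<lambda>c. (y c - y0) + (A0 - A c) *v (matrix_inv A0 *v y0)"
  have "(?r \<longlongrightarrow> (y0 - y0) + (A0 - A0) *v (matrix_inv A0 *v y0)) F"
    by (intro tendsto_intros tendsto_matrix_vector_mult A y)
  then have r: "((\<lambda>c. norm (?r c) / \<kappa>) \<longlongrightarrow> 0) F"
    using co by (auto intro!: tendsto_divide_zero tendsto_norm_zero simp: coercive_def)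
  have "matrix_inv (A c) *v y c - matrix_inv A0 *v y0 = matrix_inv (A c) *v ?r c" for c
  proof -
    have e: "matrix_inv (A c) *v ?r c = matrix_inv (A c) *v y c - matrix_inv (A c) *v y0
        + matrix_inv (A c) *v ((A0 - A c) *v (matrix_inv A0 *v y0))"
      by (simp only: matrix_vector_mult_diff_distrib matrix_vector_right_distrib)
    have "p - q = p - r + (r - q)" for p q r :: "real^'n" by simp
    then show ?thesis
      unfolding e matrix_inv_resolvent[OF coercive_invertible[OF co(1)] coercive_invertible[OF co(2)], symmetric] .
  qed
  then have "norm (matrix_inv (A c) *v y c - matrix_inv A0 *v y0) \<le> norm (?r c) / \<kappa>" for c
    by (metis coercive_inv_norm_le[OF co(1)])
  then show ?thesis by (intro Lim_null[THEN iffD2, OF Lim_null_comparison[OF always_eventually r]]) simp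
qed

text \<open>By the resolvent identity the difference quotient is exactly minus the inverse at the
  shifted point, times the quotient of the matrices, times the inverse at \<open>c0\<close>;
  continuity of the inverse then gives the limit.\<close>

lemma DERIV_matrix_inv_vector:
  fixes A :: "real \<Rightarrow> real^'n^'n"
  assumes A: "\<And>i j. ((\<lambda>c. A c $ i $ j) has_real_derivative A' $ i $ j) (at c0)" and co: "\<And>c. coercive \<kappa> (A c)"
  shows "((\<lambda>c. (matrix_inv (A c) *v y) $ i) has_real_derivative
      - (matrix_inv (A c0) *v (A' *v (matrix_inv (A c0) *v y))) $ i) (at c0)"
proof -
  let ?Q = "\<lambda>h. \<chi> i j. (A (c0 + h) $ i $ j - A c0 $ i $ j) / h"
  have "A \<midarrow>c0\<rightarrow> A c0"
    using DERIV_isCont[OF A] by (auto simp: isCont_def intro!: vec_tendstoI)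
  then have Ac: "((\<lambda>h. A (c0 + h)) \<longlongrightarrow> A c0) (at 0)" by (simp add: LIM_offset_zero)
  have Q: "(?Q \<longlongrightarrow> A') (at 0)"
    using A unfolding DERIV_def by (intro vec_tendstoI) simp
  have eq: "((matrix_inv (A (c0 + h)) *v y) $ i - (matrix_inv (A c0) *v y) $ i) / h
     = - (matrix_inv (A (c0 + h)) *v (?Q h *v (matrix_inv (A c0) *v y))) $ i" for h
  proof -
    have "A c0 - A (c0 + h) = - (h *\<^sub>R ?Q h)" by (simp add: vec_eq_iff)
    then have "matrix_inv (A (c0 + h)) *v y - matrix_inv (A c0) *v y
        = matrix_inv (A (c0 + h)) *v (- (h *\<^sub>R ?Q h) *v (matrix_inv (A c0) *v y))"
      using matrix_inv_resolvent[OF coercive_invertible[OF co[of "c0 + h"]] coercive_invertible[OF co[of c0]], of y] by simp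
    also have "- (h *\<^sub>R ?Q h) *v (matrix_inv (A c0) *v y) = (- h) *\<^sub>R (?Q h *v (matrix_inv (A c0) *v y))"
      by (simp add: scaleR_matrix_vector_assoc flip: scaleR_minus_left)
    also have "matrix_inv (A (c0 + h)) *v \<dots> = (- h) *\<^sub>R (matrix_inv (A (c0 + h)) *v (?Q h *v (matrix_inv (A c0) *v y)))"
      by (simp only: matrix_vector_mult_scaleR)
    finally have "(matrix_inv (A (c0 + h)) *v y - matrix_inv (A c0) *v y) $ i
        = ((- h) *\<^sub>R (matrix_inv (A (c0 + h)) *v (?Q h *v (matrix_inv (A c0) *v y)))) $ i" by (rule arg_cong)
    then have e: "(matrix_inv (A (c0 + h)) *v y) $ i - (matrix_inv (A c0) *v y) $ i
        = (- h) * (matrix_inv (A (c0 + h)) *v (?Q h *v (matrix_inv (A c0) *v y))) $ i"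
      by (simp only: vector_minus_component vector_scaleR_component real_scaleR_def)
    show ?thesis unfolding e
    \<comment> \<open>At \<open>h = 0\<close> division yields 0 on both sides, so the identity holds
      for every \<open>h\<close> and can rewrite the whole limit.\<close>
    proof (cases "h = 0")
      case True
      then have "?Q h = 0" by (simp add: vec_eq_iff)
      then show "- h * (matrix_inv (A (c0 + h)) *v (?Q h *v (matrix_inv (A c0) *v y))) $ i / h
        = - (matrix_inv (A (c0 + h)) *v (?Q h *v (matrix_inv (A c0) *v y))) $ i"
        using True by simp
    qed simp
  qed
  have "((\<lambda>h. - (matrix_inv (A (c0 + h)) *v (?Q h *v (matrix_inv (A c0) *v y))) $ i)
     \<longlongrightarrow> - (matrix_inv (A c0) *v (A' *v (matrix_inv (A c0) *v y))) $ i) (at 0)"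
    by (intro tendsto_minus tendsto_vec_nth tendsto_matrix_inv_vector[where \<kappa>=\<kappa>] tendsto_matrix_vector_mult Q Ac tendsto_const co)
  then show ?thesis unfolding DERIV_def eq .
qed

text \<open>Cramer's rule exhibits the solution as a quotient of polynomials in the entries. On
  singular matrices \<open>matrix_inv\<close> is one unspecified matrix, the same for all of them,
  so measurability persists there.\<close>

lemma borel_measurable_matrix_inv_vector:
  fixes A :: "'a \<Rightarrow> real^'n^'n"
  assumes A[measurable]: "\<And>i j. (\<lambda>x. A x $ i $ j) \<in> borel_measurable N" and y[measurable]: "\<And>i. (\<lambda>x. y x $ i) \<in> borel_measurable N"
  shows "(\<lambda>x. (matrix_inv (A x) *v y x) $ k) \<in> borel_measurable N"
proof -
  have d: "(\<lambda>x. det (C x)) \<in> borel_measurable N" if [measurable]: "\<And>i j. (\<lambda>x. C x $ i $ j) \<in> borel_measurable N" for C :: "'a \<Rightarrow> real^'n^'n"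
    unfolding det_def by measurable
  let ?C = "\<lambda>x. \<chi> i j. if j = k then y x $ i else A x $ i $ j"
  have [measurable]: "(\<lambda>x. det (A x)) \<in> borel_measurable N" "(\<lambda>x. det (?C x)) \<in> borel_measurable N"
    by (auto intro!: d)
  have "(\<lambda>x. (matrix_inv (A x) *v y x) $ k) =
    (\<lambda>x. if det (A x) = 0 then \<Sum>j\<in>UNIV. (SOME C :: real^'n^'n. False) $ k $ j * y x $ j else det (?C x) / det (A x))"
  proof
    fix x
    show "(matrix_inv (A x) *v y x) $ k =
      (if det (A x) = 0 then \<Sum>j\<in>UNIV. (SOME C :: real^'n^'n. False) $ k $ j * y x $ j else det (?C x) / det (A x))"
    proof (cases "det (A x) = 0")
      case True
      then have "\<not> invertible (A x)" by (simp add: invertible_det_nz)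
      then have "matrix_inv (A x) = (SOME C. False)" unfolding matrix_inv_def invertible_def by meson
      then show ?thesis using True by (simp add: matrix_vector_mult_def)
    next
      case False
      then have i: "invertible (A x)" by (simp add: invertible_det_nz)
      from cramer[OF False, of "matrix_inv (A x) *v y x" "y x"] have
        "matrix_inv (A x) *v y x = (\<chi> k. det (\<chi> i j. if j = k then y x $ i else A x $ i $ j) / det (A x))"
        using matrix_inv_vector[OF i] by simp
      then show ?thesis using False by simp
    qed
  qed
  also have "\<dots> \<in> borel_measurable N" by measurable
  finally show ?thesis .
qed

section \<open>Bounded C1 functions and a monotone class theorem\<close>

lemma bounded_C1_const: "bounded_C1 (\<lambda>_. c) (\<lambda>_. 0)"
  unfolding bounded_C1_def by (auto simp: image_def zero_blinfun.rep_eq)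

lemma bounded_C1_mult:
  assumes "bounded_C1 f f'" "bounded_C1 g g'"
  shows "bounded_C1 (\<lambda>y. f y * g y) (\<lambda>y. f y *\<^sub>R g' y + g y *\<^sub>R f' y)"
proof -
  obtain K1 K2 K3 K4 where K: "\<And>y. \<bar>f y\<bar> \<le> K1" "\<And>y. \<bar>g y\<bar> \<le> K2" "\<And>y. norm (f' y) \<le> K3" "\<And>y. norm (g' y) \<le> K4"
    using assms unfolding bounded_C1_def bounded_iff by auto
  have K0: "0 \<le> K1" "0 \<le> K2"
    using order_trans[OF abs_ge_zero K(1)] order_trans[OF abs_ge_zero K(2)] by auto
  have c: "continuous_on UNIV f" "continuous_on UNIV g"
    using assms unfolding bounded_C1_def by (auto intro!: continuous_at_imp_continuous_on has_derivative_continuous)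
  have "bounded (range (\<lambda>y. f y * g y))"
    using K K0 by (intro boundedI[of _ "K1 * K2"]) (auto simp: abs_mult intro!: mult_mono)
  moreover have "norm (f y *\<^sub>R g' y + g y *\<^sub>R f' y) \<le> K1 * K4 + K2 * K3" for y
    by (rule norm_triangle_le) (auto intro!: add_mono mult_mono K K0)
  then have "bounded (range (\<lambda>y. f y *\<^sub>R g' y + g y *\<^sub>R f' y))"
    by (intro boundedI[of _ "K1 * K4 + K2 * K3"]) auto
  moreover have "((\<lambda>y. f y * g y) has_derivative blinfun_apply (f y *\<^sub>R g' y + g y *\<^sub>R f' y)) (at y)" for y
  proof -
    have "(f has_derivative f' y) (at y)" "(g has_derivative g' y) (at y)" using assms unfolding bounded_C1_def by blast+
    from has_derivative_mult[OF this]
    have "((\<lambda>y. f y * g y) has_derivative (\<lambda>h. f y * g' y h + f' y h * g y)) (at y)" .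
    moreover have "(\<lambda>h. f y * g' y h + f' y h * g y) = blinfun_apply (f y *\<^sub>R g' y + g y *\<^sub>R f' y)"
      by (simp add: fun_eq_iff blinfun.bilinear_simps mult.commute)
    ultimately show ?thesis by simp
  qed
  ultimately show ?thesis using assms c unfolding bounded_C1_def by (auto intro!: continuous_intros)
qed

lemma bounded_C1_ridge:
  fixes L :: "(real \<times> complex) \<Rightarrow>\<^sub>L real"
  assumes "\<And>s. (\<phi> has_real_derivative \<phi>' s) (at s)" "continuous_on UNIV \<phi>'" "\<And>s. \<bar>\<phi> s\<bar> \<le> K" "\<And>s. \<bar>\<phi>' s\<bar> \<le> K'"
  shows "bounded_C1 (\<lambda>y. \<phi> (L y)) (\<lambda>y. \<phi>' (L y) *\<^sub>R L)"
proof -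
  have "((\<lambda>y. \<phi> (L y)) has_derivative blinfun_apply (\<phi>' (L y) *\<^sub>R L)) (at y)" for y
  proof -
    have "((\<lambda>y. \<phi> (L y)) has_derivative (\<lambda>h. \<phi>' (L y) * L h)) (at y)"
      by (rule has_derivative_compose[where f = L, OF _ assms(1)[unfolded has_field_derivative_def]])
         (rule blinfun.bounded_linear_right[THEN bounded_linear_imp_has_derivative])
    moreover have "(\<lambda>h. \<phi>' (L y) * L h) = blinfun_apply (\<phi>' (L y) *\<^sub>R L)"
      by (simp add: fun_eq_iff blinfun.scaleR_left)
    ultimately show ?thesis by simp
  qed
  moreover have "bounded (range (\<lambda>y. \<phi> (L y)))" using assms by (intro boundedI[of _ K]) auto
  moreover have "bounded (range (\<lambda>y. \<phi>' (L y) *\<^sub>R L))"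
    using assms by (intro boundedI[of _ "K' * norm L"]) (auto intro!: mult_right_mono)
  moreover have "continuous_on UNIV (\<lambda>y. \<phi>' (L y) *\<^sub>R L)"
    using assms(2) by (intro continuous_intros continuous_on_compose2[OF assms(2)]) auto
  ultimately show ?thesis unfolding bounded_C1_def by auto
qed

text \<open>Smooth approximation of the indicator of the open half-line. The shift by
  \<open>sqrt (real n)\<close> sends the value at \<open>s = 0\<close> to 0 instead of leaving it at
  1/2, and is too small to affect the limit at \<open>s > 0\<close>.\<close>

definition smooth_step :: "nat \<Rightarrow> real \<Rightarrow> real" where
  "smooth_step n s = 1/2 + arctan (real n * s - sqrt (real n)) / pi"

lemma smooth_step_bound: "0 \<le> smooth_step n s" "smooth_step n s \<le> 1"
  using arctan_bounded[of "real n * s - sqrt (real n)"] unfolding smooth_step_def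
  by (auto simp: field_simps)

lemma smooth_step_tendsto: "(\<lambda>n. smooth_step n s) \<longlonglongrightarrow> indicator {0<..} s"
proof (cases "s > 0")
  case True
  have "filterlim (\<lambda>n. sqrt (real n)) at_top sequentially"
    by (intro filterlim_compose[OF sqrt_at_top] filterlim_real_sequentially)
  then have *: "filterlim (\<lambda>n. sqrt (real n) * (sqrt (real n) * s + - 1)) at_top sequentially"
    using filterlim_at_top_mult_at_top[OF _ filterlim_tendsto_add_at_top[OF tendsto_const[of "-1"]
        filterlim_tendsto_pos_mult_at_top[OF tendsto_const[of s] True]]]
    by (simp add: ac_simps)
  have "(\<lambda>n. real n * s - sqrt (real n)) = (\<lambda>n. sqrt (real n) * (sqrt (real n) * s + - 1))"
    by (rule ext) (simp add: algebra_simps)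
  with * have "filterlim (\<lambda>n. real n * s - sqrt (real n)) at_top sequentially" by simp
  from filterlim_compose[OF tendsto_arctan_at_top this]
  have "(\<lambda>n. smooth_step n s) \<longlonglongrightarrow> 1/2 + (pi/2) / pi" unfolding smooth_step_def by (intro tendsto_intros) auto
  then show ?thesis using True by simp
next
  case False
  have "filterlim (\<lambda>n. sqrt (real n)) at_top sequentially"
    by (intro filterlim_compose[OF sqrt_at_top] filterlim_real_sequentially)
  then have "filterlim (\<lambda>n. - (real n * s - sqrt (real n))) at_top sequentially"
    by (rule filterlim_at_top_mono) (use False in \<open>auto simp: mult_nonneg_nonpos\<close>)
  then have "filterlim (\<lambda>n. real n * s - sqrt (real n)) at_bot sequentially"
    by (simp only: filterlim_uminus_at_bot)
  from filterlim_compose[OF tendsto_arctan_at_bot this]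
  have "(\<lambda>n. smooth_step n s) \<longlonglongrightarrow> 1/2 + (-(pi/2)) / pi" unfolding smooth_step_def by (intro tendsto_intros) auto
  then show ?thesis using False by simp
qed

lemma smooth_step_ridge: "\<exists>f'. bounded_C1 (\<lambda>y. smooth_step n (c * blinfun_apply L y + d)) f'"
proof -
  let ?d = "\<lambda>s. inverse (1 + (real n * (c * s + d) - sqrt (real n))\<^sup>2) * (real n * c) / pi"
  have "bounded_C1 (\<lambda>y. smooth_step n (c * blinfun_apply L y + d)) (\<lambda>y. ?d (L y) *\<^sub>R L)"
  proof (rule bounded_C1_ridge[where K = 1 and K' = "\<bar>real n * c\<bar> / pi"])
    show "((\<lambda>s. smooth_step n (c * s + d)) has_real_derivative ?d s) (at s)" for s
      unfolding smooth_step_def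
      by (rule DERIV_cong[OF DERIV_add[OF DERIV_const DERIV_cdivide[OF DERIV_chain2[OF DERIV_arctan]]]])
        (auto intro!: derivative_eq_intros)
    have "1 + (real n * (c * s + d) - sqrt (real n))\<^sup>2 \<noteq> 0" for s
      using zero_le_power2[of "real n * (c * s + d) - sqrt (real n)"] by linarith
    then show "continuous_on UNIV ?d" by (intro continuous_intros) auto
    show "\<bar>smooth_step n (c * s + d)\<bar> \<le> 1" for s using smooth_step_bound[of n "c * s + d"] by linarith
    show "\<bar>?d s\<bar> \<le> \<bar>real n * c\<bar> / pi" for s
    proof -
      have "inverse (1 + (real n * (c * s + d) - sqrt (real n))\<^sup>2) \<le> 1"
        by (simp add: inverse_le_1_iff)
      then show ?thesis
        by (simp add: abs_mult divide_right_mono mult_left_le_one_le del: inverse_le_1_iff)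
    qed
  qed
  then show ?thesis by blast
qed

text \<open>Indicators of open boxes are limits of products of six smooth steps, one for each face.
  Boxes form an intersection-stable generator, so Dynkin's theorem gives all Borel indicators, and
  finite combinations of these approximate \<open>f\<close> uniformly.\<close>

lemma bounded_borel_induct_C1:
  fixes V :: "(real \<times> complex \<Rightarrow> real) \<Rightarrow> bool"
  assumes C1: "\<And>f f'. bounded_C1 f f' \<Longrightarrow> V f"
    and lin: "\<And>f g c. V f \<Longrightarrow> V g \<Longrightarrow> f \<in> borel_measurable borel \<Longrightarrow> g \<in> borel_measurable borel \<Longrightarrow>
        bounded (range f) \<Longrightarrow> bounded (range g) \<Longrightarrow> V (\<lambda>y. f y + c * g y)"
    and lim: "\<And>F f K. (\<And>n. V (F n)) \<Longrightarrow> (\<And>n. F n \<in> borel_measurable borel) \<Longrightarrow> f \<in> borel_measurable borel \<Longrightarrow>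
        (\<And>n y. \<bar>F n y\<bar> \<le> K) \<Longrightarrow> (\<And>y. \<bar>f y\<bar> \<le> K) \<Longrightarrow> (\<And>y. (\<lambda>n. F n y) \<longlonglongrightarrow> f y) \<Longrightarrow> V f"
    and f: "f \<in> borel_measurable borel" "bounded (range f)"
  shows "V f"
proof -
  have C1m: "g \<in> borel_measurable borel" if "bounded_C1 g g'" for g g'
    using that unfolding bounded_C1_def
    by (auto intro!: borel_measurable_continuous_onI continuous_at_imp_continuous_on has_derivative_continuous)
  have Vc: "V (\<lambda>_. c)" for c using C1 bounded_C1_const by blast
  have bi: "bounded (range (indicat_real A))" for A :: "(real \<times> complex) set"
    by (rule boundedI[of _ 1]) (auto simp: indicator_def)
  have sum: "V (\<lambda>y. \<Sum>i<n. c i * indicat_real (A i) y) \<and> bounded (range (\<lambda>y. \<Sum>i<n. c i * indicat_real (A i) y))"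
    if "\<And>i. A i \<in> sets borel" "\<And>i. V (indicat_real (A i))" for A c and n :: nat
  proof (induction n)
    case (Suc n)
    have b: "bounded (range (\<lambda>y. \<Sum>i<m. c i * indicat_real (A i) y))" for m
    proof (rule boundedI)
      fix z assume "z \<in> range (\<lambda>y. \<Sum>i<m. c i * indicat_real (A i) y)"
      then obtain y where z: "z = (\<Sum>i<m. c i * indicat_real (A i) y)" by blast
      have "\<bar>z\<bar> \<le> (\<Sum>i<m. \<bar>c i * indicat_real (A i) y\<bar>)" unfolding z by (rule sum_abs)
      also have "\<dots> \<le> (\<Sum>i<m. \<bar>c i\<bar>)" by (intro sum_mono) (simp add: indicator_def)
      finally show "norm z \<le> (\<Sum>i<m. \<bar>c i\<bar>)" by simp
    qed
    have m: "(\<lambda>y. \<Sum>i<n. c i * indicat_real (A i) y) \<in> borel_measurable borel"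
      using that(1) by (intro borel_measurable_sum borel_measurable_times borel_measurable_indicator) auto
    have "V (\<lambda>y. (\<Sum>i<n. c i * indicat_real (A i) y) + c n * indicat_real (A n) y)"
      using Suc[THEN conjunct1] that b[of n] bi m by (intro lin borel_measurable_indicator) 
    then show ?case using b[of "Suc n"] by simp
  qed (simp add: Vc)
  have ind: "V (indicat_real A)" if "A \<in> sets borel" for A
  proof -
    let ?G = "range (\<lambda>(a, b). box a b) :: (real \<times> complex) set set"
    have A: "A \<in> sigma_sets UNIV ?G"
      using that by (subst (asm) borel_eq_box) (simp add: sets_measure_of)
    have "Int_stable ?G" 
    proof (rule Int_stableI)
      fix X Y assume "X \<in> ?G" "Y \<in> ?G"
      then obtain a b c d where "X = box a b" "Y = box c d" by auto
      then have "X \<inter> Y = (\<lambda>(a, b). box a b) (\<Sum>i\<in>Basis. max (a \<bullet> i) (c \<bullet> i) *\<^sub>R i, \<Sum>i\<in>Basis. min (b \<bullet> i) (d \<bullet> i) *\<^sub>R i)"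
        by (simp only: box_Int_box prod.case)
      then show "X \<inter> Y \<in> ?G" by (rule range_eqI)
    qed
    moreover have "?G \<subseteq> Pow UNIV" by simp
    ultimately show ?thesis using A
    proof (induction A rule: sigma_sets_induct_disjoint)
      case (basic A)
      then obtain a b where A: "A = box a b" by auto
      define L1 :: "(real \<times> complex) \<Rightarrow>\<^sub>L real" where "L1 = Blinfun fst"
      define L2 :: "(real \<times> complex) \<Rightarrow>\<^sub>L real" where "L2 = Blinfun (\<lambda>y. Re (snd y))"
      define L3 :: "(real \<times> complex) \<Rightarrow>\<^sub>L real" where "L3 = Blinfun (\<lambda>y. Im (snd y))"
      have L: "blinfun_apply L1 = fst" "blinfun_apply L2 = (\<lambda>y. Re (snd y))" "blinfun_apply L3 = (\<lambda>y. Im (snd y))"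
        unfolding L1_def L2_def L3_def
        by (auto intro!: bounded_linear_Blinfun_apply bounded_linear_fst bounded_linear_snd bounded_linear_compose[OF bounded_linear_Re]
            bounded_linear_compose[OF bounded_linear_Im])
      define F where "F n y = (smooth_step n (1 * L1 y + (- fst a)) * smooth_step n (-1 * L1 y + fst b)) *
         ((smooth_step n (1 * L2 y + (- Re (snd a))) * smooth_step n (-1 * L2 y + Re (snd b))) *
          (smooth_step n (1 * L3 y + (- Im (snd a))) * smooth_step n (-1 * L3 y + Im (snd b))))" for n y
      have m: "\<exists>h'. bounded_C1 (\<lambda>y. f y * g y) h'" if "\<exists>f'. bounded_C1 f f'" "\<exists>g'. bounded_C1 g g'" for f g
        using that bounded_C1_mult by blast
      have FC: "\<exists>f'. bounded_C1 (F n) f'" for n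
        unfolding F_def[abs_def] by (intro m smooth_step_ridge)
      have box: "indicat_real A y = (indicator {0<..} (1 * L1 y + (- fst a)) * indicator {0<..} (-1 * L1 y + fst b)) *
         ((indicator {0<..} (1 * L2 y + (- Re (snd a))) * indicator {0<..} (-1 * L2 y + Re (snd b))) *
          (indicator {0<..} (1 * L3 y + (- Im (snd a))) * indicator {0<..} (-1 * L3 y + Im (snd b))))" for y
        unfolding A L by (auto simp: indicator_def mem_box Basis_prod_def Basis_complex_def inner_complex_def inner_prod_def)
      show ?case
      proof (rule lim[where F = F and K = 1])
        show "\<And>n. V (F n)" "\<And>n. F n \<in> borel_measurable borel" using FC C1 C1m by blast+
        show "indicat_real A \<in> borel_measurable borel" using A by simp
        have "0 \<le> F n y \<and> F n y \<le> 1" for n y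
          unfolding F_def using smooth_step_bound[of n] by (intro conjI mult_nonneg_nonneg mult_le_one) auto
        then show "\<bar>F n y\<bar> \<le> 1" for n y by (metis abs_of_nonneg)
        show "(\<lambda>n. F n y) \<longlonglongrightarrow> indicat_real A y" for y
          unfolding F_def box by (intro tendsto_mult smooth_step_tendsto)
      qed (auto simp: indicator_def)
    next
      case empty show ?case using Vc[of 0] by (simp add: indicator_def)
    next
      case (compl A)
      then have [measurable]: "A \<in> sets borel" by (subst borel_eq_box) (simp add: sets_measure_of)
      have "V (\<lambda>y. 1 + (-1) * indicat_real A y)" using compl Vc[of 1] bi by (intro lin) auto
      moreover have "(\<lambda>y. 1 + (-1) * indicat_real A y) = indicat_real (UNIV - A)" by (auto simp: indicator_def fun_eq_iff)
      ultimately show ?case by simp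
    next
      case (union A)
      then have [measurable]: "A i \<in> sets borel" for i by (subst borel_eq_box) (simp add: sets_measure_of subset_eq)
      have eq: "(\<Sum>i<n. 1 * indicat_real (A i) y) = indicat_real (\<Union>i<n. A i) y" for n y
        using union(1) by (subst indicator_UN_disjoint) (auto simp: disjoint_family_on_def)
      show ?case
      proof (rule lim[where F = "\<lambda>n y. \<Sum>i<n. 1 * indicat_real (A i) y" and K = 1])
        show "V (\<lambda>y. \<Sum>i<n. 1 * indicat_real (A i) y)" for n using sum[of A "\<lambda>_. 1" n] union by auto
        show "(\<lambda>n. \<Sum>i<n. 1 * indicat_real (A i) y) \<longlonglongrightarrow> indicat_real (\<Union> (range A)) y" for y
          unfolding eq by (rule LIMSEQ_indicator_UN)
        show "\<bar>\<Sum>i<n. 1 * indicat_real (A i) y\<bar> \<le> 1" for n y unfolding eq by (simp add: indicator_def)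
      qed (auto simp: indicator_def)
    qed
  qed
  obtain K where K: "\<And>y. \<bar>f y\<bar> \<le> K" using f(2) unfolding bounded_iff by auto
  then have K0: "0 \<le> K" by (meson abs_ge_zero order_trans)
  note [measurable] = f(1)
  \<comment> \<open>The floor of \<open>real n * f y\<close> lies between
    \<open>- \<lceil>K * real n\<rceil>\<close> and \<open>\<lceil>K * real n\<rceil>\<close>;
    shifted by \<open>\<lceil>K * real n\<rceil> + 1\<close> it becomes a natural number below
    \<open>?N n\<close>.\<close>
  let ?N = "\<lambda>n. nat (2 * \<lceil>K * real n\<rceil> + 2)"
  define A where "A n i = {y. \<lfloor>real n * f y\<rfloor> = int i - (\<lceil>K * real n\<rceil> + 1)}" for n i :: nat
  have [measurable]: "A n i \<in> sets borel" for n i unfolding A_def by measurable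
  have eq: "(\<Sum>i<?N n. ((real i - (\<lceil>K * real n\<rceil> + 1)) / real n) * indicat_real (A n i) y) = \<lfloor>real n * f y\<rfloor> / real n" for n y
  proof -
    define j where "j = nat (\<lfloor>real n * f y\<rfloor> + (\<lceil>K * real n\<rceil> + 1))"
    have "real n * \<bar>f y\<bar> \<le> K * real n" unfolding mult.commute[of "real n"] by (intro mult_right_mono K) simp
    then have 1: "- (K * real n) \<le> real n * f y" "real n * f y \<le> K * real n"
      using mult_left_mono[OF abs_ge_self[of "f y"], of "real n"] mult_left_mono[OF abs_ge_minus_self[of "f y"], of "real n"] by auto
    then have jb: "\<lfloor>real n * f y\<rfloor> + (\<lceil>K * real n\<rceil> + 1) \<ge> 0" "\<lfloor>real n * f y\<rfloor> \<le> \<lceil>K * real n\<rceil>" by linarith+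
    then have jN: "j < ?N n" unfolding j_def by linarith
    have ij: "indicat_real (A n i) y = (if i = j then 1 else 0)" for i
      using jb by (auto simp: A_def indicator_def j_def)
    have "(\<Sum>i<?N n. ((real i - (\<lceil>K * real n\<rceil> + 1)) / real n) * indicat_real (A n i) y)
        = (\<Sum>i<?N n. if i = j then (real j - (\<lceil>K * real n\<rceil> + 1)) / real n else 0)"
      by (intro sum.cong) (auto simp: ij)
    also have "\<dots> = (real j - (\<lceil>K * real n\<rceil> + 1)) / real n" using jN by simp
    also have "real j = \<lfloor>real n * f y\<rfloor> + (\<lceil>K * real n\<rceil> + 1)" using jb by (simp add: j_def)
    finally show ?thesis by simp
  qed
  show "V f"
  proof (rule lim[where F = "\<lambda>n y. \<lfloor>real n * f y\<rfloor> / real n" and K = "K + 1"])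
    show "V (\<lambda>y. \<lfloor>real n * f y\<rfloor> / real n)" for n
      using sum[of "A n" "\<lambda>i. (real i - (\<lceil>K * real n\<rceil> + 1)) / real n" "?N n"] ind unfolding eq by auto
    have c: "\<bar>\<lfloor>real n * f y\<rfloor> / real n - f y\<bar> \<le> 1 / real n" if "n > 0" for n y
    proof -
      have "\<bar>\<lfloor>real n * f y\<rfloor> - real n * f y\<bar> \<le> 1" by linarith
      moreover have "\<lfloor>real n * f y\<rfloor> / real n - f y = (\<lfloor>real n * f y\<rfloor> - real n * f y) / real n" using that by (simp add: field_simps)
      ultimately show ?thesis by (simp add: divide_right_mono)
    qed
    show "\<bar>\<lfloor>real n * f y\<rfloor> / real n\<bar> \<le> K + 1" for n y
    proof (cases "n = 0")
      case False
      then have "1 / real n \<le> 1" by simp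
      with c[of n y] K[of y] False show ?thesis by (simp only: abs_le_iff) linarith
    qed (simp add: K0)
    show "(\<lambda>n. \<lfloor>real n * f y\<rfloor> / real n) \<longlonglongrightarrow> f y" for y
      by (rule Lim_null[THEN iffD2], rule Lim_null_comparison[OF _ lim_1_over_n])
         (rule eventually_sequentiallyI[of 1], use c[of _ y] in simp)
    show "\<bar>f y\<bar> \<le> K + 1" for y using K[of y] by simp
  qed auto
qed

section \<open>Functionals of a path\<close>

text \<open>Time derivative of the coordinates of \<open>h_vec\<close>, as a function of the current
  angle; the value 0 belongs to the constant coordinate. All three coordinates can then be treated
  by one argument with an index \<open>i\<close>.\<close>

definition hfun :: "3 \<Rightarrow> real \<Rightarrow> real" where
  "hfun i y = (if i = 1 then 0 else if i = 2 then sin y else - cos y)"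

definition hfun' :: "3 \<Rightarrow> real \<Rightarrow> real" where
  "hfun' i y = (if i = 1 then 0 else if i = 2 then cos y else sin y)"

lemma hfun_measurable [measurable]: "hfun i \<in> borel_measurable borel" "hfun' i \<in> borel_measurable borel"
  unfolding hfun_def[abs_def] hfun'_def[abs_def] by (cases "i = 1"; cases "i = 2"; simp)+

lemma hfun_bound: "\<bar>hfun i y\<bar> \<le> 1" "\<bar>hfun' i y\<bar> \<le> 1"
  by (auto simp: hfun_def hfun'_def)

lemma DERIV_hfun: "(hfun i has_real_derivative hfun' i y) (at y)"
  unfolding hfun_def[abs_def] hfun'_def by (cases "i = 1"; cases "i = 2") (auto intro!: derivative_eq_intros)

lemma isCont_hfun: "isCont (hfun i) y" "isCont (hfun' i) y"
  using DERIV_isCont[OF DERIV_hfun] unfolding hfun'_def[abs_def] by (cases "i = 1"; cases "i = 2"; simp)+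

lemma h_vec_nth: "h_vec b t $ i = (if i = 1 then 1 else 0) + (LBINT s:{0..t}. hfun i (b s))"
  using exhaust_3[of i] by (auto simp: h_vec_def hfun_def set_lebesgue_integral_def)

lemma set_integral_cis:
  assumes [measurable]: "b \<in> borel_measurable borel"
  shows "(LBINT s:{0..t}. cis (b s)) = of_real (- h_vec b t $ 3) + \<i> * of_real (h_vec b t $ 2)"
proof -
  have i: "integrable lborel (\<lambda>s. indicat_real {0..t} s *\<^sub>R cis (b s))"
    using set_integrable_bounded[of "\<lambda>s. cis (b s)" 0 t 1] by (simp add: set_integrable_def cis_conv_exp)
  show ?thesis using integral_Re[OF i] integral_Im[OF i]
    by (simp add: set_lebesgue_integral_def complex_eq_iff h_vec_nth hfun_def)
qed

lemma kbm_eq: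
  assumes "b \<in> borel_measurable borel"
  shows "kbm T x b = (fst x + b T, snd x + cis (fst x) * (of_real (- h_vec b T $ 3) + \<i> * of_real (h_vec b T $ 2)))"
  by (simp add: kbm_def set_integral_cis[OF assms])

text \<open>The derivative of \<open>h_vec\<close> when the path \<open>b\<close> is shifted by
  \<open>k\<close>. Here and below \<open>k\<close> is the shift itself, that is, the primitive of a
  direction in L2 and not the direction.\<close>

definition h_vec_deriv :: "(real \<Rightarrow> real) \<Rightarrow> (real \<Rightarrow> real) \<Rightarrow> real \<Rightarrow> 3 \<Rightarrow> real" where
  "h_vec_deriv b k t i = (LBINT s:{0..t}. hfun' i (b s) * k s)"

text \<open>As a function of \<open>t\<close>, the path shift that belongs to the direction
  h_i.\<close>

definition h_vec_integral :: "(real \<Rightarrow> real) \<Rightarrow> 3 \<Rightarrow> real \<Rightarrow> real" where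
  "h_vec_integral b i t = (LBINT s:{0..t}. h_vec b s $ i)"

definition gram_deriv :: "real \<Rightarrow> (real \<Rightarrow> real) \<Rightarrow> (real \<Rightarrow> real) \<Rightarrow> real^3^3" where
  "gram_deriv T b k = (\<chi> i j. LBINT t:{0..T}. h_vec_deriv b k t i * h_vec b t $ j + h_vec b t $ i * h_vec_deriv b k t j)"

text \<open>The regularised inverse is bounded by \<open>1 / \<epsilon>\<close> for every path, in particular for the step
  paths of the discretisation, whose own Gram matrices need not be invertible.\<close>

definition reg_gram :: "real \<Rightarrow> real \<Rightarrow> (real \<Rightarrow> real) \<Rightarrow> real^3^3" where
  "reg_gram \<epsilon> T b = red_malliavin T b + \<epsilon> *\<^sub>R mat 1"

definition reg_weight :: "real \<Rightarrow> real \<Rightarrow> real^3 \<Rightarrow> (real \<Rightarrow> real) \<Rightarrow> real^3" where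
  "reg_weight \<epsilon> T w b = matrix_inv (reg_gram \<epsilon> T b) *v w"

text \<open>The derivative of the end point \<open>kbm T x b\<close> under a shift of the path by
  \<open>k\<close>. \<open>malliavin_deriv\<close> turns into this expression once the direction is
  replaced by its primitive.\<close>

definition kbm_tangent :: "real \<Rightarrow> real \<times> complex \<Rightarrow> (real \<Rightarrow> real) \<Rightarrow> (real \<Rightarrow> real) \<Rightarrow> real \<times> complex" where
  "kbm_tangent T x b k = (k T, cis (fst x) * (of_real (- h_vec_deriv b k T 3) + \<i> * of_real (h_vec_deriv b k T 2)))"

text \<open>The functional that is integrated by parts in the direction h_i, with the same
  \<open>i\<close> as the coordinate of the weight.\<close>

definition Phi where
  "Phi f \<epsilon> T x w i b = f (kbm T x b) * reg_weight \<epsilon> T w b $ i" for f :: "real \<times> complex \<Rightarrow> real"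

text \<open>The derivative of \<open>Phi\<close> under a path shift by \<open>k\<close>; the second
  term and its sign come from differentiating the inverse matrix.\<close>

definition DPhi where
  "DPhi f f' \<epsilon> T x w i b k = blinfun_apply (f' (kbm T x b)) (kbm_tangent T x b k) * reg_weight \<epsilon> T w b $ i
     - f (kbm T x b) * (matrix_inv (reg_gram \<epsilon> T b) *v (gram_deriv T b k *v reg_weight \<epsilon> T w b)) $ i"
  for f :: "real \<times> complex \<Rightarrow> real" and f' :: "real \<times> complex \<Rightarrow> (real \<times> complex) \<Rightarrow>\<^sub>L real"

section \<open>Measurability in the sample point and in time\<close>

lemma measurable_set_integral:
  fixes g :: "'a \<Rightarrow> real \<Rightarrow> real"
  assumes [measurable]: "case_prod g \<in> borel_measurable (N \<Otimes>\<^sub>M borel)"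
  shows "case_prod (\<lambda>\<omega> t. LBINT s:{0..t}. g \<omega> s) \<in> borel_measurable (N \<Otimes>\<^sub>M borel)"
proof -
  \<comment> \<open>The moving upper limit enters as a factor that is jointly measurable in all
    variables, so that a parametrised integral over the whole line remains.\<close>
  have *: "(\<lambda>q. (if 0 \<le> snd q \<and> snd q \<le> snd (fst q) then 1 else 0) * g (fst (fst q)) (snd q)) \<in> borel_measurable ((N \<Otimes>\<^sub>M borel) \<Otimes>\<^sub>M lborel)"
    by measurable
  have "case_prod (\<lambda>\<omega> t. LBINT s:{0..t}. g \<omega> s)
     = (\<lambda>p. LINT s|lborel. (if 0 \<le> s \<and> s \<le> snd p then 1 else 0) * g (fst p) s)"
    by (auto simp: set_lebesgue_integral_def fun_eq_iff indicator_def intro!: Bochner_Integration.integral_cong)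
  also have "\<dots> \<in> borel_measurable (N \<Otimes>\<^sub>M borel)"
    using lborel.borel_measurable_lebesgue_integral[of "\<lambda>p s. (if 0 \<le> s \<and> s \<le> snd p then 1 else 0) * g (fst p) s" "N \<Otimes>\<^sub>M borel"] *
    by (simp add: case_prod_unfold)
  finally show ?thesis .
qed

lemma measurable_section:
  assumes "case_prod g \<in> borel_measurable (N \<Otimes>\<^sub>M borel)"
  shows "(\<lambda>\<omega>. g \<omega> (t::real)) \<in> borel_measurable N"
  using measurable_compose[OF measurable_Pair2'[of t borel N] assms] by simp

context
  fixes N :: "'a measure" and Y Z :: "'a \<Rightarrow> real \<Rightarrow> real"
  assumes Y[measurable]: "case_prod Y \<in> borel_measurable (N \<Otimes>\<^sub>M borel)"
begin

lemma measurable_h_vec: "case_prod (\<lambda>\<omega> t. h_vec (Y \<omega>) t $ i) \<in> borel_measurable (N \<Otimes>\<^sub>M borel)"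
proof -
  have [measurable]: "case_prod (\<lambda>\<omega> t. LBINT s:{0..t}. hfun i (Y \<omega> s)) \<in> borel_measurable (N \<Otimes>\<^sub>M borel)"
    by (intro measurable_set_integral) measurable
  show ?thesis unfolding h_vec_nth by measurable
qed

lemma measurable_h_vec_integral: "case_prod (\<lambda>\<omega> t. h_vec_integral (Y \<omega>) i t) \<in> borel_measurable (N \<Otimes>\<^sub>M borel)"
  unfolding h_vec_integral_def by (intro measurable_set_integral measurable_h_vec)

lemma measurable_red_malliavin: "(\<lambda>\<omega>. red_malliavin T (Y \<omega>) $ i $ j) \<in> borel_measurable N"
proof -
  note [measurable] = measurable_h_vec
  have "case_prod (\<lambda>\<omega> t. LBINT s:{0..t}. h_vec (Y \<omega>) s $ i * h_vec (Y \<omega>) s $ j) \<in> borel_measurable (N \<Otimes>\<^sub>M borel)"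
    by (intro measurable_set_integral) measurable
  from measurable_section[OF this, of T] show ?thesis by (simp add: red_malliavin_gram L2_inner_def)
qed

lemma measurable_reg_gram: "(\<lambda>\<omega>. reg_gram \<epsilon> T (Y \<omega>) $ i $ j) \<in> borel_measurable N"
  unfolding reg_gram_def using measurable_red_malliavin[of T i j] by simp

lemma measurable_reg_weight: "(\<lambda>\<omega>. reg_weight \<epsilon> T w (Y \<omega>) $ i) \<in> borel_measurable N"
  unfolding reg_weight_def by (intro borel_measurable_matrix_inv_vector measurable_reg_gram) simp

lemma measurable_kbm: "(\<lambda>\<omega>. kbm T x (Y \<omega>)) \<in> borel_measurable N"
proof -
  note [measurable] = measurable_section[OF measurable_h_vec, of T] measurable_section[OF Y, of T]
  have "Y \<omega> \<in> borel_measurable borel" if "\<omega> \<in> space N" for \<omega>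
    using measurable_compose_Pair1[OF that Y] by simp
  then have "(\<lambda>\<omega>. kbm T x (Y \<omega>)) \<in> borel_measurable N \<longleftrightarrow> (\<lambda>\<omega>. (fst x + Y \<omega> T, snd x + cis (fst x) * 
      (of_real (- h_vec (Y \<omega>) T $ 3) + \<i> * of_real (h_vec (Y \<omega>) T $ 2)))) \<in> borel_measurable N"
    by (intro measurable_cong) (simp add: kbm_eq)
  then show ?thesis by simp
qed

context
  assumes Z[measurable]: "case_prod Z \<in> borel_measurable (N \<Otimes>\<^sub>M borel)"
begin

lemma measurable_h_vec_deriv: "case_prod (\<lambda>\<omega> t. h_vec_deriv (Y \<omega>) (Z \<omega>) t i) \<in> borel_measurable (N \<Otimes>\<^sub>M borel)"
  unfolding h_vec_deriv_def by (intro measurable_set_integral) measurable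

lemma measurable_gram_deriv: "(\<lambda>\<omega>. gram_deriv T (Y \<omega>) (Z \<omega>) $ i $ j) \<in> borel_measurable N"
proof -
  note [measurable] = measurable_h_vec measurable_h_vec_deriv
  have "case_prod (\<lambda>\<omega> t. LBINT s:{0..t}. h_vec_deriv (Y \<omega>) (Z \<omega>) s i * h_vec (Y \<omega>) s $ j + h_vec (Y \<omega>) s $ i * h_vec_deriv (Y \<omega>) (Z \<omega>) s j) \<in> borel_measurable (N \<Otimes>\<^sub>M borel)"
    by (intro measurable_set_integral) measurable
  from measurable_section[OF this, of T] show ?thesis by (simp add: gram_deriv_def)
qed

lemma measurable_kbm_tangent: "(\<lambda>\<omega>. kbm_tangent T x (Y \<omega>) (Z \<omega>)) \<in> borel_measurable N"
proof -
  note [measurable] = measurable_section[OF measurable_h_vec_deriv, of T] measurable_section[OF Z, of T]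
  show ?thesis unfolding kbm_tangent_def by measurable
qed

end

end

text \<open>Transfers the statements on random paths to one deterministic path, viewed as a process
  on the one-point space \<open>unit\<close>.\<close>

lemma borel_measurable_section:
  assumes [measurable]: "b \<in> borel_measurable borel" 
    and *: "\<And>Y. case_prod Y \<in> borel_measurable (count_space UNIV \<Otimes>\<^sub>M borel) \<Longrightarrow> case_prod (\<lambda>(\<omega>::unit) t. F (Y \<omega>) t) \<in> borel_measurable (count_space UNIV \<Otimes>\<^sub>M borel)"
  shows "(\<lambda>t::real. F b t :: real) \<in> borel_measurable borel"
  using measurable_compose_Pair1[OF _ *[of "\<lambda>_. b"], of "()"] by simp

lemma borel_measurable_h_vec [measurable (raw)]: "b \<in> borel_measurable borel \<Longrightarrow> (\<lambda>t. h_vec b t $ i) \<in> borel_measurable borel"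
  by (rule borel_measurable_section[where F = "\<lambda>b t. h_vec b t $ i", OF _ measurable_h_vec])

lemma borel_measurable_h_vec_integral [measurable (raw)]: "b \<in> borel_measurable borel \<Longrightarrow> h_vec_integral b i \<in> borel_measurable borel"
  by (rule borel_measurable_section[where F = "\<lambda>b t. h_vec_integral b i t", OF _ measurable_h_vec_integral])

lemma borel_measurable_h_vec_deriv [measurable (raw)]:
  assumes [measurable]: "b \<in> borel_measurable borel" "k \<in> borel_measurable borel"
  shows "(\<lambda>t. h_vec_deriv b k t i) \<in> borel_measurable borel"
proof -
  have "case_prod (\<lambda>(\<omega>::unit) t. h_vec_deriv b k t i) \<in> borel_measurable (count_space UNIV \<Otimes>\<^sub>M borel)"
    using measurable_h_vec_deriv[of "\<lambda>_::unit. b" "count_space UNIV" "\<lambda>_. k"] by simp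
  then show ?thesis using measurable_compose_Pair1[of "()" "count_space UNIV"] by fastforce
qed

lemma bounded_C1_measurable: "bounded_C1 f f' \<Longrightarrow> f \<in> borel_measurable borel"
  unfolding bounded_C1_def
  by (meson borel_measurable_continuous_onI continuous_at_imp_continuous_on has_derivative_continuous)

lemma measurable_Phi:
  assumes Y: "case_prod Y \<in> borel_measurable (N \<Otimes>\<^sub>M borel)" and f: "bounded_C1 f f'"
  shows "(\<lambda>\<omega>. Phi f \<epsilon> T x w i (Y \<omega>)) \<in> borel_measurable N"
proof -
  note [measurable] = bounded_C1_measurable[OF f] measurable_kbm[OF Y] measurable_reg_weight[OF Y]
  show ?thesis unfolding Phi_def by measurable
qed

lemma bounded_C1_measurable_deriv:
  assumes "bounded_C1 f f'" "X \<in> borel_measurable N" "V \<in> borel_measurable N"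
  shows "(\<lambda>\<omega>. blinfun_apply (f' (X \<omega>)) (V \<omega>)) \<in> borel_measurable N"
proof (rule borel_measurable_continuous_Pair[OF assms(2,3)])
  have "continuous_on UNIV f'" using assms(1) by (simp add: bounded_C1_def)
  from continuous_on_compose2[OF this continuous_on_fst[OF continuous_on_id]]
  have "continuous_on UNIV (\<lambda>p :: (real \<times> complex) \<times> (real \<times> complex). f' (fst p))" by simp
  then show "continuous_on UNIV (\<lambda>p. blinfun_apply (f' (fst p)) (snd p))"
    by (rule blinfun.continuous_on[OF _ continuous_on_snd[OF continuous_on_id]])
qed

lemma measurable_DPhi:
  assumes Y: "case_prod Y \<in> borel_measurable (N \<Otimes>\<^sub>M borel)" and Z: "case_prod Z \<in> borel_measurable (N \<Otimes>\<^sub>M borel)"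
    and f: "bounded_C1 f f'"
  shows "(\<lambda>\<omega>. DPhi f f' \<epsilon> T x w i (Y \<omega>) (Z \<omega>)) \<in> borel_measurable N"
proof -
  note [measurable] = bounded_C1_measurable[OF f] measurable_kbm[OF Y] measurable_reg_weight[OF Y] measurable_gram_deriv[OF Y Z]
    bounded_C1_measurable_deriv[OF f measurable_kbm[OF Y] measurable_kbm_tangent[OF Y Z]]
  have [measurable]: "(\<lambda>\<omega>. (matrix_inv (reg_gram \<epsilon> T (Y \<omega>)) *v (gram_deriv T (Y \<omega>) (Z \<omega>) *v reg_weight \<epsilon> T w (Y \<omega>))) $ i) \<in> borel_measurable N"
    by (intro borel_measurable_matrix_inv_vector measurable_reg_gram Y) (simp add: matrix_vector_mult_def)
  show ?thesis unfolding DPhi_def by measurable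
qed

section \<open>Bounds that are uniform over all paths\<close>

lemma h_vec_bound:
  assumes [measurable]: "b \<in> borel_measurable borel" and t: "0 \<le> t"
  shows "\<bar>h_vec b t $ i\<bar> \<le> 1 + t"
proof -
  have "\<bar>LBINT s:{0..t}. hfun i (b s)\<bar> \<le> t"
    using set_integral_norm_le[of "\<lambda>s. hfun i (b s)" 0 t 1] t by (simp add: hfun_bound)
  then show ?thesis unfolding h_vec_nth by (auto intro: order_trans[OF abs_triangle_ineq])
qed

lemma h_vec_bound':
  assumes "b \<in> borel_measurable borel" and "t \<in> {0..T}"
  shows "\<bar>h_vec b t $ i\<bar> \<le> 1 + T"
  using h_vec_bound[OF assms(1), of t i] assms(2) by simp

lemma h_vec_integral_bound:
  assumes [measurable]: "b \<in> borel_measurable borel" and t: "t \<in> {0..T}"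
  shows "\<bar>h_vec_integral b i t\<bar> \<le> (1 + T) * T"
proof -
  have "\<bar>h_vec_integral b i t\<bar> \<le> (1 + T) * t" unfolding h_vec_integral_def
    using set_integral_norm_le[of "\<lambda>s. h_vec b s $ i" 0 t "1 + T"] t h_vec_bound'[OF assms(1), of _ T] by simp
  also have "\<dots> \<le> (1 + T) * T" using t by (intro mult_left_mono) auto
  finally show ?thesis .
qed

lemma h_vec_deriv_bound:
  assumes [measurable]: "b \<in> borel_measurable borel" "k \<in> borel_measurable borel"
    and t: "t \<in> {0..T}" and K: "\<And>s. s \<in> {0..T} \<Longrightarrow> \<bar>k s\<bar> \<le> K" "0 \<le> K"
  shows "\<bar>h_vec_deriv b k t i\<bar> \<le> K * T"
proof -
  have "\<bar>hfun' i (b s) * k s\<bar> \<le> K" if "s \<in> {0..t}" for s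
    using mult_mono[OF hfun_bound(2)[of i "b s"] K(1)[of s]] that t by (simp add: abs_mult)
  then have "\<bar>h_vec_deriv b k t i\<bar> \<le> K * t" unfolding h_vec_deriv_def
    using set_integral_norm_le[of "\<lambda>s. hfun' i (b s) * k s" 0 t K] t by simp
  also have "\<dots> \<le> K * T" using t K by (intro mult_left_mono) auto
  finally show ?thesis .
qed

lemma red_malliavin_nth: "red_malliavin T b $ i $ j = (LBINT t:{0..T}. h_vec b t $ i * h_vec b t $ j)"
  by (simp add: red_malliavin_gram L2_inner_def)

lemma mult_bound: "\<bar>x\<bar> \<le> A \<Longrightarrow> \<bar>y\<bar> \<le> B \<Longrightarrow> \<bar>x * y\<bar> \<le> A * (B::real)"
  unfolding abs_mult by (intro mult_mono) auto

text \<open>Expanding the square turns the Gram form into a squared L2 norm. The coercivity of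
  \<open>reg_gram\<close> and the small ball estimate both rest on this.\<close>

lemma quad_red_malliavin:
  assumes [measurable]: "b \<in> borel_measurable borel"
  shows "v \<bullet> (red_malliavin T b *v v) = (LBINT t:{0..T}. (v \<bullet> h_vec b t)\<^sup>2)"
proof -
  have si: "set_integrable lborel {0..T} (\<lambda>t. c * (h_vec b t $ i * h_vec b t $ j))" for c i j
    by (intro set_integrable_mult_right set_integrable_bounded[of _ _ _ "(1+T) * (1+T)"])
       (auto intro!: mult_bound h_vec_bound' simp del: abs_mult)
  have "(LBINT t:{0..T}. (v \<bullet> h_vec b t)\<^sup>2) = (LBINT t:{0..T}. \<Sum>i\<in>UNIV. \<Sum>j\<in>UNIV. (v $ i * v $ j) * (h_vec b t $ i * h_vec b t $ j))"
    by (simp add: inner_vec_def power2_eq_square sum_product mult_ac)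
  also have "\<dots> = (\<Sum>i\<in>UNIV. \<Sum>j\<in>UNIV. (LBINT t:{0..T}. (v $ i * v $ j) * (h_vec b t $ i * h_vec b t $ j)))"
    using si unfolding set_lebesgue_integral_def set_integrable_def scaleR_sum_right
    by (simp only: Bochner_Integration.integral_sum Bochner_Integration.integrable_sum)
  also have "\<dots> = v \<bullet> (red_malliavin T b *v v)"
    by (simp add: inner_vec_def matrix_vector_mult_def red_malliavin_nth sum_distrib_left mult_ac)
  finally show ?thesis by simp
qed

lemma reg_gram_nth: "reg_gram \<epsilon> T b $ i $ j = red_malliavin T b $ i $ j + (if i = j then \<epsilon> else 0)"
  by (simp add: reg_gram_def mat_def)

lemma reg_gram_mult: "reg_gram \<epsilon> T b *v v = red_malliavin T b *v v + \<epsilon> *\<^sub>R v"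
  by (simp add: reg_gram_def matrix_vector_mult_add_rdistrib flip: scaleR_matrix_vector_assoc)

lemma quad_nonneg:
  assumes "b \<in> borel_measurable borel" shows "0 \<le> v \<bullet> (red_malliavin T b *v v)"
  unfolding quad_red_malliavin[OF assms] set_lebesgue_integral_def by (intro integral_nonneg_AE) (auto simp: indicator_def)

lemma coercive_reg_gram:
  assumes "b \<in> borel_measurable borel" "\<epsilon> > 0" shows "coercive \<epsilon> (reg_gram \<epsilon> T b)"
  using quad_nonneg[OF assms(1), of _ T] assms(2) by (simp add: coercive_def reg_gram_mult inner_add_right)

lemma coercive_reg':
  assumes "coercive \<kappa> (red_malliavin T b)" "\<epsilon> \<ge> 0" shows "coercive \<kappa> (reg_gram \<epsilon> T b)"
  using assms unfolding coercive_def reg_gram_mult inner_add_right inner_scaleR_right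
  by (smt (verit) inner_ge_zero mult_nonneg_nonneg)

text \<open>A crude bound through the l1 norm; 9 is the number of entries.\<close>

lemma norm_matrix_vector_le:
  fixes A :: "real^3^3" assumes A: "\<And>i j. \<bar>A $ i $ j\<bar> \<le> e"
  shows "norm (A *v v) \<le> 9 * e * norm v"
proof -
  have "\<bar>(A *v v) $ i\<bar> \<le> 3 * (e * norm v)" for i
  proof -
    have "\<bar>(A *v v) $ i\<bar> \<le> (\<Sum>j\<in>UNIV. \<bar>A $ i $ j * v $ j\<bar>)"
      unfolding matrix_vector_mult_def by simp
    also have "\<dots> \<le> (\<Sum>j\<in>(UNIV::3 set). e * norm v)"
      by (intro sum_mono mult_bound A component_le_norm_cart)
    finally show ?thesis by simp
  qed
  then have "norm (A *v v) \<le> (\<Sum>i\<in>(UNIV::3 set). 3 * (e * norm v))"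
    by (intro order_trans[OF norm_le_l1_cart] sum_mono)
  then show ?thesis by simp
qed

section \<open>Continuity along convergent paths and shifts\<close>

context
  fixes T :: real and bn :: "nat \<Rightarrow> real \<Rightarrow> real" and b :: "real \<Rightarrow> real"
  assumes bm[measurable]: "\<And>n. bn n \<in> borel_measurable borel" "b \<in> borel_measurable borel"
    and bl: "\<And>s. s \<in> {0..T} \<Longrightarrow> (\<lambda>n. bn n s) \<longlonglongrightarrow> b s"
    and T: "0 \<le> T"
begin

lemma h_vec_tendsto: "t \<in> {0..T} \<Longrightarrow> (\<lambda>n. h_vec (bn n) t $ i) \<longlonglongrightarrow> h_vec b t $ i"
  unfolding h_vec_nth
  by (intro tendsto_add tendsto_const set_integral_tendsto[where K = 1])
     (auto intro!: isCont_tendsto_compose[OF isCont_hfun(1)] bl simp: hfun_bound)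

lemma h_vec_integral_tendsto: "t \<in> {0..T} \<Longrightarrow> (\<lambda>n. h_vec_integral (bn n) i t) \<longlonglongrightarrow> h_vec_integral b i t"
  unfolding h_vec_integral_def
  by (intro set_integral_tendsto[where K = "1 + T"])
     (auto intro!: h_vec_tendsto h_vec_bound')

lemma red_malliavin_tendsto: "(\<lambda>n. red_malliavin T (bn n)) \<longlonglongrightarrow> red_malliavin T b"
proof (intro vec_tendstoI)
  fix i j
  show "(\<lambda>n. red_malliavin T (bn n) $ i $ j) \<longlonglongrightarrow> red_malliavin T b $ i $ j"
    unfolding red_malliavin_nth
  proof (rule set_integral_tendsto[where K = "(1 + T) * (1 + T)"])
    show "norm (h_vec (bn n) t $ i * h_vec (bn n) t $ j) \<le> (1 + T) * (1 + T)" if "t \<in> {0..T}" for n t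
      unfolding real_norm_def by (intro mult_bound h_vec_bound' that bm)
  qed (auto intro!: tendsto_mult h_vec_tendsto)
qed

lemma reg_gram_tendsto: "(\<lambda>n. reg_gram \<epsilon> T (bn n)) \<longlonglongrightarrow> reg_gram \<epsilon> T b"
  unfolding reg_gram_def by (intro tendsto_add red_malliavin_tendsto tendsto_const)

lemma reg_weight_tendsto:
  assumes e: "\<epsilon> > 0" shows "(\<lambda>n. reg_weight \<epsilon> T w (bn n)) \<longlonglongrightarrow> reg_weight \<epsilon> T w b"
  unfolding reg_weight_def
  by (intro tendsto_matrix_inv_vector[where \<kappa> = \<epsilon>] reg_gram_tendsto tendsto_const coercive_reg_gram bm e)

lemma kbm_tendsto: "(\<lambda>n. kbm T x (bn n)) \<longlonglongrightarrow> kbm T x b"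
  unfolding kbm_eq[OF bm(1)] kbm_eq[OF bm(2)]
  using T by (intro tendsto_intros bl h_vec_tendsto) auto

lemma Phi_tendsto:
  assumes e: "\<epsilon> > 0" and f: "bounded_C1 f f'" shows "(\<lambda>n. Phi f \<epsilon> T x w i (bn n)) \<longlonglongrightarrow> Phi f \<epsilon> T x w i b"
proof -
  have "isCont f y" for y using f has_derivative_continuous unfolding bounded_C1_def by blast
  then show ?thesis unfolding Phi_def
    by (intro tendsto_mult tendsto_vec_nth reg_weight_tendsto[OF e] isCont_tendsto_compose[OF _ kbm_tendsto])
qed

context
  fixes kn :: "nat \<Rightarrow> real \<Rightarrow> real" and k :: "real \<Rightarrow> real" and K :: real
  assumes km[measurable]: "\<And>n. kn n \<in> borel_measurable borel" "k \<in> borel_measurable borel"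
    and kl: "\<And>s. s \<in> {0..T} \<Longrightarrow> (\<lambda>n. kn n s) \<longlonglongrightarrow> k s"
    and kb: "\<And>n s. s \<in> {0..T} \<Longrightarrow> \<bar>kn n s\<bar> \<le> K" "0 \<le> K"
begin

lemma h_vec_deriv_tendsto: "t \<in> {0..T} \<Longrightarrow> (\<lambda>n. h_vec_deriv (bn n) (kn n) t i) \<longlonglongrightarrow> h_vec_deriv b k t i"
  unfolding h_vec_deriv_def
proof (rule set_integral_tendsto[where K = "1 * K"])
  fix n s assume "t \<in> {0..T}" "s \<in> {0..t}"
  then show "norm (hfun' i (bn n s) * kn n s) \<le> 1 * K"
    unfolding real_norm_def by (intro mult_bound hfun_bound kb) auto
qed (auto intro!: tendsto_mult isCont_tendsto_compose[OF isCont_hfun(2)] bl kl)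

lemma gram_deriv_tendsto: "(\<lambda>n. gram_deriv T (bn n) (kn n)) \<longlonglongrightarrow> gram_deriv T b k"
proof (intro vec_tendstoI)
  fix i j
  show "(\<lambda>n. gram_deriv T (bn n) (kn n) $ i $ j) \<longlonglongrightarrow> gram_deriv T b k $ i $ j"
    unfolding gram_deriv_def vec_lambda_beta
  proof (rule set_integral_tendsto[where K = "(K * T) * (1 + T) + (1 + T) * (K * T)"])
    show "norm (h_vec_deriv (bn n) (kn n) t i * h_vec (bn n) t $ j + h_vec (bn n) t $ i * h_vec_deriv (bn n) (kn n) t j) \<le> (K * T) * (1 + T) + (1 + T) * (K * T)" 
      if "t \<in> {0..T}" for n t
      unfolding real_norm_def
      by (intro order_trans[OF abs_triangle_ineq] add_mono mult_bound h_vec_bound' h_vec_deriv_bound that bm km kb)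
  qed (auto intro!: tendsto_add tendsto_mult h_vec_tendsto h_vec_deriv_tendsto)
qed

lemma kbm_tangent_tendsto: "(\<lambda>n. kbm_tangent T x (bn n) (kn n)) \<longlonglongrightarrow> kbm_tangent T x b k"
  unfolding kbm_tangent_def using T by (intro tendsto_intros kl h_vec_deriv_tendsto) auto

lemma DPhi_tendsto:
  assumes e: "\<epsilon> > 0" and f: "bounded_C1 f f'" shows "(\<lambda>n. DPhi f f' \<epsilon> T x w i (bn n) (kn n)) \<longlonglongrightarrow> DPhi f f' \<epsilon> T x w i b k"
proof -
  have "isCont f y" for y using f has_derivative_continuous unfolding bounded_C1_def by blast
  moreover have "isCont f' y" for y using f continuous_on_eq_continuous_at[of UNIV f'] unfolding bounded_C1_def by blast
  ultimately show ?thesis unfolding DPhi_def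
    by (intro tendsto_diff tendsto_mult tendsto_vec_nth reg_weight_tendsto[OF e] isCont_tendsto_compose[OF _ kbm_tendsto]
        blinfun.tendsto kbm_tangent_tendsto tendsto_matrix_inv_vector[where \<kappa> = \<epsilon>] reg_gram_tendsto coercive_reg_gram bm e
        tendsto_matrix_vector_mult gram_deriv_tendsto)
qed

end

end

section \<open>Differentiation along a line of paths\<close>

context
  fixes T :: real and b k :: "real \<Rightarrow> real" and K :: real
  assumes bm[measurable]: "b \<in> borel_measurable borel" and km[measurable]: "k \<in> borel_measurable borel"
    and kb: "\<And>s. s \<in> {0..T} \<Longrightarrow> \<bar>k s\<bar> \<le> K" "0 \<le> K" and T: "0 \<le> T"
begin

abbreviation (input) "bk c s \<equiv> b s + c * k s"

lemma DERIV_h_vec: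
  assumes t: "t \<in> {0..T}"
  shows "((\<lambda>c. h_vec (\<lambda>s. bk c s) t $ i) has_real_derivative h_vec_deriv (\<lambda>s. bk c s) k t i) (at c)"
proof -
  have "((\<lambda>c. LBINT s:{0..t}. hfun i (bk c s)) has_real_derivative (LBINT s:{0..t}. hfun' i (bk c s) * k s)) (at c)"
  proof (rule DERIV_set_integral[where K = 1 and K' = "1 * K"])
    show "((\<lambda>c. hfun i (bk c s)) has_real_derivative hfun' i (bk c s) * k s) (at c)" for c s
      by (rule DERIV_chain2[OF DERIV_hfun]) (auto intro!: derivative_eq_intros)
    show "\<bar>hfun' i (bk c s) * k s\<bar> \<le> 1 * K" if "s \<in> {0..t}" for c s
      using that t by (intro mult_bound hfun_bound kb) auto
  qed (auto simp: hfun_bound)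
  then show ?thesis unfolding h_vec_nth h_vec_deriv_def by (auto intro!: derivative_eq_intros)
qed

lemma DERIV_red_malliavin:
  "((\<lambda>c. red_malliavin T (\<lambda>s. bk c s) $ i $ j) has_real_derivative gram_deriv T (\<lambda>s. bk c s) k $ i $ j) (at c)"
  unfolding red_malliavin_nth gram_deriv_def vec_lambda_beta
proof (rule DERIV_set_integral[where K = "(1 + T) * (1 + T)" and K' = "(K * T) * (1 + T) + (1 + T) * (K * T)"])
  fix c t assume t: "t \<in> {0..T}"
  show "((\<lambda>c. h_vec (\<lambda>s. bk c s) t $ i * h_vec (\<lambda>s. bk c s) t $ j) has_real_derivative
      h_vec_deriv (\<lambda>s. bk c s) k t i * h_vec (\<lambda>s. bk c s) t $ j + h_vec (\<lambda>s. bk c s) t $ i * h_vec_deriv (\<lambda>s. bk c s) k t j) (at c)"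
    by (rule DERIV_cong[OF DERIV_mult[OF DERIV_h_vec[OF t] DERIV_h_vec[OF t]]]) simp
  show "\<bar>h_vec (\<lambda>s. bk c s) t $ i * h_vec (\<lambda>s. bk c s) t $ j\<bar> \<le> (1 + T) * (1 + T)"
    using t by (intro mult_bound h_vec_bound') auto
  show "\<bar>h_vec_deriv (\<lambda>s. bk c s) k t i * h_vec (\<lambda>s. bk c s) t $ j + h_vec (\<lambda>s. bk c s) t $ i * h_vec_deriv (\<lambda>s. bk c s) k t j\<bar>
      \<le> (K * T) * (1 + T) + (1 + T) * (K * T)"
    using t by (intro order_trans[OF abs_triangle_ineq] add_mono mult_bound h_vec_bound' h_vec_deriv_bound kb) auto
qed measurable

lemma DERIV_reg_weight:
  assumes e: "\<epsilon> > 0"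
  shows "((\<lambda>c. reg_weight \<epsilon> T w (\<lambda>s. bk c s) $ i) has_real_derivative
     - (matrix_inv (reg_gram \<epsilon> T (\<lambda>s. bk c s)) *v (gram_deriv T (\<lambda>s. bk c s) k *v reg_weight \<epsilon> T w (\<lambda>s. bk c s))) $ i) (at c)"
  unfolding reg_weight_def
proof (rule DERIV_matrix_inv_vector[where \<kappa> = \<epsilon>])
  show "((\<lambda>c. reg_gram \<epsilon> T (\<lambda>s. bk c s) $ i $ j) has_real_derivative gram_deriv T (\<lambda>s. bk c s) k $ i $ j) (at c)" for i j
    unfolding reg_gram_nth by (auto intro!: derivative_eq_intros DERIV_red_malliavin)
  show "coercive \<epsilon> (reg_gram \<epsilon> T (\<lambda>s. bk c s))" for c using e by (intro coercive_reg_gram) auto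
qed

lemma has_vector_derivative_kbm:
  "((\<lambda>c. kbm T x (\<lambda>s. bk c s)) has_vector_derivative kbm_tangent T x (\<lambda>s. bk c s) k) (at c)"
proof -
  have *: "(\<lambda>s. bk c s) \<in> borel_measurable borel" for c by measurable
  have h: "((\<lambda>c. h_vec (\<lambda>s. bk c s) T $ i) has_vector_derivative h_vec_deriv (\<lambda>s. bk c s) k T i) (at c)" for i
    using DERIV_h_vec[of T i c] T by (simp add: has_real_derivative_iff_has_vector_derivative)
  show ?thesis
    unfolding kbm_eq[OF *] kbm_tangent_def
    using h[unfolded has_real_derivative_iff_has_vector_derivative[symmetric]]
    by (auto intro!: derivative_eq_intros)
qed

lemma DERIV_Phi:
  assumes e: "\<epsilon> > 0" and f: "bounded_C1 f f'"
  shows "((\<lambda>c. Phi f \<epsilon> T x w i (\<lambda>s. bk c s)) has_real_derivative DPhi f f' \<epsilon> T x w i (\<lambda>s. bk c s) k) (at c)"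
proof -
  have "((\<lambda>c. f (kbm T x (\<lambda>s. bk c s))) has_derivative (\<lambda>h. f' (kbm T x (\<lambda>s. bk c s)) (h *\<^sub>R kbm_tangent T x (\<lambda>s. bk c s) k))) (at c)"
    by (rule has_derivative_compose[OF has_vector_derivative_kbm[unfolded has_vector_derivative_def]])
      (use f in \<open>unfold bounded_C1_def, blast\<close>)
  then have 1: "((\<lambda>c. f (kbm T x (\<lambda>s. bk c s))) has_real_derivative f' (kbm T x (\<lambda>s. bk c s)) (kbm_tangent T x (\<lambda>s. bk c s) k)) (at c)"
    unfolding has_field_derivative_def by (simp add: blinfun.scaleR_right mult_commute_abs)
  show ?thesis unfolding Phi_def DPhi_def
    by (rule DERIV_cong[OF DERIV_mult[OF 1 DERIV_reg_weight[OF e]]]) simp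
qed

lemma norm_kbm_tangent_le: "norm (kbm_tangent T x b k) \<le> K + 2 * (K * T)"
proof -
  have "cmod (of_real (- h_vec_deriv b k T 3) + \<i> * of_real (h_vec_deriv b k T 2)) \<le> \<bar>h_vec_deriv b k T 3\<bar> + \<bar>h_vec_deriv b k T 2\<bar>"
    by (rule norm_triangle_le) (simp add: norm_mult)
  also have "\<dots> \<le> K * T + K * T" using T by (intro add_mono h_vec_deriv_bound kb) auto
  finally have "cmod (cis (fst x) * (of_real (- h_vec_deriv b k T 3) + \<i> * of_real (h_vec_deriv b k T 2))) \<le> 2 * (K * T)" by (simp add: norm_mult)
  moreover have "\<bar>k T\<bar> \<le> K" using T by (intro kb) auto
  ultimately show ?thesis unfolding kbm_tangent_def by (intro order_trans[OF norm_Pair_le]) auto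
qed

lemma gram_deriv_bound: "\<bar>gram_deriv T b k $ i $ j\<bar> \<le> 2 * K * T * (1 + T) * T"
proof -
  have "\<bar>h_vec_deriv b k t i * h_vec b t $ j + h_vec b t $ i * h_vec_deriv b k t j\<bar> \<le> (K * T) * (1 + T) + (1 + T) * (K * T)" if t: "t \<in> {0..T}" for t
    using t by (intro order_trans[OF abs_triangle_ineq] add_mono mult_bound h_vec_bound' h_vec_deriv_bound kb) auto
  then have "\<bar>gram_deriv T b k $ i $ j\<bar> \<le> ((K * T) * (1 + T) + (1 + T) * (K * T)) * (T - 0)"
    unfolding gram_deriv_def vec_lambda_beta
    using set_integral_norm_le[of "\<lambda>t. h_vec_deriv b k t i * h_vec b t $ j + h_vec b t $ i * h_vec_deriv b k t j" 0 T] T by simp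
  then show ?thesis by (simp add: algebra_simps)
qed

lemma norm_gram_deriv_le: "norm (gram_deriv T b k *v v) \<le> 18 * K * T * (1 + T) * T * norm v"
  using norm_matrix_vector_le[of "gram_deriv T b k", OF gram_deriv_bound] by (simp add: mult_ac)

end

text \<open>The coercivity constant \<open>\<kappa>\<close> is left free here and in
  \<open>DPhi_bound\<close>. Taking \<open>\<kappa> = \<epsilon>\<close> gives deterministic bounds
  for a fixed regularisation; taking a constant of the Gram matrix itself gives bounds that stay
  uniform as \<open>\<epsilon>\<close> tends to 0.\<close>

lemma Phi_bound:
  assumes b: "b \<in> borel_measurable borel" and f: "\<And>y. \<bar>f y\<bar> \<le> F" and co: "coercive \<kappa> (reg_gram \<epsilon> T b)"
  shows "\<bar>Phi f \<epsilon> T x w i b\<bar> \<le> F * (norm w / \<kappa>)"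
  unfolding Phi_def reg_weight_def
  by (intro mult_bound f order_trans[OF component_le_norm_cart] coercive_inv_norm_le co)

lemma DPhi_bound:
  assumes b: "b \<in> borel_measurable borel" "k \<in> borel_measurable borel" and f: "\<And>y. \<bar>f y\<bar> \<le> F" "\<And>y. norm (f' y) \<le> F'"
    and k: "\<And>s. s \<in> {0..T} \<Longrightarrow> \<bar>k s\<bar> \<le> K" "0 \<le> K" and T: "0 \<le> T"
    and co: "coercive \<kappa> (reg_gram \<epsilon> T b)"
  shows "\<bar>DPhi f f' \<epsilon> T x w i b k\<bar> \<le> F' * (K + 2 * (K * T)) * (norm w / \<kappa>) + F * (18 * K * T * (1 + T) * T * (norm w / \<kappa>) / \<kappa>)"
proof -
  have k0: "\<kappa> > 0" using co by (simp add: coercive_def)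
  have F': "0 \<le> F'" using order_trans[OF norm_ge_zero f(2)] .
  have l: "norm (reg_weight \<epsilon> T w b) \<le> norm w / \<kappa>" unfolding reg_weight_def by (intro coercive_inv_norm_le co)
  have "\<bar>blinfun_apply (f' (kbm T x b)) (kbm_tangent T x b k)\<bar> \<le> F' * (K + 2 * (K * T))"
  proof -
    have "norm (kbm_tangent T x b k) \<le> K + 2 * (K * T)" by (rule norm_kbm_tangent_le[OF b _ k(2) T]) (rule k)
    from mult_mono[OF f(2)[of "kbm T x b"] this F' norm_ge_zero] show ?thesis
      using norm_blinfun[of "f' (kbm T x b)" "kbm_tangent T x b k"] unfolding real_norm_def by linarith
  qed
  moreover have "norm (matrix_inv (reg_gram \<epsilon> T b) *v (gram_deriv T b k *v reg_weight \<epsilon> T w b)) \<le> 18 * K * T * (1 + T) * T * (norm w / \<kappa>) / \<kappa>"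
  proof (rule order_trans[OF coercive_inv_norm_le[OF co]], rule divide_right_mono)
    show "norm (gram_deriv T b k *v reg_weight \<epsilon> T w b) \<le> 18 * K * T * (1 + T) * T * (norm w / \<kappa>)"
      using k T by (intro order_trans[OF norm_gram_deriv_le[OF b k T]] mult_left_mono l) auto
  qed (use k0 in auto)
  moreover have "\<bar>reg_weight \<epsilon> T w b $ i\<bar> \<le> norm w / \<kappa>" by (rule order_trans[OF component_le_norm_cart l])
  ultimately show ?thesis unfolding DPhi_def
    by (intro order_trans[OF abs_triangle_ineq4 add_mono[OF mult_bound mult_bound]] f)
      (auto intro: order_trans[OF component_le_norm_cart])
qed

section \<open>Discretisation\<close>

text \<open>The jump \<open>e j\<close> sits at the right end \<open>real (Suc j) * d\<close> of its
  interval. The path up to time \<open>real j * d\<close> therefore does not see it, which is the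
  discrete form of adaptedness.\<close>

definition step_function :: "real \<Rightarrow> nat \<Rightarrow> (nat \<Rightarrow> real) \<Rightarrow> real \<Rightarrow> real" where
  "step_function d n e t = (\<Sum>j<n. e j * indicator {real (Suc j) * d..} t)"

lemma step_function_measurable [measurable]: "step_function d n e \<in> borel_measurable borel"
  unfolding step_function_def[abs_def] by measurable

text \<open>One jump enters affinely, so varying a single increment moves the step path along a line
  in a fixed direction, the situation of \<open>DERIV_Phi\<close>.\<close>

lemma step_function_upd:
  assumes "j < n"
  shows "step_function d n (e(j := y)) = (\<lambda>s. step_function d n (e(j := 0)) s + y * indicator {real (Suc j) * d..} s)"
proof
  fix s
  have "(\<Sum>i<n. (e(j := y)) i * indicat_real {real (Suc i) * d..} s)
      = (\<Sum>i<n. (e(j := 0)) i * indicat_real {real (Suc i) * d..} s + (if i = j then y * indicat_real {real (Suc j) * d..} s else 0))"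
    by (intro sum.cong) auto
  also have "\<dots> = (\<Sum>i<n. (e(j := 0)) i * indicat_real {real (Suc i) * d..} s) + y * indicat_real {real (Suc j) * d..} s"
    using assms by (simp add: sum.distrib)
  finally show "step_function d n (e(j := y)) s = step_function d n (e(j := 0)) s + y * indicator {real (Suc j) * d..} s"
    by (simp add: step_function_def)
qed

lemma h_vec_cong: "(\<And>s. s \<in> {0..t} \<Longrightarrow> b s = b' s) \<Longrightarrow> h_vec b t = h_vec b' t"
  unfolding vec_eq_iff h_vec_nth by (auto intro!: set_lebesgue_integral_cong)

text \<open>Given \<open>Y\<close>, the variable \<open>X\<close> is still centred Gaussian: Fubini
  on the product law reduces the claim to \<open>normal_density_ibp\<close> for each frozen value of
  \<open>Y\<close>.\<close>

lemma (in prob_space) normal_ibp_indep: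
  fixes G :: "real \<Rightarrow> 'b \<Rightarrow> real"
  assumes s: "\<sigma> > 0" and X: "distributed M lborel X (normal_density 0 \<sigma>)" and Y: "Y \<in> measurable M N"
    and DQ: "distr M borel X \<Otimes>\<^sub>M distr M N Y = distr M (borel \<Otimes>\<^sub>M N) (\<lambda>\<omega>. (X \<omega>, Y \<omega>))"
    and m: "case_prod G \<in> borel_measurable (borel \<Otimes>\<^sub>M N)" "case_prod G' \<in> borel_measurable (borel \<Otimes>\<^sub>M N)"
    and d: "\<And>x y. ((\<lambda>x. G x y) has_real_derivative G' x y) (at x)" "\<And>x y. isCont (\<lambda>x. G' x y) x"
    and K: "\<And>x y. \<bar>G x y\<bar> \<le> K" "\<And>x y. \<bar>G' x y\<bar> \<le> K'"
  shows "(LINT \<omega>|M. G (X \<omega>) (Y \<omega>) * X \<omega>) = \<sigma>\<^sup>2 * (LINT \<omega>|M. G' (X \<omega>) (Y \<omega>))"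
proof -
  note [measurable] = m
  have [measurable]: "X \<in> borel_measurable M" "Y \<in> measurable M N"
    using X Y by (auto simp: distributed_def)
  define D where "D = distr M borel X"
  define Q where "Q = distr M N Y"
  have [measurable_cong]: "sets D = sets borel" "sets Q = sets N" by (simp_all add: D_def Q_def)
  interpret D: prob_space D unfolding D_def by (rule prob_space_distr) simp
  interpret Q: prob_space Q unfolding Q_def by (rule prob_space_distr) simp
  interpret DQ: pair_prob_space D Q ..
  have DQ: "D \<Otimes>\<^sub>M Q = distr M (borel \<Otimes>\<^sub>M N) (\<lambda>\<omega>. (X \<omega>, Y \<omega>))"
    using DQ unfolding D_def Q_def by simp
  have E: "(LINT \<omega>|M. g (X \<omega>) (Y \<omega>)) = (LINT y|Q. LINT x|D. g x y)"
    if [measurable]: "case_prod g \<in> borel_measurable (borel \<Otimes>\<^sub>M N)" and i: "integrable M (\<lambda>\<omega>. g (X \<omega>) (Y \<omega>))" for g :: "real \<Rightarrow> 'b \<Rightarrow> real"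
  proof -
    have "integrable (D \<Otimes>\<^sub>M Q) (case_prod g)"
      unfolding DQ using i by (subst integrable_distr_eq) auto
    then have "(LINT y|Q. LINT x|D. g x y) = (LINT p|(D \<Otimes>\<^sub>M Q). case_prod g p)"
      by (rule DQ.integral_snd)
    also have "\<dots> = (LINT \<omega>|M. g (X \<omega>) (Y \<omega>))"
      unfolding DQ by (subst integral_distr) auto
    finally show ?thesis by simp
  qed
  have inner: "(LINT x|D. g x) = (LINT x|lborel. normal_density 0 \<sigma> x * g x)" if [measurable]: "g \<in> borel_measurable borel" for g :: "real \<Rightarrow> real"
    unfolding D_def by (subst integral_distr) (auto simp: distributed_integral[OF X, of g])
  have iX: "integrable M X"
    using distributed_integrable[OF X, of "\<lambda>x. x"] integrable_normal_moment[OF s, of 0 1] by simp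
  have "integrable M (\<lambda>\<omega>. G (X \<omega>) (Y \<omega>) * X \<omega>)"
    by (rule Bochner_Integration.integrable_bound[OF integrable_mult_right[OF integrable_abs[OF iX], of K]])
       (auto simp: abs_mult intro!: mult_mono order_trans[OF K(1)])
  then have "(LINT \<omega>|M. G (X \<omega>) (Y \<omega>) * X \<omega>) = (LINT y|Q. LINT x|D. G x y * x)"
    by (intro E) auto
  also have "\<dots> = (LINT y|Q. \<sigma>\<^sup>2 * (LINT x|D. G' x y))"
  proof (rule Bochner_Integration.integral_cong[OF refl])
    fix y assume "y \<in> space Q"
    then have y: "y \<in> space N" by (simp add: Q_def)
    have [measurable]: "(\<lambda>x. G x y) \<in> borel_measurable borel" "(\<lambda>x. G' x y) \<in> borel_measurable borel"
      using measurable_compose[OF measurable_Pair2'[OF y] m(1)] measurable_compose[OF measurable_Pair2'[OF y] m(2)] by simp_all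
    show "(LINT x|D. G x y * x) = \<sigma>\<^sup>2 * (LINT x|D. G' x y)"
      using normal_density_ibp[of \<sigma> "\<lambda>x. G x y" "\<lambda>x. G' x y" K K'] s d K by (simp add: inner)
  qed
  also have "\<dots> = \<sigma>\<^sup>2 * (LINT \<omega>|M. G' (X \<omega>) (Y \<omega>))"
    by (subst E[of G']) (auto intro!: integrable_const_bound[of _ K'] simp: K)
  finally show ?thesis .
qed

lemma (in prob_space) indep_vars_pair_distr:
  fixes X :: "'i \<Rightarrow> 'a \<Rightarrow> real"
  assumes X: "indep_vars (\<lambda>_. borel) X I" and j: "j \<in> I"
  defines "N \<equiv> PiM (I - {j}) (\<lambda>_. borel)" and "Y \<equiv> \<lambda>\<omega>. restrict (\<lambda>i. X i \<omega>) (I - {j})"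
  shows "distr M borel (X j) \<Otimes>\<^sub>M distr M N Y = distr M (borel \<Otimes>\<^sub>M N) (\<lambda>\<omega>. (X j \<omega>, Y \<omega>))" "Y \<in> measurable M N"
proof -
  let ?L = "PiM {j} (\<lambda>_. borel :: real measure)" and ?R = "\<lambda>\<omega>. restrict (\<lambda>i. X i \<omega>) {j}"
  have ind: "indep_var ?L ?R N Y"
    unfolding N_def Y_def using j by (intro indep_var_restrict[OF X]) auto
  have [measurable]: "?R \<in> measurable M ?L" "Y \<in> measurable M N"
    using indep_var_rv1[OF ind] indep_var_rv2[OF ind] by auto
  show "Y \<in> measurable M N" by fact
  have eq: "distr M ?L ?R \<Otimes>\<^sub>M distr M N Y = distr M (?L \<Otimes>\<^sub>M N) (\<lambda>\<omega>. (?R \<omega>, Y \<omega>))"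
    using ind unfolding indep_var_distribution_eq by simp
  have c[measurable]: "(\<lambda>f. f j) \<in> measurable ?L borel" by (rule measurable_component_singleton) simp
  have 1: "distr (distr M ?L ?R) borel (\<lambda>f. f j) = distr M borel (X j)"
    by (subst distr_distr) (auto simp: o_def)
  have 2: "distr (distr M N Y) N (\<lambda>x. x) = distr M N Y" by (rule distr_id2) simp
  interpret Q: prob_space "distr M N Y" by (rule prob_space_distr) simp
  have "distr M borel (X j) \<Otimes>\<^sub>M distr M N Y
      = distr (distr M ?L ?R \<Otimes>\<^sub>M distr M N Y) (borel \<Otimes>\<^sub>M N) (\<lambda>(f, y). (f j, y))"
    using pair_measure_distr[of "\<lambda>f. f j" "distr M ?L ?R" borel "\<lambda>x. x" "distr M N Y" N] 
    by (simp add: 1 2 Q.sigma_finite_measure_axioms)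
  also have "\<dots> = distr M (borel \<Otimes>\<^sub>M N) (\<lambda>\<omega>. (X j \<omega>, Y \<omega>))"
    unfolding eq by (subst distr_distr) (auto simp: o_def)
  finally show "distr M borel (X j) \<Otimes>\<^sub>M distr M N Y = distr M (borel \<Otimes>\<^sub>M N) (\<lambda>\<omega>. (X j \<omega>, Y \<omega>))" .
qed

section \<open>Linearity in the direction of the shift\<close>

lemma set_integral_sum_scale:
  fixes g :: "'i \<Rightarrow> real \<Rightarrow> real"
  assumes "\<And>j. j \<in> J \<Longrightarrow> set_integrable lborel A (g j)"
  shows "(LBINT t:A. \<Sum>j\<in>J. c j * g j t) = (\<Sum>j\<in>J. c j * (LBINT t:A. g j t))"
proof -
  have "(LBINT t:A. \<Sum>j\<in>J. c j * g j t) = (LBINT t. \<Sum>j\<in>J. c j * (indicator A t *\<^sub>R g j t))"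
    by (simp add: set_lebesgue_integral_def sum_distrib_left mult_ac)
  also have "\<dots> = (\<Sum>j\<in>J. c j * (LBINT t:A. g j t))"
    using assms by (subst Bochner_Integration.integral_sum) (auto simp: set_lebesgue_integral_def set_integrable_def)
  finally show ?thesis .
qed

context
  fixes T K :: real and b :: "real \<Rightarrow> real" and k :: "'i \<Rightarrow> real \<Rightarrow> real" and J :: "'i set"
  assumes bm[measurable]: "b \<in> borel_measurable borel" and km[measurable]: "\<And>j. k j \<in> borel_measurable borel"
    and kb: "\<And>j s. \<bar>k j s\<bar> \<le> K" and K: "0 \<le> K" and T: "0 \<le> T"
begin

lemma h_vec_deriv_sum: "h_vec_deriv b (\<lambda>s. \<Sum>j\<in>J. c j * k j s) t i = (\<Sum>j\<in>J. c j * h_vec_deriv b (k j) t i)"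
proof -
  have "set_integrable lborel {0..t} (\<lambda>s. hfun' i (b s) * k j s)" for j
  proof (rule set_integrable_bounded)
    show "norm (hfun' i (b s) * k j s) \<le> 1 * K" for s unfolding real_norm_def by (intro mult_bound hfun_bound kb)
  qed measurable
  then show ?thesis unfolding h_vec_deriv_def
    by (subst set_integral_sum_scale[symmetric]) (auto simp: sum_distrib_left mult_ac)
qed

lemma kbm_tangent_sum: "kbm_tangent T x b (\<lambda>s. \<Sum>j\<in>J. c j * k j s) = (\<Sum>j\<in>J. c j *\<^sub>R kbm_tangent T x b (k j))"
  unfolding kbm_tangent_def h_vec_deriv_sum
  by (simp add: prod_eq_iff fst_sum snd_sum sum_distrib_left sum_distrib_right scaleR_conv_of_real sum_negf[symmetric]
      sum.distrib[symmetric] algebra_simps)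

lemma gram_deriv_sum: "gram_deriv T b (\<lambda>s. \<Sum>j\<in>J. c j * k j s) = (\<Sum>j\<in>J. c j *\<^sub>R gram_deriv T b (k j))"
proof -
  have "gram_deriv T b (\<lambda>s. \<Sum>j\<in>J. c j * k j s) $ l $ m = (\<Sum>j\<in>J. c j * gram_deriv T b (k j) $ l $ m)" for l m
  proof -
    have si: "set_integrable lborel {0..T} (\<lambda>t. h_vec_deriv b (k j) t l * h_vec b t $ m + h_vec b t $ l * h_vec_deriv b (k j) t m)" for j
    proof (rule set_integrable_bounded)
      fix t assume t: "t \<in> {0..T}"
      show "norm (h_vec_deriv b (k j) t l * h_vec b t $ m + h_vec b t $ l * h_vec_deriv b (k j) t m) \<le> (K * T) * (1 + T) + (1 + T) * (K * T)"
        unfolding real_norm_def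
        by (intro order_trans[OF abs_triangle_ineq] add_mono mult_bound h_vec_bound' h_vec_deriv_bound t bm km kb K)
    qed measurable
    show ?thesis unfolding gram_deriv_def vec_lambda_beta h_vec_deriv_sum
      by (subst set_integral_sum_scale[OF si, symmetric])
         (simp add: sum_distrib_left sum_distrib_right sum.distrib[symmetric] algebra_simps)
  qed
  then show ?thesis by (simp add: vec_eq_iff sum_component)
qed

lemma DPhi_sum: "DPhi f f' \<epsilon> T x w i b (\<lambda>s. \<Sum>j\<in>J. c j * k j s) = (\<Sum>j\<in>J. c j * DPhi f f' \<epsilon> T x w i b (k j))"
proof -
  have m: "(\<Sum>j\<in>J. c j *\<^sub>R A j) *v y = (\<Sum>j\<in>J. c j *\<^sub>R (A j *v y))" for A :: "'i \<Rightarrow> real^3^3" and y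
    by (simp add: vec_eq_iff matrix_vector_mult_def sum_component sum_distrib_left sum_distrib_right mult_ac sum.swap[of _ _ J])
  have v: "A *v (\<Sum>j\<in>J. c j *\<^sub>R y j) = (\<Sum>j\<in>J. c j *\<^sub>R (A *v y j))" for y and A :: "real^3^3"
    by (simp add: vec_eq_iff matrix_vector_mult_def sum_component sum_distrib_left sum_distrib_right mult_ac sum.swap[of _ _ J])
  show ?thesis unfolding DPhi_def kbm_tangent_sum gram_deriv_sum m v
    by (simp add: blinfun.sum_right blinfun.scaleR_right sum_component sum_distrib_left sum_distrib_right
        sum_subtractf[symmetric] algebra_simps)
qed

end

lemma set_integral_split:
  fixes f :: "real \<Rightarrow> real"
  assumes [measurable]: "f \<in> borel_measurable borel" and b: "\<And>s. s \<in> {a..c} \<Longrightarrow> \<bar>f s\<bar> \<le> K" and abc: "a \<le> e" "e \<le> c"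
  shows "(LBINT s:{a..c}. f s) = (LBINT s:{a..e}. f s) + (LBINT s:{e..c}. f s)"
proof -
  have "(LBINT s:{a..e} \<union> {e..c}. f s) = (LBINT s:{a..e}. f s) + (LBINT s:{e..c}. f s)"
  proof (rule set_integral_Un_AE)
    show "AE x in lborel. \<not> (x \<in> {a..e} \<and> x \<in> {e..c})"
      using AE_lborel_singleton[of e] by eventually_elim auto
    show "set_integrable lborel {a..e} f" "set_integrable lborel {e..c} f"
      using abc by (auto intro!: set_integrable_bounded[of _ _ _ K] b)
  qed auto
  then show ?thesis using abc by (simp add: ivl_disj_un_two_touch)
qed

lemma h_vec_Lipschitz:
  assumes [measurable]: "b \<in> borel_measurable borel" and st: "0 \<le> s" "s \<le> t"
  shows "\<bar>h_vec b t $ i - h_vec b s $ i\<bar> \<le> t - s"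
proof -
  have "h_vec b t $ i - h_vec b s $ i = (LBINT r:{s..t}. hfun i (b r))"
    unfolding h_vec_nth using set_integral_split[of "\<lambda>r. hfun i (b r)" 0 t 1 s] st by (simp add: hfun_bound)
  then show ?thesis using set_integral_norm_le[of "\<lambda>r. hfun i (b r)" s t 1] st by (simp add: hfun_bound)
qed

text \<open>The stochastic integral of h_i against a path that starts at 0. As h_i is absolutely
  continuous in time, exchanging the two integrations gives this pathwise form.\<close>

definition delta :: "real \<Rightarrow> 3 \<Rightarrow> (real \<Rightarrow> real) \<Rightarrow> real" where
  "delta T i b = (if i = 1 then b T else 0) + (LBINT s:{0..T}. hfun i (b s) * (b T - b s))"

locale grid =
  fixes T d :: real and n :: nat
  assumes T: "T > 0" and n: "n > 0" and d: "d = T / real n"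
begin

lemma d_pos: "d > 0" and nd: "real n * d = T"
  using T n by (auto simp: d)

lemma floor_le_n: "t \<in> {0..T} \<Longrightarrow> nat \<lfloor>t / d\<rfloor> \<le> n"
  and ceiling_le_n: "t \<in> {0..T} \<Longrightarrow> nat \<lceil>t / d\<rceil> \<le> n"
proof -
  assume t: "t \<in> {0..T}"
  then have "t / d \<le> real n" using d_pos nd by (simp add: field_simps)
  then show "nat \<lfloor>t / d\<rfloor> \<le> n" "nat \<lceil>t / d\<rceil> \<le> n" by (simp_all add: nat_le_iff floor_le_iff ceiling_le_iff)
qed

lemma floor_bounds:
  assumes "0 \<le> t" shows "real (nat \<lfloor>t / d\<rfloor>) * d \<le> t" "t \<le> real (nat \<lfloor>t / d\<rfloor>) * d + d"
proof -
  have k: "real (nat \<lfloor>t / d\<rfloor>) = of_int \<lfloor>t / d\<rfloor>" using assms d_pos by (simp add: )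
  have "of_int \<lfloor>t / d\<rfloor> \<le> t / d" "t / d \<le> of_int \<lfloor>t / d\<rfloor> + 1" by linarith+
  then show "real (nat \<lfloor>t / d\<rfloor>) * d \<le> t" "t \<le> real (nat \<lfloor>t / d\<rfloor>) * d + d"
    unfolding k using d_pos by (simp_all only: pos_le_divide_eq pos_divide_le_eq distrib_right mult_1)
qed

lemma ceiling_bounds:
  assumes "0 \<le> t" shows "t \<le> real (nat \<lceil>t / d\<rceil>) * d" "real (nat \<lceil>t / d\<rceil>) * d \<le> t + d"
proof -
  have k: "real (nat \<lceil>t / d\<rceil>) = of_int \<lceil>t / d\<rceil>" using assms d_pos by (simp add: )
  have "t / d \<le> of_int \<lceil>t / d\<rceil>" "of_int \<lceil>t / d\<rceil> \<le> t / d + 1" by linarith+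
  then show "t \<le> real (nat \<lceil>t / d\<rceil>) * d" "real (nat \<lceil>t / d\<rceil>) * d \<le> t + d"
    unfolding k using mult_right_mono[of "t / d" "of_int \<lceil>t / d\<rceil>" d, OF _ less_imp_le[OF d_pos]]
      mult_right_mono[of "of_int \<lceil>t / d\<rceil>" "t / d + 1" d, OF _ less_imp_le[OF d_pos]] d_pos
    by (simp_all add: distrib_right)
qed

lemma sum_indicator_floor:
  assumes t: "t \<in> {0..T}"
  shows "(\<Sum>j<n. a j * indicator {real (Suc j) * d..} t) = (\<Sum>j<nat \<lfloor>t / d\<rfloor>. a j :: real)"
proof -
  have iff: "real (Suc j) * d \<le> t \<longleftrightarrow> j < nat \<lfloor>t / d\<rfloor>" for j
  proof -
    have "real (Suc j) * d \<le> t \<longleftrightarrow> of_int (int (Suc j)) \<le> t / d" using d_pos by (simp add: field_simps)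
    also have "\<dots> \<longleftrightarrow> int (Suc j) \<le> \<lfloor>t / d\<rfloor>" by (simp only: le_floor_iff)
    finally show ?thesis by linarith
  qed
  show ?thesis
    by (rule sum.mono_neutral_cong_right) (use floor_le_n[OF t] in \<open>auto simp: iff indicator_def simp del: of_nat_Suc\<close>)
qed

lemma sum_indicator_ceiling:
  assumes t: "t \<in> {0..T}"
  shows "(\<Sum>j<n. a j * indicator {..real j * d} t) = (\<Sum>j = nat \<lceil>t / d\<rceil>..<n. a j :: real)"
proof -
  have iff: "t \<le> real j * d \<longleftrightarrow> nat \<lceil>t / d\<rceil> \<le> j" for j
  proof -
    have "t \<le> real j * d \<longleftrightarrow> t / d \<le> of_int (int j)" using d_pos by (simp add: field_simps)
    also have "\<dots> \<longleftrightarrow> \<lceil>t / d\<rceil> \<le> int j" by (simp only: ceiling_le_iff)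
    finally show ?thesis by linarith
  qed
  show ?thesis
    by (rule sum.mono_neutral_cong_right) (use ceiling_le_n[OF t] in \<open>auto simp: iff indicator_def\<close>)
qed

definition grid_increment :: "(real \<Rightarrow> real) \<Rightarrow> nat \<Rightarrow> real" where "grid_increment b j = b (real (Suc j) * d) - b (real j * d)"
definition step_path :: "(real \<Rightarrow> real) \<Rightarrow> real \<Rightarrow> real" where "step_path b = step_function d n (grid_increment b)"
text \<open>Left-point Riemann sums for the primitive of h_i. They jump at the same times as
  \<open>step_path\<close>, so this shift is a combination of the directions in which single
  increments act; the factor \<open>d\<close> in its coefficients is the variance of an
  increment.\<close>

definition step_direction :: "(real \<Rightarrow> real) \<Rightarrow> 3 \<Rightarrow> real \<Rightarrow> real" where
  "step_direction b i s = (\<Sum>j<n. (d * h_vec (step_path b) (real j * d) $ i) * indicator {real (Suc j) * d..} s)"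
definition ito_sum :: "(real \<Rightarrow> real) \<Rightarrow> 3 \<Rightarrow> real" where
  "ito_sum b i = (\<Sum>j<n. h_vec (step_path b) (real j * d) $ i * grid_increment b j)"
text \<open>Discrete counterpart of the factor \<open>b T - b s\<close> in
  \<open>delta\<close>.\<close>

definition remaining_increment :: "(real \<Rightarrow> real) \<Rightarrow> real \<Rightarrow> real" where
  "remaining_increment b s = (\<Sum>j<n. grid_increment b j * indicator {..real j * d} s)"

lemma measurable_grid [measurable]: "step_path b \<in> borel_measurable borel" "step_direction b i \<in> borel_measurable borel" "remaining_increment b \<in> borel_measurable borel"
  unfolding step_path_def step_direction_def[abs_def] remaining_increment_def[abs_def] by measurable

lemma step_path_eq: "t \<in> {0..T} \<Longrightarrow> step_path b t = b (real (nat \<lfloor>t / d\<rfloor>) * d) - b 0"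
  unfolding step_path_def step_function_def grid_increment_def
  by (subst sum_indicator_floor) (simp_all only: sum_lessThan_telescope[of "\<lambda>j. b (real j * d)"] of_nat_0 mult_zero_left)

lemma remaining_increment_eq: "t \<in> {0..T} \<Longrightarrow> remaining_increment b t = b T - b (real (nat \<lceil>t / d\<rceil>) * d)"
  unfolding remaining_increment_def grid_increment_def
  using ceiling_le_n[of t] sum_Suc_diff'[of "nat \<lceil>t / d\<rceil>" n "\<lambda>j. b (real j * d)"]
  by (subst sum_indicator_ceiling) (auto simp: nd)

lemma node_in: "j \<le> n \<Longrightarrow> real j * d \<in> {0..T}"
  using d_pos nd by (auto simp: intro!: mult_right_mono simp flip: nd)

lemma step_direction_bound: "\<bar>step_direction b i s\<bar> \<le> (1 + T) * T"
proof -
  have "\<bar>step_direction b i s\<bar> \<le> (\<Sum>j<n. \<bar>(d * h_vec (step_path b) (real j * d) $ i) * indicator {real (Suc j) * d..} s\<bar>)"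
    unfolding step_direction_def by (rule sum_abs)
  also have "\<dots> \<le> (\<Sum>j<n. (d * (1 + T)) * 1)"
  proof (rule sum_mono)
    fix j assume "j \<in> {..<n}"
    then have "\<bar>d * h_vec (step_path b) (real j * d) $ i\<bar> \<le> d * (1 + T)"
      using d_pos node_in[of j] by (intro mult_bound h_vec_bound') auto
    then show "\<bar>(d * h_vec (step_path b) (real j * d) $ i) * indicator {real (Suc j) * d..} s\<bar> \<le> (d * (1 + T)) * 1"
      by (rule mult_bound) (auto simp: indicator_def)
  qed
  also have "\<dots> = (1 + T) * T" using nd by (simp add: algebra_simps flip: nd)
  finally show ?thesis .
qed

text \<open>Since \<open>h_vec\<close> is 1-Lipschitz in time, each full interval contributes an
  error of at most \<open>d * d\<close>, together at most \<open>T * d\<close>; the unfinished last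
  interval adds \<open>(1 + T) * d\<close>.\<close>

lemma step_direction_h_vec_integral: 
  assumes t: "t \<in> {0..T}"
  shows "\<bar>step_direction b i t - h_vec_integral (step_path b) i t\<bar> \<le> (1 + 2 * T) * d"
proof -
  let ?h = "\<lambda>s. h_vec (step_path b) s $ i"
  have split: "h_vec_integral (step_path b) i c = h_vec_integral (step_path b) i a + (LBINT s:{a..c}. ?h s)" if "0 \<le> a" "a \<le> c" "c \<le> T" for a c
    unfolding h_vec_integral_def using that by (intro set_integral_split[where K = "1 + T"] h_vec_bound') auto
  have main: "\<bar>(\<Sum>j<k. d * ?h (real j * d)) - h_vec_integral (step_path b) i (real k * d)\<bar> \<le> real k * d * d" if "k \<le> n" for k
    using that
  proof (induction k)
    case 0
    then show ?case by (simp add: h_vec_integral_def set_lebesgue_integral_def AE_lborel_singleton)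
        (auto intro!: integral_eq_zero_AE simp: indicator_def intro: eventually_mono[OF AE_lborel_singleton[of 0]])
  next
    case (Suc k)
    have k: "real (Suc k) * d \<in> {0..T}" "0 \<le> real k * d" using node_in[OF Suc.prems] d_pos by auto
    have "h_vec_integral (step_path b) i (real (Suc k) * d) = h_vec_integral (step_path b) i (real k * d) + (LBINT s:{real k * d..real (Suc k) * d}. ?h s)"
      using k d_pos by (intro split) (auto intro!: mult_right_mono)
    moreover have "(LBINT s:{real k * d..real (Suc k) * d}. ?h s - ?h (real k * d)) 
        = (LBINT s:{real k * d..real (Suc k) * d}. ?h s) - d * ?h (real k * d)"
    proof (subst set_integral_diff)
      show "set_integrable lborel {real k * d..real (Suc k) * d} ?h"
        using k by (intro set_integrable_bounded[of _ _ _ "1 + T"]) (auto intro!: h_vec_bound')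
      show "set_integrable lborel {real k * d..real (Suc k) * d} (\<lambda>s. ?h (real k * d))"
        by (intro set_integrable_bounded[of _ _ _ "\<bar>?h (real k * d)\<bar>"]) auto
    qed (use d_pos in \<open>simp add: set_integral_const algebra_simps\<close>)
    moreover have "\<bar>LBINT s:{real k * d..real (Suc k) * d}. ?h s - ?h (real k * d)\<bar> \<le> d * d"
    proof -
      have "norm (?h s - ?h (real k * d)) \<le> d" if "s \<in> {real k * d..real (Suc k) * d}" for s
        using h_vec_Lipschitz[of "step_path b" "real k * d" s i] that k d_pos by (auto simp: algebra_simps)
      then show ?thesis
        using set_integral_norm_le[of "\<lambda>s. ?h s - ?h (real k * d)" "real k * d" "real (Suc k) * d" d] d_pos
        by (simp add: algebra_simps)
    qed
    moreover have "\<bar>(\<Sum>j<k. d * ?h (real j * d)) - h_vec_integral (step_path b) i (real k * d)\<bar> \<le> real k * d * d"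
      using Suc by simp
    moreover have "real (Suc k) * d * d = real k * d * d + d * d" by (simp add: algebra_simps)
    ultimately show ?case unfolding sum.lessThan_Suc by linarith
  qed
  define k where "k = nat \<lfloor>t / d\<rfloor>"
  have k: "real k * d \<le> t" "t \<le> real k * d + d" "k \<le> n"
    using floor_bounds[of t] floor_le_n[OF t] t unfolding k_def atLeastAtMost_iff by blast+
  have "step_direction b i t = (\<Sum>j<k. d * ?h (real j * d))"
    unfolding step_direction_def k_def by (rule sum_indicator_floor[OF t])
  moreover have "h_vec_integral (step_path b) i t = h_vec_integral (step_path b) i (real k * d) + (LBINT s:{real k * d..t}. ?h s)"
    using k t d_pos by (intro split) auto
  moreover have "\<bar>LBINT s:{real k * d..t}. ?h s\<bar> \<le> (1 + T) * (t - real k * d)"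
  proof -
    have "0 \<le> real k * d" using d_pos by simp
    then have "norm (?h s) \<le> 1 + T" if "s \<in> {real k * d..t}" for s
      using that t unfolding real_norm_def by (intro h_vec_bound') auto
    from set_integral_norm_le[OF _ this k(1)] show ?thesis by simp
  qed
  moreover have "(1 + T) * (t - real k * d) \<le> (1 + T) * d" using k T by (intro mult_left_mono) auto
  moreover have "real k * d * d \<le> T * d"
    using node_in[OF k(3)] d_pos by (intro mult_right_mono) auto
  ultimately show ?thesis using main[OF k(3)] by (simp add: algebra_simps)
qed

text \<open>Exchanging the sum over increments with the time integral inside \<open>h_vec\<close>
  leaves an ordinary integral, which converges for each continuous path as the grid is
  refined.\<close>

lemma ito_sum_eq: "ito_sum b i = (if i = 1 then b T - b 0 else 0) + (LBINT s:{0..T}. hfun i (step_path b s) * remaining_increment b s)"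
proof -
  have tr: "(LBINT s:{0..real j * d}. hfun i (step_path b s)) = (LBINT s:{0..T}. indicator {..real j * d} s * hfun i (step_path b s))" if "j < n" for j
    using node_in[of j] that unfolding set_lebesgue_integral_def
    by (intro Bochner_Integration.integral_cong) (auto simp: indicator_def)
  have si: "set_integrable lborel {0..T} (\<lambda>s. indicator {..real j * d} s * hfun i (step_path b s))" for j
    by (intro set_integrable_bounded[of _ _ _ 1]) (auto simp: indicator_def hfun_bound)
  have "ito_sum b i = (\<Sum>j<n. (if i = 1 then 1 else 0) * grid_increment b j) + (\<Sum>j<n. grid_increment b j * (LBINT s:{0..T}. indicator {..real j * d} s * hfun i (step_path b s)))"
    unfolding ito_sum_def h_vec_nth sum.distrib[symmetric]
    by (intro sum.cong refl) (subst tr; simp add: algebra_simps)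
  also have "(\<Sum>j<n. (if i = 1 then 1 else 0) * grid_increment b j) = (if i = 1 then b T - b 0 else 0)"
    unfolding grid_increment_def using sum_lessThan_telescope[of "\<lambda>j. b (real j * d)" n] by (simp add: nd)
  also have "(\<Sum>j<n. grid_increment b j * (LBINT s:{0..T}. indicator {..real j * d} s * hfun i (step_path b s)))
     = (LBINT s:{0..T}. hfun i (step_path b s) * remaining_increment b s)"
    by (subst set_integral_sum_scale[OF si, symmetric]) (simp only: remaining_increment_def sum_distrib_left mult_ac)
  finally show ?thesis .
qed

text \<open>Summation by parts bounds the discrete stochastic integral in \<open>L\<^sup>2\<close> without orthogonality of
  the increments.\<close>

lemma ito_sum_bound: "\<bar>ito_sum b i\<bar> \<le> (1 + T) * \<bar>b T - b 0\<bar> + (\<Sum>j<n. d * \<bar>b (real (Suc j) * d) - b 0\<bar>)"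
proof -
  let ?h = "\<lambda>j. h_vec (step_path b) (real j * d) $ i"
  have abel: "(\<Sum>j<m. ?h j * grid_increment b j) = ?h m * (b (real m * d) - b 0) - (\<Sum>j<m. (?h (Suc j) - ?h j) * (b (real (Suc j) * d) - b 0))" for m
    by (induction m) (auto simp: grid_increment_def algebra_simps)
  have "\<bar>\<Sum>j<n. (?h (Suc j) - ?h j) * (b (real (Suc j) * d) - b 0)\<bar> \<le> (\<Sum>j<n. d * \<bar>b (real (Suc j) * d) - b 0\<bar>)"
  proof (rule order_trans[OF sum_abs], rule sum_mono, rule mult_bound)
    fix j
    show "\<bar>?h (Suc j) - ?h j\<bar> \<le> d"
      using h_vec_Lipschitz[of "step_path b" "real j * d" "real (Suc j) * d" i] d_pos by (auto simp: algebra_simps)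
  qed simp
  moreover have "\<bar>?h n * (b T - b 0)\<bar> \<le> (1 + T) * \<bar>b T - b 0\<bar>"
    using T nd by (intro mult_bound h_vec_bound') auto
  ultimately show ?thesis unfolding ito_sum_def abel nd by linarith
qed

end

section \<open>Refinement of the grid along a continuous path\<close>

lemma node_tendsto:
  fixes T s :: real
  assumes T: "T > 0" and s: "s \<in> {0..T}"
  shows "(\<lambda>m. real (nat \<lfloor>s / (T / real (Suc m))\<rfloor>) * (T / real (Suc m))) \<longlonglongrightarrow> s"
    "(\<lambda>m. real (nat \<lceil>s / (T / real (Suc m))\<rceil>) * (T / real (Suc m))) \<longlonglongrightarrow> s"
proof -
  have g: "grid T (T / real (Suc m)) (Suc m)" for m using T by unfold_locales auto
  have d0: "(\<lambda>m. T / real (Suc m)) \<longlonglongrightarrow> 0"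
    using tendsto_mult_right_zero[OF LIMSEQ_inverse_real_of_nat, of T] by (simp add: divide_inverse)
  show "(\<lambda>m. real (nat \<lfloor>s / (T / real (Suc m))\<rfloor>) * (T / real (Suc m))) \<longlonglongrightarrow> s"
    by (rule Lim_null[THEN iffD2], rule Lim_null_comparison[OF always_eventually d0])
       (use grid.floor_bounds[OF g, of s] s in \<open>auto simp: abs_le_iff algebra_simps simp del: of_nat_Suc of_nat_nat\<close>)
  show "(\<lambda>m. real (nat \<lceil>s / (T / real (Suc m))\<rceil>) * (T / real (Suc m))) \<longlonglongrightarrow> s"
    by (rule Lim_null[THEN iffD2], rule Lim_null_comparison[OF always_eventually d0])
       (use grid.ceiling_bounds[OF g, of s] s in \<open>auto simp: abs_le_iff algebra_simps simp del: of_nat_Suc of_nat_nat\<close>)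
qed

context
  fixes T :: real and b :: "real \<Rightarrow> real"
  assumes T: "T > 0" and cont: "continuous_on UNIV b" and b0: "b 0 = 0"
begin

abbreviation (input) "dm m \<equiv> T / real (Suc m)"

lemma path_borel': "b \<in> borel_measurable borel" using cont by (rule borel_measurable_continuous_onI)

lemma gridm: "grid T (dm m) (Suc m)" using T by unfold_locales auto

lemma isCont_b: "isCont b s" using cont by (simp add: continuous_on_eq_continuous_at)

lemma step_path_tendsto: "s \<in> {0..T} \<Longrightarrow> (\<lambda>m. grid.step_path (dm m) (Suc m) b s) \<longlonglongrightarrow> b s"
  using isCont_tendsto_compose[OF isCont_b node_tendsto(1)[OF T]]
  by (simp add: grid.step_path_eq[OF gridm] b0 del: of_nat_Suc)

lemma remaining_increment_tendsto: "s \<in> {0..T} \<Longrightarrow> (\<lambda>m. grid.remaining_increment (dm m) (Suc m) b s) \<longlonglongrightarrow> b T - b s"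
  using tendsto_diff[OF tendsto_const isCont_tendsto_compose[OF isCont_b node_tendsto(2)[OF T]]]
  by (simp add: grid.remaining_increment_eq[OF gridm] del: of_nat_Suc)

lemma step_direction_tendsto:
  assumes t: "t \<in> {0..T}" shows "(\<lambda>m. grid.step_direction (dm m) (Suc m) b i t) \<longlonglongrightarrow> h_vec_integral b i t"
proof -
  have 1: "(\<lambda>m. h_vec_integral (grid.step_path (dm m) (Suc m) b) i t) \<longlonglongrightarrow> h_vec_integral b i t"
    using T t by (intro h_vec_integral_tendsto[where T = T] step_path_tendsto grid.measurable_grid[OF gridm] path_borel') auto
  have "(\<lambda>m. (1 + 2 * T) * dm m) \<longlonglongrightarrow> (1 + 2 * T) * (T * 0)"
    unfolding divide_inverse by (intro tendsto_intros LIMSEQ_inverse_real_of_nat)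
  then have z: "(\<lambda>m. (1 + 2 * T) * dm m) \<longlonglongrightarrow> 0" by simp
  have "(\<lambda>m. grid.step_direction (dm m) (Suc m) b i t - h_vec_integral (grid.step_path (dm m) (Suc m) b) i t) \<longlonglongrightarrow> 0"
    by (rule Lim_null_comparison[OF _ z]) (use grid.step_direction_h_vec_integral[OF gridm t] in \<open>auto intro!: always_eventually simp del: of_nat_Suc\<close>)
  from tendsto_add[OF this 1] show ?thesis by simp
qed

lemma ito_sum_tendsto: "(\<lambda>m. grid.ito_sum (dm m) (Suc m) b i) \<longlonglongrightarrow> delta T i b"
proof -
  \<comment> \<open>A continuous path is bounded on \<open>{0..T}\<close>, which dominates the
    remaining increments for all grids at once.\<close>
  have "compact (b ` {0..T})" using cont by (intro compact_continuous_image continuous_on_subset[OF cont]) auto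
  then obtain S where "\<forall>y\<in>b ` {0..T}. norm y \<le> S"
    using compact_imp_bounded[of "b ` {0..T}"] unfolding bounded_iff by blast
  then have S: "\<bar>b t\<bar> \<le> S" if "t \<in> {0..T}" for t using that by auto
  have S2: "\<bar>grid.remaining_increment (dm m) (Suc m) b s\<bar> \<le> 2 * S" if s: "s \<in> {0..T}" for m s
    using S[of T] S[OF grid.node_in[OF gridm grid.ceiling_le_n[OF gridm s]], of m] T
    unfolding grid.remaining_increment_eq[OF gridm s] by auto
  have "(\<lambda>m. LBINT s:{0..T}. hfun i (grid.step_path (dm m) (Suc m) b s) * grid.remaining_increment (dm m) (Suc m) b s)
    \<longlonglongrightarrow> (LBINT s:{0..T}. hfun i (b s) * (b T - b s))"
  proof (rule set_integral_tendsto[where K = "1 * (2 * S)"])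
    note [measurable] = path_borel' grid.measurable_grid[OF gridm]
    show "(\<lambda>s. hfun i (grid.step_path (dm m) (Suc m) b s) * grid.remaining_increment (dm m) (Suc m) b s) \<in> borel_measurable borel" for m by measurable
    show "(\<lambda>s. hfun i (b s) * (b T - b s)) \<in> borel_measurable borel" by measurable
    show "norm (hfun i (grid.step_path (dm m) (Suc m) b s) * grid.remaining_increment (dm m) (Suc m) b s) \<le> 1 * (2 * S)" if "s \<in> {0..T}" for m s
      unfolding real_norm_def by (intro mult_bound hfun_bound S2 that)
    show "AE s in lborel. s \<in> {0..T} \<longrightarrow>
      (\<lambda>m. hfun i (grid.step_path (dm m) (Suc m) b s) * grid.remaining_increment (dm m) (Suc m) b s) \<longlonglongrightarrow> hfun i (b s) * (b T - b s)"
      by (intro AE_I2 impI tendsto_mult isCont_tendsto_compose[OF isCont_hfun(1)] step_path_tendsto remaining_increment_tendsto)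
  qed
  then show ?thesis unfolding delta_def grid.ito_sum_eq[OF gridm] b0 by (intro tendsto_add) auto
qed

end

text \<open>Brownian motion extended to negative times, by the constant \<open>B 0\<close> in the application, so that
  paths are continuous, hence Borel, on the whole line.\<close>

locale bm_line = brownian_motion M B for M :: "'w measure" and B :: "real \<Rightarrow> 'w \<Rightarrow> real" +
  assumes borel [measurable]: "B t \<in> borel_measurable M"
    and continuous: "\<omega> \<in> space M \<Longrightarrow> continuous_on UNIV (\<lambda>t. B t \<omega>)"
begin

abbreviation path :: "'w \<Rightarrow> real \<Rightarrow> real" where "path \<omega> \<equiv> (\<lambda>s. B s \<omega>)"

lemma path_measurable: "\<omega> \<in> space M \<Longrightarrow> path \<omega> \<in> borel_measurable borel"
  using continuous by (rule borel_measurable_continuous_onI)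

text \<open>Rounding time down to a multiple of \<open>1 / real (Suc n)\<close> leaves countably
  many times, each with a measurable value; continuity of the paths gives the limit.\<close>

lemma joint_measurable [measurable]: "case_prod path \<in> borel_measurable (M \<Otimes>\<^sub>M borel)"
proof -
  have lim: "(\<lambda>n. real_of_int \<lfloor>real (Suc n) * t\<rfloor> / real (Suc n)) \<longlonglongrightarrow> t" for t
  proof (rule Lim_null[THEN iffD2], rule Lim_null_comparison[OF always_eventually LIMSEQ_inverse_real_of_nat], rule allI)
    fix n
    have "real_of_int \<lfloor>real (Suc n) * t\<rfloor> / real (Suc n) - t = (real_of_int \<lfloor>real (Suc n) * t\<rfloor> - real (Suc n) * t) / real (Suc n)"
      by (simp add: diff_divide_distrib)
    moreover have "\<bar>real_of_int \<lfloor>real (Suc n) * t\<rfloor> - real (Suc n) * t\<bar> \<le> 1" by linarith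
    ultimately show "norm (real_of_int \<lfloor>real (Suc n) * t\<rfloor> / real (Suc n) - t) \<le> inverse (real (Suc n))"
      by (simp add: divide_right_mono inverse_eq_divide del: of_nat_Suc)
  qed
  have "(\<lambda>p. B (snd p) (fst p)) \<in> borel_measurable (M \<Otimes>\<^sub>M borel)"
  proof (rule borel_measurable_LIMSEQ_real)
    fix p assume "p \<in> space (M \<Otimes>\<^sub>M (borel :: real measure))"
    then have "fst p \<in> space M" by (auto simp: space_pair_measure)
    then have "isCont (\<lambda>t. B t (fst p)) (snd p)" using continuous by (simp add: continuous_on_eq_continuous_at)
    then show "(\<lambda>n. B (real_of_int \<lfloor>real (Suc n) * snd p\<rfloor> / real (Suc n)) (fst p)) \<longlonglongrightarrow> B (snd p) (fst p)"
      by (rule isCont_tendsto_compose[OF _ lim])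
  next
    fix n :: nat
    show "(\<lambda>p. B (real_of_int \<lfloor>real (Suc n) * snd p\<rfloor> / real (Suc n)) (fst p)) \<in> borel_measurable (M \<Otimes>\<^sub>M borel)"
      by (rule measurable_compose_countable[where f = "\<lambda>i p. B (real_of_int i / real (Suc n)) (fst p)"]) measurable
  qed
  then show ?thesis by (simp add: case_prod_unfold)
qed

lemma increment_moment:
  assumes st: "0 \<le> s" "s \<le> t"
  shows "integrable M (\<lambda>\<omega>. (B t \<omega> - B s \<omega>) ^ (2 * k))"
    "(LINT \<omega>|M. (B t \<omega> - B s \<omega>) ^ (2 * k)) = (t - s) ^ k * (fact (2 * k) / (2 ^ k * fact k))"
proof -
  have "integrable M (\<lambda>\<omega>. (B t \<omega> - B s \<omega>) ^ (2 * k)) \<and>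
    (LINT \<omega>|M. (B t \<omega> - B s \<omega>) ^ (2 * k)) = (t - s) ^ k * (fact (2 * k) / (2 ^ k * fact k))"
  proof (cases "s = t")
    case True then show ?thesis by (cases "k = 0") (auto simp: prob_space power_0_left)
  next
    case False
    then have st': "s < t" using st by simp
    define \<sigma> where "\<sigma> = sqrt (t - s)"
    have s: "\<sigma> > 0" "\<sigma>\<^sup>2 = t - s" using st' by (auto simp: \<sigma>_def)
    have X: "distributed M lborel (\<lambda>\<omega>. B t \<omega> - B s \<omega>) (normal_density 0 \<sigma>)"
      unfolding \<sigma>_def by (rule gaussian_increments[OF st(1) st'])
    have "integrable M (\<lambda>\<omega>. (B t \<omega> - B s \<omega>) ^ (2 * k))"
      using distributed_integrable[OF X, of "\<lambda>x. x ^ (2 * k)"] integrable_normal_moment[OF s(1), of 0 "2 * k"] by simp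
    moreover have "(LINT \<omega>|M. (B t \<omega> - B s \<omega>) ^ (2 * k)) = (LINT x|lborel. normal_density 0 \<sigma> x * (x - 0) ^ (2 * k))"
      using distributed_integral[OF X, of "\<lambda>x. x ^ (2 * k)"] by simp
    ultimately show ?thesis
      using integral_normal_moment_even[OF s(1), of 0 k] st' unfolding s(2) by (simp add: power_divide)
  qed
  then show "integrable M (\<lambda>\<omega>. (B t \<omega> - B s \<omega>) ^ (2 * k))"
    "(LINT \<omega>|M. (B t \<omega> - B s \<omega>) ^ (2 * k)) = (t - s) ^ k * (fact (2 * k) / (2 ^ k * fact k))" by auto
qed

lemma increment_second_moment:
  assumes "0 \<le> s" "s \<le> t"
  shows "integrable M (\<lambda>\<omega>. (B t \<omega> - B s \<omega>)\<^sup>2)" "(LINT \<omega>|M. (B t \<omega> - B s \<omega>)\<^sup>2) = t - s"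
    "integrable M (\<lambda>\<omega>. B t \<omega> - B s \<omega>)"
proof -
  show 2: "integrable M (\<lambda>\<omega>. (B t \<omega> - B s \<omega>)\<^sup>2)" and "(LINT \<omega>|M. (B t \<omega> - B s \<omega>)\<^sup>2) = t - s"
    using increment_moment[OF assms, of 1] by auto
  have "\<bar>y\<bar> \<le> 1 + y\<^sup>2" for y :: real
    using sum_squares_bound[of "\<bar>y\<bar>" 1] by simp
  then show "integrable M (\<lambda>\<omega>. B t \<omega> - B s \<omega>)"
    using 2 by (intro Bochner_Integration.integrable_bound[of M "\<lambda>\<omega>. 1 + (B t \<omega> - B s \<omega>)\<^sup>2" "\<lambda>\<omega>. B t \<omega> - B s \<omega>"]
        Bochner_Integration.integrable_add integrable_const AE_I2) (simp_all add: abs_of_nonneg add_nonneg_nonneg)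
qed

context
  fixes T d :: real and n :: nat
  assumes g: "grid T d n"
begin

interpretation grid T d n by (rule g)

lemma measurable_step_path [measurable]: "case_prod (\<lambda>\<omega>. step_path (path \<omega>)) \<in> borel_measurable (M \<Otimes>\<^sub>M borel)"
  unfolding step_path_def step_function_def grid_increment_def by measurable

lemma measurable_step_path_node [measurable]: "(\<lambda>\<omega>. h_vec (step_path (path \<omega>)) t $ i) \<in> borel_measurable M"
  by (rule measurable_section[OF measurable_h_vec[OF measurable_step_path]])

lemma measurable_grid_increment [measurable]: "(\<lambda>\<omega>. grid_increment (path \<omega>) j) \<in> borel_measurable M"
  unfolding grid_increment_def by measurable

lemma measurable_step_direction [measurable]: "case_prod (\<lambda>\<omega>. step_direction (path \<omega>) i) \<in> borel_measurable (M \<Otimes>\<^sub>M borel)"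
  unfolding step_direction_def by measurable

lemma measurable_ito_sum [measurable]: "(\<lambda>\<omega>. ito_sum (path \<omega>) i) \<in> borel_measurable M"
  unfolding ito_sum_def by measurable

text \<open>The bound does not depend on the grid: by the Cauchy-Schwarz inequality the sum in
  \<open>ito_sum_bound\<close> has second moment at most
  \<open>real n * d\<^sup>2 * (real n * T)\<close>, which is \<open>T ^ 3\<close>. The factors 2
  come from squaring a sum of two terms.\<close>

lemma ito_sum_L2: "integrable M (\<lambda>\<omega>. (ito_sum (path \<omega>) i)\<^sup>2)" "(LINT \<omega>|M. (ito_sum (path \<omega>) i)\<^sup>2) \<le> 2 * (1 + T)\<^sup>2 * T + 2 * T ^ 3"
proof -
  let ?D = "\<lambda>j \<omega>. B (real (Suc j) * d) \<omega> - B 0 \<omega>"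
  let ?b = "\<lambda>\<omega>. 2 * (1 + T)\<^sup>2 * (B T \<omega> - B 0 \<omega>)\<^sup>2 + 2 * (real n * d\<^sup>2 * (\<Sum>j<n. (?D j \<omega>)\<^sup>2))"
  have le: "(ito_sum (path \<omega>) i)\<^sup>2 \<le> ?b \<omega>" for \<omega>
  proof -
    have "(ito_sum (path \<omega>) i)\<^sup>2 \<le> ((1 + T) * \<bar>B T \<omega> - B 0 \<omega>\<bar> + (\<Sum>j<n. d * \<bar>?D j \<omega>\<bar>))\<^sup>2"
      using ito_sum_bound[of "path \<omega>" i] by (intro power2_le_iff_abs_le[THEN iffD2]) (auto intro: order_trans[OF abs_ge_zero])
    also have "\<dots> \<le> 2 * ((1 + T) * \<bar>B T \<omega> - B 0 \<omega>\<bar>)\<^sup>2 + 2 * (\<Sum>j<n. d * \<bar>?D j \<omega>\<bar>)\<^sup>2"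
      using sum_squares_bound[of "(1 + T) * \<bar>B T \<omega> - B 0 \<omega>\<bar>" "\<Sum>j<n. d * \<bar>?D j \<omega>\<bar>"] by (simp add: power2_sum)
    also have "(\<Sum>j<n. d * \<bar>?D j \<omega>\<bar>)\<^sup>2 \<le> (\<Sum>j<n. (d * \<bar>?D j \<omega>\<bar>)\<^sup>2) * real n"
      using sum_squared_le_sum_of_squares[where I = "{..<n}" and f = "\<lambda>j. d * \<bar>?D j \<omega>\<bar>"] by simp
    also have "\<dots> = real n * d\<^sup>2 * (\<Sum>j<n. (?D j \<omega>)\<^sup>2)"
      by (simp add: power_mult_distrib sum_distrib_left sum_distrib_right mult_ac)
    finally show ?thesis by (simp add: power_mult_distrib)
  qed
  have Dj: "integrable M (\<lambda>\<omega>. (?D j \<omega>)\<^sup>2)" "(LINT \<omega>|M. (?D j \<omega>)\<^sup>2) = real (Suc j) * d" for j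
    using increment_second_moment[of 0 "real (Suc j) * d"] d_pos by auto
  have DT: "integrable M (\<lambda>\<omega>. (B T \<omega> - B 0 \<omega>)\<^sup>2)" "(LINT \<omega>|M. (B T \<omega> - B 0 \<omega>)\<^sup>2) = T"
    using increment_second_moment[of 0 T] T by auto
  have ib: "integrable M ?b" using Dj DT by auto
  then show i: "integrable M (\<lambda>\<omega>. (ito_sum (path \<omega>) i)\<^sup>2)"
    by (rule Bochner_Integration.integrable_bound) (auto intro!: AE_I2 order_trans[OF le])
  have "(LINT \<omega>|M. (ito_sum (path \<omega>) i)\<^sup>2) \<le> (LINT \<omega>|M. ?b \<omega>)" by (intro integral_mono i ib le)
  also have "\<dots> = 2 * (1 + T)\<^sup>2 * T + 2 * (real n * d\<^sup>2 * (\<Sum>j<n. real (Suc j) * d))"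
    using Dj DT by simp
  also have "(\<Sum>j<n. real (Suc j) * d) \<le> (\<Sum>j<n. T)"
    by (intro sum_mono) (use node_in in \<open>auto simp del: of_nat_Suc\<close>)
  then have "2 * (real n * d\<^sup>2 * (\<Sum>j<n. real (Suc j) * d)) \<le> 2 * (real n * d\<^sup>2 * (\<Sum>j<n. T))"
    by (intro mult_left_mono) auto
  also have "\<dots> = 2 * T ^ 3" using nd by (simp add: power2_eq_square power3_eq_cube mult_ac flip: nd)
  finally show "(LINT \<omega>|M. (ito_sum (path \<omega>) i)\<^sup>2) \<le> 2 * (1 + T)\<^sup>2 * T + 2 * T ^ 3" by simp
qed

text \<open>Integration by parts in one Gaussian increment while the others are frozen. The factor
  \<open>h_vec\<close> at time \<open>real j * d\<close> does not contain this increment and acts as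
  a constant; \<open>d\<close> is the variance.\<close>

lemma ibp_single:
  assumes j: "j < n" and e: "\<epsilon> > 0" and f: "bounded_C1 f f'"
  shows "(LINT \<omega>|M. h_vec (step_path (path \<omega>)) (real j * d) $ i * Phi f \<epsilon> T x w i (step_path (path \<omega>)) * grid_increment (path \<omega>) j)
     = d * (LINT \<omega>|M. h_vec (step_path (path \<omega>)) (real j * d) $ i * DPhi f f' \<epsilon> T x w i (step_path (path \<omega>)) (indicator {real (Suc j) * d..}))"
proof -
  obtain F F' where F: "\<And>y. \<bar>f y\<bar> \<le> F" "\<And>y. norm (f' y) \<le> F'"
    using f unfolding bounded_C1_def bounded_iff by auto
  define N where "N = PiM ({..<n} - {j}) (\<lambda>_. borel :: real measure)"
  define Y where "Y = (\<lambda>\<omega>. restrict (\<lambda>i. grid_increment (path \<omega>) i) ({..<n} - {j}))"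
  let ?k = "indicat_real {real (Suc j) * d..}"
  define b0 where "b0 r = step_function d n (r(j := 0))" for r
  define G where "G y r = h_vec (b0 r) (real j * d) $ i * Phi f \<epsilon> T x w i (\<lambda>s. b0 r s + y * ?k s)" for y r
  define G' where "G' y r = h_vec (b0 r) (real j * d) $ i * DPhi f f' \<epsilon> T x w i (\<lambda>s. b0 r s + y * ?k s) ?k" for y r
  have [measurable]: "b0 r \<in> borel_measurable borel" for r unfolding b0_def by measurable
  have X: "distributed M lborel (\<lambda>\<omega>. grid_increment (path \<omega>) j) (normal_density 0 (sqrt d))"
    using gaussian_increments[of "real j * d" "real (Suc j) * d"] d_pos unfolding grid_increment_def by (simp add: algebra_simps)
  have ind: "indep_vars (\<lambda>_. borel) (\<lambda>j \<omega>. grid_increment (path \<omega>) j) {..<n}"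
    unfolding grid_increment_def using d_pos by (intro independent_increments[of "\<lambda>j. real j * d"]) (auto intro!: mult_right_mono)
  note pd = indep_vars_pair_distr[OF ind, where j = j, folded N_def Y_def]
  have gpG: "step_path (path \<omega>) = (\<lambda>s. b0 (Y \<omega>) s + grid_increment (path \<omega>) j * ?k s)" for \<omega>
  proof -
    have e: "step_path (path \<omega>) = step_function d n ((Y \<omega>)(j := grid_increment (path \<omega>) j))"
      unfolding step_path_def step_function_def Y_def by (intro ext sum.cong) auto
    show ?thesis unfolding b0_def by (rule trans[OF e step_function_upd[OF j]])
  qed
  have hG: "h_vec (step_path (path \<omega>)) (real j * d) = h_vec (b0 (Y \<omega>)) (real j * d)" for \<omega>
    unfolding gpG using d_pos by (intro h_vec_cong) (auto simp: algebra_simps)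
  have h1: "\<bar>h_vec (b0 r) (real j * d) $ i\<bar> \<le> 1 + T" for r
    using node_in[of j] j by (intro h_vec_bound') auto
  have mY: "case_prod (\<lambda>(p :: real \<times> (nat \<Rightarrow> real)) s. b0 (snd p) s + fst p * ?k s) \<in> borel_measurable ((borel \<Otimes>\<^sub>M N) \<Otimes>\<^sub>M borel)"
  proof -
    have [measurable]: "(\<lambda>q. ((snd (fst q))(j := 0)) k :: real) \<in> borel_measurable ((borel \<Otimes>\<^sub>M N) \<Otimes>\<^sub>M (borel :: real measure))" if "k \<in> {..<n}" for k
    proof (cases "k = j")
      case False
      have [measurable]: "(\<lambda>r. r k) \<in> borel_measurable N" unfolding N_def using False that by (intro measurable_component_singleton) auto
      show ?thesis using False by simp
    qed simp
    show ?thesis unfolding b0_def step_function_def case_prod_beta by measurable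
  qed
  have mk: "case_prod (\<lambda>(p :: real \<times> (nat \<Rightarrow> real)). ?k) \<in> borel_measurable ((borel \<Otimes>\<^sub>M N) \<Otimes>\<^sub>M borel)" by measurable
  have mh: "(\<lambda>p. h_vec (b0 (snd p)) (real j * d) $ i) \<in> borel_measurable ((borel :: real measure) \<Otimes>\<^sub>M N)"
  proof -
    have "h_vec (\<lambda>s. b0 r s + y * ?k s) (real j * d) = h_vec (b0 r) (real j * d)" for r y
      using d_pos by (intro h_vec_cong) (auto simp: algebra_simps)
    then show ?thesis using measurable_section[OF measurable_h_vec[OF mY], of "real j * d" i] by simp
  qed
  have "(LINT \<omega>|M. G (grid_increment (path \<omega>) j) (Y \<omega>) * grid_increment (path \<omega>) j) = (sqrt d)\<^sup>2 * (LINT \<omega>|M. G' (grid_increment (path \<omega>) j) (Y \<omega>))"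
  proof (rule normal_ibp_indep[where X = "\<lambda>\<omega>. grid_increment (path \<omega>) j" and Y = Y and N = N and G = G and G' = G' and K = "(1 + T) * (F * (norm w / \<epsilon>))"
        and K' = "(1 + T) * (F' * (1 + 2 * (1 * T)) * (norm w / \<epsilon>) + F * (18 * 1 * T * (1 + T) * T * (norm w / \<epsilon>) / \<epsilon>))"])
    show "sqrt d > 0" using d_pos by simp
    show "distributed M lborel (\<lambda>\<omega>. grid_increment (path \<omega>) j) (normal_density 0 (sqrt d))" by (rule X)
    show "Y \<in> measurable M N" using pd(2) j by (simp add: Y_def)
    show "distr M borel (\<lambda>\<omega>. grid_increment (path \<omega>) j) \<Otimes>\<^sub>M distr M N Y = distr M (borel \<Otimes>\<^sub>M N) (\<lambda>\<omega>. (grid_increment (path \<omega>) j, Y \<omega>))"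
      using pd(1) j by (simp add: Y_def)
    show "case_prod G \<in> borel_measurable (borel \<Otimes>\<^sub>M N)"
      unfolding G_def case_prod_beta by (intro borel_measurable_times mh measurable_Phi[OF mY f])
    show "case_prod G' \<in> borel_measurable (borel \<Otimes>\<^sub>M N)"
      unfolding G'_def case_prod_beta by (intro borel_measurable_times mh measurable_DPhi[OF mY mk f])
    show "((\<lambda>y. G y r) has_real_derivative G' y r) (at y)" for y r
      unfolding G_def G'_def
      by (intro DERIV_cmult DERIV_Phi[OF _ _ _ _ _ e f, where K = 1]) (use T in \<open>auto simp: indicator_def\<close>)
    show "isCont (\<lambda>y. G' y r) y" for y r
      unfolding continuous_at_sequentially
    proof (intro allI impI)
      fix u assume u: "u \<longlonglongrightarrow> y"
      show "((\<lambda>y. G' y r) \<circ> u) \<longlonglongrightarrow> G' y r"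
        unfolding G'_def o_def
        by (intro tendsto_mult tendsto_const DPhi_tendsto[OF _ _ _ _ _ _ _ _ _ e f, where K = 1])
           (use T u in \<open>auto simp: indicator_def intro!: tendsto_intros\<close>)
    qed
    show "\<bar>G y r\<bar> \<le> (1 + T) * (F * (norm w / \<epsilon>))" for y r
      unfolding G_def by (intro mult_bound h1 Phi_bound F coercive_reg_gram e) auto
    show "\<bar>G' y r\<bar> \<le> (1 + T) * (F' * (1 + 2 * (1 * T)) * (norm w / \<epsilon>) + F * (18 * 1 * T * (1 + T) * T * (norm w / \<epsilon>) / \<epsilon>))" for y r
      unfolding G'_def by (intro mult_bound h1 DPhi_bound F coercive_reg_gram e) (use T in \<open>auto simp: indicator_def\<close>)
  qed
  then show ?thesis unfolding hG unfolding gpG using d_pos by (simp add: G_def G'_def del: of_nat_Suc)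
qed

end

end

section \<open>Integration by parts for the regularised weight\<close>

context bm_line
begin

text \<open>Summation of \<open>ibp_single\<close> over the grid; linearity of \<open>DPhi\<close>
  in the shift collects the single directions into \<open>step_direction\<close>.\<close>

lemma ibp_grid:
  assumes g: "grid T d n" and e: "\<epsilon> > 0" and f: "bounded_C1 f f'"
  shows "(LINT \<omega>|M. Phi f \<epsilon> T x w i (grid.step_path d n (path \<omega>)) * grid.ito_sum d n (path \<omega>) i)
     = (LINT \<omega>|M. DPhi f f' \<epsilon> T x w i (grid.step_path d n (path \<omega>)) (grid.step_direction d n (path \<omega>) i))"
proof -
  note of_nat_Suc [simp del]
  interpret grid T d n by (rule g)
  obtain F F' where F: "\<And>y. \<bar>f y\<bar> \<le> F" "\<And>y. norm (f' y) \<le> F'"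
    using f unfolding bounded_C1_def bounded_iff by auto
  note mg = measurable_step_path[OF g] and [measurable] = measurable_step_path_node[OF g] measurable_grid_increment[OF g] measurable_Phi[OF measurable_step_path[OF g] f]
  let ?k = "\<lambda>j. indicat_real {real (Suc j) * d..}"
  have mD[measurable]: "(\<lambda>\<omega>. DPhi f f' \<epsilon> T x w i (step_path (path \<omega>)) (?k j)) \<in> borel_measurable M" for j
    by (rule measurable_DPhi[OF mg _ f]) measurable
  have hb: "\<bar>h_vec (step_path b) (real j * d) $ i\<bar> \<le> 1 + T" if "j < n" for j b
    using node_in[of j] that by (intro h_vec_bound') auto
  define KP where "KP = F * (norm w / \<epsilon>)"
  have Pb: "\<bar>Phi f \<epsilon> T x w i (step_path b)\<bar> \<le> KP" for b
    unfolding KP_def by (intro Phi_bound F coercive_reg_gram e) auto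
  define KD where "KD = F' * (1 + 2 * (1 * T)) * (norm w / \<epsilon>) + F * (18 * 1 * T * (1 + T) * T * (norm w / \<epsilon>) / \<epsilon>)"
  have Db: "\<bar>DPhi f f' \<epsilon> T x w i (step_path b) (?k j)\<bar> \<le> KD" for j b
    unfolding KD_def by (intro DPhi_bound F coercive_reg_gram e) (use T in \<open>auto simp: indicator_def\<close>)
  have i1: "integrable M (\<lambda>\<omega>. h_vec (step_path (path \<omega>)) (real j * d) $ i * Phi f \<epsilon> T x w i (step_path (path \<omega>)) * grid_increment (path \<omega>) j)" if j: "j < n" for j
  proof (rule Bochner_Integration.integrable_bound)
    show "integrable M (\<lambda>\<omega>. ((1 + T) * KP) * \<bar>grid_increment (path \<omega>) j\<bar>)"
      unfolding grid_increment_def using d_pos by (intro integrable_mult_right integrable_abs increment_second_moment(3)) (auto intro!: mult_right_mono)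
    show "AE \<omega> in M. norm (h_vec (step_path (path \<omega>)) (real j * d) $ i * Phi f \<epsilon> T x w i (step_path (path \<omega>)) * grid_increment (path \<omega>) j)
        \<le> norm ((1 + T) * KP * \<bar>grid_increment (path \<omega>) j\<bar>)"
      unfolding real_norm_def by (intro AE_I2 order_trans[OF _ abs_ge_self] mult_bound hb Pb j order_refl)
  qed measurable
  have i2: "integrable M (\<lambda>\<omega>. h_vec (step_path (path \<omega>)) (real j * d) $ i * DPhi f f' \<epsilon> T x w i (step_path (path \<omega>)) (?k j))" if j: "j < n" for j
  proof (rule integrable_const_bound)
    show "AE \<omega> in M. norm (h_vec (step_path (path \<omega>)) (real j * d) $ i * DPhi f f' \<epsilon> T x w i (step_path (path \<omega>)) (?k j)) \<le> (1 + T) * KD"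
      unfolding real_norm_def by (intro AE_I2 mult_bound hb Db j)
  qed (intro borel_measurable_times measurable_step_path_node[OF g] mD)
  have "(LINT \<omega>|M. Phi f \<epsilon> T x w i (step_path (path \<omega>)) * ito_sum (path \<omega>) i)
     = (LINT \<omega>|M. (\<Sum>j<n. h_vec (step_path (path \<omega>)) (real j * d) $ i * Phi f \<epsilon> T x w i (step_path (path \<omega>)) * grid_increment (path \<omega>) j))"
    unfolding ito_sum_def by (simp only: sum_distrib_left mult_ac)
  also have "\<dots> = (\<Sum>j<n. d * (LINT \<omega>|M. h_vec (step_path (path \<omega>)) (real j * d) $ i * DPhi f f' \<epsilon> T x w i (step_path (path \<omega>)) (?k j)))"
    by (subst Bochner_Integration.integral_sum) (use i1 in \<open>auto intro!: sum.cong ibp_single[OF g _ e f]\<close>)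
  also have "\<dots> = (LINT \<omega>|M. (\<Sum>j<n. d * (h_vec (step_path (path \<omega>)) (real j * d) $ i * DPhi f f' \<epsilon> T x w i (step_path (path \<omega>)) (?k j))))"
    by (subst Bochner_Integration.integral_sum) (use i2 in auto)
  also have "\<dots> = (LINT \<omega>|M. DPhi f f' \<epsilon> T x w i (step_path (path \<omega>)) (step_direction (path \<omega>) i))"
    unfolding step_direction_def[abs_def]
    by (subst DPhi_sum[where K = 1]) (use T in \<open>auto simp: indicator_def mult.assoc simp del: of_nat_Suc\<close>)
  finally show ?thesis .
qed

lemma B0: "AE \<omega> in M. B 0 \<omega> = 0" by (rule start)

text \<open>Refinement of the grid. For fixed \<open>\<epsilon>\<close> the side with the derivative
  has a constant bound; the other side is handled by the L2 bound for \<open>ito_sum\<close>, which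
  is uniform over the grids.\<close>

theorem ibp_regularized:
  assumes T: "T > 0" and e: "\<epsilon> > 0" and f: "bounded_C1 f f'"
  shows "integrable M (\<lambda>\<omega>. Phi f \<epsilon> T x w i (path \<omega>) * delta T i (path \<omega>))"
    "(LINT \<omega>|M. Phi f \<epsilon> T x w i (path \<omega>) * delta T i (path \<omega>))
      = (LINT \<omega>|M. DPhi f f' \<epsilon> T x w i (path \<omega>) (h_vec_integral (path \<omega>) i))"
proof -
  note of_nat_Suc [simp del]
  obtain F F' where F: "\<And>y. \<bar>f y\<bar> \<le> F" "\<And>y. norm (f' y) \<le> F'"
    using f unfolding bounded_C1_def bounded_iff by auto
  have F0: "0 \<le> F" using F(1) by (meson abs_ge_zero order_trans)
  let ?d = "\<lambda>m. T / real (Suc m)"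
  have g: "grid T (?d m) (Suc m)" for m using T by unfold_locales auto
  let ?p = "\<lambda>m \<omega>. grid.step_path (?d m) (Suc m) (path \<omega>)" and ?K = "\<lambda>m \<omega>. grid.step_direction (?d m) (Suc m) (path \<omega>) i"
    and ?S = "\<lambda>m \<omega>. grid.ito_sum (?d m) (Suc m) (path \<omega>) i"
  note [measurable] = measurable_ito_sum[OF g] measurable_Phi[OF measurable_step_path[OF g] f] measurable_Phi[OF joint_measurable f]
    measurable_DPhi[OF measurable_step_path[OF g] measurable_step_direction[OF g] f] measurable_DPhi[OF joint_measurable measurable_h_vec_integral[OF joint_measurable] f]
  define KP where "KP = F * (norm w / \<epsilon>)"
  have Pb: "\<bar>Phi f \<epsilon> T x w i b\<bar> \<le> KP" if "b \<in> borel_measurable borel" for b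
    unfolding KP_def using that by (intro Phi_bound F coercive_reg_gram e) auto
  have pm: "?p m \<omega> \<in> borel_measurable borel" "?K m \<omega> \<in> borel_measurable borel" for m \<omega>
    using grid.measurable_grid[OF g] by auto
  have conv: "(\<lambda>m. Phi f \<epsilon> T x w i (?p m \<omega>)) \<longlonglongrightarrow> Phi f \<epsilon> T x w i (path \<omega>)"
    "(\<lambda>m. ?S m \<omega>) \<longlonglongrightarrow> delta T i (path \<omega>)"
    "(\<lambda>m. DPhi f f' \<epsilon> T x w i (?p m \<omega>) (?K m \<omega>)) \<longlonglongrightarrow> DPhi f f' \<epsilon> T x w i (path \<omega>) (h_vec_integral (path \<omega>) i)"
    if \<omega>: "\<omega> \<in> space M" "B 0 \<omega> = 0" for \<omega>
  proof -
    note c = T continuous[OF \<omega>(1)] \<omega>(2)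
    note [measurable] = path_measurable[OF \<omega>(1)]
    show "(\<lambda>m. Phi f \<epsilon> T x w i (?p m \<omega>)) \<longlonglongrightarrow> Phi f \<epsilon> T x w i (path \<omega>)"
      by (rule Phi_tendsto[OF pm(1) path_measurable[OF \<omega>(1)] step_path_tendsto[OF c] _ e f]) (use T in auto)
    show "(\<lambda>m. ?S m \<omega>) \<longlonglongrightarrow> delta T i (path \<omega>)" by (rule ito_sum_tendsto[OF c])
    show "(\<lambda>m. DPhi f f' \<epsilon> T x w i (?p m \<omega>) (?K m \<omega>)) \<longlonglongrightarrow> DPhi f f' \<epsilon> T x w i (path \<omega>) (h_vec_integral (path \<omega>) i)"
      by (rule DPhi_tendsto[OF pm(1) path_measurable[OF \<omega>(1)] step_path_tendsto[OF c] _ pm(2) _ step_direction_tendsto[OF c] grid.step_direction_bound[OF g] _ e f]) (use T in auto)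
  qed
  have P2: "(Phi f \<epsilon> T x w i (?p m \<omega>) * ?S m \<omega>)\<^sup>2 \<le> KP\<^sup>2 * (?S m \<omega>)\<^sup>2" for m \<omega>
    unfolding power_mult_distrib using order_trans[OF Pb[OF pm(1)] abs_ge_self]
    by (intro mult_right_mono) (simp_all only: abs_le_square_iff[symmetric] zero_le_power2)
  have i2: "integrable M (\<lambda>\<omega>. (Phi f \<epsilon> T x w i (?p m \<omega>) * ?S m \<omega>)\<^sup>2)" for m
    by (rule Bochner_Integration.integrable_bound[OF integrable_mult_right[OF ito_sum_L2(1)[OF g[of m], of i], of "KP\<^sup>2"]])
      (auto intro!: AE_I2 order_trans[OF P2])
  have b2: "(LINT \<omega>|M. (Phi f \<epsilon> T x w i (?p m \<omega>) * ?S m \<omega>)\<^sup>2) \<le> KP\<^sup>2 * (2 * (1 + T)\<^sup>2 * T + 2 * T ^ 3)" for m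
  proof -
    have "(LINT \<omega>|M. (Phi f \<epsilon> T x w i (?p m \<omega>) * ?S m \<omega>)\<^sup>2) \<le> (LINT \<omega>|M. KP\<^sup>2 * (?S m \<omega>)\<^sup>2)"
      by (intro integral_mono i2 integrable_mult_right ito_sum_L2[OF g] P2)
    also have "\<dots> \<le> KP\<^sup>2 * (2 * (1 + T)\<^sup>2 * T + 2 * T ^ 3)"
      using ito_sum_L2[OF g[of m], of i] by (simp add: mult_left_mono)
    finally show ?thesis .
  qed
  have md[measurable]: "(\<lambda>\<omega>. delta T i (path \<omega>)) \<in> borel_measurable M"
  proof -
    have "case_prod (\<lambda>\<omega> t. LBINT s:{0..t}. hfun i (B s \<omega>) * (B T \<omega> - B s \<omega>)) \<in> borel_measurable (M \<Otimes>\<^sub>M borel)"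
      by (intro measurable_set_integral) measurable
    from measurable_section[OF this, of T] have [measurable]: "(\<lambda>\<omega>. LBINT s:{0..T}. hfun i (B s \<omega>) * (B T \<omega> - B s \<omega>)) \<in> borel_measurable M" .
    show ?thesis unfolding delta_def by measurable
  qed
  have lim: "AE \<omega> in M. (\<lambda>m. Phi f \<epsilon> T x w i (?p m \<omega>) * ?S m \<omega>) \<longlonglongrightarrow> Phi f \<epsilon> T x w i (path \<omega>) * delta T i (path \<omega>)"
    using B0 by (rule AE_mp) (auto intro!: AE_I2 tendsto_mult conv)
  have mm: "(\<lambda>\<omega>. Phi f \<epsilon> T x w i (?p m \<omega>) * ?S m \<omega>) \<in> borel_measurable M" for m by measurable
  note V = integral_tendsto_of_L2_bounded[OF mm _ lim i2 b2]
  show "integrable M (\<lambda>\<omega>. Phi f \<epsilon> T x w i (path \<omega>) * delta T i (path \<omega>))" by (rule V(1)) measurable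
  have 1: "(\<lambda>m. LINT \<omega>|M. Phi f \<epsilon> T x w i (?p m \<omega>) * ?S m \<omega>) \<longlonglongrightarrow> (LINT \<omega>|M. Phi f \<epsilon> T x w i (path \<omega>) * delta T i (path \<omega>))"
    by (rule V(2)) measurable
  have 2: "(\<lambda>m. LINT \<omega>|M. DPhi f f' \<epsilon> T x w i (?p m \<omega>) (?K m \<omega>)) \<longlonglongrightarrow> (LINT \<omega>|M. DPhi f f' \<epsilon> T x w i (path \<omega>) (h_vec_integral (path \<omega>) i))"
  proof (rule integral_dominated_convergence)
    let ?K = "(1 + T) * T"
    show "integrable M (\<lambda>_. F' * (?K + 2 * (?K * T)) * (norm w / \<epsilon>) + F * (18 * ?K * T * (1 + T) * T * (norm w / \<epsilon>) / \<epsilon>))" by simp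
    show "AE \<omega> in M. (\<lambda>m. DPhi f f' \<epsilon> T x w i (?p m \<omega>) (grid.step_direction (?d m) (Suc m) (path \<omega>) i)) \<longlonglongrightarrow> DPhi f f' \<epsilon> T x w i (path \<omega>) (h_vec_integral (path \<omega>) i)"
      using B0 by (rule AE_mp) (auto intro!: AE_I2 conv)
    show "AE \<omega> in M. norm (DPhi f f' \<epsilon> T x w i (?p m \<omega>) (grid.step_direction (?d m) (Suc m) (path \<omega>) i)) \<le> 
      F' * (?K + 2 * (?K * T)) * (norm w / \<epsilon>) + F * (18 * ?K * T * (1 + T) * T * (norm w / \<epsilon>) / \<epsilon>)" for m
      unfolding real_norm_def
      by (intro AE_I2 DPhi_bound F coercive_reg_gram e pm grid.step_direction_bound[OF g]) (use T in auto)
  qed measurable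
  show "(LINT \<omega>|M. Phi f \<epsilon> T x w i (path \<omega>) * delta T i (path \<omega>))
      = (LINT \<omega>|M. DPhi f f' \<epsilon> T x w i (path \<omega>) (h_vec_integral (path \<omega>) i))"
    using LIMSEQ_unique[OF 1] 2 unfolding ibp_grid[OF g e f] by blast
qed

end

section \<open>Nondegeneracy of the reduced Malliavin matrix\<close>

lemma set_integral_shift:
  fixes f :: "real \<Rightarrow> real"
  shows "(LBINT t:{a..c}. f (t + w)) = (LBINT t:{a + w..c + w}. f t)"
proof -
  have "(LBINT t:{a + w..c + w}. f t) = (LINT t|lborel. indicator {a + w..c + w} (w + 1 * t) *\<^sub>R f (w + 1 * t))"
    unfolding set_lebesgue_integral_def by (subst lborel_integral_real_affine[of 1 _ w]) auto
  also have "\<dots> = (LBINT t:{a..c}. f (t + w))"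
    unfolding set_lebesgue_integral_def
    by (intro Bochner_Integration.integral_cong) (auto simp: indicator_def add.commute)
  finally show ?thesis by simp
qed

lemma set_integral_abs_le:
  fixes f g :: "real \<Rightarrow> real"
  assumes f: "set_integrable lborel {a..c} f" and g: "set_integrable lborel {a..c} g" and "\<And>t. t \<in> {a..c} \<Longrightarrow> \<bar>f t\<bar> \<le> g t"
  shows "\<bar>LBINT t:{a..c}. f t\<bar> \<le> (LBINT t:{a..c}. g t)"
proof -
  have "\<bar>LBINT t:{a..c}. f t\<bar> \<le> (LBINT t:{a..c}. \<bar>f t\<bar>)"
    using set_integral_norm_bound[OF f] by simp
  also have "\<dots> \<le> (LBINT t:{a..c}. g t)" by (intro set_integral_mono set_integrable_abs f g assms(3))
  finally show ?thesis .
qed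

lemma set_integral_nonneg_mono:
  fixes f :: "real \<Rightarrow> real"
  assumes "set_integrable lborel {a..c} f" "\<And>t. t \<in> {a..c} \<Longrightarrow> 0 \<le> f t" and "{a'..c'} \<subseteq> {a..c}"
  shows "(LBINT t:{a'..c'}. f t) \<le> (LBINT t:{a..c}. f t)"
  unfolding set_lebesgue_integral_def
  using assms(1) set_integrable_subset[OF assms(1) _ assms(3)] assms(2,3)
  by (intro integral_mono) (auto simp: set_integrable_def indicator_def)

section \<open>Lower bound for the Gram form from two short windows\<close>

locale window =
  fixes T w :: real and b :: "real \<Rightarrow> real"
  assumes cont: "continuous_on UNIV b" and T: "T > 0" and w: "w > 0" "2 * w \<le> 1"
begin

lemma path_borel [measurable]: "b \<in> borel_measurable borel" using cont by (rule borel_measurable_continuous_onI)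

lemma h_vec_borel [measurable]: "(\<lambda>t. h_vec b t $ i) \<in> borel_measurable borel" by (rule borel_measurable_h_vec[OF path_borel])

lemma h_vec_shift_borel [measurable]: "(\<lambda>t. h_vec b (t + w) $ i) \<in> borel_measurable borel"
  by (rule measurable_compose[OF _ h_vec_borel]) measurable

text \<open>The failure of the path to be constant on the two adjacent intervals of length
  \<open>w\<close> after \<open>a\<close>. It is measured in L1 so that its moments follow from
  those of single increments.\<close>

definition osc :: "real \<Rightarrow> real" where "osc a = (LBINT s:{a..a + 2 * w}. \<bar>b s - b a\<bar>)"

text \<open>The difference of \<open>h_vec\<close> over a time \<open>w\<close> is integrated over
  an interval, because the Gram matrix controls \<open>v \<bullet> h_vec b\<close> in L2 and not at
  single times.\<close>

definition dif :: "real \<Rightarrow> 3 \<Rightarrow> real" where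
  "dif a i = (LBINT t:{a..a + w}. h_vec b (t + w) $ i - h_vec b t $ i)"

lemma osc_integrable: "set_integrable lborel {a..a + 2 * w} (\<lambda>s. \<bar>b s - b a\<bar>)"
proof -
  have "continuous_on {a..a + 2 * w} (\<lambda>s. \<bar>b s - b a\<bar>)"
    by (intro continuous_intros continuous_on_subset[OF cont]) auto
  then show ?thesis by (rule borel_integrable_atLeastAtMost')
qed

lemma h_vec_diff:
  assumes "0 \<le> s" "s \<le> t"
  shows "h_vec b t $ i - h_vec b s $ i = (LBINT r:{s..t}. hfun i (b r))"
  unfolding h_vec_nth using set_integral_split[of "\<lambda>r. hfun i (b r)" 0 t 1 s] assms by (simp add: hfun_bound)

lemma hfun_Lipschitz: "\<bar>hfun i y - hfun i z\<bar> \<le> \<bar>y - z\<bar>"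
  using DERIV_quot_bound[OF DERIV_hfun hfun_bound(2), of i z "y - z"] by simp

text \<open>For a path frozen at \<open>b a\<close> the integral would be
  \<open>w\<^sup>2 * hfun i (b a)\<close>. As \<open>hfun\<close> is 1-Lipschitz, freezing costs at
  most \<open>osc a\<close> for each starting time in the interval of length
  \<open>w\<close>.\<close>

lemma dif_approx:
  assumes a: "0 \<le> a"
  shows "\<bar>dif a i - w\<^sup>2 * hfun i (b a)\<bar> \<le> w * osc a" "\<bar>dif a i\<bar> \<le> w\<^sup>2"
proof -
  have h_vec_deriv: "h_vec b (t + w) $ i - h_vec b t $ i = (LBINT r:{t..t + w}. hfun i (b r))" if "t \<in> {a..a + w}" for t
    using that a w by (intro h_vec_diff) auto
  have si: "set_integrable lborel {x..y} (\<lambda>r. hfun i (b r))" for x y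
    by (intro set_integrable_bounded[of _ _ _ 1]) (auto simp: hfun_bound)
  have sc: "set_integrable lborel {x..y} (\<lambda>r. c)" for x y c :: real
    by (intro set_integrable_bounded[of _ _ _ "\<bar>c\<bar>"]) auto
  have m: "(\<lambda>t. h_vec b (t + w) $ i - h_vec b t $ i) \<in> borel_measurable borel" by measurable
  have b1: "\<bar>h_vec b (t + w) $ i - h_vec b t $ i\<bar> \<le> w" if "t \<in> {a..a + w}" for t
    using h_vec_Lipschitz[of b t "t + w" i] that a w by auto
  have sd: "set_integrable lborel {a..a + w} (\<lambda>t. h_vec b (t + w) $ i - h_vec b t $ i)"
    using b1 by (intro set_integrable_bounded[OF m, of _ _ w]) auto
  show "\<bar>dif a i\<bar> \<le> w\<^sup>2"
    unfolding dif_def using set_integral_norm_le[OF m, of a "a + w" w] b1 w by (simp add: power2_eq_square)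
  have p: "\<bar>h_vec b (t + w) $ i - h_vec b t $ i - w * hfun i (b a)\<bar> \<le> osc a" if t: "t \<in> {a..a + w}" for t
  proof -
    have "h_vec b (t + w) $ i - h_vec b t $ i - w * hfun i (b a) = (LBINT r:{t..t + w}. hfun i (b r) - hfun i (b a))"
      using w by (subst set_integral_diff(2)[OF si sc]) (simp add: h_vec_deriv[OF t] set_integral_const)
    also have "\<bar>\<dots>\<bar> \<le> (LBINT r:{t..t + w}. \<bar>b r - b a\<bar>)"
      using t w by (intro set_integral_abs_le set_integral_diff(1) si sc set_integrable_subset[OF osc_integrable] hfun_Lipschitz) auto
    also have "\<dots> \<le> osc a" unfolding osc_def
      using t w by (intro set_integral_nonneg_mono osc_integrable) auto
    finally show ?thesis .
  qed
  have "dif a i - w\<^sup>2 * hfun i (b a) = (LBINT t:{a..a + w}. h_vec b (t + w) $ i - h_vec b t $ i - w * hfun i (b a))"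
    using w unfolding dif_def by (subst set_integral_diff(2)[OF sd sc]) (simp add: set_integral_const power2_eq_square)
  also have "\<bar>\<dots>\<bar> \<le> osc a * (a + w - a)"
    using set_integral_norm_le[of "\<lambda>t. h_vec b (t + w) $ i - h_vec b t $ i - w * hfun i (b a)" a "a + w" "osc a"] p w m by simp
  finally show "\<bar>dif a i - w\<^sup>2 * hfun i (b a)\<bar> \<le> w * osc a" by (simp add: mult.commute)
qed

definition gram_seminorm :: "real^3 \<Rightarrow> real" where "gram_seminorm v = sqrt (v \<bullet> (red_malliavin T b *v v))"

lemma inner_h_vec: "v \<bullet> h_vec b t = v $ 1 + v $ 2 * h_vec b t $ 2 + v $ 3 * h_vec b t $ 3"
  by (simp add: inner_vec_def sum_3) (simp add: h_vec_nth[of b t 1] hfun_def)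

lemma inner_bound: "t \<in> {0..T} \<Longrightarrow> \<bar>v \<bullet> h_vec b t\<bar> \<le> norm v * (3 * (1 + T))"
proof -
  assume t: "t \<in> {0..T}"
  have "norm (h_vec b t) \<le> (\<Sum>i\<in>(UNIV::3 set). 1 + T)"
    by (rule order_trans[OF norm_le_l1_cart]) (intro sum_mono h_vec_bound' path_borel t)
  then have "norm (h_vec b t) \<le> 3 * (1 + T)" by simp
  then show ?thesis using Cauchy_Schwarz_ineq2[of v "h_vec b t"] by (meson mult_left_mono norm_ge_zero order_trans)
qed

lemma minner [measurable]: "(\<lambda>t. v \<bullet> h_vec b t) \<in> borel_measurable borel"
  unfolding inner_vec_def by measurable

lemma inner_integrable: "{a..c} \<subseteq> {0..T} \<Longrightarrow> set_integrable lborel {a..c} (\<lambda>t. v \<bullet> h_vec b t)"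
  by (rule set_integrable_bounded[OF minner]) (use inner_bound in \<open>auto simp only: real_norm_def subset_eq\<close>)

text \<open>The Cauchy-Schwarz inequality, with the L2 norm over \<open>{a..c}\<close> enlarged to
  the one over \<open>{0..T}\<close>.\<close>

lemma L1_le_gram_seminorm:
  assumes ac: "{a..c} \<subseteq> {0..T}" "a < c"
  shows "\<bar>LBINT t:{a..c}. v \<bullet> h_vec b t\<bar> \<le> sqrt (c - a) * gram_seminorm v"
proof -
  let ?g = "\<lambda>t. \<bar>v \<bullet> h_vec b t\<bar>"
  have sq: "set_integrable lborel {0..T} (\<lambda>t. (v \<bullet> h_vec b t)\<^sup>2)"
    by (intro set_integrable_bounded[of _ _ _ "(norm v * (3 * (1 + T)))\<^sup>2"]) (auto intro!: power_mono[OF inner_bound, of _ _ 2, simplified])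
  have "(LBINT t:{a..c}. ?g t) ^ Suc 1 \<le> (c - a) ^ 1 * (LBINT t:{a..c}. ?g t ^ Suc 1)"
    using set_integrable_subset[OF sq _ ac(1)] ac
    by (intro set_integral_power_le set_integrable_abs inner_integrable) (auto simp: power2_eq_square)
  also have "\<dots> \<le> (c - a) * (LBINT t:{0..T}. (v \<bullet> h_vec b t)\<^sup>2)"
    using set_integral_nonneg_mono[OF sq _ ac(1)] ac by (auto simp: power2_eq_square intro!: mult_left_mono)
  also have "\<dots> = (c - a) * (v \<bullet> (red_malliavin T b *v v))" by (simp add: quad_red_malliavin)
  finally have "(LBINT t:{a..c}. ?g t) \<le> sqrt ((c - a) * (v \<bullet> (red_malliavin T b *v v)))"
    by (intro real_le_rsqrt) (simp add: power2_eq_square)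
  moreover have "\<bar>LBINT t:{a..c}. v \<bullet> h_vec b t\<bar> \<le> (LBINT t:{a..c}. ?g t)"
    using ac by (intro set_integral_abs_le set_integrable_abs inner_integrable) auto
  ultimately show ?thesis by (simp add: gram_seminorm_def real_sqrt_mult)
qed

lemma gram_seminorm_nonneg: "0 \<le> gram_seminorm v" using quad_nonneg[OF path_borel] by (simp add: gram_seminorm_def)

text \<open>The first coordinate of \<open>h_vec\<close> is constant and cancels in differences, so
  \<open>v $ 1\<close> disappears. Each of the two intervals contributes
  \<open>sqrt w * gram_seminorm v\<close>, and \<open>sqrt w\<close> is at most 1.\<close>

lemma dif_combination:
  assumes a: "0 \<le> a" "a + 2 * w \<le> T"
  shows "\<bar>v $ 2 * dif a 2 + v $ 3 * dif a 3\<bar> \<le> 2 * gram_seminorm v"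
proof -
  have sd: "set_integrable lborel {a..a + w} (\<lambda>t. h_vec b (t + w) $ i - h_vec b t $ i)" for i
  proof (rule set_integrable_bounded)
    show "norm (h_vec b (t + w) $ i - h_vec b t $ i) \<le> w" if "t \<in> {a..a + w}" for t
      using h_vec_Lipschitz[OF path_borel, of t "t + w" i] that a w by auto
  qed measurable
  have sub: "{a..a + w} \<subseteq> {0..T}" "{a + w..a + w + w} \<subseteq> {0..T}" using a w by auto
  have ss: "set_integrable lborel {a..a + w} (\<lambda>t. v \<bullet> h_vec b (t + w))"
  proof (rule set_integrable_bounded)
    show "(\<lambda>t. v \<bullet> h_vec b (t + w)) \<in> borel_measurable borel" by (rule measurable_compose[OF _ minner]) measurable
    show "norm (v \<bullet> h_vec b (t + w)) \<le> norm v * (3 * (1 + T))" if "t \<in> {a..a + w}" for t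
      unfolding real_norm_def using that a w by (intro inner_bound) auto
  qed
  have "v $ 2 * dif a 2 + v $ 3 * dif a 3 = (LBINT t:{a..a + w}. v $ 2 * (h_vec b (t + w) $ 2 - h_vec b t $ 2)
      + v $ 3 * (h_vec b (t + w) $ 3 - h_vec b t $ 3))"
    unfolding dif_def by (subst set_integral_add(2)) (auto simp only: set_integrable_mult_right sd set_integral_mult_right)
  also have "\<dots> = (LBINT t:{a..a + w}. v \<bullet> h_vec b (t + w) - v \<bullet> h_vec b t)"
    by (simp add: inner_h_vec algebra_simps)
  also have "\<dots> = (LBINT t:{a + w..a + w + w}. v \<bullet> h_vec b t) - (LBINT t:{a..a + w}. v \<bullet> h_vec b t)"
    by (subst set_integral_diff(2)[OF ss inner_integrable[OF sub(1)]])
      (simp add: set_integral_shift[where f = "\<lambda>t. v \<bullet> h_vec b t"])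
  also have "\<bar>\<dots>\<bar> \<le> sqrt w * gram_seminorm v + sqrt w * gram_seminorm v"
    using L1_le_gram_seminorm[OF sub(1), of v] L1_le_gram_seminorm[OF sub(2), of v] w by simp
  also have "\<dots> \<le> 1 * gram_seminorm v + 1 * gram_seminorm v"
    using w gram_seminorm_nonneg[of v] by (intro add_mono mult_right_mono) auto
  finally show ?thesis by simp
qed

text \<open>The increments of \<open>v \<bullet> h_vec b\<close> near two times \<open>a\<close>, \<open>a'\<close> form a linear system for
  \<open>(v $ 2, v $ 3)\<close> whose determinant is close to \<open>w\<^sup>4 sin (b a' - b a)\<close>.\<close>

lemma coercive_red_malliavin:
  assumes \<theta>: "0 < \<theta>" "\<theta> \<le> 1" and w\<theta>: "w = \<theta> ^ 3"
    and a: "0 \<le> a" "a + 2 * w \<le> T" and a': "0 \<le> a'" "a' + 2 * w \<le> T"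
    and s: "\<theta> \<le> \<bar>sin (b a' - b a)\<bar>" and o: "osc a \<le> w * \<theta> / 8" "osc a' \<le> w * \<theta> / 8"
  shows "coercive (\<theta> ^ 14 / (1 / sqrt T + 16 * (T + 1))\<^sup>2) (red_malliavin T b)"
proof -
  define K where "K = 1 / sqrt T + 16 * (T + 1)"
  have K: "K > 0" using T by (simp add: K_def add_nonneg_pos)
  let ?P = "dif a 2" and ?Q = "dif a 3" and ?P' = "dif a' 2" and ?Q' = "dif a' 3"
  define D where "D = ?P * ?Q' - ?P' * ?Q"
  have h: "hfun 2 y = sin y" "hfun 3 y = - cos y" for y by (auto simp: hfun_def)
  have t1: "\<bar>dif x i * dif y j - w\<^sup>2 * hfun i (b x) * (w\<^sup>2 * hfun j (b y))\<bar> \<le> w ^ 4 * \<theta> / 4"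
    if x: "0 \<le> x" "osc x \<le> w * \<theta> / 8" and y: "0 \<le> y" "osc y \<le> w * \<theta> / 8" for x y i j
  proof -
    have "dif x i * dif y j - w\<^sup>2 * hfun i (b x) * (w\<^sup>2 * hfun j (b y))
      = (dif x i - w\<^sup>2 * hfun i (b x)) * dif y j + (w\<^sup>2 * hfun i (b x)) * (dif y j - w\<^sup>2 * hfun j (b y))"
      by (simp add: algebra_simps)
    also have "\<bar>\<dots>\<bar> \<le> (w * (w * \<theta> / 8)) * w\<^sup>2 + (w\<^sup>2 * 1) * (w * (w * \<theta> / 8))"
      using x y w order_trans[OF dif_approx(1)[OF x(1), of i] mult_left_mono[OF x(2), of w]]
         order_trans[OF dif_approx(1)[OF y(1), of j] mult_left_mono[OF y(2), of w]]
      by (intro order_trans[OF abs_triangle_ineq] add_mono mult_bound dif_approx(2) hfun_bound) auto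
    also have "\<dots> = w ^ 4 * \<theta> / 4" by (simp add: field_simps power2_eq_square power4_eq_xxxx)
    finally show ?thesis .
  qed
  have "w ^ 4 * \<theta> \<le> w ^ 4 * \<bar>sin (b a' - b a)\<bar>" using s by (intro mult_left_mono) auto
  also have "\<dots> = \<bar>w\<^sup>2 * hfun 2 (b a) * (w\<^sup>2 * hfun 3 (b a')) - w\<^sup>2 * hfun 2 (b a') * (w\<^sup>2 * hfun 3 (b a))\<bar>"
  proof -
    have "w\<^sup>2 * hfun 2 (b a) * (w\<^sup>2 * hfun 3 (b a')) - w\<^sup>2 * hfun 2 (b a') * (w\<^sup>2 * hfun 3 (b a)) = w ^ 4 * sin (b a' - b a)"
      unfolding h sin_diff by (simp add: algebra_simps power2_eq_square power4_eq_xxxx)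
    then show ?thesis using w by (simp add: abs_mult)
  qed
  finally have "w ^ 4 * \<theta> \<le> \<bar>w\<^sup>2 * hfun 2 (b a) * (w\<^sup>2 * hfun 3 (b a')) - w\<^sup>2 * hfun 2 (b a') * (w\<^sup>2 * hfun 3 (b a))\<bar>" .
  \<comment> \<open>Each of the two products is off by at most \<open>w ^ 4 * \<theta> / 4\<close>,
    so half of the main term survives.\<close>
  then have D: "w ^ 4 * \<theta> / 2 \<le> \<bar>D\<bar>"
    using t1[OF a(1) o(1) a'(1) o(2), of 2 3] t1[OF a'(1) o(2) a(1) o(1), of 2 3] unfolding D_def by linarith
  have *: "norm v \<le> K / \<theta> ^ 7 * gram_seminorm v" for v
  proof -
    note L = dif_combination[OF a, of v] and L' = dif_combination[OF a', of v] and q0 = gram_seminorm_nonneg[of v]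
    \<comment> \<open>Cramer's rule for the two unknowns.\<close>
    have e2: "v $ 2 * D = (v $ 2 * ?P + v $ 3 * ?Q) * ?Q' - (v $ 2 * ?P' + v $ 3 * ?Q') * ?Q"
      and e3: "v $ 3 * D = (v $ 2 * ?P' + v $ 3 * ?Q') * ?P - (v $ 2 * ?P + v $ 3 * ?Q) * ?P'"
      by (simp_all add: D_def algebra_simps)
    have "\<bar>v $ 2 * D\<bar> \<le> 2 * gram_seminorm v * w\<^sup>2 + 2 * gram_seminorm v * w\<^sup>2" "\<bar>v $ 3 * D\<bar> \<le> 2 * gram_seminorm v * w\<^sup>2 + 2 * gram_seminorm v * w\<^sup>2"
      unfolding e2 e3
      by (intro order_trans[OF abs_triangle_ineq4] add_mono mult_bound L L' dif_approx(2) a a')+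
    then have "\<bar>v $ i\<bar> * (w ^ 4 * \<theta> / 2) \<le> 4 * gram_seminorm v * w\<^sup>2" if "i \<in> {2, 3}" for i
      using that mult_left_mono[OF D, of "\<bar>v $ i\<bar>"] by (auto simp: abs_mult)
    then have "\<bar>v $ i\<bar> * (w\<^sup>2 * \<theta>) * w\<^sup>2 \<le> 8 * gram_seminorm v * w\<^sup>2" if "i \<in> {2, 3}" for i
      using that by (simp add: power2_eq_square power4_eq_xxxx algebra_simps)
    then have "\<bar>v $ i\<bar> * (w\<^sup>2 * \<theta>) \<le> 8 * gram_seminorm v" if "i \<in> {2, 3}" for i
      using that w by (simp add: mult_le_cancel_right)
    \<comment> \<open>The choice \<open>w = \<theta> ^ 3\<close> turns everything into powers of
      \<open>\<theta>\<close>; squaring the resulting bound, which has \<open>\<theta> ^ 7\<close>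
      in the denominator, produces the exponent 14.\<close>
    moreover have "w\<^sup>2 * \<theta> = \<theta> ^ 7" unfolding w\<theta> by (simp add: power_mult[symmetric] flip: power_Suc2)
    ultimately have v23: "\<bar>v $ 2\<bar> \<le> 8 * gram_seminorm v / \<theta> ^ 7" "\<bar>v $ 3\<bar> \<le> 8 * gram_seminorm v / \<theta> ^ 7"
      using \<theta> by (auto simp: pos_le_divide_eq)
    have sh: "set_integrable lborel {0..T} (\<lambda>t. h_vec b t $ i)" for i
      by (intro set_integrable_bounded[of _ _ _ "1 + T"]) (auto intro!: h_vec_bound')
    have hb: "\<bar>LBINT t:{0..T}. h_vec b t $ i\<bar> \<le> T * T" if "i \<noteq> 1" for i
    proof -
      have "\<bar>h_vec b t $ i\<bar> \<le> T" if "t \<in> {0..T}" for t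
        using h_vec_Lipschitz[of b 0 t i] that \<open>i \<noteq> 1\<close> set_integral_norm_le[of "\<lambda>s. hfun i (b s)" 0 t 1]
        by (auto simp: h_vec_nth hfun_bound)
      then show ?thesis using set_integral_norm_le[of "\<lambda>t. h_vec b t $ i" 0 T T] T by simp
    qed
    have sc: "set_integrable lborel {0..T} (\<lambda>t. c)" for c :: real
      by (intro set_integrable_bounded[of _ _ _ "\<bar>c\<bar>"]) auto
    \<comment> \<open>With \<open>v $ 2\<close> and \<open>v $ 3\<close> under control, the integral
      of \<open>v \<bullet> h_vec b\<close> over the whole time interval bounds
      \<open>v $ 1\<close>.\<close>
    have "(LBINT t:{0..T}. v \<bullet> h_vec b t) = v $ 1 * T + v $ 2 * (LBINT t:{0..T}. h_vec b t $ 2) + v $ 3 * (LBINT t:{0..T}. h_vec b t $ 3)"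
      unfolding inner_h_vec using T by (simp add: set_integral_add sh sc set_integral_const)
    moreover have "\<bar>LBINT t:{0..T}. v \<bullet> h_vec b t\<bar> \<le> sqrt T * gram_seminorm v" using L1_le_gram_seminorm[of 0 T v] T by simp
    moreover have "\<bar>v $ 2 * (LBINT t:{0..T}. h_vec b t $ 2)\<bar> \<le> 8 * gram_seminorm v / \<theta> ^ 7 * (T * T)"
      "\<bar>v $ 3 * (LBINT t:{0..T}. h_vec b t $ 3)\<bar> \<le> 8 * gram_seminorm v / \<theta> ^ 7 * (T * T)"
      by (intro mult_bound v23 hb; simp)+
    ultimately have "\<bar>v $ 1 * T\<bar> \<le> sqrt T * gram_seminorm v + 16 * gram_seminorm v / \<theta> ^ 7 * (T * T)" by linarith
    then have "\<bar>v $ 1\<bar> \<le> (sqrt T * gram_seminorm v + 16 * gram_seminorm v / \<theta> ^ 7 * (T * T)) / T"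
      using T by (simp add: pos_le_divide_eq abs_mult)
    also have "\<dots> = gram_seminorm v / sqrt T + 16 * gram_seminorm v / \<theta> ^ 7 * T"
    proof -
      have "sqrt T / T = 1 / sqrt T" using T by (simp add: field_simps)
      then have "sqrt T * gram_seminorm v / T = gram_seminorm v / sqrt T" by (metis times_divide_eq_left mult_1)
      then show ?thesis using T by (simp add: add_divide_distrib)
    qed
    also have "gram_seminorm v / sqrt T \<le> (gram_seminorm v / sqrt T) / \<theta> ^ 7"
      using \<theta> q0 T by (simp add: pos_le_divide_eq power_le_one mult_left_le)
    finally have v1: "\<bar>v $ 1\<bar> \<le> (gram_seminorm v / sqrt T) / \<theta> ^ 7 + 16 * gram_seminorm v / \<theta> ^ 7 * T" by simp
    have "norm v \<le> \<bar>v $ 1\<bar> + \<bar>v $ 2\<bar> + \<bar>v $ 3\<bar>"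
      using norm_le_l1_cart[of v] by (simp add: sum_3)
    also have "\<dots> \<le> ((gram_seminorm v / sqrt T) / \<theta> ^ 7 + 16 * gram_seminorm v / \<theta> ^ 7 * T) + 8 * gram_seminorm v / \<theta> ^ 7 + 8 * gram_seminorm v / \<theta> ^ 7"
      using v1 v23 by linarith
    also have "\<dots> = K / \<theta> ^ 7 * gram_seminorm v" using \<theta> T by (simp add: K_def field_simps)
    finally show ?thesis .
  qed
  show ?thesis unfolding coercive_def K_def[symmetric]
  proof (intro conjI allI)
    show "0 < \<theta> ^ 14 / K\<^sup>2" using \<theta> K by simp
    fix v
    have "(norm v)\<^sup>2 \<le> (K / \<theta> ^ 7 * gram_seminorm v)\<^sup>2" by (intro power_mono *) simp
    also have "\<dots> = K\<^sup>2 / \<theta> ^ 14 * (v \<bullet> (red_malliavin T b *v v))"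
      using quad_nonneg[OF path_borel, of v T] by (simp add: gram_seminorm_def power_mult_distrib power_divide power_mult[symmetric])
    finally show "\<theta> ^ 14 / K\<^sup>2 * (v \<bullet> v) \<le> v \<bullet> (red_malliavin T b *v v)"
      using K \<theta> by (simp add: power2_norm_eq_inner field_simps)
  qed
qed

end

text \<open>\<open>R\<close> is the value \<open>r n\<close> at the first good scale
  \<open>n\<close>. It equals \<open>r (Suc n)\<close> at that index only if scale \<open>n\<close>
  is bad, so its moment is at most \<open>r 0 ^ p\<close> plus the sum of
  \<open>r (Suc n) ^ p * prob (bad n)\<close>.\<close>

lemma (in prob_space) first_good_moment:
  fixes r :: "nat \<Rightarrow> real"
  assumes bad[measurable]: "\<And>n. bad n \<in> events" and r: "\<And>n. 0 \<le> r n"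
    and sm: "summable (\<lambda>n. r (Suc n) ^ p * prob (bad n))" and z: "(\<lambda>n. prob (bad n)) \<longlonglongrightarrow> 0"
  shows "\<exists>R. R \<in> borel_measurable M \<and> integrable M (\<lambda>\<omega>. R \<omega> ^ p) \<and> (AE \<omega> in M. \<exists>n. \<omega> \<notin> bad n \<and> R \<omega> = r n)"
proof -
  define N where "N \<omega> = (LEAST n. \<omega> \<notin> bad n)" for \<omega>
  have [measurable]: "N \<in> measurable M (count_space UNIV)" unfolding N_def by measurable
  let ?R = "\<lambda>\<omega>. r (N \<omega>)"
  have [measurable]: "?R \<in> borel_measurable M" by measurable
  have "prob (\<Inter>n. bad n) \<le> prob (bad n)" for n by (intro finite_measure_mono) auto
  then have "prob (\<Inter>n. bad n) \<le> 0" by (intro LIMSEQ_le_const[OF z]) auto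
  then have "prob (\<Inter>n. bad n) = 0" by (simp add: measure_le_0_iff)
  then have "AE \<omega> in M. \<omega> \<notin> (\<Inter>n. bad n)" by (subst (asm) prob_eq_0) auto
  then have ae: "AE \<omega> in M. \<exists>n. \<omega> \<notin> bad n" by simp
  have le: "?R \<omega> ^ p \<le> (r 0 ^ p + (\<Sum>n<N \<omega>. r (Suc n) ^ p * indicator (bad n) \<omega>))" for \<omega>
  proof (cases "N \<omega>")
    case (Suc k)
    \<comment> \<open>Every scale below the value of \<open>LEAST\<close> is bad, also when no good
      scale exists; hence the estimate holds for every \<open>\<omega>\<close>.\<close>
    have "\<omega> \<in> bad k" using not_less_Least[of k "\<lambda>n. \<omega> \<notin> bad n"] Suc unfolding N_def by auto
    then have "r (N \<omega>) ^ p = r (Suc k) ^ p * indicator (bad k) \<omega>" using Suc by simp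
    also have "\<dots> \<le> (\<Sum>n<N \<omega>. r (Suc n) ^ p * indicator (bad n) \<omega>)"
      using Suc r by (intro member_le_sum) auto
    finally show ?thesis using r[of 0] by (simp add: add_increasing)
  qed simp
  have "ennreal (?R \<omega> ^ p) \<le> ennreal (r 0 ^ p) + (\<Sum>n. ennreal (r (Suc n) ^ p) * indicator (bad n) \<omega>)" for \<omega>
  proof -
    have "ennreal (?R \<omega> ^ p) \<le> ennreal (r 0 ^ p + (\<Sum>n<N \<omega>. r (Suc n) ^ p * indicator (bad n) \<omega>))"
      by (intro ennreal_leI le)
    also have "\<dots> = ennreal (r 0 ^ p) + (\<Sum>n<N \<omega>. ennreal (r (Suc n) ^ p) * indicator (bad n) \<omega>)"
    proof -
      have e: "ennreal (r (Suc n) ^ p * indicator (bad n) \<omega>) = ennreal (r (Suc n) ^ p) * indicator (bad n) \<omega>" for n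
        by (cases "\<omega> \<in> bad n") auto
      have "0 \<le> r (Suc n) ^ p * indicator (bad n) \<omega>" for n using r by simp
      then show ?thesis using r by (simp only: ennreal_plus sum_nonneg zero_le_power sum_ennreal[symmetric] e)
    qed
    also have "\<dots> \<le> ennreal (r 0 ^ p) + (\<Sum>n. ennreal (r (Suc n) ^ p) * indicator (bad n) \<omega>)"
      by (intro add_left_mono sum_le_suminf) auto
    finally show ?thesis .
  qed
  then have "(\<integral>\<^sup>+\<omega>. ennreal (?R \<omega> ^ p) \<partial>M) \<le> (\<integral>\<^sup>+\<omega>. ennreal (r 0 ^ p) + (\<Sum>n. ennreal (r (Suc n) ^ p) * indicator (bad n) \<omega>) \<partial>M)"
    by (intro nn_integral_mono) auto
  also have "\<dots> = ennreal (r 0 ^ p) + (\<Sum>n. ennreal (r (Suc n) ^ p) * emeasure M (bad n))"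
    by (simp add: nn_integral_add nn_integral_suminf nn_integral_cmult_indicator emeasure_space_1)
  also have "(\<Sum>n. ennreal (r (Suc n) ^ p) * emeasure M (bad n)) = (\<Sum>n. ennreal (r (Suc n) ^ p * prob (bad n)))"
    using r by (simp add: emeasure_eq_measure ennreal_mult)
  also have "\<dots> = ennreal (\<Sum>n. r (Suc n) ^ p * prob (bad n))"
    using r sm by (intro suminf_ennreal2) auto
  finally have "(\<integral>\<^sup>+\<omega>. ennreal (?R \<omega> ^ p) \<partial>M) < \<infinity>" by (simp add: le_less_trans)
  then have "integrable M (\<lambda>\<omega>. ?R \<omega> ^ p)" using r by (intro integrableI_bounded) auto
  moreover have "AE \<omega> in M. \<exists>n. \<omega> \<notin> bad n \<and> ?R \<omega> = r n"
    using ae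
  proof eventually_elim
    fix \<omega> assume "\<exists>n. \<omega> \<notin> bad n"
    then have "\<omega> \<notin> bad (N \<omega>)" unfolding N_def by (rule LeastI_ex)
    then show "\<exists>n. \<omega> \<notin> bad n \<and> ?R \<omega> = r n" by blast
  qed
  ultimately show ?thesis by (intro exI[of _ ?R]) auto
qed

text \<open>The moment of order \<open>2 * q\<close> of a standard Gaussian variable.\<close>

definition gauss_const :: "nat \<Rightarrow> real" where "gauss_const q = fact (2 * q) / (2 ^ q * fact q)"

lemma gauss_const_nonneg: "0 \<le> gauss_const q" by (simp add: gauss_const_def)

section \<open>Probability of a bad scale\<close>

context bm_line
begin

text \<open>Jensen's inequality in time and Fubini reduce the moment to those of single increments.
  The integrated oscillation over a length \<open>L\<close> is thus of order L^(3/2).\<close>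

lemma path_osc_moment:
  assumes a: "0 \<le> a" and L: "0 < L" and q: "q > 0"
  shows "integrable M (\<lambda>\<omega>. (LBINT s:{a..a + L}. \<bar>B s \<omega> - B a \<omega>\<bar>) ^ (2 * q))"
    "(LINT \<omega>|M. (LBINT s:{a..a + L}. \<bar>B s \<omega> - B a \<omega>\<bar>) ^ (2 * q)) \<le> L ^ (2 * q) * (gauss_const q * L ^ q)"
    "(\<lambda>\<omega>. LBINT s:{a..a + L}. \<bar>B s \<omega> - B a \<omega>\<bar>) \<in> borel_measurable M"
proof -
  let ?I = "\<lambda>\<omega>. LBINT s:{a..a + L}. \<bar>B s \<omega> - B a \<omega>\<bar>"
  obtain k where k: "2 * q = Suc k" using q by (cases "2 * q") auto
  have si: "set_integrable lborel {a..a + L} (\<lambda>s. \<bar>B s \<omega> - B a \<omega>\<bar> ^ n)" if "\<omega> \<in> space M" for \<omega> n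
    using continuous_on_subset[OF continuous[OF that], of "{a..a + L}"]
    by (intro borel_integrable_atLeastAtMost') (auto intro!: continuous_intros)
  show m[measurable]: "?I \<in> borel_measurable M"
  proof -
    have "(\<lambda>\<omega>. LINT s|lborel. indicator {a..a + L} s *\<^sub>R \<bar>B s \<omega> - B a \<omega>\<bar>) \<in> borel_measurable M"
      by (rule lborel.borel_measurable_lebesgue_integral) (simp add: split_beta', measurable)
    then show ?thesis by (simp add: set_lebesgue_integral_def)
  qed
  have nn: "0 \<le> ?I \<omega>" for \<omega>
    unfolding set_lebesgue_integral_def by (intro integral_nonneg_AE) (auto simp: indicator_def)
  have "(\<integral>\<^sup>+\<omega>. ennreal (?I \<omega> ^ (2 * q)) \<partial>M) \<le> (\<integral>\<^sup>+\<omega>. ennreal (L ^ k) * (\<integral>\<^sup>+s. ennreal (indicator {a..a + L} s * \<bar>B s \<omega> - B a \<omega>\<bar> ^ (2 * q)) \<partial>lborel) \<partial>M)"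
  proof (rule nn_integral_mono)
    fix \<omega> assume \<omega>: "\<omega> \<in> space M"
    have "?I \<omega> ^ (2 * q) \<le> L ^ k * (LBINT s:{a..a + L}. \<bar>B s \<omega> - B a \<omega>\<bar> ^ (2 * q))"
      using set_integral_power_le[of a "a + L" "\<lambda>s. \<bar>B s \<omega> - B a \<omega>\<bar>" k] si[OF \<omega>, of 1] si[OF \<omega>, of "Suc k"] L
      unfolding k by simp
    then have "ennreal (?I \<omega> ^ (2 * q)) \<le> ennreal (L ^ k * (LBINT s:{a..a + L}. \<bar>B s \<omega> - B a \<omega>\<bar> ^ (2 * q)))"
      by (rule ennreal_leI)
    also have "\<dots> = ennreal (L ^ k) * ennreal (LBINT s:{a..a + L}. \<bar>B s \<omega> - B a \<omega>\<bar> ^ (2 * q))"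
      using L by (intro ennreal_mult) (auto simp: set_lebesgue_integral_def intro!: integral_nonneg_AE)
    also have "ennreal (LBINT s:{a..a + L}. \<bar>B s \<omega> - B a \<omega>\<bar> ^ (2 * q)) 
        = (\<integral>\<^sup>+s. ennreal (indicator {a..a + L} s * \<bar>B s \<omega> - B a \<omega>\<bar> ^ (2 * q)) \<partial>lborel)"
      using si[OF \<omega>, of "2 * q"] unfolding set_lebesgue_integral_def set_integrable_def
      by (subst nn_integral_eq_integral) auto
    finally show "ennreal (?I \<omega> ^ (2 * q)) \<le> ennreal (L ^ k) * (\<integral>\<^sup>+s. ennreal (indicator {a..a + L} s * \<bar>B s \<omega> - B a \<omega>\<bar> ^ (2 * q)) \<partial>lborel)" .
  qed
  also have "\<dots> = ennreal (L ^ k) * (\<integral>\<^sup>+\<omega>. (\<integral>\<^sup>+s. ennreal (indicator {a..a + L} s * \<bar>B s \<omega> - B a \<omega>\<bar> ^ (2 * q)) \<partial>lborel) \<partial>M)"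
    by (intro nn_integral_cmult) measurable
  also have "(\<integral>\<^sup>+\<omega>. (\<integral>\<^sup>+s. ennreal (indicator {a..a + L} s * \<bar>B s \<omega> - B a \<omega>\<bar> ^ (2 * q)) \<partial>lborel) \<partial>M)
     = (\<integral>\<^sup>+s. (\<integral>\<^sup>+\<omega>. ennreal (indicator {a..a + L} s * \<bar>B s \<omega> - B a \<omega>\<bar> ^ (2 * q)) \<partial>M) \<partial>lborel)"
  proof -
    interpret pair_sigma_finite lborel M ..
    show ?thesis by (rule Fubini') (simp add: split_beta', measurable)
  qed
  also have "\<dots> \<le> (\<integral>\<^sup>+s. ennreal (gauss_const q * L ^ q) * indicator {a..a + L} s \<partial>lborel)"
  proof (rule nn_integral_mono)
    fix s
    show "(\<integral>\<^sup>+\<omega>. ennreal (indicator {a..a + L} s * \<bar>B s \<omega> - B a \<omega>\<bar> ^ (2 * q)) \<partial>M) \<le> ennreal (gauss_const q * L ^ q) * indicator {a..a + L} s"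
    proof (cases "s \<in> {a..a + L}")
      case True
      have "(\<integral>\<^sup>+\<omega>. ennreal ((B s \<omega> - B a \<omega>) ^ (2 * q)) \<partial>M) = ennreal ((s - a) ^ q * gauss_const q)"
        using increment_moment[of a s q] a True by (subst nn_integral_eq_integral) (auto simp: gauss_const_def)
      also have "\<dots> \<le> ennreal (gauss_const q * L ^ q)"
        using True by (intro ennreal_leI) (auto simp: mult.commute gauss_const_nonneg intro!: mult_left_mono power_mono)
      finally show ?thesis using True by (simp add: power_even_abs)
    qed simp
  qed
  also have "\<dots> = ennreal (gauss_const q * L ^ q) * ennreal L"
    using L by (simp add: nn_integral_cmult_indicator)
  also have "ennreal (L ^ k) * (ennreal (gauss_const q * L ^ q) * ennreal L) = ennreal (L ^ (2 * q) * (gauss_const q * L ^ q))"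
    using L gauss_const_nonneg[of q] unfolding k by (simp add: ennreal_mult[symmetric] mult_ac)
  finally have le: "(\<integral>\<^sup>+\<omega>. ennreal (?I \<omega> ^ (2 * q)) \<partial>M) \<le> ennreal (L ^ (2 * q) * (gauss_const q * L ^ q))"
    by (simp add: mult_left_mono)
  then show i: "integrable M (\<lambda>\<omega>. ?I \<omega> ^ (2 * q))"
    using nn by (intro integrableI_bounded) (auto simp: le_less_trans)
  show "(LINT \<omega>|M. ?I \<omega> ^ (2 * q)) \<le> L ^ (2 * q) * (gauss_const q * L ^ q)"
    using le i L gauss_const_nonneg[of q] by (simp add: nn_integral_eq_integral)
qed

end

text \<open>The mean value theorem, with the cosine at least 1/2 on [0,1] because 1 < \<pi> /
  3.\<close>

lemma abs_sin_ge_half: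
  fixes x :: real assumes "\<bar>x\<bar> \<le> 1" shows "\<bar>x\<bar> / 2 \<le> \<bar>sin x\<bar>"
proof -
  have *: "y / 2 \<le> sin y" if y: "0 < y" "y \<le> 1" for y :: real
  proof -
    obtain z where z: "0 < z" "z < y" "sin y - sin 0 = (y - 0) * cos z"
      using MVT2[of 0 y sin cos] y by (auto intro!: DERIV_sin)
    have "cos (pi / 3) \<le> cos z" using z y pi_gt3 by (intro cos_monotone_0_pi_le) auto
    then have "1 / 2 \<le> cos z" by (simp add: cos_60)
    then have "y * (1 / 2) \<le> y * cos z" using y by (intro mult_left_mono) auto
    then show ?thesis using z by simp
  qed
  show ?thesis using *[of x] *[of "-x"] assms by (cases "x = 0"; cases "x > 0") (auto simp: abs_if)
qed

context bm_line
begin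

text \<open>A small sine forces the increment either into
  \<open>{-2 * \<theta>..2 * \<theta>}\<close>, where its density is at most
  \<open>1 / (2 * sqrt \<theta>)\<close>, or beyond 1 in absolute value, where Chebyshev's
  inequality applies with variance \<open>\<theta>\<close>. The parts contribute
  \<open>2 * sqrt \<theta>\<close> and at most \<open>sqrt \<theta>\<close>.\<close>

lemma prob_abs_sin_increment:
  assumes s: "0 \<le> s" and \<theta>: "0 < \<theta>" "\<theta> \<le> 1"
  shows "prob {\<omega> \<in> space M. \<bar>sin (B (s + \<theta>) \<omega> - B s \<omega>)\<bar> < \<theta>} \<le> 3 * sqrt \<theta>"
proof -
  let ?Z = "\<lambda>\<omega>. B (s + \<theta>) \<omega> - B s \<omega>"
  have X: "distributed M lborel ?Z (normal_density 0 (sqrt \<theta>))"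
    using gaussian_increments[of s "s + \<theta>"] s \<theta> by simp
  have nb: "normal_density 0 (sqrt \<theta>) x \<le> 1 / (2 * sqrt \<theta>)" for x
  proof -
    have "sqrt (2 * pi * (sqrt \<theta>)\<^sup>2) = sqrt (2 * pi) * sqrt \<theta>" using \<theta> by (simp add: real_sqrt_mult)
    moreover have "2 \<le> sqrt (2 * pi)" using pi_gt3 by (intro real_le_rsqrt) simp
    ultimately have "2 * sqrt \<theta> \<le> sqrt (2 * pi * (sqrt \<theta>)\<^sup>2)" using \<theta> by simp
    then have "1 / sqrt (2 * pi * (sqrt \<theta>)\<^sup>2) * exp (- (x - 0)\<^sup>2 / (2 * (sqrt \<theta>)\<^sup>2)) \<le> 1 / (2 * sqrt \<theta>) * 1"
      using \<theta> by (intro mult_mono frac_le) auto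
    then show ?thesis by (simp add: normal_density_def)
  qed
  have "emeasure M (?Z -` {-2 * \<theta>..2 * \<theta>} \<inter> space M) = (\<integral>\<^sup>+x. ennreal (normal_density 0 (sqrt \<theta>) x) * indicator {-2 * \<theta>..2 * \<theta>} x \<partial>lborel)"
    by (rule distributed_emeasure[OF X]) simp
  also have "\<dots> \<le> (\<integral>\<^sup>+x. ennreal (1 / (2 * sqrt \<theta>)) * indicator {-2 * \<theta>..2 * \<theta>} x \<partial>lborel)"
    by (intro nn_integral_mono mult_right_mono ennreal_leI nb) auto
  also have "\<dots> = ennreal (1 / (2 * sqrt \<theta>)) * ennreal (4 * \<theta>)"
    using \<theta> by (simp add: nn_integral_cmult_indicator)
  also have "\<dots> = ennreal (2 * sqrt \<theta>)"
    using \<theta> by (simp add: ennreal_mult[symmetric] field_simps)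
  finally have 1: "prob (?Z -` {-2 * \<theta>..2 * \<theta>} \<inter> space M) \<le> 2 * sqrt \<theta>"
    using \<theta> by (simp add: emeasure_eq_measure)
  have "prob {\<omega> \<in> space M. (?Z \<omega>)\<^sup>2 \<ge> 1} \<le> (LINT \<omega>|M. (?Z \<omega>)\<^sup>2) / 1"
    using s \<theta> by (intro integral_Markov_inequality_measure[where A = "{}"] increment_second_moment) auto
  also have "\<dots> = \<theta>" using increment_second_moment(2)[of s "s + \<theta>"] s \<theta> by simp
  also have "\<theta> \<le> sqrt \<theta>" using \<theta> by (intro real_le_rsqrt) (simp add: power2_eq_square mult_left_le)
  finally have 2: "prob {\<omega> \<in> space M. (?Z \<omega>)\<^sup>2 \<ge> 1} \<le> sqrt \<theta>" .
  have "prob {\<omega> \<in> space M. \<bar>sin (?Z \<omega>)\<bar> < \<theta>} \<le> prob ((?Z -` {-2 * \<theta>..2 * \<theta>} \<inter> space M) \<union> {\<omega> \<in> space M. (?Z \<omega>)\<^sup>2 \<ge> 1})"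
  proof (rule finite_measure_mono)
    show "{\<omega> \<in> space M. \<bar>sin (?Z \<omega>)\<bar> < \<theta>} \<subseteq> (?Z -` {-2 * \<theta>..2 * \<theta>} \<inter> space M) \<union> {\<omega> \<in> space M. (?Z \<omega>)\<^sup>2 \<ge> 1}"
    proof
      fix \<omega> assume "\<omega> \<in> {\<omega> \<in> space M. \<bar>sin (?Z \<omega>)\<bar> < \<theta>}"
      then have \<omega>: "\<omega> \<in> space M" "\<bar>sin (?Z \<omega>)\<bar> < \<theta>" by auto
      show "\<omega> \<in> (?Z -` {-2 * \<theta>..2 * \<theta>} \<inter> space M) \<union> {\<omega> \<in> space M. (?Z \<omega>)\<^sup>2 \<ge> 1}"
      proof (cases "\<bar>?Z \<omega>\<bar> \<le> 1")
        case True
        from le_less_trans[OF abs_sin_ge_half[OF this] \<omega>(2)] have "\<bar>?Z \<omega>\<bar> \<le> 2 * \<theta>" by simp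
        then show ?thesis using \<omega> by (auto simp: abs_le_iff)
      next
        case False
        then have "1 \<le> (?Z \<omega>)\<^sup>2" using abs_le_square_iff[of 1 "?Z \<omega>"] by simp
        then show ?thesis using \<omega> by simp
      qed
    qed
  qed measurable
  also have "\<dots> \<le> prob (?Z -` {-2 * \<theta>..2 * \<theta>} \<inter> space M) + prob {\<omega> \<in> space M. (?Z \<omega>)\<^sup>2 \<ge> 1}"
    by (rule measure_Un_le) measurable
  finally show ?thesis using 1 2 by simp
qed

text \<open>\<open>2 * \<theta> ^ 3\<close> is the length of the two adjacent windows for
  \<open>w = \<theta> ^ 3\<close>, the choice made in \<open>coercive_red_malliavin\<close>.\<close>

definition osc_at :: "real \<Rightarrow> nat \<Rightarrow> 'w \<Rightarrow> real" where
  "osc_at \<theta> k \<omega> = (LBINT s:{real k * \<theta>..real k * \<theta> + 2 * \<theta> ^ 3}. \<bar>B s \<omega> - B (real k * \<theta>) \<omega>\<bar>)"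

text \<open>The number \<open>m\<close> of increments stays fixed while their length \<open>\<theta>\<close> tends to \<open>0\<close>: independence
  bounds the probability of the first event by a multiple of \<open>\<theta> powr (m / 2)\<close>. The second event is that
  the path oscillates too much on the much shorter time scale \<open>\<theta> ^ 3\<close>.\<close>

definition bad :: "nat \<Rightarrow> real \<Rightarrow> 'w set" where
  "bad m \<theta> = {\<omega> \<in> space M. \<forall>k<m. \<bar>sin (B (real (Suc k) * \<theta>) \<omega> - B (real k * \<theta>) \<omega>)\<bar> < \<theta>}
     \<union> (\<Union>k\<le>m. {\<omega> \<in> space M. \<theta> ^ 4 / 8 \<le> osc_at \<theta> k \<omega>})"

lemma bad_measurable:
  assumes "0 < \<theta>" shows "bad m \<theta> \<in> events"
proof -
  have [measurable]: "osc_at \<theta> k \<in> borel_measurable M" for k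
    unfolding osc_at_def[abs_def] using path_osc_moment(3)[of "real k * \<theta>" "2 * \<theta> ^ 3" 1] assms by simp
  show ?thesis unfolding bad_def by measurable
qed

text \<open>With \<open>2 * q\<close> independent increments the first event has probability at most
  \<open>(3 * sqrt \<theta>) ^ (2 * q)\<close>. For the oscillations, Markov's inequality of order
  \<open>2 * q\<close> divides \<open>\<theta> ^ (9 * q)\<close> from the moment by
  \<open>\<theta> ^ (8 * q)\<close> from the threshold. Both parts are of order
  \<open>\<theta> ^ q\<close>.\<close>

lemma prob_bad:
  assumes \<theta>: "0 < \<theta>" "\<theta> \<le> 1" and q: "q > 0"
  shows "prob (bad (2 * q) \<theta>) \<le> (9 ^ q + real (2 * q + 1) * (16 ^ (2 * q) * (gauss_const q * 2 ^ q))) * \<theta> ^ q"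
proof -
  let ?m = "2 * q"
  let ?A = "{\<omega> \<in> space M. \<forall>k<?m. \<bar>sin (B (real (Suc k) * \<theta>) \<omega> - B (real k * \<theta>) \<omega>)\<bar> < \<theta>}"
  let ?O = "\<lambda>k. {\<omega> \<in> space M. \<theta> ^ 4 / 8 \<le> osc_at \<theta> k \<omega>}"
  have [measurable]: "osc_at \<theta> k \<in> borel_measurable M" for k
    unfolding osc_at_def[abs_def] using path_osc_moment(3)[of "real k * \<theta>" "2 * \<theta> ^ 3" 1] \<theta> by simp
  have A: "prob ?A \<le> 9 ^ q * \<theta> ^ q"
  proof -
    let ?X = "\<lambda>k \<omega>. B (real (Suc k) * \<theta>) \<omega> - B (real k * \<theta>) \<omega>" and ?S = "{y. \<bar>sin y\<bar> < \<theta>}"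
    have ind: "indep_vars (\<lambda>_. borel) ?X {..<?m}"
      using \<theta> by (intro independent_increments[of "\<lambda>k. real k * \<theta>"]) (auto intro!: mult_right_mono)
    have "0 < ?m" using q by simp
    then have eq: "?A = (\<Inter>k\<in>{..<?m}. ?X k -` ?S \<inter> space M)"
      by (intro set_eqI) (simp only: INT_iff mem_Collect_eq Int_iff vimage_eq lessThan_iff Ball_def; blast)
    have "prob ?A = (\<Prod>k\<in>{..<?m}. prob (?X k -` ?S \<inter> space M))"
      unfolding eq
    proof (rule indep_varsD[OF ind])
      show "?S \<in> sets borel" by measurable
    qed (use \<open>0 < ?m\<close> in blast)+
    also have "\<dots> \<le> (\<Prod>k\<in>{..<?m}. 3 * sqrt \<theta>)"
    proof (intro prod_mono conjI)
      fix k
      have "?X k -` ?S \<inter> space M = {\<omega> \<in> space M. \<bar>sin (B (real k * \<theta> + \<theta>) \<omega> - B (real k * \<theta>) \<omega>)\<bar> < \<theta>}"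
        by (auto simp: algebra_simps)
      then show "prob (?X k -` ?S \<inter> space M) \<le> 3 * sqrt \<theta>"
        using prob_abs_sin_increment[of "real k * \<theta>" \<theta>] \<theta> by simp
    qed simp
    also have "\<dots> = 9 ^ q * \<theta> ^ q" using \<theta> by (simp add: power_mult power_mult_distrib)
    finally show ?thesis .
  qed
  have O: "prob (?O k) \<le> 16 ^ (2 * q) * (gauss_const q * 2 ^ q) * \<theta> ^ q" for k
  proof -
    have k0: "0 \<le> real k * \<theta>" "0 < 2 * \<theta> ^ 3" using \<theta> by auto
    note m = path_osc_moment[OF k0 q, folded osc_at_def]
    have nn: "0 \<le> osc_at \<theta> k \<omega>" for \<omega>
      unfolding osc_at_def set_lebesgue_integral_def by (intro integral_nonneg_AE) (auto simp: indicator_def)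
    have "prob (?O k) \<le> prob {\<omega> \<in> space M. osc_at \<theta> k \<omega> ^ (2 * q) \<ge> (\<theta> ^ 4 / 8) ^ (2 * q)}"
      using \<theta> by (intro finite_measure_mono) (auto intro!: power_mono)
    also have "\<dots> \<le> (LINT \<omega>|M. osc_at \<theta> k \<omega> ^ (2 * q)) / (\<theta> ^ 4 / 8) ^ (2 * q)"
      using \<theta> nn by (intro integral_Markov_inequality_measure[where A = "{}"] m) auto
    also have "\<dots> \<le> ((2 * \<theta> ^ 3) ^ (2 * q) * (gauss_const q * (2 * \<theta> ^ 3) ^ q)) / (\<theta> ^ 4 / 8) ^ (2 * q)"
      using \<theta> by (intro divide_right_mono m) auto
    also have "\<dots> = 16 ^ (2 * q) * (gauss_const q * 2 ^ q) * \<theta> ^ q"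
    proof -
      have p: "(\<theta> ^ 3) ^ (2 * q) * (\<theta> ^ 3) ^ q = \<theta> ^ q * (\<theta> ^ 4) ^ (2 * q)"
        by (simp add: power_mult[symmetric] power_add[symmetric])
      have "(2 * \<theta> ^ 3) ^ (2 * q) * (2 * \<theta> ^ 3) ^ q = 2 ^ (2 * q) * 2 ^ q * ((\<theta> ^ 3) ^ (2 * q) * (\<theta> ^ 3) ^ q)"
        by (simp only: power_mult_distrib mult_ac)
      then have "(2 * \<theta> ^ 3) ^ (2 * q) * (2 * \<theta> ^ 3) ^ q = 2 ^ (2 * q) * 2 ^ q * (\<theta> ^ q * (\<theta> ^ 4) ^ (2 * q))"
        by (simp only: p)
      moreover have "(16::real) ^ (2 * q) = 2 ^ (2 * q) * 8 ^ (2 * q)" by (simp add: power_mult_distrib[symmetric])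
      ultimately show ?thesis using \<theta> by (simp add: field_simps power_divide)
    qed
    finally show ?thesis .
  qed
  have "prob (bad ?m \<theta>) \<le> prob ?A + prob (\<Union>k\<le>?m. ?O k)"
    unfolding bad_def by (rule measure_Un_le) measurable
  also have "prob (\<Union>k\<le>?m. ?O k) \<le> (\<Sum>k\<le>?m. prob (?O k))"
    by (rule finite_measure_subadditive_finite) auto
  also have "\<dots> \<le> (\<Sum>k\<le>?m. 16 ^ (2 * q) * (gauss_const q * 2 ^ q) * \<theta> ^ q)" by (intro sum_mono O)
  finally show ?thesis using A by (simp add: algebra_simps)
qed

text \<open>Off the bad event some increment has a sine of size at least \<open>\<theta>\<close>,
  and its end points serve as \<open>a\<close> and \<open>a'\<close>. The spare step in
  \<open>(real m + 1) * \<theta>\<close> leaves room for the window after the last base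
  point.\<close>

lemma not_bad_coercive:
  assumes \<omega>: "\<omega> \<in> space M" "\<omega> \<notin> bad m \<theta>" and \<theta>: "0 < \<theta>" "\<theta> \<le> 1 / 2" and mT: "(real m + 1) * \<theta> \<le> T"
  shows "coercive (\<theta> ^ 14 / (1 / sqrt T + 16 * (T + 1))\<^sup>2) (red_malliavin T (path \<omega>))"
proof -
  from \<omega> obtain k where k: "k < m" and s: "\<theta> \<le> \<bar>sin (B (real (Suc k) * \<theta>) \<omega> - B (real k * \<theta>) \<omega>)\<bar>"
    unfolding bad_def by (auto simp: not_less)
  have o: "osc_at \<theta> j \<omega> \<le> \<theta> ^ 4 / 8" if "j \<le> m" for j
    using \<omega> that unfolding bad_def by (auto simp: not_le intro: less_imp_le)
  have T0: "T > 0" by (rule less_le_trans[OF _ mT]) (use \<theta> in auto)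
  have c: "\<theta> ^ 3 \<le> \<theta> / 4"
  proof -
    have "\<theta> * \<theta> \<le> (1 / 2) * (1 / 2)" using \<theta> by (intro mult_mono) auto
    then have "\<theta> * (\<theta> * \<theta>) \<le> \<theta> * (1 / 4)" using \<theta> by (intro mult_left_mono) auto
    then show ?thesis by (simp add: power3_eq_cube mult.assoc)
  qed
  interpret window T "\<theta> ^ 3" "path \<omega>"
    using continuous[OF \<omega>(1)] T0 \<theta> c by unfold_locales auto
  have "real (Suc k) * \<theta> \<le> real m * \<theta>" "real k * \<theta> \<le> real m * \<theta>" using k \<theta> by (intro mult_right_mono; simp)+
  then have in_T: "real (Suc k) * \<theta> + 2 * \<theta> ^ 3 \<le> T" "real k * \<theta> + 2 * \<theta> ^ 3 \<le> T"
    using mT c \<theta> unfolding distrib_right by linarith+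
  show ?thesis
  proof (rule coercive_red_malliavin[where a = "real k * \<theta>" and a' = "real (Suc k) * \<theta>"])
    have w4: "\<theta> ^ 3 * \<theta> / 8 = \<theta> ^ 4 / 8" by (simp add: power4_eq_xxxx power3_eq_cube)
    show "osc (real k * \<theta>) \<le> \<theta> ^ 3 * \<theta> / 8" "osc (real (Suc k) * \<theta>) \<le> \<theta> ^ 3 * \<theta> / 8"
      using o[of k] o[of "Suc k"] k unfolding w4 osc_def osc_at_def by auto
  qed (use s \<theta> in_T in auto)
qed

text \<open>The scale is halved until it is good. The bound for the inverse at scale
  \<open>\<theta>\<close> grows like the power -14 of \<open>\<theta>\<close>, while the probability
  of a bad scale decays like \<open>\<theta> ^ q\<close> with \<open>q\<close> at choice.
  \<open>R\<close> depends on the moment order \<open>p\<close>.\<close>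

theorem nondegenerate:
  assumes T: "T > 0"
  shows "\<exists>R. R \<in> borel_measurable M \<and> integrable M (\<lambda>\<omega>. R \<omega> ^ p) \<and> (AE \<omega> in M. coercive (1 / R \<omega>) (red_malliavin T (path \<omega>)))"
proof -
  \<comment> \<open>The \<open>p\<close>-th power of the bound costs \<open>14 * p\<close> powers of
    \<open>\<theta>\<close>; one more makes the series over the scales geometric.\<close>
  define q where "q = 14 * p + 1"
  \<comment> \<open>Small enough for \<open>2 * q\<close> increments and one spare step to fit into
    \<open>{0..T}\<close>.\<close>
  define \<theta>0 where "\<theta>0 = min (1 / 2) (T / (real (2 * q) + 1))"
  define \<theta> where "\<theta> n = \<theta>0 * (1 / 2) ^ n" for n :: nat
  define K where "K = 1 / sqrt T + 16 * (T + 1)"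
  define C where "C = 9 ^ q + real (2 * q + 1) * (16 ^ (2 * q) * (gauss_const q * 2 ^ q))"
  have q: "q > 0" by (simp add: q_def)
  have K: "K > 0" using T by (simp add: K_def add_nonneg_pos)
  have \<theta>0: "\<theta>0 > 0" "\<theta>0 \<le> 1 / 2" "(real (2 * q) + 1) * \<theta>0 \<le> T"
  proof -
    have "(real (2 * q) + 1) * \<theta>0 \<le> (real (2 * q) + 1) * (T / (real (2 * q) + 1))"
      unfolding \<theta>0_def by (intro mult_left_mono) auto
    also have "\<dots> = T" by (simp add: add_nonneg_eq_0_iff)
    finally show "(real (2 * q) + 1) * \<theta>0 \<le> T" .
    show "\<theta>0 \<le> 1 / 2" unfolding \<theta>0_def by (rule min.cobounded1)
  qed (use T in \<open>auto simp: \<theta>0_def intro!: divide_pos_pos add_nonneg_pos\<close>)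
  have \<theta>: "0 < \<theta> n" "\<theta> n \<le> \<theta>0" for n
    using \<theta>0 by (auto simp: \<theta>_def power_le_one intro!: mult_left_le)
  have \<theta>T: "(real (2 * q) + 1) * \<theta> n \<le> T" for n
    by (rule order_trans[OF mult_left_mono[OF \<theta>(2)] \<theta>0(3)]) simp
  have pb: "prob (bad (2 * q) (\<theta> n)) \<le> C * \<theta> n ^ q" for n
    unfolding C_def using \<theta>[of n] \<theta>0 q by (intro prob_bad) auto
  have \<theta>sum: "summable \<theta>" unfolding \<theta>_def by (intro summable_mult summable_geometric) simp
  have \<theta>lim: "\<theta> \<longlonglongrightarrow> 0" using summable_LIMSEQ_zero[OF \<theta>sum] .
  have C0: "0 \<le> C" unfolding C_def using gauss_const_nonneg[of q] by simp
  define r where "r n = K\<^sup>2 / \<theta> n ^ 14" for n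
  have r0: "0 \<le> r n" for n using \<theta>[of n] by (simp add: r_def)
  have "\<exists>R. R \<in> borel_measurable M \<and> integrable M (\<lambda>\<omega>. R \<omega> ^ p) \<and> (AE \<omega> in M. \<exists>n. \<omega> \<notin> bad (2 * q) (\<theta> n) \<and> R \<omega> = r n)"
  proof (rule first_good_moment)
    show "bad (2 * q) (\<theta> n) \<in> events" for n by (rule bad_measurable[OF \<theta>(1)])
    have le: "r (Suc n) ^ p * prob (bad (2 * q) (\<theta> n)) \<le> (K\<^sup>2 * 2 ^ 14) ^ p * C * \<theta> n" for n
    proof -
      have h: "\<theta> (Suc n) = \<theta> n / 2" by (simp add: \<theta>_def)
      have "r (Suc n) = (K\<^sup>2 * 2 ^ 14) / \<theta> n ^ 14" unfolding r_def h power_divide by simp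
      then have "r (Suc n) ^ p * prob (bad (2 * q) (\<theta> n)) \<le> ((K\<^sup>2 * 2 ^ 14) / \<theta> n ^ 14) ^ p * (C * \<theta> n ^ q)"
        using pb[of n] \<theta>(1)[of n] by (intro mult_mono) auto
      also have "\<dots> = (K\<^sup>2 * 2 ^ 14) ^ p * C * \<theta> n"
        using \<theta>(1)[of n] by (simp add: power_divide q_def power_mult[symmetric] power_add)
      finally show ?thesis .
    qed
    show "summable (\<lambda>n. r (Suc n) ^ p * prob (bad (2 * q) (\<theta> n)))"
      by (rule summable_comparison_test'[OF summable_mult[OF \<theta>sum, of "(K\<^sup>2 * 2 ^ 14) ^ p * C"], of 0])
         (use le r0 in \<open>simp add: abs_mult\<close>)
    have "(\<lambda>n. C * \<theta> n ^ q) \<longlonglongrightarrow> C * 0 ^ q" by (intro tendsto_intros \<theta>lim)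
    then have "(\<lambda>n. C * \<theta> n ^ q) \<longlonglongrightarrow> 0" using q by (simp add: power_0_left)
    then show "(\<lambda>n. prob (bad (2 * q) (\<theta> n))) \<longlonglongrightarrow> 0"
      by (rule Lim_null_comparison[rotated]) (use pb in auto)
  qed (rule r0)
  then obtain R where R: "R \<in> borel_measurable M" "integrable M (\<lambda>\<omega>. R \<omega> ^ p)"
    "AE \<omega> in M. \<exists>n. \<omega> \<notin> bad (2 * q) (\<theta> n) \<and> R \<omega> = r n" by blast
  have "AE \<omega> in M. coercive (1 / R \<omega>) (red_malliavin T (path \<omega>))"
    using R(3) AE_space
  proof eventually_elim
    fix \<omega> assume "\<exists>n. \<omega> \<notin> bad (2 * q) (\<theta> n) \<and> R \<omega> = r n" and \<omega>: "\<omega> \<in> space M"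
    then obtain n where n: "\<omega> \<notin> bad (2 * q) (\<theta> n)" "R \<omega> = r n" by blast
    have "coercive (\<theta> n ^ 14 / K\<^sup>2) (red_malliavin T (path \<omega>))"
      unfolding K_def using \<theta>[of n] \<theta>0 \<theta>T[of n] by (intro not_bad_coercive[OF \<omega> n(1)]) auto
    then show "coercive (1 / R \<omega>) (red_malliavin T (path \<omega>))" by (simp add: n(2) r_def)
  qed
  with R show ?thesis by blast
qed

end

section \<open>Integration by parts for the inverse Gram weight\<close>

definition gram_weight :: "real \<Rightarrow> real^3 \<Rightarrow> (real \<Rightarrow> real) \<Rightarrow> real^3" where
  "gram_weight T y b = matrix_inv (red_malliavin T b) *v y"

text \<open>Minus the derivative of coordinate \<open>i\<close> of the weight in the direction h_i,
  by the formula for the derivative of an inverse.\<close>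

definition correction :: "real \<Rightarrow> real^3 \<Rightarrow> (real \<Rightarrow> real) \<Rightarrow> 3 \<Rightarrow> real" where
  "correction T y b i = (matrix_inv (red_malliavin T b) *v (gram_deriv T b (h_vec_integral b i) *v gram_weight T y b)) $ i"

text \<open>The divergence of the combination of the h_i with the weight as coefficients, by the
  product rule \<delta>(\<lambda> h) = \<lambda> \<delta>(h) - D_h \<lambda>. \<open>delta_h\<close>
  is its negative, since \<open>h_dir\<close> carries a minus sign.\<close>

definition div_form :: "real \<Rightarrow> real^3 \<Rightarrow> (real \<Rightarrow> real) \<Rightarrow> real" where
  "div_form T y b = (\<Sum>i\<in>UNIV. gram_weight T y b $ i * delta T i b + correction T y b i)"

text \<open>\<open>malliavin_deriv\<close> of the end point in the weighted direction, which is the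
  negative of \<open>h_dir\<close>.\<close>

definition kbm_tangent_dir :: "real \<Rightarrow> real \<times> complex \<Rightarrow> real^3 \<Rightarrow> (real \<Rightarrow> real) \<Rightarrow> real \<times> complex" where
  "kbm_tangent_dir T x y b = (\<Sum>i\<in>UNIV. gram_weight T y b $ i *\<^sub>R kbm_tangent T x b (h_vec_integral b i))"

lemma div_form_linear:
  "div_form T (y + z) b = div_form T y b + div_form T z b" "div_form T (c *\<^sub>R y) b = c * div_form T y b"
  unfolding div_form_def correction_def gram_weight_def
  by (simp_all add: matrix_vector_right_distrib matrix_vector_mult_scaleR sum.distrib sum_distrib_left algebra_simps)

lemma div_form_basis: "div_form T y b = (\<Sum>j\<in>UNIV. y $ j * div_form T (axis j 1) b)"
proof -
  have "y = y $ 1 *\<^sub>R axis 1 1 + (y $ 2 *\<^sub>R axis 2 1 + y $ 3 *\<^sub>R axis 3 1)"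
    by (simp add: vec_eq_iff forall_3 axis_def)
  then have "div_form T y b = div_form T (y $ 1 *\<^sub>R axis 1 1 + (y $ 2 *\<^sub>R axis 2 1 + y $ 3 *\<^sub>R axis 3 1)) b" by simp
  then show ?thesis by (simp add: div_form_linear sum_3)
qed

lemma sum_Phi_delta:
  "(\<Sum>i\<in>UNIV. Phi f \<epsilon> T x w i b * delta T i b) = f (kbm T x b) * (\<Sum>i\<in>UNIV. reg_weight \<epsilon> T w b $ i * delta T i b)"
  by (simp add: Phi_def sum_distrib_left mult_ac)

locale bm_horizon = bm_line M B for M :: "'w measure" and B + fixes T :: real assumes T: "T > 0"
begin

text \<open>One variable with moments of all orders that dominates every \<open>delta T i\<close>.
  The interval is written \<open>{0..0 + T}\<close> to match \<open>path_osc_moment\<close>.\<close>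

definition path_size :: "'w \<Rightarrow> real" where
  "path_size \<omega> = (1 + T) * \<bar>B T \<omega> - B 0 \<omega>\<bar> + (LBINT s:{0..0 + T}. \<bar>B s \<omega> - B 0 \<omega>\<bar>)"

lemma path_size_measurable [measurable]: "path_size \<in> borel_measurable M"
proof -
  note [measurable] = path_osc_moment(3)[of 0 T 1, simplified]
  show ?thesis unfolding path_size_def using T by simp
qed

lemma path_size_nonneg: "0 \<le> path_size \<omega>"
  unfolding path_size_def set_lebesgue_integral_def using T
  by (intro add_nonneg_nonneg integral_nonneg_AE) (auto simp: indicator_def)

lemma power_add_le: "0 \<le> x \<Longrightarrow> 0 \<le> y \<Longrightarrow> (x + y) ^ n \<le> 2 ^ n * (x ^ n + y ^ n)" for x y :: real
proof -
  assume x: "0 \<le> x" "0 \<le> y"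
  have "(x + y) ^ n \<le> (2 * max x y) ^ n" using x by (intro power_mono) auto
  also have "\<dots> \<le> 2 ^ n * (x ^ n + y ^ n)"
    using x unfolding power_mult_distrib by (intro mult_left_mono) (auto simp: max_def)
  finally show ?thesis .
qed

lemma path_size_moment:
  assumes q: "q > 0" shows "integrable M (\<lambda>\<omega>. path_size \<omega> ^ (2 * q))"
proof (rule Bochner_Integration.integrable_bound)
  let ?a = "\<lambda>\<omega>. (1 + T) * \<bar>B T \<omega> - B 0 \<omega>\<bar>" and ?b = "\<lambda>\<omega>. LBINT s:{0..0 + T}. \<bar>B s \<omega> - B 0 \<omega>\<bar>"
  have "integrable M (\<lambda>\<omega>. ?a \<omega> ^ (2 * q))"
    unfolding power_mult_distrib power_even_abs[OF dvd_triv_left] using T by (intro integrable_mult_right increment_moment) auto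
  then show "integrable M (\<lambda>\<omega>. 2 ^ (2 * q) * (?a \<omega> ^ (2 * q) + ?b \<omega> ^ (2 * q)))"
    using path_osc_moment(1)[OF _ T q, of 0] by simp
  have b0: "0 \<le> ?b \<omega>" for \<omega>
    unfolding set_lebesgue_integral_def by (intro integral_nonneg_AE) (auto simp: indicator_def)
  have "\<bar>path_size \<omega> ^ (2 * q)\<bar> \<le> \<bar>2 ^ (2 * q) * (?a \<omega> ^ (2 * q) + ?b \<omega> ^ (2 * q))\<bar>" for \<omega>
  proof -
    have "path_size \<omega> ^ (2 * q) \<le> 2 ^ (2 * q) * (?a \<omega> ^ (2 * q) + ?b \<omega> ^ (2 * q))"
      unfolding path_size_def using T by (intro power_add_le b0) auto
    then show ?thesis unfolding abs_of_nonneg[OF zero_le_power[OF path_size_nonneg]] by (rule order_trans[OF _ abs_ge_self])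
  qed
  then show "AE \<omega> in M. norm (path_size \<omega> ^ (2 * q)) \<le> norm (2 ^ (2 * q) * (?a \<omega> ^ (2 * q) + ?b \<omega> ^ (2 * q)))"
    by (intro AE_I2) (simp only: real_norm_def)
qed measurable

lemma delta_le_path_size:
  assumes \<omega>: "\<omega> \<in> space M" and B0: "B 0 \<omega> = 0" shows "\<bar>delta T i (path \<omega>)\<bar> \<le> path_size \<omega>"
proof -
  note [measurable] = path_measurable[OF \<omega>]
  have c: "continuous_on {0..T} (path \<omega>)" using continuous_on_subset[OF continuous[OF \<omega>]] by auto
  have sa: "set_integrable lborel {0..T} (\<lambda>s. \<bar>B s \<omega>\<bar>)"
    by (intro borel_integrable_atLeastAtMost') (intro continuous_intros c)
  have sc: "set_integrable lborel {0..T} (\<lambda>s. \<bar>B T \<omega>\<bar>)"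
    by (intro borel_integrable_atLeastAtMost') (intro continuous_intros)
  have sh: "set_integrable lborel {0..T} (\<lambda>s. hfun i (B s \<omega>) * (B T \<omega> - B s \<omega>))"
  proof (rule borel_integrable_atLeastAtMost')
    have "continuous_on UNIV (hfun i)" by (simp add: continuous_on_eq_continuous_at isCont_hfun)
    from continuous_on_compose2[OF this c] have "continuous_on {0..T} (\<lambda>s. hfun i (B s \<omega>))" by simp
    then show "continuous_on {0..T} (\<lambda>s. hfun i (B s \<omega>) * (B T \<omega> - B s \<omega>))"
      by (rule continuous_on_mult[OF _ continuous_on_diff[OF continuous_on_const c]])
  qed
  have "\<bar>LBINT s:{0..T}. hfun i (B s \<omega>) * (B T \<omega> - B s \<omega>)\<bar> \<le> (LBINT s:{0..T}. \<bar>B T \<omega>\<bar> + \<bar>B s \<omega>\<bar>)"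
  proof (rule set_integral_abs_le[OF sh set_integral_add(1)[OF sc sa]])
    fix s
    have "\<bar>hfun i (B s \<omega>) * (B T \<omega> - B s \<omega>)\<bar> \<le> 1 * (\<bar>B T \<omega>\<bar> + \<bar>B s \<omega>\<bar>)"
      by (intro mult_bound hfun_bound) simp
    then show "\<bar>hfun i (B s \<omega>) * (B T \<omega> - B s \<omega>)\<bar> \<le> \<bar>B T \<omega>\<bar> + \<bar>B s \<omega>\<bar>" by simp
  qed
  also have "\<dots> = T * \<bar>B T \<omega>\<bar> + (LBINT s:{0..T}. \<bar>B s \<omega>\<bar>)"
    using T by (subst set_integral_add(2)[OF sc sa]) (simp add: set_integral_const)
  finally show ?thesis unfolding delta_def path_size_def B0 by (auto simp: algebra_simps)
qed

lemma delta_measurable [measurable]: "(\<lambda>\<omega>. delta T i (path \<omega>)) \<in> borel_measurable M"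
proof -
  have "case_prod (\<lambda>\<omega> t. LBINT s:{0..t}. hfun i (B s \<omega>) * (B T \<omega> - B s \<omega>)) \<in> borel_measurable (M \<Otimes>\<^sub>M borel)"
    by (intro measurable_set_integral) measurable
  from measurable_section[OF this, of T] have [measurable]: "(\<lambda>\<omega>. LBINT s:{0..T}. hfun i (B s \<omega>) * (B T \<omega> - B s \<omega>)) \<in> borel_measurable M" .
  show ?thesis unfolding delta_def by measurable
qed

lemma gram_weight_measurable [measurable]: "(\<lambda>\<omega>. gram_weight T y (path \<omega>) $ i) \<in> borel_measurable M"
  unfolding gram_weight_def by (intro borel_measurable_matrix_inv_vector measurable_red_malliavin joint_measurable) simp

lemma correction_measurable [measurable]: "(\<lambda>\<omega>. correction T y (path \<omega>) i) \<in> borel_measurable M"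
proof -
  note [measurable] = measurable_gram_deriv[OF joint_measurable measurable_h_vec_integral[OF joint_measurable]]
  show ?thesis unfolding correction_def
    by (intro borel_measurable_matrix_inv_vector measurable_red_malliavin joint_measurable)
      (simp add: matrix_vector_mult_def)
qed

lemma div_form_measurable [measurable]: "(\<lambda>\<omega>. div_form T y (path \<omega>)) \<in> borel_measurable M"
  unfolding div_form_def by measurable

text \<open>The constant of \<open>norm_gram_deriv_le\<close> for the shifts
  \<open>h_vec_integral\<close>, which are bounded by \<open>(1 + T) * T\<close>.\<close>

definition correction_const :: real where "correction_const = 18 * ((1 + T) * T) * T * (1 + T) * T"

lemma correction_const_nonneg: "0 \<le> correction_const" unfolding correction_const_def using T by simp

lemma gram_weight_bound: "coercive (1 / R) (red_malliavin T b) \<Longrightarrow> norm (gram_weight T y b) \<le> norm y * R"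
  unfolding gram_weight_def using coercive_inv_norm_le by fastforce

lemma correction_bound:
  assumes b: "b \<in> borel_measurable borel" and co: "coercive (1 / R) (red_malliavin T b)"
  shows "\<bar>correction T y b i\<bar> \<le> correction_const * norm y * R\<^sup>2"
proof -
  have R: "R > 0" using co by (simp add: coercive_def)
  have "\<bar>correction T y b i\<bar> \<le> norm (gram_deriv T b (h_vec_integral b i) *v gram_weight T y b) / (1 / R)"
    unfolding correction_def by (rule order_trans[OF component_le_norm_cart coercive_inv_norm_le[OF co]])
  also have "norm (gram_deriv T b (h_vec_integral b i) *v gram_weight T y b) \<le> correction_const * norm (gram_weight T y b)"
    unfolding correction_const_def using T by (intro norm_gram_deriv_le[OF b _ h_vec_integral_bound[OF b]] borel_measurable_h_vec_integral b) auto
  also have "\<dots> \<le> correction_const * (norm y * R)" by (intro mult_left_mono gram_weight_bound co correction_const_nonneg)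
  finally show ?thesis using R by (simp add: divide_right_mono power2_eq_square mult_ac)
qed

lemma two_mult_le: "x * y \<le> x\<^sup>2 + y\<^sup>2" for x y :: real
  using sum_squares_bound[of x y] zero_le_power2[of x] zero_le_power2[of y] by linarith

text \<open>Products of \<open>R\<close> and \<open>path_size\<close> are separated into squares, so
  that moments of the bound only ask for moments of each variable alone.\<close>

lemma div_form_bound:
  assumes \<omega>: "\<omega> \<in> space M" "B 0 \<omega> = 0" and co: "coercive (1 / R) (red_malliavin T (path \<omega>))"
  shows "\<bar>div_form T y (path \<omega>)\<bar> \<le> 3 * norm y * (1 + correction_const) * (R\<^sup>2 + (path_size \<omega>)\<^sup>2)"
proof -
  have R: "R > 0" using co by (simp add: coercive_def)
  have "\<bar>gram_weight T y (path \<omega>) $ i * delta T i (path \<omega>) + correction T y (path \<omega>) i\<bar> \<le> norm y * (1 + correction_const) * (R\<^sup>2 + (path_size \<omega>)\<^sup>2)" for i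
  proof -
    have "\<bar>gram_weight T y (path \<omega>) $ i * delta T i (path \<omega>) + correction T y (path \<omega>) i\<bar> \<le> (norm y * R) * path_size \<omega> + correction_const * norm y * R\<^sup>2"
      by (intro order_trans[OF abs_triangle_ineq] add_mono mult_bound order_trans[OF component_le_norm_cart gram_weight_bound[OF co]]
          delta_le_path_size \<omega> correction_bound co path_measurable)
    also have "\<dots> \<le> norm y * (R\<^sup>2 + (path_size \<omega>)\<^sup>2) + correction_const * norm y * (R\<^sup>2 + (path_size \<omega>)\<^sup>2)"
      using two_mult_le[of R "path_size \<omega>"] correction_const_nonneg
      by (intro add_mono mult_left_mono) (auto simp: mult.assoc intro!: mult_left_mono)
    finally show ?thesis by (simp add: algebra_simps)
  qed
  then have "\<bar>div_form T y (path \<omega>)\<bar> \<le> (\<Sum>i\<in>(UNIV::3 set). norm y * (1 + correction_const) * (R\<^sup>2 + (path_size \<omega>)\<^sup>2))"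
    unfolding div_form_def by (intro order_trans[OF sum_abs] sum_mono)
  then show ?thesis by simp
qed

text \<open>The bound is required for every admissible \<open>R\<close>, because
  \<open>nondegenerate\<close> provides an \<open>R\<close> that depends on the moment order; here
  the order is \<open>2 * n\<close>.\<close>

lemma moment_bound:
  fixes Y :: "'w \<Rightarrow> real"
  assumes [measurable]: "Y \<in> borel_measurable M" and c: "0 \<le> c"
    and b: "\<And>R \<omega>. \<omega> \<in> space M \<Longrightarrow> B 0 \<omega> = 0 \<Longrightarrow> coercive (1 / R) (red_malliavin T (path \<omega>)) \<Longrightarrow> \<bar>Y \<omega>\<bar> \<le> c * (1 + R\<^sup>2 + (path_size \<omega>)\<^sup>2)"
    and n: "n > 0"
  shows "integrable M (\<lambda>\<omega>. \<bar>Y \<omega>\<bar> ^ n)"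
proof -
  obtain R where R: "R \<in> borel_measurable M" "integrable M (\<lambda>\<omega>. R \<omega> ^ (2 * n))"
    "AE \<omega> in M. coercive (1 / R \<omega>) (red_malliavin T (path \<omega>))"
    using nondegenerate[OF T] by blast
  show ?thesis
  proof (rule Bochner_Integration.integrable_bound)
    let ?b = "\<lambda>\<omega>. c ^ n * (2 ^ n * (2 ^ n * (1 + R \<omega> ^ (2 * n)) + path_size \<omega> ^ (2 * n)))"
    show "integrable M ?b"
      by (intro integrable_mult_right Bochner_Integration.integrable_add R path_size_moment n integrable_const)
    show "AE \<omega> in M. norm (\<bar>Y \<omega>\<bar> ^ n) \<le> norm (?b \<omega>)"
      using R(3) B0 AE_space
    proof eventually_elim
      fix \<omega> assume co: "coercive (1 / R \<omega>) (red_malliavin T (path \<omega>))" and \<omega>: "B 0 \<omega> = 0" "\<omega> \<in> space M"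
      have "\<bar>Y \<omega>\<bar> ^ n \<le> (c * (1 + (R \<omega>)\<^sup>2 + (path_size \<omega>)\<^sup>2)) ^ n" by (intro power_mono b \<omega> co) simp
      also have "\<dots> \<le> c ^ n * (2 ^ n * ((1 + (R \<omega>)\<^sup>2) ^ n + ((path_size \<omega>)\<^sup>2) ^ n))"
        unfolding power_mult_distrib[of c] using c by (intro mult_left_mono power_add_le) auto
      also have "\<dots> \<le> c ^ n * (2 ^ n * (2 ^ n * (1 ^ n + ((R \<omega>)\<^sup>2) ^ n) + ((path_size \<omega>)\<^sup>2) ^ n))"
        using c by (intro mult_left_mono add_right_mono power_add_le) auto
      also have "\<dots> = ?b \<omega>" by (simp add: power_mult)
      finally show "norm (\<bar>Y \<omega>\<bar> ^ n) \<le> norm (?b \<omega>)"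
        unfolding real_norm_def abs_of_nonneg[OF zero_le_power[OF abs_ge_zero]] by (rule order_trans[OF _ abs_ge_self])
    qed
  qed measurable
qed

lemma div_form_moment: "n > 0 \<Longrightarrow> integrable M (\<lambda>\<omega>. \<bar>div_form T y (path \<omega>)\<bar> ^ n)"
proof (rule moment_bound[where c = "3 * norm y * (1 + correction_const)"])
  show c: "0 \<le> 3 * norm y * (1 + correction_const)" using correction_const_nonneg by simp
  fix R \<omega> assume "\<omega> \<in> space M" "B 0 \<omega> = 0" "coercive (1 / R) (red_malliavin T (path \<omega>))"
  then have "\<bar>div_form T y (path \<omega>)\<bar> \<le> 3 * norm y * (1 + correction_const) * (R\<^sup>2 + (path_size \<omega>)\<^sup>2)" by (rule div_form_bound)
  also have "\<dots> \<le> 3 * norm y * (1 + correction_const) * (1 + R\<^sup>2 + (path_size \<omega>)\<^sup>2)" by (intro mult_left_mono c) simp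
  finally show "\<bar>div_form T y (path \<omega>)\<bar> \<le> 3 * norm y * (1 + correction_const) * (1 + R\<^sup>2 + (path_size \<omega>)\<^sup>2)" .
qed simp_all

lemma div_form_integrable: "integrable M (\<lambda>\<omega>. div_form T y (path \<omega>))"
  using div_form_moment[of 1 y] by (simp add: integrable_abs_iff)

text \<open>Removal of the regularisation. Coercivity of the Gram matrix with constant
  \<open>1 / R\<close> passes to every \<open>reg_gram\<close>, so both sides are dominated,
  independently of \<open>\<epsilon>\<close>, by integrable variables built from \<open>R\<close>
  and \<open>path_size\<close>. The equations for the three coordinates are added.\<close>

theorem ibp:
  assumes f: "bounded_C1 f f'"
  shows "integrable M (\<lambda>\<omega>. blinfun_apply (f' (kbm T x (path \<omega>))) (kbm_tangent_dir T x y (path \<omega>)))"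
    "(LINT \<omega>|M. blinfun_apply (f' (kbm T x (path \<omega>))) (kbm_tangent_dir T x y (path \<omega>)))
      = (LINT \<omega>|M. f (kbm T x (path \<omega>)) * div_form T y (path \<omega>))"
proof -
  note of_nat_Suc [simp del]
  obtain F F' where F: "\<And>y. \<bar>f y\<bar> \<le> F" "\<And>y. norm (f' y) \<le> F'"
    using f unfolding bounded_C1_def bounded_iff by auto
  obtain R where R[measurable]: "R \<in> borel_measurable M" and R2: "integrable M (\<lambda>\<omega>. R \<omega> ^ 2)"
    and co: "AE \<omega> in M. coercive (1 / R \<omega>) (red_malliavin T (path \<omega>))"
    using nondegenerate[OF T] by blast
  let ?e = "\<lambda>n. inverse (real (Suc n))"
  let ?P = "\<lambda>n i \<omega>. Phi f (?e n) T x y i (path \<omega>)" and ?D = "\<lambda>n i \<omega>. DPhi f f' (?e n) T x y i (path \<omega>) (h_vec_integral (path \<omega>) i)"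
  let ?X = "\<lambda>\<omega>. kbm T x (path \<omega>)"
  note mD = measurable_DPhi[OF joint_measurable measurable_h_vec_integral[OF joint_measurable] f]
  note [measurable] = measurable_Phi[OF joint_measurable f] bounded_C1_measurable[OF f] measurable_kbm[OF joint_measurable]
  have mdX[measurable]: "(\<lambda>\<omega>. kbm_tangent_dir T x y (path \<omega>)) \<in> borel_measurable M"
  proof -
    note [measurable] = measurable_kbm_tangent[OF joint_measurable measurable_h_vec_integral[OF joint_measurable]]
    show ?thesis unfolding kbm_tangent_dir_def by measurable
  qed
  have mf: "(\<lambda>\<omega>. blinfun_apply (f' (?X \<omega>)) (kbm_tangent_dir T x y (path \<omega>))) \<in> borel_measurable M"
    by (rule bounded_C1_measurable_deriv[OF f]) measurable
  define KD where "KD = F' * ((1 + T) * T + 2 * ((1 + T) * T * T)) * norm y + F * (correction_const * norm y)"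
  have lim_reg_weight: "(\<lambda>n. reg_weight (?e n) T y (path \<omega>)) \<longlonglongrightarrow> gram_weight T y (path \<omega>)" 
    "(\<lambda>n. matrix_inv (reg_gram (?e n) T (path \<omega>)) *v (A *v reg_weight (?e n) T y (path \<omega>))) \<longlonglongrightarrow> matrix_inv (red_malliavin T (path \<omega>)) *v (A *v gram_weight T y (path \<omega>))"
    if c: "coercive (1 / R \<omega>) (red_malliavin T (path \<omega>))" for \<omega> A
  proof -
    have "(\<lambda>n. reg_gram (?e n) T (path \<omega>)) \<longlonglongrightarrow> red_malliavin T (path \<omega>) + 0 *\<^sub>R mat 1"
      unfolding reg_gram_def by (intro tendsto_intros LIMSEQ_inverse_real_of_nat)
    then have r: "(\<lambda>n. reg_gram (?e n) T (path \<omega>)) \<longlonglongrightarrow> red_malliavin T (path \<omega>)" by simp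
    have cr: "coercive (1 / R \<omega>) (reg_gram (?e n) T (path \<omega>))" for n by (rule coercive_reg'[OF c]) simp
    show 1: "(\<lambda>n. reg_weight (?e n) T y (path \<omega>)) \<longlonglongrightarrow> gram_weight T y (path \<omega>)"
      unfolding reg_weight_def gram_weight_def by (rule tendsto_matrix_inv_vector[OF r tendsto_const cr c])
    show "(\<lambda>n. matrix_inv (reg_gram (?e n) T (path \<omega>)) *v (A *v reg_weight (?e n) T y (path \<omega>))) \<longlonglongrightarrow> matrix_inv (red_malliavin T (path \<omega>)) *v (A *v gram_weight T y (path \<omega>))"
      by (rule tendsto_matrix_inv_vector[OF r tendsto_matrix_vector_mult[OF tendsto_const 1] cr c])
  qed
  have bD: "AE \<omega> in M. \<bar>?D n i \<omega>\<bar> \<le> KD * (R \<omega> + (R \<omega>)\<^sup>2)" for n i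
    using co AE_space
  proof eventually_elim
    fix \<omega> assume c: "coercive (1 / R \<omega>) (red_malliavin T (path \<omega>))" and \<omega>: "\<omega> \<in> space M"
    have R0: "R \<omega> > 0" using c by (simp add: coercive_def)
    have F0: "0 \<le> F" "0 \<le> F'" using F by (meson abs_ge_zero norm_ge_zero order_trans)+
    have "\<bar>?D n i \<omega>\<bar> \<le> F' * ((1 + T) * T + 2 * ((1 + T) * T * T)) * (norm y / (1 / R \<omega>)) + F * (18 * ((1 + T) * T) * T * (1 + T) * T * (norm y / (1 / R \<omega>)) / (1 / R \<omega>))"
      using T by (intro DPhi_bound F path_measurable \<omega> borel_measurable_h_vec_integral h_vec_integral_bound coercive_reg'[OF c]) auto
    also have "\<dots> = F' * ((1 + T) * T + 2 * ((1 + T) * T * T)) * norm y * R \<omega> + F * (correction_const * norm y) * (R \<omega>)\<^sup>2"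
      unfolding correction_const_def by (simp add: power2_eq_square)
    also have "\<dots> \<le> KD * (R \<omega> + (R \<omega>)\<^sup>2)"
    proof -
      have "0 \<le> F' * ((1 + T) * T + 2 * ((1 + T) * T * T)) * norm y" "0 \<le> F * (correction_const * norm y)"
        using F0 T correction_const_nonneg by auto
      moreover have "a * R \<omega> + c * (R \<omega>)\<^sup>2 \<le> (a + c) * (R \<omega> + (R \<omega>)\<^sup>2)" if "0 \<le> a" "0 \<le> c" for a c
        using that R0 by (simp add: algebra_simps)
      ultimately show ?thesis unfolding KD_def by blast
    qed
    finally show "\<bar>?D n i \<omega>\<bar> \<le> KD * (R \<omega> + (R \<omega>)\<^sup>2)" .
  qed
  have R1: "integrable M R"
  proof (rule Bochner_Integration.integrable_bound[of _ "\<lambda>\<omega>. 1 + (R \<omega>)\<^sup>2"])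
    have "\<bar>z\<bar> \<le> 1 + z\<^sup>2" for z :: real using sum_squares_bound[of "\<bar>z\<bar>" 1] by simp
    then show "AE \<omega> in M. norm (R \<omega>) \<le> norm (1 + (R \<omega>)\<^sup>2)" by (intro AE_I2) simp
  qed (use R2 in auto)
  have iD: "integrable M (?D n i)" for n i
  proof (rule Bochner_Integration.integrable_bound)
    show "integrable M (\<lambda>\<omega>. KD * (R \<omega> + (R \<omega>)\<^sup>2))" using R1 R2 by simp
    show "AE \<omega> in M. norm (?D n i \<omega>) \<le> norm (KD * (R \<omega> + (R \<omega>)\<^sup>2))"
      using bD[of n i] by eventually_elim simp
  qed (rule mD)
  let ?Y = "\<lambda>\<omega>. blinfun_apply (f' (?X \<omega>)) (kbm_tangent_dir T x y (path \<omega>))" and ?C = "\<lambda>\<omega>. \<Sum>i\<in>UNIV. correction T y (path \<omega>) i"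
  have limD: "AE \<omega> in M. (\<lambda>n. \<Sum>i\<in>UNIV. ?D n i \<omega>) \<longlonglongrightarrow> ?Y \<omega> - f (?X \<omega>) * ?C \<omega>"
    using co
  proof eventually_elim
    fix \<omega> assume c: "coercive (1 / R \<omega>) (red_malliavin T (path \<omega>))"
    have "(\<lambda>n. \<Sum>i\<in>UNIV. ?D n i \<omega>) \<longlonglongrightarrow> (\<Sum>i\<in>UNIV. blinfun_apply (f' (?X \<omega>)) (kbm_tangent T x (path \<omega>) (h_vec_integral (path \<omega>) i)) * gram_weight T y (path \<omega>) $ i - f (?X \<omega>) * correction T y (path \<omega>) i)"
      unfolding DPhi_def correction_def
      by (intro tendsto_sum tendsto_diff tendsto_mult tendsto_const tendsto_vec_nth lim_reg_weight c)
    also have "(\<Sum>i\<in>UNIV. blinfun_apply (f' (?X \<omega>)) (kbm_tangent T x (path \<omega>) (h_vec_integral (path \<omega>) i)) * gram_weight T y (path \<omega>) $ i - f (?X \<omega>) * correction T y (path \<omega>) i) = ?Y \<omega> - f (?X \<omega>) * ?C \<omega>"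
      by (simp add: kbm_tangent_dir_def blinfun.sum_right blinfun.scaleR_right sum_subtractf sum_distrib_left mult.commute)
    finally show "(\<lambda>n. \<Sum>i\<in>UNIV. ?D n i \<omega>) \<longlonglongrightarrow> ?Y \<omega> - f (?X \<omega>) * ?C \<omega>" .
  qed
  have wD: "integrable M (\<lambda>\<omega>. 3 * (KD * (R \<omega> + (R \<omega>)\<^sup>2)))" using R1 R2 by simp
  have bsD: "AE \<omega> in M. norm (\<Sum>i\<in>UNIV. ?D n i \<omega>) \<le> 3 * (KD * (R \<omega> + (R \<omega>)\<^sup>2))" for n
    using bD[of n 1] bD[of n 2] bD[of n 3] by eventually_elim (simp add: sum_3)
  have mC: "(\<lambda>\<omega>. ?Y \<omega> - f (?X \<omega>) * ?C \<omega>) \<in> borel_measurable M"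
    by (intro borel_measurable_diff mf) measurable
  have mDs: "(\<lambda>\<omega>. \<Sum>i\<in>UNIV. ?D n i \<omega>) \<in> borel_measurable M" for n by (intro borel_measurable_sum mD)
  have i1: "integrable M (\<lambda>\<omega>. ?Y \<omega> - f (?X \<omega>) * ?C \<omega>)"
    and l1: "(\<lambda>n. LINT \<omega>|M. (\<Sum>i\<in>UNIV. ?D n i \<omega>)) \<longlonglongrightarrow> (LINT \<omega>|M. ?Y \<omega> - f (?X \<omega>) * ?C \<omega>)"
    using integrable_dominated_convergence[OF mC mDs wD limD bsD] integral_dominated_convergence[OF mC mDs wD limD bsD] by auto
  let ?S = "\<lambda>\<omega>. \<Sum>i\<in>UNIV. gram_weight T y (path \<omega>) $ i * delta T i (path \<omega>)"
  have F0: "0 \<le> F" using F by (meson abs_ge_zero order_trans)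
  have iDm: "integrable M (\<lambda>\<omega>. (path_size \<omega>)\<^sup>2)" using path_size_moment[of 1] by simp
  have l2: "(\<lambda>n. LINT \<omega>|M. (\<Sum>i\<in>UNIV. ?P n i \<omega> * delta T i (path \<omega>))) \<longlonglongrightarrow> (LINT \<omega>|M. f (?X \<omega>) * ?S \<omega>)"
    and i2: "integrable M (\<lambda>\<omega>. f (?X \<omega>) * ?S \<omega>)"
  proof -
    have m1: "(\<lambda>\<omega>. f (?X \<omega>) * ?S \<omega>) \<in> borel_measurable M" by measurable
    have m2: "(\<lambda>\<omega>. \<Sum>i\<in>UNIV. ?P n i \<omega> * delta T i (path \<omega>)) \<in> borel_measurable M" for n by measurable
    have w: "integrable M (\<lambda>\<omega>. 3 * (F * norm y * ((R \<omega>)\<^sup>2 + (path_size \<omega>)\<^sup>2)))" using R2 iDm by simp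
    have l: "AE \<omega> in M. (\<lambda>n. \<Sum>i\<in>UNIV. ?P n i \<omega> * delta T i (path \<omega>)) \<longlonglongrightarrow> f (?X \<omega>) * ?S \<omega>"
      unfolding sum_Phi_delta using co
      by eventually_elim (intro tendsto_mult tendsto_const tendsto_sum tendsto_vec_nth lim_reg_weight)
    have b: "AE \<omega> in M. norm (\<Sum>i\<in>UNIV. ?P n i \<omega> * delta T i (path \<omega>)) \<le> 3 * (F * norm y * ((R \<omega>)\<^sup>2 + (path_size \<omega>)\<^sup>2))" for n
      using co B0 AE_space
    proof eventually_elim
      fix \<omega> assume c: "coercive (1 / R \<omega>) (red_malliavin T (path \<omega>))" and \<omega>: "B 0 \<omega> = 0" "\<omega> \<in> space M"
      have "\<bar>?P n i \<omega> * delta T i (path \<omega>)\<bar> \<le> F * norm y * ((R \<omega>)\<^sup>2 + (path_size \<omega>)\<^sup>2)" for i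
      proof -
        have "\<bar>?P n i \<omega> * delta T i (path \<omega>)\<bar> \<le> (F * (norm y / (1 / R \<omega>))) * path_size \<omega>"
          by (intro mult_bound Phi_bound F coercive_reg'[OF c] path_measurable delta_le_path_size \<omega>) simp
        also have "\<dots> = F * norm y * (R \<omega> * path_size \<omega>)" by simp
        also have "\<dots> \<le> F * norm y * ((R \<omega>)\<^sup>2 + (path_size \<omega>)\<^sup>2)"
          using F0 by (intro mult_left_mono two_mult_le) auto
        finally show ?thesis .
      qed
      then have "\<bar>\<Sum>i\<in>UNIV. ?P n i \<omega> * delta T i (path \<omega>)\<bar> \<le> (\<Sum>i\<in>(UNIV :: 3 set). F * norm y * ((R \<omega>)\<^sup>2 + (path_size \<omega>)\<^sup>2))"
        by (intro order_trans[OF sum_abs] sum_mono)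
      then show "norm (\<Sum>i\<in>UNIV. ?P n i \<omega> * delta T i (path \<omega>)) \<le> 3 * (F * norm y * ((R \<omega>)\<^sup>2 + (path_size \<omega>)\<^sup>2))" by simp
    qed
    show "(\<lambda>n. LINT \<omega>|M. (\<Sum>i\<in>UNIV. ?P n i \<omega> * delta T i (path \<omega>))) \<longlonglongrightarrow> (LINT \<omega>|M. f (?X \<omega>) * ?S \<omega>)"
      by (rule integral_dominated_convergence[OF m1 m2 w l b])
    show "integrable M (\<lambda>\<omega>. f (?X \<omega>) * ?S \<omega>)"
      by (rule integrable_dominated_convergence[OF m1 m2 w l b])
  qed
  have e: "(LINT \<omega>|M. (\<Sum>i\<in>UNIV. ?P n i \<omega> * delta T i (path \<omega>))) = (LINT \<omega>|M. (\<Sum>i\<in>UNIV. ?D n i \<omega>))" for n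
    using ibp_regularized[OF T _ f, of "?e n" x y] iD[of n]
    by (simp add: Bochner_Integration.integral_sum)
  have eq: "(LINT \<omega>|M. ?Y \<omega> - f (?X \<omega>) * ?C \<omega>) = (LINT \<omega>|M. f (?X \<omega>) * ?S \<omega>)"
    using LIMSEQ_unique[OF l1] l2 unfolding e by blast
  have split: "f (?X \<omega>) * div_form T y (path \<omega>) = f (?X \<omega>) * ?S \<omega> + f (?X \<omega>) * ?C \<omega>" for \<omega>
    by (simp add: div_form_def sum.distrib distrib_left)
  have i3: "integrable M (\<lambda>\<omega>. f (?X \<omega>) * div_form T y (path \<omega>))"
    by (rule Bochner_Integration.integrable_bound[OF integrable_mult_right[OF integrable_abs[OF div_form_integrable[of y]], of F]])
       (use F0 in \<open>auto simp: abs_mult intro!: AE_I2 mult_right_mono F(1)\<close>)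
  \<comment> \<open>Integrability of the correction term is inferred from that of the whole product
    with \<open>div_form\<close> and of the other summand.\<close>
  have i4: "integrable M (\<lambda>\<omega>. f (?X \<omega>) * ?C \<omega>)"
    using Bochner_Integration.integrable_diff[OF i3 i2] unfolding split by simp
  show iY: "integrable M ?Y"
    using Bochner_Integration.integrable_add[OF i1 i4] by simp
  show "(LINT \<omega>|M. ?Y \<omega>) = (LINT \<omega>|M. f (?X \<omega>) * div_form T y (path \<omega>))"
    using eq i2 i4 iY unfolding split by simp
qed

end

section \<open>The divergence formula\<close>

text \<open>Fubini on a square cut along the diagonal, which is a null set: integration by parts for
  primitives of bounded functions.\<close>

lemma lborel_split_square:
  fixes f g :: "real \<Rightarrow> real"
  assumes [measurable]: "f \<in> borel_measurable borel" "g \<in> borel_measurable borel"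
    and F: "\<And>t. t \<in> {0..T} \<Longrightarrow> \<bar>f t\<bar> \<le> F" and G: "\<And>t. t \<in> {0..T} \<Longrightarrow> \<bar>g t\<bar> \<le> G" and T: "0 \<le> T"
  shows "(LBINT t:{0..T}. f t * (LBINT s:{0..t}. g s)) + (LBINT s:{0..T}. g s * (LBINT t:{0..s}. f t))
    = (LBINT t:{0..T}. f t) * (LBINT s:{0..T}. g s)"
proof -
  define f0 where "f0 t = indicator {0..T} t * f t" for t
  define g0 where "g0 t = indicator {0..T} t * g t" for t
  have [measurable]: "f0 \<in> borel_measurable borel" "g0 \<in> borel_measurable borel" unfolding f0_def g0_def by measurable
  have if0: "integrable lborel f0" "integrable lborel g0"
    using set_integrable_bounded[of f 0 T F] set_integrable_bounded[of g 0 T G] F G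
    by (simp_all add: set_integrable_def f0_def[abs_def] g0_def[abs_def])
  have prod: "integrable (lborel \<Otimes>\<^sub>M lborel) (\<lambda>(t, s). f0 t * g0 s)"
  proof (rule lborel_pair.Fubini_integrable)
    have "(\<lambda>t. LINT s|lborel. norm (case (t, s) of (t, s) \<Rightarrow> f0 t * g0 s)) = (\<lambda>t. \<bar>f0 t\<bar> * (LINT s|lborel. \<bar>g0 s\<bar>))"
      by (simp add: abs_mult)
    then show "integrable lborel (\<lambda>t. LINT s|lborel. norm (case (t, s) of (t, s) \<Rightarrow> f0 t * g0 s))"
      using if0(1) by simp
  qed (use if0 in \<open>auto\<close>)
  let ?A = "\<lambda>t s. f0 t * (if s \<le> t then 1 else 0) * g0 s" and ?B = "\<lambda>t s. f0 t * (if t \<le> s then 1 else 0) * g0 s"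
  have iA: "integrable (lborel \<Otimes>\<^sub>M lborel) (\<lambda>(t, s). ?A t s)" and iB: "integrable (lborel \<Otimes>\<^sub>M lborel) (\<lambda>(t, s). ?B t s)"
    by (rule Bochner_Integration.integrable_bound[OF prod], measurable, auto simp: abs_mult)+
  have eA: "(LBINT t:{0..T}. f t * (LBINT s:{0..t}. g s)) = (LINT t|lborel. LINT s|lborel. ?A t s)"
    unfolding set_lebesgue_integral_def
  proof (rule Bochner_Integration.integral_cong[OF refl])
    fix t
    have L: "(LINT s|lborel. ?A t s) = f0 t * (LINT s|lborel. indicator {0..t} s *\<^sub>R g s)"
    proof (cases "t \<in> {0..T}")
      case True
      then have "(\<lambda>s. ?A t s) = (\<lambda>s. f0 t * (indicator {0..t} s *\<^sub>R g s))"
        by (auto simp: fun_eq_iff g0_def indicator_def)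
      then show ?thesis by simp
    qed (simp add: f0_def)
    show "indicator {0..T} t *\<^sub>R (f t * (LINT s|lborel. indicator {0..t} s *\<^sub>R g s)) = (LINT s|lborel. ?A t s)"
      unfolding L by (simp add: f0_def)
  qed
  have eB: "(LBINT s:{0..T}. g s * (LBINT t:{0..s}. f t)) = (LINT s|lborel. LINT t|lborel. ?B t s)"
    unfolding set_lebesgue_integral_def
  proof (rule Bochner_Integration.integral_cong[OF refl])
    fix s
    have L: "(LINT t|lborel. ?B t s) = g0 s * (LINT t|lborel. indicator {0..s} t *\<^sub>R f t)"
    proof (cases "s \<in> {0..T}")
      case True
      then have "(\<lambda>t. ?B t s) = (\<lambda>t. g0 s * (indicator {0..s} t *\<^sub>R f t))"
        by (auto simp: fun_eq_iff f0_def indicator_def)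
      then show ?thesis by simp
    qed (simp add: g0_def)
    show "indicator {0..T} s *\<^sub>R (g s * (LINT t|lborel. indicator {0..s} t *\<^sub>R f t)) = (LINT t|lborel. ?B t s)"
      unfolding L by (simp add: g0_def)
  qed
  have "(LINT t|lborel. LINT s|lborel. ?A t s) = (LINT p|(lborel \<Otimes>\<^sub>M lborel). (\<lambda>(t, s). ?A t s) p)"
    using lborel_pair.integral_fst'[OF iA] by simp
  moreover have "(LINT s|lborel. LINT t|lborel. ?B t s) = (LINT p|(lborel \<Otimes>\<^sub>M lborel). (\<lambda>(t, s). ?B t s) p)"
    using lborel_pair.integral_snd[OF iB] by simp
  moreover have "(LINT p|(lborel \<Otimes>\<^sub>M lborel). (\<lambda>(t, s). f0 t * g0 s) p) = (LBINT t:{0..T}. f t) * (LBINT s:{0..T}. g s)"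
    using lborel_pair.integral_fst'[OF prod] by (simp add: set_lebesgue_integral_def f0_def g0_def)
  moreover have "(LINT p|(lborel \<Otimes>\<^sub>M lborel). (\<lambda>(t, s). f0 t * g0 s) p)
     = (LINT p|(lborel \<Otimes>\<^sub>M lborel). (\<lambda>(t, s). ?A t s) p + (\<lambda>(t, s). ?B t s) p)"
  proof (rule integral_cong_AE)
    have "AE p in lborel \<Otimes>\<^sub>M lborel. snd p \<noteq> (fst p :: real)"
    proof (rule lborel_pair.AE_pair_measure)
      have "(\<lambda>p. snd p - fst p :: real) -` (- {0}) \<inter> space (lborel \<Otimes>\<^sub>M lborel) \<in> sets (lborel \<Otimes>\<^sub>M (lborel :: real measure))"
        by measurable
      moreover have "(\<lambda>p. snd p - fst p :: real) -` (- {0}) \<inter> space (lborel \<Otimes>\<^sub>M lborel) = {p \<in> space (lborel \<Otimes>\<^sub>M (lborel :: real measure)). snd p \<noteq> fst p}"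
        by auto
      ultimately show "{p \<in> space (lborel \<Otimes>\<^sub>M (lborel :: real measure)). snd p \<noteq> fst p} \<in> sets (lborel \<Otimes>\<^sub>M lborel)" by simp
    qed (auto intro!: AE_I2 AE_lborel_singleton)
    then show "AE p in lborel \<Otimes>\<^sub>M lborel. (\<lambda>(t, s). f0 t * g0 s) p = (\<lambda>(t, s). ?A t s) p + (\<lambda>(t, s). ?B t s) p"
      by eventually_elim auto
  qed measurable
  ultimately show ?thesis unfolding eA eB using iA iB by simp
qed

text \<open>Cauchy's formula for a repeated integral, from \<open>lborel_split_square\<close> with
  the constant 1 as one factor.\<close>

lemma h_vec_integral_eq:
  assumes [measurable]: "b \<in> borel_measurable borel" and s: "0 \<le> s"
  shows "h_vec_integral b i s = (if i = 1 then s else 0) + (LBINT r:{0..s}. hfun i (b r) * (s - r))"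
proof -
  have 1: "set_integrable lborel {0..s} (\<lambda>r. LBINT q:{0..r}. hfun i (b q))"
  proof (rule set_integrable_bounded)
    show "(\<lambda>r. LBINT q:{0..r}. hfun i (b q)) \<in> borel_measurable borel"
      using borel_measurable_diff[OF borel_measurable_h_vec[OF assms(1), of i] borel_measurable_const[of "if i = 1 then 1 else 0"]] by (simp add: h_vec_nth)
    show "norm (LBINT q:{0..r}. hfun i (b q)) \<le> s" if "r \<in> {0..s}" for r
      using set_integral_norm_le[of "\<lambda>q. hfun i (b q)" 0 r 1] that by (simp add: hfun_bound)
  qed
  have 2: "set_integrable lborel {0..s} (\<lambda>r. c)" for c :: real by (rule set_integrable_bounded[of _ _ _ "\<bar>c\<bar>"]) auto
  have 3: "set_integrable lborel {0..s} (\<lambda>r. hfun i (b r) * s)" "set_integrable lborel {0..s} (\<lambda>r. hfun i (b r) * r)"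
  proof -
    have "\<bar>hfun i (b r) * q\<bar> \<le> 1 * s" if "0 \<le> q" "q \<le> s" for r q
      using that by (intro mult_bound hfun_bound) auto
    then show "set_integrable lborel {0..s} (\<lambda>r. hfun i (b r) * s)" "set_integrable lborel {0..s} (\<lambda>r. hfun i (b r) * r)"
      using s by (intro set_integrable_bounded[of _ _ _ "1 * s"]; simp)+
  qed
  have "h_vec_integral b i s = (if i = 1 then s else 0) + (LBINT r:{0..s}. LBINT q:{0..r}. hfun i (b q))"
    unfolding h_vec_integral_def h_vec_nth using s by (subst set_integral_add(2)[OF 2 1]) (simp add: set_integral_const)
  also have "(LBINT r:{0..s}. LBINT q:{0..r}. hfun i (b q)) = (LBINT r:{0..s}. hfun i (b r) * (s - r))"
  proof -
    have one: "(LBINT t:{0..r}. 1) = r" if "0 \<le> r" for r :: real using that by (simp add: set_integral_const)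
    have "(LBINT r:{0..s}. hfun i (b r) * (LBINT t:{0..r}. 1)) = (LBINT r:{0..s}. hfun i (b r) * r)"
      by (intro set_lebesgue_integral_cong) (auto simp: one)
    moreover have "(LBINT r:{0..s}. hfun i (b r) * (s - r)) = (LBINT r:{0..s}. hfun i (b r) * s) - (LBINT r:{0..s}. hfun i (b r) * r)"
      unfolding right_diff_distrib by (rule set_integral_diff(2)[OF 3])
    ultimately show ?thesis
      using lborel_split_square[of "\<lambda>_. 1" "\<lambda>r. hfun i (b r)" s 1 1] s
      by (simp add: hfun_bound one mult.commute[of s])
  qed
  finally show ?thesis .
qed

text \<open>Explains the column vector in the double integral of \<open>delta_h\<close>: its
  coordinates are the path shifts that belong to the h_i.\<close>

lemma h_vec_integral_col3:
  assumes [measurable]: "b \<in> borel_measurable borel" and s: "0 \<le> s"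
  shows "col3 (s, \<i> * (LBINT \<rho>:{0..s}. cis (b \<rho>) * of_real (\<rho> - s))) $ i = h_vec_integral b i s"
proof -
  have i: "integrable lborel (\<lambda>\<rho>. indicat_real {0..s} \<rho> *\<^sub>R (cis (b \<rho>) * of_real (\<rho> - s)))"
  proof -
    have "norm (cis (b \<rho>) * of_real (\<rho> - s)) \<le> s" if "\<rho> \<in> {0..s}" for \<rho>
      using that by (simp add: norm_mult flip: of_real_diff)
    then have "set_integrable lborel {0..s} (\<lambda>\<rho>. cis (b \<rho>) * of_real (\<rho> - s))"
      by (intro set_integrable_bounded[of _ _ _ s]) (simp_all add: cis_conv_exp)
    then show ?thesis by (simp add: set_integrable_def)
  qed
  have "Re (LBINT \<rho>:{0..s}. cis (b \<rho>) * of_real (\<rho> - s)) = (LBINT \<rho>:{0..s}. cos (b \<rho>) * (\<rho> - s))"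
    "Im (LBINT \<rho>:{0..s}. cis (b \<rho>) * of_real (\<rho> - s)) = (LBINT \<rho>:{0..s}. sin (b \<rho>) * (\<rho> - s))"
    using integral_Re[OF i] integral_Im[OF i] by (simp_all add: set_lebesgue_integral_def)
  moreover have "(LBINT \<rho>:{0..s}. sin (b \<rho>) * (s - \<rho>)) = - (LBINT \<rho>:{0..s}. sin (b \<rho>) * (\<rho> - s))"
    unfolding set_lebesgue_integral_def integral_minus[symmetric] by (intro Bochner_Integration.integral_cong) (auto simp: algebra_simps)
  moreover have "(LBINT \<rho>:{0..s}. - cos (b \<rho>) * (s - \<rho>)) = (LBINT \<rho>:{0..s}. cos (b \<rho>) * (\<rho> - s))"
    unfolding set_lebesgue_integral_def by (intro Bochner_Integration.integral_cong) (auto simp: algebra_simps)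
  ultimately show ?thesis
    unfolding h_vec_integral_eq[OF assms] using exhaust_3[of i] by (auto simp: col3_def hfun_def)
qed

lemma delta_col3:
  assumes c: "continuous_on UNIV b"
  shows "col3 (b T, - \<i> * (LBINT t:{0..T}. cis (b t) * of_real (b T - b t))) $ i = delta T i b"
proof -
  have "continuous_on {0..T} b" using c continuous_on_subset by blast
  then have "set_integrable lborel {0..T} (\<lambda>t. cis (b t) * of_real (b T - b t))"
    unfolding cis_conv_exp by (intro borel_integrable_atLeastAtMost' continuous_intros)
  then have i: "integrable lborel (\<lambda>t. indicat_real {0..T} t *\<^sub>R (cis (b t) * of_real (b T - b t)))"
    by (simp add: set_integrable_def)
  have "Re (LBINT t:{0..T}. cis (b t) * of_real (b T - b t)) = (LBINT t:{0..T}. cos (b t) * (b T - b t))"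
    "Im (LBINT t:{0..T}. cis (b t) * of_real (b T - b t)) = (LBINT t:{0..T}. sin (b t) * (b T - b t))"
    using integral_Re[OF i] integral_Im[OF i] by (simp_all add: set_lebesgue_integral_def)
  moreover have "(LBINT t:{0..T}. - cos (b t) * (b T - b t)) = - (LBINT t:{0..T}. cos (b t) * (b T - b t))"
    unfolding set_lebesgue_integral_def integral_minus[symmetric] by (intro Bochner_Integration.integral_cong) (auto simp: algebra_simps)
  ultimately show ?thesis
    using exhaust_3[of i] by (auto simp: col3_def delta_def hfun_def)
qed

text \<open>\<open>K_mat b t s\<close> is the response of the products
  \<open>h_vec b t $ l * h_vec b t $ m\<close> to a change of the path at time \<open>s\<close>.
  Integrated against a shift over \<open>s \<le> t\<close>, and then over \<open>t\<close>, it gives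
  \<open>gram_deriv\<close>.\<close>

lemma K_mat_nth:
  assumes "b \<in> borel_measurable borel"
  shows "K_mat b t s $ l $ m = hfun' l (b s) * h_vec b t $ m + h_vec b t $ l * hfun' m (b s)"
  using exhaust_3[of l] exhaust_3[of m] h_vec_nth[of b t 1]
  by (auto simp: K_mat_def Let_def block_def outer_def matrix_matrix_mult_def columnvector_def rowvector_def col2_def
      set_integral_cis[OF assms] hfun'_def hfun_def)

definition rotated :: "real \<times> complex \<Rightarrow> real \<times> complex \<Rightarrow> real^3" where
  "rotated x v = block 1 0 0 (rot (- fst x)) *v col3 v"

lemma rotated_nth:
  "rotated x v $ 1 = fst v" "rotated x v $ 2 = cos (fst x) * Re (snd v) + sin (fst x) * Im (snd v)"
  "rotated x v $ 3 = - sin (fst x) * Re (snd v) + cos (fst x) * Im (snd v)"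
  by (simp_all add: rotated_def block_def rot_def col3_def matrix_vector_mult_def sum_3)

lemma weight_vec_eq: "weight_vec T x v b = gram_weight T (rotated x v) b"
  by (simp add: weight_vec_def gram_weight_def rotated_def)

text \<open>Both sides are expanded over index triples. The iterated time integrals of
  \<open>K_mat\<close> against the shifts assemble to \<open>gram_deriv\<close>, and the double
  integral becomes the sum of the \<open>correction\<close> terms.\<close>

lemma delta_h_eq:
  assumes c: "continuous_on UNIV b" and T: "T > 0"
  shows "delta_h T x v b = - div_form T (rotated x v) b"
proof -
  have [measurable]: "b \<in> borel_measurable borel" using c by (rule borel_measurable_continuous_onI)
  note bm = this
  let ?A = "matrix_inv (red_malliavin T b)" and ?l = "gram_weight T (rotated x v) b"
  \<comment> \<open>A triple consists of the direction \<open>i\<close> and the entry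
    \<open>(l, m)\<close> of \<open>K_mat\<close>; with triples as indices, each integral is
    exchanged with one finite sum only.\<close>
  let ?c = "\<lambda>(j :: 3 \<times> 3 \<times> 3). ?A $ fst j $ fst (snd j) * ?l $ snd (snd j)"
  let ?g = "\<lambda>t (j :: 3 \<times> 3 \<times> 3) s. h_vec_integral b (fst j) s * (hfun' (fst (snd j)) (b s) * h_vec b t $ snd (snd j) + h_vec b t $ fst (snd j) * hfun' (snd (snd j)) (b s))"
  let ?G = "\<lambda>(j :: 3 \<times> 3 \<times> 3) t. h_vec_deriv b (h_vec_integral b (fst j)) t (fst (snd j)) * h_vec b t $ snd (snd j) + h_vec b t $ fst (snd j) * h_vec_deriv b (h_vec_integral b (fst j)) t (snd (snd j))"
  have tri: "(\<Sum>i\<in>UNIV. \<Sum>l\<in>UNIV. \<Sum>m\<in>UNIV. F (i, l, m)) = (\<Sum>j\<in>UNIV. F j)" for F :: "3 \<times> 3 \<times> 3 \<Rightarrow> real"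
    by (simp add: sum.cartesian_product)
  have hb: "\<bar>h_vec_integral b i s\<bar> \<le> (1 + T) * T" if "s \<in> {0..T}" for i s by (rule h_vec_integral_bound[OF bm that])
  have integrand: "col3 (s, \<i> * (LBINT \<rho>:{0..s}. cis (b \<rho>) * of_real (\<rho> - s))) \<bullet> (?A *v (K_mat b t s *v ?l))
      = (\<Sum>j\<in>UNIV. ?c j * ?g t j s)" if s: "0 \<le> s" for s t
    unfolding inner_vec_def h_vec_integral_col3[OF bm s] tri[symmetric]
    by (simp add: matrix_vector_mult_def K_mat_nth[OF bm] sum_distrib_left sum_distrib_right mult_ac)
  have inner: "(LBINT s:{0..t}. col3 (s, \<i> * (LBINT \<rho>:{0..s}. cis (b \<rho>) * of_real (\<rho> - s))) \<bullet> (?A *v (K_mat b t s *v ?l)))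
      = (\<Sum>j\<in>UNIV. ?c j * ?G j t)" if t: "t \<in> {0..T}" for t
  proof -
    have si: "set_integrable lborel {0..t} (\<lambda>s. h_vec_integral b i s * hfun' l (b s))" for i l
    proof (rule set_integrable_bounded)
      show "norm (h_vec_integral b i s * hfun' l (b s)) \<le> ((1 + T) * T) * 1" if "s \<in> {0..t}" for s
        unfolding real_norm_def using that t by (intro mult_bound hb hfun_bound) auto
    qed measurable
    have si': "set_integrable lborel {0..t} (\<lambda>s. hfun' l (b s) * h_vec_integral b i s)" for i l
      using si[of i l] by (simp only: mult.commute)
    have sg: "?g t j = (\<lambda>s. (h_vec_integral b (fst j) s * hfun' (fst (snd j)) (b s)) * h_vec b t $ snd (snd j) + h_vec b t $ fst (snd j) * (h_vec_integral b (fst j) s * hfun' (snd (snd j)) (b s)))" for j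
      by (simp add: fun_eq_iff algebra_simps)
    have sj: "set_integrable lborel {0..t} (?g t j)" for j
      unfolding sg by (intro set_integral_add(1) set_integrable_mult_left set_integrable_mult_right si)
    have Ij: "(LBINT s:{0..t}. ?g t j s) = ?G j t" for j
      unfolding sg by (subst set_integral_add(2)) 
        (auto simp: h_vec_deriv_def mult.commute[of "h_vec_integral b _ _"] intro!: set_integrable_mult_left set_integrable_mult_right si si')
    have "(LBINT s:{0..t}. col3 (s, \<i> * (LBINT \<rho>:{0..s}. cis (b \<rho>) * of_real (\<rho> - s))) \<bullet> (?A *v (K_mat b t s *v ?l)))
       = (LBINT s:{0..t}. \<Sum>j\<in>UNIV. ?c j * ?g t j s)"
      by (intro set_lebesgue_integral_cong) (auto simp: integrand simp del: of_real_diff)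
    also have "\<dots> = (\<Sum>j\<in>UNIV. ?c j * (LBINT s:{0..t}. ?g t j s))" by (rule set_integral_sum_scale[OF sj])
    finally show ?thesis by (simp only: Ij)
  qed
  have SG: "set_integrable lborel {0..T} (?G j)" for j
  proof (rule set_integrable_bounded)
    show "norm (?G j t) \<le> (((1 + T) * T) * T) * (1 + T) + (1 + T) * (((1 + T) * T) * T)" if t: "t \<in> {0..T}" for t
      unfolding real_norm_def using T
      by (intro order_trans[OF abs_triangle_ineq] add_mono mult_bound h_vec_bound' h_vec_deriv_bound t bm borel_measurable_h_vec_integral hb) auto
  qed measurable
  have "(LBINT t:{0..T}. LBINT s:{0..t}. col3 (s, \<i> * (LBINT \<rho>:{0..s}. cis (b \<rho>) * of_real (\<rho> - s))) \<bullet> (?A *v (K_mat b t s *v ?l)))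
     = (LBINT t:{0..T}. \<Sum>j\<in>UNIV. ?c j * ?G j t)"
    by (intro set_lebesgue_integral_cong) (auto simp: inner simp del: of_real_diff)
  also have "\<dots> = (\<Sum>j\<in>UNIV. ?c j * (LBINT t:{0..T}. ?G j t))" by (rule set_integral_sum_scale[OF SG])
  also have "\<dots> = (\<Sum>i\<in>UNIV. correction T (rotated x v) b i)"
    unfolding tri[symmetric] correction_def by (simp add: matrix_vector_mult_def gram_deriv_def sum_distrib_left mult_ac)
  finally show ?thesis
    unfolding delta_h_def weight_vec_eq div_form_def sum.distrib inner_vec_def delta_col3[OF c] by (simp add: mult.commute)
qed

lemma h_vec_deriv_cong: "(\<And>s. s \<in> {0..t} \<Longrightarrow> k s = k' s) \<Longrightarrow> h_vec_deriv b k t i = h_vec_deriv b k' t i"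
  unfolding h_vec_deriv_def by (intro set_lebesgue_integral_cong) auto

lemma kbm_tangent_cong: "(\<And>s. s \<in> {0..T} \<Longrightarrow> k s = k' s) \<Longrightarrow> 0 \<le> T \<Longrightarrow> kbm_tangent T x b k = kbm_tangent T x b k'"
  unfolding kbm_tangent_def using h_vec_deriv_cong[of T k k' b] by auto

text \<open>\<open>malliavin_deriv\<close> sees the direction only through its primitive, here minus
  the weighted sum of the shifts \<open>h_vec_integral\<close>.\<close>

lemma malliavin_deriv_h_dir:
  assumes bm[measurable]: "b \<in> borel_measurable borel" and T: "T > 0"
  shows "malliavin_deriv T x b (h_dir T x v b) = - kbm_tangent_dir T x (rotated x v) b"
proof -
  let ?l = "gram_weight T (rotated x v) b"
  \<comment> \<open>Cutting the shifts off outside \<open>{0..T}\<close> makes them bounded on the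
    whole line, as \<open>kbm_tangent_sum\<close> requires, and changes nothing on
    \<open>{0..T}\<close>.\<close>
  define k where "k t = (\<Sum>i\<in>UNIV. (- ?l $ i) * (indicator {0..T} t * h_vec_integral b i t))" for t
  have [measurable]: "k \<in> borel_measurable borel" unfolding k_def[abs_def] by measurable
  have ind: "\<bar>indicator {0..T} t * h_vec_integral b i t\<bar> \<le> (1 + T) * T" for i t
    using h_vec_integral_bound[OF bm, of t T i] T by (auto simp: indicator_def)
  have sh: "set_integrable lborel {0..t} (\<lambda>s. h_vec b s $ i)" if "t \<in> {0..T}" for t i
    using that by (intro set_integrable_bounded[of _ _ _ "1 + T"]) (auto intro!: h_vec_bound')
  have ik: "(LBINT s:{0..t}. h_dir T x v b s) = k t" if t: "t \<in> {0..T}" for t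
  proof -
    have "h_dir T x v b s = (\<Sum>i\<in>UNIV. (- ?l $ i) * h_vec b s $ i)" for s
      by (simp add: h_dir_def a_adj_def weight_vec_eq sum_negf)
    then have "(LBINT s:{0..t}. h_dir T x v b s) = (\<Sum>i\<in>UNIV. (- ?l $ i) * h_vec_integral b i t)"
      unfolding h_vec_integral_def using set_integral_sum_scale[OF sh[OF t], where J = UNIV and c = "\<lambda>i. - ?l $ i"] by simp
    then show ?thesis using t by (simp add: k_def)
  qed
  have kb: "\<bar>k t\<bar> \<le> (\<Sum>i\<in>UNIV. \<bar>- ?l $ i\<bar> * ((1 + T) * T))" for t
    unfolding k_def by (intro order_trans[OF sum_abs] sum_mono mult_bound ind) simp
  have i: "integrable lborel (\<lambda>t. indicat_real {0..T} t *\<^sub>R (cis (b t) * of_real (k t)))"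
  proof -
    have "set_integrable lborel {0..T} (\<lambda>t. cis (b t) * of_real (k t))"
      by (rule set_integrable_bounded) (use kb in \<open>auto simp: norm_mult cis_conv_exp\<close>)
    then show ?thesis by (simp add: set_integrable_def)
  qed
  have "(LBINT t:{0..T}. cis (b t) * of_real (LBINT s:{0..t}. h_dir T x v b s)) = (LBINT t:{0..T}. cis (b t) * of_real (k t))"
    by (intro set_lebesgue_integral_cong) (auto simp: ik)
  also have "\<dots> = of_real (h_vec_deriv b k T 2) + \<i> * of_real (h_vec_deriv b k T 3)"
    using integral_Re[OF i] integral_Im[OF i]
    by (simp add: complex_eq_iff set_lebesgue_integral_def h_vec_deriv_def hfun'_def)
  finally have "malliavin_deriv T x b (h_dir T x v b) = kbm_tangent T x b k"
    unfolding malliavin_deriv_def kbm_tangent_def using ik[of T] T by (simp add: algebra_simps)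
  also have "\<dots> = (\<Sum>i\<in>UNIV. (- ?l $ i) *\<^sub>R kbm_tangent T x b (\<lambda>t. indicator {0..T} t * h_vec_integral b i t))"
    unfolding k_def[abs_def] using T by (intro kbm_tangent_sum[where K = "(1 + T) * T"] ind) auto
  also have "\<dots> = (\<Sum>i\<in>UNIV. (- ?l $ i) *\<^sub>R kbm_tangent T x b (h_vec_integral b i))"
  proof -
    have "kbm_tangent T x b (\<lambda>t. indicator {0..T} t * h_vec_integral b i t) = kbm_tangent T x b (h_vec_integral b i)" for i
      using T by (intro kbm_tangent_cong) auto
    then show ?thesis by simp
  qed
  finally show ?thesis by (simp add: kbm_tangent_dir_def sum_negf)
qed

text \<open>The derivative of the end point with respect to the starting point, along
  \<open>v\<close> and for a fixed path.\<close>

definition kbm_deriv :: "real \<Rightarrow> real \<times> complex \<Rightarrow> (real \<Rightarrow> real) \<Rightarrow> real \<times> complex \<Rightarrow> real \<times> complex" where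
  "kbm_deriv T x b v = (fst v, snd v + \<i> * cis (fst x) * (LBINT s:{0..T}. cis (b s)) * of_real (fst v))"

text \<open>The origin of the weight. By \<open>lborel_split_square\<close> the tangents along the
  shifts are combinations of rows of the Gram matrix, and paired with the weight these rows give
  \<open>rotated x v\<close>, because the weight solves that linear system. Multiplication by
  \<open>cis (fst x)\<close> undoes the rotation.\<close>

lemma kbm_tangent_dir_eq:
  assumes bm[measurable]: "b \<in> borel_measurable borel" and T: "T > 0" and inv: "invertible (red_malliavin T b)"
  shows "kbm_tangent_dir T x (rotated x v) b = kbm_deriv T x b v"
proof -
  let ?C = "red_malliavin T b" and ?l = "gram_weight T (rotated x v) b" and ?w = "rotated x v"
  have Cl: "(\<Sum>i\<in>UNIV. ?l $ i * ?C $ j $ i) = ?w $ j" for j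
  proof -
    have "?C *v ?l = ?w" unfolding gram_weight_def by (rule matrix_inv_vector(1)[OF inv])
    then show ?thesis by (auto simp: matrix_vector_mult_def vec_eq_iff mult.commute)
  qed
  have sym: "?C $ i $ j = ?C $ j $ i" for i j by (simp add: red_malliavin_nth mult.commute)
  have h1: "h_vec b t $ 1 = 1" for t by (simp add: h_vec_nth hfun_def)
  have hIT: "h_vec_integral b i T = ?C $ 1 $ i" for i by (simp add: h_vec_integral_def red_malliavin_nth h1)
  have tri: "h_vec_deriv b (h_vec_integral b i) T l + (LBINT s:{0..T}. h_vec b s $ i * (LBINT t:{0..s}. hfun' l (b t))) = (LBINT t:{0..T}. hfun' l (b t)) * h_vec_integral b i T" for i l
    unfolding h_vec_deriv_def h_vec_integral_def using T
    by (intro lborel_split_square[where F = 1 and G = "1 + T"]) (auto simp: hfun_bound intro!: h_vec_bound')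
  have s3: "(LBINT t:{0..s}. hfun' 3 (b t)) = h_vec b s $ 2" for s by (simp add: h_vec_nth hfun_def hfun'_def)
  have s2: "(LBINT t:{0..s}. hfun' 2 (b t)) = - h_vec b s $ 3" for s by (simp add: h_vec_nth hfun_def hfun'_def set_lebesgue_integral_def)
  have d3: "h_vec_deriv b (h_vec_integral b i) T 3 = h_vec b T $ 2 * ?C $ 1 $ i - ?C $ 2 $ i" for i
    using tri[of i 3] unfolding s3 hIT by (simp add: red_malliavin_nth mult.commute)
  have d2: "h_vec_deriv b (h_vec_integral b i) T 2 = - h_vec b T $ 3 * ?C $ 1 $ i + ?C $ 3 $ i" for i
    using tri[of i 2] unfolding s2 hIT by (simp add: red_malliavin_nth set_lebesgue_integral_def mult.commute)
  have f: "fst (kbm_tangent_dir T x ?w b) = ?w $ 1"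
    unfolding kbm_tangent_dir_def fst_sum by (simp add: kbm_tangent_def hIT Cl)
  have S3: "(\<Sum>i\<in>UNIV. ?l $ i * h_vec_deriv b (h_vec_integral b i) T 3) = h_vec b T $ 2 * ?w $ 1 - ?w $ 2"
    unfolding d3 Cl[symmetric] by (simp add: sum_distrib_left sum_subtractf algebra_simps)
  have S2: "(\<Sum>i\<in>UNIV. ?l $ i * h_vec_deriv b (h_vec_integral b i) T 2) = - h_vec b T $ 3 * ?w $ 1 + ?w $ 3"
    unfolding d2 Cl[symmetric] sum_distrib_left sum.distrib[symmetric] by (intro sum.cong) (auto simp: algebra_simps)
  have "snd (kbm_tangent_dir T x ?w b) = cis (fst x) * (of_real (- (\<Sum>i\<in>UNIV. ?l $ i * h_vec_deriv b (h_vec_integral b i) T 3)) + \<i> * of_real (\<Sum>i\<in>UNIV. ?l $ i * h_vec_deriv b (h_vec_integral b i) T 2))"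
    unfolding kbm_tangent_dir_def snd_sum of_real_minus of_real_sum sum_distrib_left sum_negf[symmetric] sum.distrib[symmetric]
    by (intro sum.cong) (simp_all add: kbm_tangent_def scaleR_conv_of_real algebra_simps)
  also have "\<dots> = snd v + \<i> * cis (fst x) * (LBINT s:{0..T}. cis (b s)) * of_real (fst v)"
  proof -
    have cs: "(cos (fst x))\<^sup>2 = 1 - (sin (fst x))\<^sup>2" by (simp add: cos_squared_eq)
    have "cis (fst x) * (of_real (?w $ 2) + \<i> * of_real (?w $ 3)) = snd v"
      by (simp add: rotated_nth complex_eq_iff algebra_simps flip: power2_eq_square) (simp add: cs algebra_simps)
    moreover have "cis (fst x) * (of_real (- (h_vec b T $ 2 * ?w $ 1 - ?w $ 2)) + \<i> * of_real (- h_vec b T $ 3 * ?w $ 1 + ?w $ 3))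
      = cis (fst x) * (of_real (?w $ 2) + \<i> * of_real (?w $ 3)) + \<i> * cis (fst x) * (of_real (- h_vec b T $ 3) + \<i> * of_real (h_vec b T $ 2)) * of_real (?w $ 1)"
      by (simp add: algebra_simps)
    ultimately show ?thesis unfolding S2 S3 set_integral_cis[OF bm] by (simp add: rotated_nth(1))
  qed
  finally show ?thesis using f by (simp add: kbm_deriv_def prod_eq_iff rotated_nth(1))
qed

section \<open>Differentiability of the semigroup\<close>

lemma cis_measurable [measurable]: "cis \<in> borel_measurable borel"
proof -
  have "(\<lambda>t. exp (\<i> * of_real t)) \<in> borel_measurable borel" by measurable
  then show ?thesis by (simp add: cis_conv_exp[abs_def])
qed

lemma kbm_line_derivative:
  "((\<lambda>r. kbm T (x + r *\<^sub>R v) b) has_vector_derivative kbm_deriv T (x + r *\<^sub>R v) b v) (at r)"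
proof -
  have "((\<lambda>r. cis (fst x + r * fst v)) has_vector_derivative fst v *\<^sub>R (\<i> * cis (fst x + r * fst v))) (at r)"
    unfolding has_vector_derivative_def by (auto intro!: derivative_eq_intros simp: fun_eq_iff scaleR_conv_of_real algebra_simps)
  note d = this
  have "((\<lambda>r. (fst x + r * fst v + b T, snd x + r *\<^sub>R snd v + cis (fst x + r * fst v) * (LBINT s:{0..T}. cis (b s))))
     has_vector_derivative (fst v, snd v + (fst v *\<^sub>R (\<i> * cis (fst x + r * fst v))) * (LBINT s:{0..T}. cis (b s)))) (at r)"
    by (intro has_vector_derivative_Pair) (auto intro!: derivative_eq_intros d)
  then show ?thesis by (simp add: kbm_def kbm_deriv_def scaleR_conv_of_real mult_ac)
qed

lemma kbm_deriv_norm: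
  assumes [measurable]: "b \<in> borel_measurable borel" and T: "T > 0"
  shows "norm (kbm_deriv T x b v) \<le> (2 + T) * norm v"
proof -
  have "norm (LBINT s:{0..T}. cis (b s)) \<le> T"
    using set_integral_norm_le[of "\<lambda>s. cis (b s)" 0 T 1] T by simp
  then have "norm (\<i> * cis (fst x) * (LBINT s:{0..T}. cis (b s)) * of_real (fst v)) \<le> T * norm v"
    using norm_fst_le[of "fst v" "snd v"] T by (simp add: norm_mult mult_mono)
  moreover have "\<bar>fst v\<bar> \<le> norm v" "norm (snd v) \<le> norm v"
    using norm_fst_le[of "fst v" "snd v"] norm_snd_le[of "snd v" "fst v"] by auto
  ultimately have "norm (fst v) + norm (snd v + \<i> * cis (fst x) * (LBINT s:{0..T}. cis (b s)) * of_real (fst v)) \<le> norm v + (norm v + T * norm v)"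
    by (intro add_mono norm_triangle_le) auto
  then show ?thesis unfolding kbm_deriv_def by (intro order_trans[OF norm_Pair_le]) (simp add: algebra_simps)
qed

lemma kbm_FTC:
  assumes f: "bounded_C1 f f'"
  shows "f (kbm T (x + v) b) - f (kbm T x b) = (LBINT r:{0..1}. blinfun_apply (f' (kbm T (x + r *\<^sub>R v) b)) (kbm_deriv T (x + r *\<^sub>R v) b v))"
proof -
  let ?g = "\<lambda>r. kbm T (x + r *\<^sub>R v) b" and ?d = "\<lambda>r. kbm_deriv T (x + r *\<^sub>R v) b v"
  have fd: "(f has_derivative f' y) (at y)" for y using f unfolding bounded_C1_def by blast
  have der: "((\<lambda>r. f (?g r)) has_vector_derivative f' (?g r) (?d r)) (at r)" for r
  proof -
    have "((\<lambda>r. f (?g r)) has_derivative (\<lambda>h. f' (?g r) (h *\<^sub>R ?d r))) (at r)"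
      by (rule has_derivative_compose[OF kbm_line_derivative[unfolded has_vector_derivative_def] fd])
    then show ?thesis by (simp add: has_vector_derivative_def blinfun.scaleR_right)
  qed
  have cg: "continuous_on {0..1} ?g"
    using kbm_line_derivative by (intro continuous_at_imp_continuous_on ballI has_vector_derivative_continuous)
  have cd: "continuous_on {0..1} ?d"
    unfolding kbm_deriv_def cis_conv_exp by (intro continuous_intros)
  have "continuous_on UNIV f'" using f by (simp add: bounded_C1_def)
  from continuous_on_compose2[OF this cg] have "continuous_on {0..1} (\<lambda>r. f' (?g r))" by simp
  then have "continuous_on {0..1} (\<lambda>r. f' (?g r) (?d r))" by (rule blinfun.continuous_on[OF _ cd])
  from integral_FTC_atLeastAtMost[OF zero_le_one has_vector_derivative_at_within[OF der] this]
  show ?thesis by (simp add: set_lebesgue_integral_def)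
qed

lemma rotated_bound: "\<bar>rotated x v $ i\<bar> \<le> 2 * norm v"
proof -
  have 1: "\<bar>fst v\<bar> \<le> norm v" "\<bar>Re (snd v)\<bar> \<le> norm v" "\<bar>Im (snd v)\<bar> \<le> norm v"
    using norm_fst_le[of "fst v" "snd v"] order_trans[OF abs_Re_le_cmod norm_snd_le[of "snd v" "fst v"]]
      order_trans[OF abs_Im_le_cmod norm_snd_le[of "snd v" "fst v"]] by auto
  have "\<bar>cos (fst x) * Re (snd v) + sin (fst x) * Im (snd v)\<bar> \<le> 1 * norm v + 1 * norm v"
    "\<bar>- sin (fst x) * Re (snd v) + cos (fst x) * Im (snd v)\<bar> \<le> 1 * norm v + 1 * norm v"
    by (intro order_trans[OF abs_triangle_ineq] add_mono mult_bound 1; simp)+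
  then show ?thesis using exhaust_3[of i] 1 by (auto simp: rotated_nth)
qed

lemma abs_cos_diff: "\<bar>cos y - cos z\<bar> \<le> \<bar>y - z\<bar>" and abs_sin_diff: "\<bar>sin y - sin z\<bar> \<le> \<bar>y - z\<bar>" for y z :: real
  using DERIV_quot_bound[of cos "\<lambda>y. - sin y" 1 z "y - z"] DERIV_quot_bound[of sin cos 1 z "y - z"] DERIV_cos DERIV_sin
  by auto

lemma rotated_diff_bound: "\<bar>rotated z v $ i - rotated x v $ i\<bar> \<le> 2 * norm (z - x) * norm v"
proof -
  have 1: "\<bar>fst v\<bar> \<le> norm v" "\<bar>Re (snd v)\<bar> \<le> norm v" "\<bar>Im (snd v)\<bar> \<le> norm v"
    using norm_fst_le[of "fst v" "snd v"] order_trans[OF abs_Re_le_cmod norm_snd_le[of "snd v" "fst v"]]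
      order_trans[OF abs_Im_le_cmod norm_snd_le[of "snd v" "fst v"]] by auto
  have "\<bar>fst z - fst x\<bar> \<le> norm (z - x)" using norm_fst_le[of "fst (z - x)" "snd (z - x)"] unfolding prod.collapse by simp
  then have 2: "\<bar>cos (fst z) - cos (fst x)\<bar> \<le> norm (z - x)" "\<bar>sin (fst z) - sin (fst x)\<bar> \<le> norm (z - x)"
    "\<bar>sin (fst x) - sin (fst z)\<bar> \<le> norm (z - x)"
    using abs_cos_diff[of "fst z" "fst x"] abs_sin_diff[of "fst z" "fst x"] by (auto simp: abs_minus_commute)
  have "rotated z v $ 2 - rotated x v $ 2 = (cos (fst z) - cos (fst x)) * Re (snd v) + (sin (fst z) - sin (fst x)) * Im (snd v)"
    "rotated z v $ 3 - rotated x v $ 3 = (sin (fst x) - sin (fst z)) * Re (snd v) + (cos (fst z) - cos (fst x)) * Im (snd v)"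
    by (simp_all add: rotated_nth algebra_simps)
  moreover have "\<bar>(cos (fst z) - cos (fst x)) * Re (snd v) + (sin (fst z) - sin (fst x)) * Im (snd v)\<bar> \<le> norm (z - x) * norm v + norm (z - x) * norm v"
    "\<bar>(sin (fst x) - sin (fst z)) * Re (snd v) + (cos (fst z) - cos (fst x)) * Im (snd v)\<bar> \<le> norm (z - x) * norm v + norm (z - x) * norm v"
    by (intro order_trans[OF abs_triangle_ineq] add_mono mult_bound 1 2)+
  ultimately show ?thesis using exhaust_3[of i] by (auto simp: rotated_nth(1) mult_ac)
qed

context bm_horizon
begin

abbreviation D :: "real^3 \<Rightarrow> 'w \<Rightarrow> real" where "D y \<omega> \<equiv> div_form T y (path \<omega>)"
abbreviation X :: "real \<times> complex \<Rightarrow> 'w \<Rightarrow> real \<times> complex" where "X x \<omega> \<equiv> kbm T x (path \<omega>)"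

text \<open>The coefficients of \<open>dual_pairing\<close> with respect to the coordinates of
  \<open>rotated x v\<close>. The dependence on \<open>v\<close> becomes explicit, and continuity in
  the starting point has to be shown for three scalar functions only.\<close>

definition weight_mean :: "(real \<times> complex \<Rightarrow> real) \<Rightarrow> real \<times> complex \<Rightarrow> 3 \<Rightarrow> real" where
  "weight_mean f x i = (LINT \<omega>|M. f (X x \<omega>) * D (axis i 1) \<omega>)"

definition dual_pairing :: "(real \<times> complex \<Rightarrow> real) \<Rightarrow> real \<times> complex \<Rightarrow> real \<times> complex \<Rightarrow> real" where
  "dual_pairing f x v = (LINT \<omega>|M. f (X x \<omega>) * D (rotated x v) \<omega>)"

abbreviation P :: "(real \<times> complex \<Rightarrow> real) \<Rightarrow> real \<times> complex \<Rightarrow> real" where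
  "P \<equiv> kbm_semigroup M B T"

lemma X_measurable [measurable]: "X x \<in> borel_measurable M"
  using measurable_kbm[OF joint_measurable] .

lemma int_cis_measurable [measurable]: "(\<lambda>\<omega>. LBINT s:{0..T}. cis (B s \<omega>)) \<in> borel_measurable M"
proof -
  have "(\<lambda>\<omega>. snd (X (0, 0) \<omega>)) \<in> borel_measurable M"
    by (rule measurable_compose[OF X_measurable]) (intro borel_measurable_continuous_onI continuous_intros)
  then show ?thesis by (simp add: kbm_def)
qed

lemma line_measurable [measurable]: "(\<lambda>p. X (x + fst p *\<^sub>R v) (snd p)) \<in> borel_measurable (lborel \<Otimes>\<^sub>M M)"
  unfolding kbm_def by simp

lemma kbm_deriv_measurable [measurable]: "(\<lambda>\<omega>. kbm_deriv T x (path \<omega>) v) \<in> borel_measurable M"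
  unfolding kbm_deriv_def by simp

lemma line_deriv_measurable [measurable]: "(\<lambda>p. kbm_deriv T (x + fst p *\<^sub>R v) (path (snd p)) v) \<in> borel_measurable (lborel \<Otimes>\<^sub>M M)"
  unfolding kbm_deriv_def by simp

lemma fD_integrable:
  assumes [measurable]: "f \<in> borel_measurable borel" and F: "\<And>y. \<bar>f y\<bar> \<le> F"
  shows "integrable M (\<lambda>\<omega>. f (X x \<omega>) * D y \<omega>)" "integrable M (\<lambda>\<omega>. f (X x \<omega>))"
proof -
  show "integrable M (\<lambda>\<omega>. f (X x \<omega>) * D y \<omega>)"
  proof (rule Bochner_Integration.integrable_bound)
    show "integrable M (\<lambda>\<omega>. F * \<bar>D y \<omega>\<bar>)" by (intro integrable_mult_right integrable_abs div_form_integrable)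
    show "AE \<omega> in M. norm (f (X x \<omega>) * D y \<omega>) \<le> norm (F * \<bar>D y \<omega>\<bar>)"
      unfolding real_norm_def by (intro AE_I2 order_trans[OF _ abs_ge_self] mult_bound F order_refl)
  qed measurable
  show "integrable M (\<lambda>\<omega>. f (X x \<omega>))" using F by (intro integrable_const_bound[of _ F]) auto
qed

lemma dual_pairing_eq:
  assumes "f \<in> borel_measurable borel" "\<And>y. \<bar>f y\<bar> \<le> F"
  shows "dual_pairing f x v = (\<Sum>i\<in>UNIV. rotated x v $ i * weight_mean f x i)"
proof -
  have "dual_pairing f x v = (LINT \<omega>|M. (\<Sum>i\<in>UNIV. rotated x v $ i * (f (X x \<omega>) * D (axis i 1) \<omega>)))"
    unfolding dual_pairing_def by (subst div_form_basis) (simp add: sum_distrib_left mult_ac)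
  then show ?thesis using fD_integrable[OF assms] by (simp add: weight_mean_def Bochner_Integration.integral_sum)
qed

definition weight_mass :: real where "weight_mass = (\<Sum>i\<in>UNIV. LINT \<omega>|M. \<bar>D (axis i 1) \<omega>\<bar>)"

lemma weight_mass_nonneg: "0 \<le> weight_mass" unfolding weight_mass_def by (intro sum_nonneg integral_nonneg_AE) auto

lemma weight_mean_bound:
  assumes "f \<in> borel_measurable borel" and F: "\<And>y. \<bar>f y\<bar> \<le> F"
  shows "\<bar>weight_mean f x i\<bar> \<le> F * (LINT \<omega>|M. \<bar>D (axis i 1) \<omega>\<bar>)"
proof -
  have "\<bar>weight_mean f x i\<bar> \<le> (LINT \<omega>|M. \<bar>f (X x \<omega>) * D (axis i 1) \<omega>\<bar>)" unfolding weight_mean_def by (rule integral_abs_bound)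
  also have "\<dots> \<le> (LINT \<omega>|M. F * \<bar>D (axis i 1) \<omega>\<bar>)"
    by (intro integral_mono integrable_abs fD_integrable[OF assms] integrable_mult_right div_form_integrable mult_bound F order_refl)
  finally show ?thesis by simp
qed

text \<open>Only the supremum of \<open>f\<close> enters, which later turns the Lipschitz bound for
  the semigroup into one in total variation.\<close>

lemma dual_pairing_bound:
  assumes "f \<in> borel_measurable borel" and F: "\<And>y. \<bar>f y\<bar> \<le> F"
  shows "\<bar>dual_pairing f x v\<bar> \<le> 2 * norm v * (F * weight_mass)"
proof -
  have "\<bar>dual_pairing f x v\<bar> \<le> (\<Sum>i\<in>UNIV. 2 * norm v * (F * (LINT \<omega>|M. \<bar>D (axis i 1) \<omega>\<bar>)))"
    unfolding dual_pairing_eq[OF assms] by (intro order_trans[OF sum_abs] sum_mono mult_bound rotated_bound weight_mean_bound assms)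
  then show ?thesis by (simp add: weight_mass_def sum_distrib_left)
qed

lemma dual_pairing_line_measurable:
  assumes [measurable]: "f \<in> borel_measurable borel" and F: "\<And>y. \<bar>f y\<bar> \<le> F"
  shows "(\<lambda>r. dual_pairing f (x + r *\<^sub>R v) v) \<in> borel_measurable borel"
proof -
  have weight_mean: "(\<lambda>r. weight_mean f (x + r *\<^sub>R v) i) \<in> borel_measurable borel" for i
  proof -
    have "(\<lambda>p. f (X (x + fst p *\<^sub>R v) (snd p)) * D (axis i 1) (snd p)) \<in> borel_measurable (lborel \<Otimes>\<^sub>M M)" by measurable
    then have "(\<lambda>r. LINT \<omega>|M. f (X (x + r *\<^sub>R v) \<omega>) * D (axis i 1) \<omega>) \<in> borel_measurable lborel"
      by (intro borel_measurable_lebesgue_integral) (simp add: case_prod_unfold)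
    then show ?thesis by (simp add: weight_mean_def)
  qed
  have [measurable]: "(\<lambda>r. rotated (x + r *\<^sub>R v) v $ i) \<in> borel_measurable borel" for i
    using exhaust_3[of i] by (auto simp: rotated_nth)
  note [measurable] = weight_mean
  show ?thesis unfolding dual_pairing_eq[OF assms] by measurable
qed

text \<open>The Malliavin derivative in \<open>ibp\<close> is replaced by the derivative in the
  starting point, through \<open>kbm_tangent_dir_eq\<close> on the almost sure event of
  invertibility.\<close>

lemma ibp_flow:
  assumes f: "bounded_C1 f f'"
  shows "(LINT \<omega>|M. blinfun_apply (f' (X x \<omega>)) (kbm_deriv T x (path \<omega>) v)) = dual_pairing f x v"
proof -
  obtain R where co: "AE \<omega> in M. coercive (1 / R \<omega>) (red_malliavin T (path \<omega>))" using nondegenerate[OF T] by blast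
  have "(LINT \<omega>|M. blinfun_apply (f' (X x \<omega>)) (kbm_deriv T x (path \<omega>) v)) 
     = (LINT \<omega>|M. blinfun_apply (f' (X x \<omega>)) (kbm_tangent_dir T x (rotated x v) (path \<omega>)))"
  proof (rule integral_cong_AE)
    show "(\<lambda>\<omega>. blinfun_apply (f' (X x \<omega>)) (kbm_deriv T x (path \<omega>) v)) \<in> borel_measurable M"
      by (rule bounded_C1_measurable_deriv[OF f]) measurable
    show "(\<lambda>\<omega>. blinfun_apply (f' (X x \<omega>)) (kbm_tangent_dir T x (rotated x v) (path \<omega>))) \<in> borel_measurable M"
      using ibp(1)[OF f] by (rule borel_measurable_integrable)
    show "AE \<omega> in M. blinfun_apply (f' (X x \<omega>)) (kbm_deriv T x (path \<omega>) v) = blinfun_apply (f' (X x \<omega>)) (kbm_tangent_dir T x (rotated x v) (path \<omega>))"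
      using co AE_space by eventually_elim (simp add: kbm_tangent_dir_eq[OF path_measurable T coercive_invertible])
  qed
  then show ?thesis by (simp add: ibp(2)[OF f] dual_pairing_def)
qed

text \<open>For C1 functions this is the fundamental theorem of calculus along the segment, Fubini
  and \<open>ibp_flow\<close>. No derivative of \<open>f\<close> is left in the formula, so it is
  stable under bounded pointwise limits.\<close>

theorem semigroup_increment:
  assumes f: "f \<in> borel_measurable borel" "bounded (range f)"
  shows "P f (x + v) - P f x = (LBINT r:{0..1}. dual_pairing f (x + r *\<^sub>R v) v)"
  using f
proof (rule bounded_borel_induct_C1[rotated 3])
  have bd: "\<exists>F. \<forall>y. \<bar>f y\<bar> \<le> F" if "bounded (range f)" for f :: "real \<times> complex \<Rightarrow> real"
    using that unfolding bounded_iff by auto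
  have Ji: "set_integrable lborel {0..1} (\<lambda>r. dual_pairing f (x + r *\<^sub>R v) v)" if "f \<in> borel_measurable borel" "\<And>y. \<bar>f y\<bar> \<le> F" for f F
    by (rule set_integrable_bounded[OF dual_pairing_line_measurable[OF that], where K = "2 * norm v * (F * weight_mass)"]) (use dual_pairing_bound[OF that] in simp)
  {
    fix f f' assume f: "bounded_C1 f f'"
    obtain F' where F': "\<And>y. norm (f' y) \<le> F'" using f unfolding bounded_C1_def bounded_iff by auto
    obtain F where F: "\<And>y. \<bar>f y\<bar> \<le> F" using f bd[of f] unfolding bounded_C1_def by blast
    note fm[measurable] = bounded_C1_measurable[OF f]
    let ?g = "\<lambda>r \<omega>. indicator {0..1} r * blinfun_apply (f' (X (x + r *\<^sub>R v) \<omega>)) (kbm_deriv T (x + r *\<^sub>R v) (path \<omega>) v)"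
    have mg: "(\<lambda>p. ?g (fst p) (snd p)) \<in> borel_measurable (lborel \<Otimes>\<^sub>M M)"
      by (intro borel_measurable_times bounded_C1_measurable_deriv[OF f]) measurable
    interpret L: pair_sigma_finite lborel M ..
    have F'0: "0 \<le> F'" using order_trans[OF norm_ge_zero F'] .
    have gb: "\<bar>?g r \<omega>\<bar> \<le> indicator {0..1} r * (F' * ((2 + T) * norm v))" if "\<omega> \<in> space M" for r \<omega>
    proof -
      have "\<bar>blinfun_apply (f' (X (x + r *\<^sub>R v) \<omega>)) (kbm_deriv T (x + r *\<^sub>R v) (path \<omega>) v)\<bar> \<le> F' * ((2 + T) * norm v)"
        using norm_blinfun[of "f' (X (x + r *\<^sub>R v) \<omega>)" "kbm_deriv T (x + r *\<^sub>R v) (path \<omega>) v"]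
          mult_mono[OF F' kbm_deriv_norm[OF path_measurable[OF that] T] F'0 norm_ge_zero]
        unfolding real_norm_def by (rule order_trans)
      then show ?thesis by (auto simp: indicator_def)
    qed
    have ig: "integrable (lborel \<Otimes>\<^sub>M M) (\<lambda>p. ?g (fst p) (snd p))"
    proof (rule L.Fubini_integrable[OF mg])
      have gi: "integrable M (\<lambda>\<omega>. ?g r \<omega>)" for r
        by (rule integrable_const_bound[of _ "indicator {0..1} r * (F' * ((2 + T) * norm v))"])
          (use gb measurable_compose[OF measurable_Pair1' mg, of r] in \<open>auto intro!: AE_I2\<close>)
      then show "AE r in lborel. integrable M (\<lambda>\<omega>. ?g (fst (r, \<omega>)) (snd (r, \<omega>)))" by simp
      show "integrable lborel (\<lambda>r. LINT \<omega>|M. norm (?g (fst (r, \<omega>)) (snd (r, \<omega>))))"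
      proof (rule Bochner_Integration.integrable_bound)
        show "integrable lborel (\<lambda>r :: real. indicator {0..1} r * (F' * ((2 + T) * norm v)))"
          by (intro integrable_mult_left integrable_real_indicator) auto
        show "(\<lambda>r. LINT \<omega>|M. norm (?g (fst (r, \<omega>)) (snd (r, \<omega>)))) \<in> borel_measurable lborel"
          using measurable_compose[OF mg borel_measurable_norm] by (intro borel_measurable_lebesgue_integral) (simp add: case_prod_unfold)
        have "(LINT \<omega>|M. norm (?g r \<omega>)) \<le> (LINT \<omega>|M. indicator {0..1} r * (F' * ((2 + T) * norm v)))" for r
          using gb gi[of r] by (intro integral_mono) auto
        moreover have "0 \<le> (LINT \<omega>|M. norm (?g r \<omega>))" for r by simp
        ultimately show "AE r in lborel. norm (LINT \<omega>|M. norm (?g (fst (r, \<omega>)) (snd (r, \<omega>)))) \<le> norm (indicator {0..1} r * (F' * ((2 + T) * norm v)))"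
          by (intro AE_I2) (simp add: prob_space order_trans[OF _ abs_ge_self])
      qed
    qed
    have "P f (x + v) - P f x = (LINT \<omega>|M. f (X (x + v) \<omega>) - f (X x \<omega>))"
      unfolding kbm_semigroup_def using fD_integrable(2)[OF fm F] by simp
    also have "\<dots> = (LINT \<omega>|M. LINT r|lborel. ?g r \<omega>)"
      unfolding kbm_FTC[OF f] set_lebesgue_integral_def by simp
    also have "\<dots> = (LINT r|lborel. LINT \<omega>|M. ?g r \<omega>)"
      using L.Fubini_integral[of "?g"] ig by (simp add: case_prod_unfold)
    also have "\<dots> = (LBINT r:{0..1}. dual_pairing f (x + r *\<^sub>R v) v)"
      by (simp add: set_lebesgue_integral_def ibp_flow[OF f])
    finally show "P f (x + v) - P f x = (LBINT r:{0..1}. dual_pairing f (x + r *\<^sub>R v) v)" .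
  next
    fix f g :: "real \<times> complex \<Rightarrow> real" and c
    assume V: "P f (x + v) - P f x = (LBINT r:{0..1}. dual_pairing f (x + r *\<^sub>R v) v)" "P g (x + v) - P g x = (LBINT r:{0..1}. dual_pairing g (x + r *\<^sub>R v) v)"
      and m: "f \<in> borel_measurable borel" "g \<in> borel_measurable borel" and b: "bounded (range f)" "bounded (range g)"
    obtain F G where F: "\<And>y. \<bar>f y\<bar> \<le> F" and G: "\<And>y. \<bar>g y\<bar> \<le> G" using bd[OF b(1)] bd[OF b(2)] by blast
    have P: "P (\<lambda>y. f y + c * g y) z = P f z + c * P g z" for z
      unfolding kbm_semigroup_def using fD_integrable(2)[OF m(1) F] fD_integrable(2)[OF m(2) G] by simp
    have dual_pairing: "dual_pairing (\<lambda>y. f y + c * g y) z v = dual_pairing f z v + c * dual_pairing g z v" for z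
    proof -
      have "dual_pairing (\<lambda>y. f y + c * g y) z v = (LINT \<omega>|M. f (X z \<omega>) * D (rotated z v) \<omega> + c * (g (X z \<omega>) * D (rotated z v) \<omega>))"
        unfolding dual_pairing_def by (simp add: distrib_right mult.assoc)
      then show ?thesis unfolding dual_pairing_def using fD_integrable(1)[OF m(1) F] fD_integrable(1)[OF m(2) G] by simp
    qed
    show "P (\<lambda>y. f y + c * g y) (x + v) - P (\<lambda>y. f y + c * g y) x = (LBINT r:{0..1}. dual_pairing (\<lambda>y. f y + c * g y) (x + r *\<^sub>R v) v)"
      unfolding P dual_pairing using V Ji[OF m(1) F] Ji[OF m(2) G]
      by (subst set_integral_add(2)) (auto simp: algebra_simps)
  next
    fix F :: "nat \<Rightarrow> real \<times> complex \<Rightarrow> real" and f K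
    assume V: "\<And>n. P (F n) (x + v) - P (F n) x = (LBINT r:{0..1}. dual_pairing (F n) (x + r *\<^sub>R v) v)"
      and m[measurable]: "\<And>n. F n \<in> borel_measurable borel" "f \<in> borel_measurable borel"
      and b: "\<And>n y. \<bar>F n y\<bar> \<le> K" "\<And>y. \<bar>f y\<bar> \<le> K" and l: "\<And>y. (\<lambda>n. F n y) \<longlonglongrightarrow> f y"
    have lP: "(\<lambda>n. P (F n) z) \<longlonglongrightarrow> P f z" for z
      unfolding kbm_semigroup_def by (rule integral_dominated_convergence[where w = "\<lambda>_. K"]) (auto simp: b l)
    have lJ: "(\<lambda>n. dual_pairing (F n) z v) \<longlonglongrightarrow> dual_pairing f z v" for z
      unfolding dual_pairing_def
    proof (rule integral_dominated_convergence[where w = "\<lambda>\<omega>. K * \<bar>D (rotated z v) \<omega>\<bar>"])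
      show "AE \<omega> in M. norm (F n (X z \<omega>) * D (rotated z v) \<omega>) \<le> K * \<bar>D (rotated z v) \<omega>\<bar>" for n
        unfolding real_norm_def by (intro AE_I2 mult_bound b order_refl)
    qed (auto intro!: tendsto_mult l div_form_integrable)
    have "(\<lambda>n. LBINT r:{0..1}. dual_pairing (F n) (x + r *\<^sub>R v) v) \<longlonglongrightarrow> (LBINT r:{0..1}. dual_pairing f (x + r *\<^sub>R v) v)"
      by (rule set_integral_tendsto[where K = "2 * norm v * (K * weight_mass)"])
         (auto intro!: dual_pairing_line_measurable[OF m(1) b(1)] dual_pairing_line_measurable[OF m(2) b(2)] lJ dual_pairing_bound[OF m(1) b(1)])
    moreover have "(\<lambda>n. P (F n) (x + v) - P (F n) x) \<longlonglongrightarrow> P f (x + v) - P f x" by (intro tendsto_diff lP)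
    ultimately show "P f (x + v) - P f x = (LBINT r:{0..1}. dual_pairing f (x + r *\<^sub>R v) v)"
      unfolding V by (rule LIMSEQ_unique[rotated])
  }
qed

end

section \<open>Continuity of the coefficients and differentiability\<close>

context bm_horizon
begin

lemma P_Lipschitz:
  assumes f: "f \<in> borel_measurable borel" and F: "\<And>y. \<bar>f y\<bar> \<le> F"
  shows "\<bar>P f y - P f x\<bar> \<le> 2 * norm (y - x) * (F * weight_mass)"
proof -
  have b: "bounded (range f)" using F by (intro boundedI[of _ F]) auto
  have "\<bar>P f (x + (y - x)) - P f x\<bar> \<le> (2 * norm (y - x) * (F * weight_mass)) * (1 - 0)"
    unfolding semigroup_increment[OF f b]
    using set_integral_norm_le[OF dual_pairing_line_measurable[OF f F, of x "y - x"], of 0 1 "2 * norm (y - x) * (F * weight_mass)"] dual_pairing_bound[OF f F] by simp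
  then show ?thesis by simp
qed

text \<open>Continuity survives bounded pointwise limits because convergence in \<open>L\<^sup>1\<close> of the law of \<open>X x\<close>
  is, by \<open>P_Lipschitz\<close>, uniform for starting points near \<open>x\<close>.\<close>

lemma weight_mean_continuous:
  assumes f: "f \<in> borel_measurable borel" "bounded (range f)"
  shows "isCont (\<lambda>y. weight_mean f y i) x"
  using f
proof (rule bounded_borel_induct_C1[rotated 3])
  have bd: "\<exists>F. \<forall>y. \<bar>f y\<bar> \<le> F" if "bounded (range f)" for f :: "real \<times> complex \<Rightarrow> real"
    using that unfolding bounded_iff by auto
  {
    fix f f' assume f: "bounded_C1 f f'"
    obtain F where F: "\<And>y. \<bar>f y\<bar> \<le> F" using f bd[of f] unfolding bounded_C1_def by blast
    note [measurable] = bounded_C1_measurable[OF f]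
    have cf: "isCont f y" for y using f has_derivative_continuous unfolding bounded_C1_def by blast
    show "isCont (\<lambda>y. weight_mean f y i) x"
      unfolding continuous_at_sequentially
    proof (intro allI impI)
      fix u assume u: "u \<longlonglongrightarrow> x"
      have kl: "(\<lambda>n. X (u n) \<omega>) \<longlonglongrightarrow> X x \<omega>" for \<omega>
        unfolding kbm_def cis_conv_exp using u by (intro tendsto_intros)
      show "((\<lambda>y. weight_mean f y i) \<circ> u) \<longlonglongrightarrow> weight_mean f x i"
        unfolding o_def weight_mean_def
      proof (rule integral_dominated_convergence[where w = "\<lambda>\<omega>. F * \<bar>D (axis i 1) \<omega>\<bar>"])
        show "AE \<omega> in M. norm (f (X (u n) \<omega>) * D (axis i 1) \<omega>) \<le> F * \<bar>D (axis i 1) \<omega>\<bar>" for n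
          unfolding real_norm_def by (intro AE_I2 mult_bound F order_refl)
        show "AE \<omega> in M. (\<lambda>n. f (X (u n) \<omega>) * D (axis i 1) \<omega>) \<longlonglongrightarrow> f (X x \<omega>) * D (axis i 1) \<omega>"
          by (intro AE_I2 tendsto_mult tendsto_const isCont_tendsto_compose[OF cf kl])
      qed (auto intro!: div_form_integrable)
    qed
  next
    fix f g :: "real \<times> complex \<Rightarrow> real" and c
    assume V: "isCont (\<lambda>y. weight_mean f y i) x" "isCont (\<lambda>y. weight_mean g y i) x"
      and m: "f \<in> borel_measurable borel" "g \<in> borel_measurable borel" and b: "bounded (range f)" "bounded (range g)"
    obtain F G where F: "\<And>y. \<bar>f y\<bar> \<le> F" and G: "\<And>y. \<bar>g y\<bar> \<le> G" using bd[OF b(1)] bd[OF b(2)] by blast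
    have "weight_mean (\<lambda>y. f y + c * g y) z i = weight_mean f z i + c * weight_mean g z i" for z
    proof -
      have "weight_mean (\<lambda>y. f y + c * g y) z i = (LINT \<omega>|M. f (X z \<omega>) * D (axis i 1) \<omega> + c * (g (X z \<omega>) * D (axis i 1) \<omega>))"
        unfolding weight_mean_def by (simp add: distrib_right mult.assoc)
      then show ?thesis unfolding weight_mean_def using fD_integrable(1)[OF m(1) F] fD_integrable(1)[OF m(2) G] by simp
    qed
    then show "isCont (\<lambda>y. weight_mean (\<lambda>y. f y + c * g y) y i) x" using V by (simp add: continuous_intros)
  next
    fix F :: "nat \<Rightarrow> real \<times> complex \<Rightarrow> real" and f K
    assume V: "\<And>n. isCont (\<lambda>y. weight_mean (F n) y i) x"
      and m[measurable]: "\<And>n. F n \<in> borel_measurable borel" "f \<in> borel_measurable borel"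
      and b: "\<And>n y. \<bar>F n y\<bar> \<le> K" "\<And>y. \<bar>f y\<bar> \<le> K" and l: "\<And>y. (\<lambda>n. F n y) \<longlonglongrightarrow> f y"
    define D2 where "D2 = (LINT \<omega>|M. \<bar>D (axis i 1) \<omega>\<bar> ^ 2)"
    have iD2: "integrable M (\<lambda>\<omega>. \<bar>D (axis i 1) \<omega>\<bar> ^ 2)" by (rule div_form_moment) simp
    have D20: "0 \<le> D2" unfolding D2_def by (intro integral_nonneg_AE) auto
    \<comment> \<open>\<open>P (g n) y\<close> is the squared L2 distance between \<open>F n\<close>
      and \<open>f\<close> under the law of \<open>X y\<close>, and \<open>P_Lipschitz\<close>
      applies to it with a constant independent of \<open>n\<close>.\<close>
    define g where "g n y = (F n y - f y)\<^sup>2" for n y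
    have gm[measurable]: "g n \<in> borel_measurable borel" for n unfolding g_def[abs_def] by measurable
    have gb: "\<bar>g n y\<bar> \<le> (2 * K)\<^sup>2" for n y
    proof -
      have "\<bar>F n y - f y\<bar> \<le> 2 * K" using b(1)[of n y] b(2)[of y] by linarith
      then have "\<bar>F n y - f y\<bar>\<^sup>2 \<le> (2 * K)\<^sup>2" by (intro power_mono) auto
      then show ?thesis by (simp add: g_def)
    qed
    have gl: "(\<lambda>n. P (g n) x) \<longlonglongrightarrow> 0"
    proof -
      have "(\<lambda>n. P (g n) x) \<longlonglongrightarrow> (LINT \<omega>|M. 0)"
        unfolding kbm_semigroup_def
      proof (rule integral_dominated_convergence[where w = "\<lambda>_. (2 * K)\<^sup>2"])
        have "(\<lambda>n. g n y) \<longlonglongrightarrow> (f y - f y)\<^sup>2" for y unfolding g_def by (intro tendsto_intros l)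
        then show "AE \<omega> in M. (\<lambda>n. g n (X x \<omega>)) \<longlonglongrightarrow> 0" by simp
        show "AE \<omega> in M. norm (g n (X x \<omega>)) \<le> (2 * K)\<^sup>2" for n unfolding real_norm_def by (intro AE_I2 gb)
      qed auto
      then show ?thesis by simp
    qed
    \<comment> \<open>The Cauchy-Schwarz inequality in weighted additive form; the parameter
      \<open>s\<close> is chosen below.\<close>
    have cs: "\<bar>weight_mean (F n) y i - weight_mean f y i\<bar> \<le> P (g n) y / s + s * D2" if s: "s > 0" for n y s
    proof -
      have "weight_mean (F n) y i - weight_mean f y i = (LINT \<omega>|M. (F n (X y \<omega>) - f (X y \<omega>)) * D (axis i 1) \<omega>)"
        unfolding weight_mean_def using fD_integrable(1)[OF m(1) b(1)] fD_integrable(1)[OF m(2) b(2)] by (simp add: left_diff_distrib)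
      also have "\<bar>\<dots>\<bar> \<le> (LINT \<omega>|M. \<bar>(F n (X y \<omega>) - f (X y \<omega>)) * D (axis i 1) \<omega>\<bar>)" by (rule integral_abs_bound)
      also have "\<dots> \<le> (LINT \<omega>|M. g n (X y \<omega>) / s + s * \<bar>D (axis i 1) \<omega>\<bar> ^ 2)"
      proof (rule integral_mono)
        show "integrable M (\<lambda>\<omega>. \<bar>(F n (X y \<omega>) - f (X y \<omega>)) * D (axis i 1) \<omega>\<bar>)"
          using fD_integrable(1)[OF m(1) b(1)] fD_integrable(1)[OF m(2) b(2)] by (simp add: left_diff_distrib)
        show "integrable M (\<lambda>\<omega>. g n (X y \<omega>) / s + s * \<bar>D (axis i 1) \<omega>\<bar> ^ 2)"
          using fD_integrable(2)[OF gm gb] iD2 by simp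
        fix \<omega>
        let ?a = "\<bar>F n (X y \<omega>) - f (X y \<omega>)\<bar>" and ?d = "\<bar>D (axis i 1) \<omega>\<bar>"
        have "s * (?a * ?d) = ?a * (s * ?d)" by simp
        also have "\<dots> \<le> ?a\<^sup>2 + (s * ?d)\<^sup>2" by (rule two_mult_le)
        also have "\<dots> = s * (g n (X y \<omega>) / s + s * ?d ^ 2)"
          using s by (simp add: g_def field_simps power2_eq_square)
        finally show "\<bar>(F n (X y \<omega>) - f (X y \<omega>)) * D (axis i 1) \<omega>\<bar> \<le> g n (X y \<omega>) / s + s * ?d ^ 2"
          using s by (simp add: abs_mult)
      qed
      also have "\<dots> = P (g n) y / s + s * D2"
        using fD_integrable(2)[OF gm gb] iD2 by (simp add: kbm_semigroup_def D2_def)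
      finally show ?thesis .
    qed
    show "isCont (\<lambda>y. weight_mean f y i) x"
      unfolding continuous_at_eps_delta
    proof (intro allI impI)
      fix e :: real assume e: "0 < e"
      \<comment> \<open>This leaves at most \<open>e / 8\<close> for the term with
        \<open>D2\<close>. The distance term also gets \<open>e / 8\<close>: half of it from the
        choice of \<open>n\<close> at \<open>x\<close>, half from the Lipschitz bound near
        \<open>x\<close>.\<close>
      define s where "s = e / (8 * (D2 + 1))"
      have s: "s > 0" using e D20 by (simp add: s_def)
      have sD: "s * D2 \<le> e / 8"
      proof -
        have "s * D2 \<le> s * (D2 + 1)" using s by simp
        also have "\<dots> = e / 8" using D20 by (simp add: s_def field_simps)
        finally show ?thesis .
      qed
      have es: "0 < e * s / 16" using e s by simp
      from LIMSEQ_D[OF gl es] obtain n where "norm (P (g n) x - 0) < e * s / 16" by blast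
      then have n: "P (g n) x \<le> e * s / 16" by simp
      define C where "C = (2 * K)\<^sup>2 * weight_mass"
      have C0: "0 \<le> C" unfolding C_def using weight_mass_nonneg by simp
      obtain d1 where d1: "d1 > 0" "\<And>y. dist y x < d1 \<Longrightarrow> dist (weight_mean (F n) y i) (weight_mean (F n) x i) < e / 4"
        using V[of n, unfolded continuous_at_eps_delta, THEN spec, of "e / 4"] e by auto
      define d where "d = min d1 (e * s / (32 * (C + 1)))"
      have d: "d > 0" unfolding d_def using d1 e s C0 by simp
      have near: "\<bar>weight_mean (F n) y i - weight_mean f y i\<bar> \<le> e / 4" if y: "dist y x < d" for y
      proof -
        have "P (g n) y \<le> P (g n) x + 2 * norm (y - x) * C"
          using P_Lipschitz[OF gm gb, of n y x] unfolding C_def by linarith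
        also have "2 * norm (y - x) * C \<le> e * s / 16"
        proof -
          have "norm (y - x) \<le> e * s / (32 * (C + 1))" using y unfolding d_def dist_norm by linarith
          then have "2 * norm (y - x) * C \<le> 2 * (e * s / (32 * (C + 1))) * (C + 1)"
            using C0 es by (intro mult_mono) auto
          also have "\<dots> = e * s / 16" using C0 by (simp add: field_simps)
          finally show ?thesis .
        qed
        finally have "P (g n) y \<le> e * s / 8" using n by simp
        then have "P (g n) y / s \<le> e / 8" using s by (simp add: field_simps)
        with cs[OF s, of n y] sD show ?thesis by linarith
      qed
      show "\<exists>d>0. \<forall>y. dist y x < d \<longrightarrow> dist (weight_mean f y i) (weight_mean f x i) < e"
      proof (intro exI[of _ d] conjI allI impI d)
        fix y assume y: "dist y x < d"
        have "dist (weight_mean (F n) y i) (weight_mean (F n) x i) < e / 4" using y by (intro d1) (simp add: d_def)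
        moreover have "\<bar>weight_mean (F n) x i - weight_mean f x i\<bar> \<le> e / 4" using d by (intro near) simp
        ultimately show "dist (weight_mean f y i) (weight_mean f x i) < e" using near[OF y] e unfolding dist_real_def by linarith
      qed
    qed
  }
qed

text \<open>The increment is an average of the pairing over a segment, so it suffices to compare the
  pairing at the points of the segment with the one at \<open>x\<close>.\<close>

theorem P_has_derivative:
  assumes f: "f \<in> borel_measurable borel" "bounded (range f)"
  shows "(P f has_derivative dual_pairing f x) (at x)"
proof -
  obtain F where F: "\<And>y. \<bar>f y\<bar> \<le> F" using f(2) unfolding bounded_iff by auto
  have bl: "bounded_linear (dual_pairing f x)"
  proof -
    have "linear (\<lambda>v. rotated x v $ i)" for i
      using exhaust_3[of i] by (auto simp: rotated_nth linear_iff algebra_simps)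
    then have "linear (\<lambda>v. \<Sum>i\<in>UNIV. rotated x v $ i * weight_mean f x i)"
      by (intro linear_compose_sum ballI) (auto simp: linear_iff algebra_simps)
    then show ?thesis unfolding dual_pairing_eq[OF f(1) F, abs_def] by (simp add: linear_conv_bounded_linear)
  qed
  define Q where "Q = (\<Sum>i\<in>UNIV. \<bar>weight_mean f x i\<bar>)"
  have Q0: "0 \<le> Q" unfolding Q_def by (intro sum_nonneg) auto
  show ?thesis unfolding has_derivative_at_alt
  proof (intro conjI allI impI bl)
    fix e :: real assume e: "0 < e"
    have "\<exists>d>0. \<forall>z. dist z x < d \<longrightarrow> dist (weight_mean f z i) (weight_mean f x i) < e / 12" for i
      using weight_mean_continuous[OF f, where i = i and x = x, unfolded continuous_at_eps_delta, THEN spec, of "e / 12"] e by auto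
    then obtain \<delta> where \<delta>: "\<And>i. \<delta> i > 0" "\<And>i z. dist z x < \<delta> i \<Longrightarrow> dist (weight_mean f z i) (weight_mean f x i) < e / 12" by metis
    \<comment> \<open>Three coordinates, each at most \<open>2 * norm (y - x)\<close> times
      \<open>e / 12\<close>, use half of the allowance \<open>e * norm (y - x)\<close>; the radius
      \<open>e / (4 * (Q + 1))\<close> keeps the rotation of the coefficients within the other
      half.\<close>
    define d where "d = min (min (\<delta> 1) (min (\<delta> 2) (\<delta> 3))) (e / (4 * (Q + 1)))"
    have d: "d > 0" using \<delta>(1) e Q0 by (simp add: d_def)
    show "\<exists>d>0. \<forall>y. norm (y - x) < d \<longrightarrow> norm (P f y - P f x - dual_pairing f x (y - x)) \<le> e * norm (y - x)"
    proof (intro exI[of _ d] conjI allI impI d)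
      fix y assume y: "norm (y - x) < d"
      let ?v = "y - x"
      have close: "\<bar>dual_pairing f (x + r *\<^sub>R ?v) ?v - dual_pairing f x ?v\<bar> \<le> e * norm ?v" if r: "r \<in> {0..1}" for r
      proof -
        let ?z = "x + r *\<^sub>R ?v"
        have "norm (?z - x) \<le> 1 * norm ?v" using r by (auto simp: mult_left_le_one_le)
        then have zd: "norm (?z - x) < d" "norm (?z - x) \<le> e / (4 * (Q + 1))" using y by (auto simp: d_def)
        have qd: "\<bar>weight_mean f ?z i - weight_mean f x i\<bar> \<le> e / 12" for i
          using \<delta>(2)[of ?z i] zd(1) exhaust_3[of i] by (auto simp: d_def dist_norm intro: less_imp_le)
        have eq: "dual_pairing f ?z ?v - dual_pairing f x ?v = (\<Sum>i\<in>UNIV. rotated ?z ?v $ i * (weight_mean f ?z i - weight_mean f x i) + (rotated ?z ?v $ i - rotated x ?v $ i) * weight_mean f x i)"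
          unfolding dual_pairing_eq[OF f(1) F] sum_subtractf[symmetric] by (intro sum.cong) (auto simp: algebra_simps)
        have "\<bar>dual_pairing f ?z ?v - dual_pairing f x ?v\<bar> \<le> (\<Sum>i\<in>UNIV. (2 * norm ?v) * (e / 12) + (2 * (e / (4 * (Q + 1))) * norm ?v) * \<bar>weight_mean f x i\<bar>)"
          unfolding eq
        proof (rule order_trans[OF sum_abs sum_mono], rule order_trans[OF abs_triangle_ineq add_mono])
          fix i
          show "\<bar>rotated ?z ?v $ i * (weight_mean f ?z i - weight_mean f x i)\<bar> \<le> 2 * norm ?v * (e / 12)"
            by (intro mult_bound rotated_bound qd)
          have "2 * norm (?z - x) * norm ?v \<le> 2 * (e / (4 * (Q + 1))) * norm ?v"
            using zd by (intro mult_right_mono mult_left_mono) auto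
          then show "\<bar>(rotated ?z ?v $ i - rotated x ?v $ i) * weight_mean f x i\<bar> \<le> 2 * (e / (4 * (Q + 1))) * norm ?v * \<bar>weight_mean f x i\<bar>"
            by (intro mult_bound order_trans[OF rotated_diff_bound] order_refl)
        qed
        also have "\<dots> = e / 2 * norm ?v + e / 2 * norm ?v * (Q / (Q + 1))"
        proof -
          have "(\<Sum>i\<in>UNIV. (2 * norm ?v) * (e / 12) + (2 * (e / (4 * (Q + 1))) * norm ?v) * \<bar>weight_mean f x i\<bar>)
            = 3 * ((2 * norm ?v) * (e / 12)) + (2 * (e / (4 * (Q + 1))) * norm ?v) * Q"
            by (simp add: sum.distrib Q_def sum_distrib_left)
          then show ?thesis using Q0 by (simp add: field_simps)
        qed
        also have "\<dots> \<le> e / 2 * norm ?v + e / 2 * norm ?v * 1"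
          using Q0 e by (intro add_left_mono mult_left_mono) auto
        finally show ?thesis by simp
      qed
      have m: "(\<lambda>r. dual_pairing f (x + r *\<^sub>R ?v) ?v) \<in> borel_measurable borel" by (rule dual_pairing_line_measurable[OF f(1) F])
      have "P f y - P f x - dual_pairing f x ?v = (LBINT r:{0..1}. dual_pairing f (x + r *\<^sub>R ?v) ?v - dual_pairing f x ?v)"
      proof (subst set_integral_diff(2))
        show "set_integrable lborel {0..1} (\<lambda>r. dual_pairing f (x + r *\<^sub>R ?v) ?v)"
          by (rule set_integrable_bounded[OF m, where K = "2 * norm ?v * (F * weight_mass)"]) (use dual_pairing_bound[OF f(1) F] in simp)
        show "set_integrable lborel {0..1} (\<lambda>r :: real. dual_pairing f x ?v)"
          by (rule set_integrable_bounded[where K = "\<bar>dual_pairing f x ?v\<bar>"]) auto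
        show "P f y - P f x - dual_pairing f x ?v = (LBINT r:{0..1}. dual_pairing f (x + r *\<^sub>R ?v) ?v) - (LBINT r:{0..1::real}. dual_pairing f x ?v)"
          using semigroup_increment[OF f, of x ?v] by (simp add: set_integral_const)
      qed
      also have "\<bar>\<dots>\<bar> \<le> e * norm ?v * (1 - 0)"
        using set_integral_norm_le[of "\<lambda>r. dual_pairing f (x + r *\<^sub>R ?v) ?v - dual_pairing f x ?v" 0 1 "e * norm ?v"] close m by simp
      finally show "norm (P f y - P f x - dual_pairing f x ?v) \<le> e * norm ?v" by simp
    qed
  qed
qed

end

section \<open>Dependence on the path over [0,T] only\<close>

context
  fixes T :: real and b b' :: "real \<Rightarrow> real"
  assumes eq: "\<And>s. s \<in> {0..T} \<Longrightarrow> b s = b' s"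
begin

lemma kbm_cong: "0 \<le> T \<Longrightarrow> kbm T x b = kbm T x b'"
  unfolding kbm_def using eq by (auto intro!: set_lebesgue_integral_cong)

lemma h_vec_cong': "t \<in> {0..T} \<Longrightarrow> h_vec b t = h_vec b' t"
  using eq by (intro h_vec_cong) auto

lemma weight_vec_cong: "weight_vec T x v b = weight_vec T x v b'"
proof -
  have "red_malliavin T b = red_malliavin T b'"
    unfolding vec_eq_iff red_malliavin_nth by (intro allI set_lebesgue_integral_cong) (auto simp: h_vec_cong')
  then show ?thesis by (simp add: weight_vec_def)
qed

lemma red_malliavin_cong: "red_malliavin T b = red_malliavin T b'"
  unfolding vec_eq_iff red_malliavin_nth by (intro allI set_lebesgue_integral_cong) (auto simp: h_vec_cong')

lemma h_dir_cong: "t \<in> {0..T} \<Longrightarrow> h_dir T x v b t = h_dir T x v b' t"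
  by (simp add: h_dir_def a_adj_def weight_vec_cong h_vec_cong')

lemma K_mat_cong: "t \<in> {0..T} \<Longrightarrow> s \<in> {0..t} \<Longrightarrow> K_mat b t s = K_mat b' t s"
proof -
  assume t: "t \<in> {0..T}" "s \<in> {0..t}"
  have "(LBINT r:{0..t}. cis (b r)) = (LBINT r:{0..t}. cis (b' r))"
    using t eq by (intro set_lebesgue_integral_cong) auto
  then show ?thesis using t eq by (simp add: K_mat_def)
qed

lemma delta_h_cong:
  assumes T: "0 \<le> T" shows "delta_h T x v b = delta_h T x v b'"
proof -
  have 1: "(LBINT t:{0..T}. cis (b t) * of_real (b T - b t)) = (LBINT t:{0..T}. cis (b' t) * of_real (b' T - b' t))"
    using T eq by (intro set_lebesgue_integral_cong) auto
  have 2: "(LBINT \<rho>:{0..s}. cis (b \<rho>) * of_real (\<rho> - s)) = (LBINT \<rho>:{0..s}. cis (b' \<rho>) * of_real (\<rho> - s))" if "s \<in> {0..T}" for s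
    using that eq by (intro set_lebesgue_integral_cong) auto
  have 3: "(LBINT s:{0..t}. col3 (s, \<i> * (LBINT \<rho>:{0..s}. cis (b \<rho>) * of_real (\<rho> - s))) \<bullet> (matrix_inv (red_malliavin T b) *v (K_mat b t s *v weight_vec T x v b)))
    = (LBINT s:{0..t}. col3 (s, \<i> * (LBINT \<rho>:{0..s}. cis (b' \<rho>) * of_real (\<rho> - s))) \<bullet> (matrix_inv (red_malliavin T b') *v (K_mat b' t s *v weight_vec T x v b')))"
    if t: "t \<in> {0..T}" for t
  proof (intro set_lebesgue_integral_cong allI impI)
    fix s assume "s \<in> {0..t}"
    then have "s \<in> {0..T}" "s \<in> {0..t}" using t by auto
    then show "col3 (s, \<i> * (LBINT \<rho>:{0..s}. cis (b \<rho>) * of_real (\<rho> - s))) \<bullet> (matrix_inv (red_malliavin T b) *v (K_mat b t s *v weight_vec T x v b))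
      = col3 (s, \<i> * (LBINT \<rho>:{0..s}. cis (b' \<rho>) * of_real (\<rho> - s))) \<bullet> (matrix_inv (red_malliavin T b') *v (K_mat b' t s *v weight_vec T x v b'))"
      by (simp only: 2 K_mat_cong[OF t] weight_vec_cong red_malliavin_cong)
  qed simp
  have 4: "b T = b' T" using T by (intro eq) auto
  have 5: "(LBINT t:{0..T}. LBINT s:{0..t}. col3 (s, \<i> * (LBINT \<rho>:{0..s}. cis (b \<rho>) * of_real (\<rho> - s))) \<bullet> (matrix_inv (red_malliavin T b) *v (K_mat b t s *v weight_vec T x v b)))
    = (LBINT t:{0..T}. LBINT s:{0..t}. col3 (s, \<i> * (LBINT \<rho>:{0..s}. cis (b' \<rho>) * of_real (\<rho> - s))) \<bullet> (matrix_inv (red_malliavin T b') *v (K_mat b' t s *v weight_vec T x v b')))"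
    by (rule set_lebesgue_integral_cong, simp, intro allI impI, rule 3)
  show ?thesis unfolding delta_h_def 5 1 unfolding 4 weight_vec_cong ..
qed

lemma malliavin_deriv_cong:
  assumes T: "0 \<le> T" and g: "\<And>t. t \<in> {0..T} \<Longrightarrow> g t = g' t"
  shows "malliavin_deriv T x b g = malliavin_deriv T x b' g'"
proof -
  have 1: "(LBINT s:{0..t}. g s) = (LBINT s:{0..t}. g' s)" if "t \<in> {0..T}" for t
    using that g by (intro set_lebesgue_integral_cong) auto
  have 2: "(LBINT t:{0..T}. cis (b t) * of_real (LBINT s:{0..t}. g s)) = (LBINT t:{0..T}. cis (b' t) * of_real (LBINT s:{0..t}. g' s))"
    using eq by (intro set_lebesgue_integral_cong) (auto simp: 1)
  show ?thesis unfolding malliavin_deriv_def 2 using T 1[of T] by simp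
qed

end

lemma L2_norm_cong: "(\<And>t. t \<in> {0..T} \<Longrightarrow> g t = g' t) \<Longrightarrow> L2_norm T g = L2_norm T g'"
  unfolding L2_norm_def L2_inner_def by (auto intro!: arg_cong[where f = sqrt] set_lebesgue_integral_cong)

section \<open>Moments and duality for the direction and its dual\<close>

context bm_horizon
begin

text \<open>Integer moments suffice, since a real power is at most 1 plus the next integer
  power.\<close>

lemma powr_integrable:
  fixes p :: real
  assumes [measurable]: "Y \<in> borel_measurable M" and Y: "\<And>n. n > 0 \<Longrightarrow> integrable M (\<lambda>\<omega>. \<bar>Y \<omega>\<bar> ^ n)" and p: "p \<ge> 1"
  shows "integrable M (\<lambda>\<omega>. \<bar>Y \<omega>\<bar> powr p)"
proof -
  define n where "n = nat \<lceil>p\<rceil>"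
  have n: "n > 0" "p \<le> real n" using p by (auto simp: n_def)
  have "\<bar>y\<bar> powr p \<le> 1 + \<bar>y\<bar> ^ n" for y :: real
  proof (cases "\<bar>y\<bar> \<le> 1")
    case True
    then have "\<bar>y\<bar> powr p \<le> 1" using p by (intro powr_le1) auto
    then show ?thesis by (simp add: add_increasing2)
  next
    case False
    then have "\<bar>y\<bar> powr p \<le> \<bar>y\<bar> powr real n" using n by (intro powr_mono) auto
    also have "\<dots> = \<bar>y\<bar> ^ n" using False by (intro powr_realpow) auto
    finally show ?thesis by simp
  qed
  then show ?thesis
    by (intro Bochner_Integration.integrable_bound[of M "\<lambda>\<omega>. 1 + \<bar>Y \<omega>\<bar> ^ n" "\<lambda>\<omega>. \<bar>Y \<omega>\<bar> powr p"] AE_I2)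
       (auto simp: Y n intro: order_trans)
qed

lemma h_dir_eq: "h_dir T x v b t = - (\<Sum>i\<in>UNIV. gram_weight T (rotated x v) b $ i * h_vec b t $ i)"
  by (simp add: h_dir_def a_adj_def weight_vec_eq)

lemma h_dir_joint_measurable: "case_prod (\<lambda>\<omega> t. h_dir T x v (path \<omega>) t) \<in> borel_measurable (M \<Otimes>\<^sub>M borel)"
proof -
  note [measurable] = measurable_h_vec[OF joint_measurable]
  show ?thesis unfolding h_dir_eq by measurable
qed

lemma h_dir_bound:
  assumes \<omega>: "\<omega> \<in> space M" and t: "t \<in> {0..T}"
  shows "\<bar>h_dir T x v (path \<omega>) t\<bar> \<le> 3 * (norm (gram_weight T (rotated x v) (path \<omega>)) * (1 + T))"
proof -
  have "\<bar>h_dir T x v (path \<omega>) t\<bar> \<le> (\<Sum>i\<in>(UNIV::3 set). norm (gram_weight T (rotated x v) (path \<omega>)) * (1 + T))"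
    unfolding h_dir_eq abs_minus_cancel
    by (intro order_trans[OF sum_abs] sum_mono mult_bound component_le_norm_cart h_vec_bound' path_measurable \<omega> t)
  then show ?thesis by simp
qed

lemma h_dir_section [measurable]: "\<omega> \<in> space M \<Longrightarrow> h_dir T x v (path \<omega>) \<in> borel_measurable borel"
  using measurable_compose_Pair1[OF _ h_dir_joint_measurable[of x v]] by simp

lemma random_L2_h_dir: "random_L2 M T (\<lambda>\<omega>. h_dir T x v (path \<omega>))"
  unfolding random_L2_def
proof (intro conjI ballI)
  have "(\<lambda>p. p) \<in> measurable (M \<Otimes>\<^sub>M restrict_space lborel {0..T}) (M \<Otimes>\<^sub>M borel)"
  proof -
    have "(\<lambda>t. t) \<in> measurable (restrict_space lborel {0..T}) borel"
      by (rule measurable_restrict_space1) simp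
    then have "(\<lambda>p. (fst p, snd p)) \<in> measurable (M \<Otimes>\<^sub>M restrict_space lborel {0..T}) (M \<Otimes>\<^sub>M borel)"
      by (intro measurable_Pair measurable_fst measurable_compose[OF measurable_snd])
    then show ?thesis by simp
  qed
  from measurable_compose[OF this h_dir_joint_measurable]
  show "(\<lambda>(\<omega>, t). h_dir T x v (path \<omega>) t) \<in> borel_measurable (M \<Otimes>\<^sub>M restrict_space lborel {0..T})" by simp
  fix \<omega> assume \<omega>: "\<omega> \<in> space M"
  note [measurable] = h_dir_section[OF \<omega>]
  show "set_integrable lborel {0..T} (\<lambda>t. (h_dir T x v (path \<omega>) t)\<^sup>2)"
    by (rule set_integrable_bounded[where K = "(3 * (norm (gram_weight T (rotated x v) (path \<omega>)) * (1 + T)))\<^sup>2"])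
       (use power_mono[OF h_dir_bound[OF \<omega>] abs_ge_zero, of _ x v 2] in auto)
qed

lemma L2_norm_measurable: "(\<lambda>\<omega>. L2_norm T (h_dir T x v (path \<omega>))) \<in> borel_measurable M"
proof -
  note [measurable] = h_dir_joint_measurable[of x v]
  have "case_prod (\<lambda>\<omega> t. LBINT s:{0..t}. h_dir T x v (path \<omega>) s * h_dir T x v (path \<omega>) s) \<in> borel_measurable (M \<Otimes>\<^sub>M borel)"
    by (intro measurable_set_integral) measurable
  from measurable_section[OF this, of T] show ?thesis unfolding L2_norm_def L2_inner_def by measurable
qed

lemma L2_norm_le:
  assumes \<omega>: "\<omega> \<in> space M"
  shows "\<bar>L2_norm T (h_dir T x v (path \<omega>))\<bar> \<le> 3 * (1 + T) * sqrt T * norm (gram_weight T (rotated x v) (path \<omega>))"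
proof -
  let ?c = "3 * (norm (gram_weight T (rotated x v) (path \<omega>)) * (1 + T))"
  note [measurable] = h_dir_section[OF \<omega>]
  have "(LBINT t:{0..T}. h_dir T x v (path \<omega>) t * h_dir T x v (path \<omega>) t) \<le> ?c * ?c * (T - 0)"
    using set_integral_norm_le[of "\<lambda>t. h_dir T x v (path \<omega>) t * h_dir T x v (path \<omega>) t" 0 T "?c * ?c"] T
      mult_bound[OF h_dir_bound[OF \<omega>] h_dir_bound[OF \<omega>]] by (auto simp: abs_le_iff)
  then have "L2_norm T (h_dir T x v (path \<omega>)) \<le> sqrt (?c\<^sup>2 * T)"
    unfolding L2_norm_def L2_inner_def by (intro real_sqrt_le_mono) (simp add: power2_eq_square)
  also have "\<dots> = ?c * sqrt T" using T by (simp add: real_sqrt_mult)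
  finally have "L2_norm T (h_dir T x v (path \<omega>)) \<le> ?c * sqrt T" .
  moreover have "0 \<le> L2_norm T (h_dir T x v (path \<omega>))"
    unfolding L2_norm_def L2_inner_def set_lebesgue_integral_def by (auto intro!: integral_nonneg_AE AE_I2 simp: indicator_def)
  ultimately show ?thesis by (simp add: algebra_simps)
qed

lemma Lp_L2_h_dir:
  assumes p: "p \<ge> 1" shows "Lp_L2 M T p (\<lambda>\<omega>. h_dir T x v (path \<omega>))"
proof -
  let ?Y = "\<lambda>\<omega>. L2_norm T (h_dir T x v (path \<omega>))"
  let ?c = "3 * (1 + T) * sqrt T * norm (rotated x v)"
  have c: "0 \<le> ?c" using T by simp
  have "integrable M (\<lambda>\<omega>. \<bar>?Y \<omega>\<bar> ^ n)" if n: "n > 0" for n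
  proof (rule moment_bound[OF L2_norm_measurable c _ n])
    fix R \<omega> assume \<omega>: "\<omega> \<in> space M" and co: "coercive (1 / R) (red_malliavin T (path \<omega>))"
    have "\<bar>?Y \<omega>\<bar> \<le> 3 * (1 + T) * sqrt T * (norm (rotated x v) * R)"
      using T by (intro order_trans[OF L2_norm_le[OF \<omega>]] mult_left_mono gram_weight_bound co) auto
    also have "\<dots> = ?c * R" by simp
    also have "R \<le> 1 + R\<^sup>2 + (path_size \<omega>)\<^sup>2"
      using two_mult_le[of 1 R] zero_le_power2[of "path_size \<omega>"] unfolding mult_1_left one_power2 by linarith
    then have "?c * R \<le> ?c * (1 + R\<^sup>2 + (path_size \<omega>)\<^sup>2)" by (rule mult_left_mono[OF _ c])
    finally show "\<bar>?Y \<omega>\<bar> \<le> ?c * (1 + R\<^sup>2 + (path_size \<omega>)\<^sup>2)" .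
  qed
  from powr_integrable[OF L2_norm_measurable this p]
  have "integrable M (\<lambda>\<omega>. \<bar>?Y \<omega>\<bar> powr p)" by simp
  moreover have "\<bar>?Y \<omega>\<bar> = ?Y \<omega>" for \<omega>
    unfolding L2_norm_def L2_inner_def set_lebesgue_integral_def by (auto intro!: integral_nonneg_AE AE_I2 simp: indicator_def)
  ultimately show ?thesis unfolding Lp_L2_def using random_L2_h_dir by simp
qed

lemma delta_h_path: "\<omega> \<in> space M \<Longrightarrow> delta_h T x v (path \<omega>) = - D (rotated x v) \<omega>"
  by (rule delta_h_eq[OF continuous T])

lemma delta_h_measurable: "(\<lambda>\<omega>. delta_h T x v (path \<omega>)) \<in> borel_measurable M"
  by (subst measurable_cong[OF delta_h_path]) measurable

lemma Lp_real_delta_h: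
  assumes p: "p \<ge> 1" shows "Lp_real M p (\<lambda>\<omega>. delta_h T x v (path \<omega>))"
proof -
  have "integrable M (\<lambda>\<omega>. \<bar>D (rotated x v) \<omega>\<bar> powr p)"
    by (rule powr_integrable[OF _ div_form_moment p]) measurable
  then have "integrable M (\<lambda>\<omega>. \<bar>delta_h T x v (path \<omega>)\<bar> powr p)"
    by (subst Bochner_Integration.integrable_cong[OF refl]) (simp_all add: delta_h_path)
  then show ?thesis unfolding Lp_real_def using delta_h_measurable by simp
qed

text \<open>\<open>ibp\<close> with both sides negated: \<open>h_dir\<close> and
  \<open>delta_h\<close> are the negatives of the weighted direction and of
  \<open>div_form\<close>.\<close>

lemma has_malliavin_dual_h_dir:
  "has_malliavin_dual M B T x (\<lambda>\<omega>. h_dir T x v (path \<omega>)) (\<lambda>\<omega>. delta_h T x v (path \<omega>))"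
  unfolding has_malliavin_dual_def
proof (intro conjI allI impI random_L2_h_dir)
  show "integrable M (\<lambda>\<omega>. delta_h T x v (path \<omega>))"
    by (subst Bochner_Integration.integrable_cong[OF refl delta_h_path]) (auto intro!: div_form_integrable)
  fix f f' assume f: "bounded_C1 f f'"
  have e: "blinfun_apply (f' (X x \<omega>)) (malliavin_deriv T x (path \<omega>) (h_dir T x v (path \<omega>)))
     = - blinfun_apply (f' (X x \<omega>)) (kbm_tangent_dir T x (rotated x v) (path \<omega>))" if "\<omega> \<in> space M" for \<omega>
    by (simp add: malliavin_deriv_h_dir[OF path_measurable[OF that] T] blinfun.minus_right)
  show "integrable M (\<lambda>\<omega>. blinfun_apply (f' (X x \<omega>)) (malliavin_deriv T x (path \<omega>) (h_dir T x v (path \<omega>))))"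
    by (subst Bochner_Integration.integrable_cong[OF refl e]) (auto intro!: ibp(1)[OF f])
  have "(LINT \<omega>|M. blinfun_apply (f' (X x \<omega>)) (malliavin_deriv T x (path \<omega>) (h_dir T x v (path \<omega>))))
     = (LINT \<omega>|M. - blinfun_apply (f' (X x \<omega>)) (kbm_tangent_dir T x (rotated x v) (path \<omega>)))"
    by (rule Bochner_Integration.integral_cong[OF refl e])
  also have "\<dots> = (LINT \<omega>|M. f (X x \<omega>) * delta_h T x v (path \<omega>))"
    using ibp(2)[OF f, of x "rotated x v"] by (simp add: delta_h_path cong: Bochner_Integration.integral_cong)
  finally show "(LINT \<omega>|M. blinfun_apply (f' (X x \<omega>)) (malliavin_deriv T x (path \<omega>) (h_dir T x v (path \<omega>))))
     = (LINT \<omega>|M. f (X x \<omega>) * delta_h T x v (path \<omega>))" .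
qed

lemma semigroup_derivative:
  assumes f: "f \<in> borel_measurable borel" "bounded (range f)"
  shows "(kbm_semigroup M B T f has_derivative dual_pairing f x) (at x)"
    "dual_pairing f x v = - (LINT \<omega>|M. f (X x \<omega>) * delta_h T x v (path \<omega>))"
proof -
  show "(P f has_derivative dual_pairing f x) (at x)" by (rule P_has_derivative[OF f])
  show "dual_pairing f x v = - (LINT \<omega>|M. f (X x \<omega>) * delta_h T x v (path \<omega>))"
    by (simp add: dual_pairing_def delta_h_path cong: Bochner_Integration.integral_cong)
qed

end

text \<open>The Brownian axioms speak of nonnegative times, where nothing changes; the times of an
  increment family are nonnegative because they increase from a nonnegative start.\<close>

lemma brownian_motion_extend:
  assumes "brownian_motion M B" and T: "T > 0" shows "bm_horizon M (\<lambda>t. B (max 0 t)) T"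
proof -
  interpret brownian_motion M B by fact
  have m: "B (max 0 t) \<in> borel_measurable M" for t by (rule measurable) simp
  show ?thesis
  proof unfold_locales
    show "AE \<omega> in M. B (max 0 0) \<omega> = 0" using start by simp
    show c: "continuous_on UNIV (\<lambda>t. B (max 0 t) \<omega>)" if "\<omega> \<in> space M" for \<omega>
      by (rule continuous_on_compose2[OF continuous_paths[OF that]]) (auto intro!: continuous_intros)
    then show "continuous_on {0..} (\<lambda>t. B (max 0 t) \<omega>)" if "\<omega> \<in> space M" for \<omega>
      using that continuous_on_subset by blast
    show "distributed M lborel (\<lambda>\<omega>. B (max 0 t) \<omega> - B (max 0 s) \<omega>) (normal_density 0 (sqrt (t - s)))" if "0 \<le> s" "s < t" for s t
      using gaussian_increments[OF that] that by simp
    fix n and \<tau> :: "nat \<Rightarrow> real" assume \<tau>: "0 \<le> \<tau> 0" "\<And>i. i < n \<Longrightarrow> \<tau> i \<le> \<tau> (Suc i)"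
    have nn: "0 \<le> \<tau> i" if "i \<le> n" for i using that
    proof (induction i)
      case (Suc i)
      then show ?case using \<tau>(2)[of i] by auto
    qed (rule \<tau>(1))
    show "indep_vars (\<lambda>_. borel) (\<lambda>i \<omega>. B (max 0 (\<tau> (Suc i))) \<omega> - B (max 0 (\<tau> i)) \<omega>) {..<n}"
      using independent_increments[OF \<tau>] by (subst indep_vars_cong) (auto simp: nn max_absorb2)
  qed (rule m T)+
qed

theorem theorem2p3:
  fixes M :: "'w measure" and B :: "real \<Rightarrow> 'w \<Rightarrow> real"
    and T :: real and x v :: "real \<times> complex"
  assumes "brownian_motion M B" and "T > 0"
  shows "(\<forall>p\<ge>1. Lp_L2 M T p (\<lambda>\<omega>. h_dir T x v (\<lambda>s. B s \<omega>))) \<and>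
    has_malliavin_dual M B T x
      (\<lambda>\<omega>. h_dir T x v (\<lambda>s. B s \<omega>)) (\<lambda>\<omega>. delta_h T x v (\<lambda>s. B s \<omega>)) \<and>
    (\<forall>p\<ge>1. Lp_real M p (\<lambda>\<omega>. delta_h T x v (\<lambda>s. B s \<omega>))) \<and>
    (\<forall>f :: real \<times> complex \<Rightarrow> real. f \<in> borel_measurable borel \<and> bounded (range f) \<longrightarrow>
       kbm_semigroup M B T f differentiable (at x) \<and>
       frechet_derivative (kbm_semigroup M B T f) (at x) v
         = - (LINT \<omega>|M. f (kbm T x (\<lambda>s. B s \<omega>)) * delta_h T x v (\<lambda>s. B s \<omega>)))"
proof -
  \<comment> \<open>Every notion in the claim depends on the path over \<open>{0..T}\<close> only.
    There \<open>B\<close> and \<open>B'\<close> agree for every \<open>\<omega>\<close>, so each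
    part is transferred by rewriting.\<close>
  define B' where "B' = (\<lambda>t. B (max 0 t))"
  interpret B': bm_horizon M B' T unfolding B'_def by (rule brownian_motion_extend[OF assms])
  have T: "0 \<le> T" using assms(2) by simp
  have eq: "s \<in> {0..T} \<Longrightarrow> B s \<omega> = B' s \<omega>" for s \<omega> by (simp add: B'_def)
  have k: "kbm T x (\<lambda>s. B s \<omega>) = kbm T x (\<lambda>s. B' s \<omega>)" for x \<omega> by (rule kbm_cong[OF eq T])
  have d: "delta_h T x v (\<lambda>s. B s \<omega>) = delta_h T x v (\<lambda>s. B' s \<omega>)" for x \<omega> by (rule delta_h_cong[OF eq T])
  have h: "t \<in> {0..T} \<Longrightarrow> h_dir T x v (\<lambda>s. B s \<omega>) t = h_dir T x v (\<lambda>s. B' s \<omega>) t" for t x \<omega> by (rule h_dir_cong[OF eq])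
  have m: "malliavin_deriv T x (\<lambda>s. B s \<omega>) (h_dir T x v (\<lambda>s. B s \<omega>)) = malliavin_deriv T x (\<lambda>s. B' s \<omega>) (h_dir T x v (\<lambda>s. B' s \<omega>))" for x \<omega>
    by (rule malliavin_deriv_cong[OF eq T h])
  have n: "L2_norm T (h_dir T x v (\<lambda>s. B s \<omega>)) = L2_norm T (h_dir T x v (\<lambda>s. B' s \<omega>))" for \<omega>
    by (rule L2_norm_cong[OF h])
  have r: "random_L2 M T (\<lambda>\<omega>. h_dir T x v (\<lambda>s. B s \<omega>)) \<longleftrightarrow> random_L2 M T (\<lambda>\<omega>. h_dir T x v (\<lambda>s. B' s \<omega>))"
  proof -
    have "(\<lambda>(\<omega>, t). h_dir T x v (\<lambda>s. B s \<omega>) t) \<in> borel_measurable (M \<Otimes>\<^sub>M restrict_space lborel {0..T}) \<longleftrightarrow>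
      (\<lambda>(\<omega>, t). h_dir T x v (\<lambda>s. B' s \<omega>) t) \<in> borel_measurable (M \<Otimes>\<^sub>M restrict_space lborel {0..T})"
      by (intro measurable_cong) (auto simp: space_pair_measure space_restrict_space h)
    moreover have "set_integrable lborel {0..T} (\<lambda>t. (h_dir T x v (\<lambda>s. B s \<omega>) t)\<^sup>2) \<longleftrightarrow> set_integrable lborel {0..T} (\<lambda>t. (h_dir T x v (\<lambda>s. B' s \<omega>) t)\<^sup>2)" for \<omega>
      by (intro set_integrable_cong) (auto simp: h)
    ultimately show ?thesis unfolding random_L2_def by simp
  qed
  have sg: "kbm_semigroup M B T f = kbm_semigroup M B' T f" for f
    by (simp add: kbm_semigroup_def k fun_eq_iff)
  have A: "\<forall>p\<ge>1. Lp_L2 M T p (\<lambda>\<omega>. h_dir T x v (\<lambda>s. B s \<omega>))"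
    using B'.Lp_L2_h_dir unfolding Lp_L2_def r n by blast
  have C: "has_malliavin_dual M B T x (\<lambda>\<omega>. h_dir T x v (\<lambda>s. B s \<omega>)) (\<lambda>\<omega>. delta_h T x v (\<lambda>s. B s \<omega>))"
    using B'.has_malliavin_dual_h_dir[of x v] unfolding has_malliavin_dual_def r d k m .
  have E: "\<forall>p\<ge>1. Lp_real M p (\<lambda>\<omega>. delta_h T x v (\<lambda>s. B s \<omega>))"
    using B'.Lp_real_delta_h unfolding d by blast
  have G: "kbm_semigroup M B T f differentiable (at x) \<and>
       frechet_derivative (kbm_semigroup M B T f) (at x) v
         = - (LINT \<omega>|M. f (kbm T x (\<lambda>s. B s \<omega>)) * delta_h T x v (\<lambda>s. B s \<omega>))"
    if f: "f \<in> borel_measurable borel" "bounded (range f)" for f :: "real \<times> complex \<Rightarrow> real"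
  proof -
    note der = B'.semigroup_derivative[OF f, of x]
    show ?thesis unfolding sg k d
      using der(1) frechet_derivative_at[OF der(1)] der(2)[of v] by (auto simp: differentiable_def)
  qed
  show ?thesis using A C E G by blast
qed

end
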